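(* Let $Q=\mathrm{diag}(q_1,q_2)$ with $q_1,q_2\in\mathbb{C}^\times$, $q_1\ne q_2$. Let $\boldsymbol\lambda=(\lambda^{(1)},\dots,\lambda^{(k)})$ be non-degenerate polynomial $\mathfrak{gl}_{1|1}$-weights, $n=\sum_s(\lambda^{(s)}_1+\lambda^{(s)}_2)$, $\boldsymbol b\in\mathbb{C}^k$, and suppose $L(\boldsymbol\lambda,\boldsymbol b)$ is cyclic. Let $0\le l\le k$, $W=(L(\boldsymbol\lambda,\boldsymbol b))_{(n-l,l)}$ and $\mathcal B^Q_l(\boldsymbol\lambda,\boldsymbol b)$ the image of $\mathcal B^Q$ in $\mathrm{End}(W)$. Then: (i) $\mathcal B^Q_l(\boldsymbol\lambda,\boldsymbol b)\cong\mathbb{C}[w_1,\dots,w_k]^{\mathfrak S_l\times\mathfrak S_{k-l}}/\langle\sigma_i(\boldsymbol w)-\varepsilon_i\rangle_{i=1,\dots,k}$, where $\varepsilon_i$ are defined by $q_1\varphi_{\boldsymbol\lambda,\boldsymbol b}(x)-q_2\psi_{\boldsymbol\lambda,\boldsymbol b}(x)=(q_1-q_2)\big(x^k+\sum_{i=1}^k(-1)^i\varepsilon_ix^{k-i}\big)$ and $\sigma_i(\boldsymbol w)$ are elementary symmetric polynomials in $w_1,\dots,w_k$; under this isomorphism $\prod_{s=1}^k(x-b_s)\mathcal T_Q(x)$ corresponds to $(q_1-q_2)\prod_{i=1}^l(x-w_i-1)\prod_{j=l+1}^k(x-w_j)$. (ii) $\mathcal B^Q_l(\boldsymbol\lambda,\boldsymbol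 b)$ is a Frobenius algebra and the module $W$ is isomorphic to its regular representation. (iii) $\mathcal B^Q_l(\boldsymbol\lambda,\boldsymbol b)$ is a maximal commutative subalgebra of $\mathrm{End}(W)$ of dimension $\binom kl$. (iv) Every $\mathcal B^Q$-eigenspace in $W$ has dimension one. (v) The $\mathcal B^Q$-eigenspaces in $W$ are in bijection with monic degree $l$ divisors $y(x)$ of $q_1\varphi_{\boldsymbol\lambda,\boldsymbol b}(x)-q_2\psi_{\boldsymbol\lambda,\boldsymbol b}(x)$, the eigenvalue of $\mathcal T_Q(x)$ corresponding to $y$ being $\frac{y(x-1)}{y(x)}\big(q_1\varphi_{\boldsymbol\lambda,\boldsymbol b}(x)-q_2\psi_{\boldsymbol\lambda,\boldsymbol b}(x)\big)\prod_{s=1}^k(x-b_s)^{-1}$. (vi) Every generalized $\mathcal B^Q$-eigenspace in $W$ is a cyclic $\mathcal B^Q$-module. (vii) The generalized $\mathcal B^Q$-eigenspace associated to the eigenvalue corresponding to $y$ has dimension $\prod_{a\in\mathbb{C}}\binom{\mathrm{Mult}_a(q_1\varphi_{\boldsymbol\lambda,\boldsymbol b}-q_2\psi_{\boldsymbol\lambda,\boldsymbol b})}{\mathrm{Mult}_a(y)}$, where $\mathrm{Mult}_a(p)$ is the multiplicity of $a$ as a root of $p$.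
   Context: Superspace $\mathbb{C}^{1|1}$ with basis $v_1$ (even), $v_2$ (odd), $|1|=\bar0,|2|=\bar1$. $\mathfrak{gl}_{1|1}$ has basis $e_{ij}$ of parity $|i|+|j|$ with $[e_{ij},e_{rs}]=\delta_{jr}e_{is}-(-1)^{(|i|+|j|)(|r|+|s|)}\delta_{is}e_{rj}$. With $P=\sum_{i,j}(-1)^{|j|}E_{ij}\otimes E_{ji}$ and $\mathcal R(x)=1+P/x$, $\mathrm{Y}(\mathfrak{gl}_{1|1})$ is generated by $T^{(r)}_{ij}$ ($r\ge1$, parity $|i|+|j|$) with relation $\mathcal R^{(12)}(x_1-x_2)T^{(13)}(x_1)T^{(23)}(x_2)=T^{(23)}(x_2)T^{(13)}(x_1)\mathcal R^{(12)}(x_1-x_2)$, $T(x)=\sum E_{ij}\otimes T_{ij}(x)$, $T_{ij}(x)=\delta_{ij}+\sum_rT^{(r)}_{ij}x^{-r}$; coproduct $\Delta(T_{ij}(x))=\sum_rT_{rj}(x)\otimes T_{ir}(x)$; $\mathfrak{gl}_{1|1}\subset\mathrm{Y}(\mathfrak{gl}_{1|1})$ via $e_{ij}\mapsto(-1)^{|i|}T^{(1)}_{ji}$. The evaluation module $M(z)$ is $M$ with $T_{ij}(x)$ acting by $\delta_{ij}+(-1)^{|j|}e_{ji}(x-z)^{-1}$. Weights, $L_\lambda$, polynomial and non-degenerate weights: $\lambda=(\lambda_1,\lambda_2)$ is non-degenerate if $\lambda_1+\lambda_2\neq0$, polynomial if $\lambda_i\in\mathbb{Z}_{\ge0}$ and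 ($\lambda_1>0$ or $\lambda=0$); $L_\lambda$ is the irreducible module generated by an even $v_\lambda$ with $e_{12}v_\lambda=0$, $e_{ii}v_\lambda=\lambda_iv_\lambda$. $L(\boldsymbol\lambda,\boldsymbol b)=\bigotimes_sL_{\lambda^{(s)}}(b_s)$, vacuum $|0\rangle=\otimes_sv_{\lambda^{(s)}}$, cyclic if generated by $|0\rangle$. $\varphi_{\boldsymbol\lambda,\boldsymbol b}(x)=\prod_s(x-b_s+\lambda^{(s)}_1)$, $\psi_{\boldsymbol\lambda,\boldsymbol b}(x)=\prod_s(x-b_s-\lambda^{(s)}_2)$. $(M)_{(a,b)}$ is the subspace where $e_{11},e_{22}$ act by $a,b$. $\mathcal T_Q(x)=q_1T_{11}(x)-q_2T_{22}(x)$; $\mathrm{Ber}^Q(x)=\frac{q_1}{q_2}T_{11}(x)\big(T_{22}(x)-T_{12}(x)T_{11}(x)^{-1}T_{21}(x)\big)^{-1}$ (central coefficients). The Bethe algebra $\mathcal B^Q$ is the commutative subalgebra generated by coefficients of $\mathcal T_Q(x)$ and $\mathrm{Ber}^Q(x)$; it preserves weight subspaces. For a character $\mathcal E$ of an algebra $\mathcal A$ acting on $M$, the eigenspace is $\bigcap_a\ker(a-\mathcal E(a))$ and the generalized eigenspace $\bigcap_a\bigcup_m\ker(a-\mathcal E(a))^m$. A Frobenius algebra is a finite-dimensional commutative algebra with an invariant non-degenerate symmetric bilinear form.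
   Formalization: W is taken to be the weight subspace of weight (Σλ₁−l, Σλ₂+l) instead of (n−l, l); the two agree when all λ₂ vanish, and the printed weight makes the claim false otherwise (k=1, λ=(1,1), l=0 gives W=0, not dimension 1). *)

theory Defs
  imports "HOL-Library.Function_Algebras" "HOL-Library.Poly_Mapping"
    "HOL-Computational_Algebra.Polynomial" "HOL-Computational_Algebra.Polynomial_FPS"
    "HOL-Combinatorics.Permutations"
begin

text \<open>Vectors are functions 'i => complex (supported on a finite carrier set of
basis labels), operators are matrices ('i * 'i) => coefficient; the complex vector
space structure is the pointwise one.\<close>

definition fscale :: "complex \<Rightarrow> ('a \<Rightarrow> complex) \<Rightarrow> ('a \<Rightarrow> complex)" where
  "fscale c f = (\<lambda>x. c * f x)"

global_interpretation fvs: vector_space fscale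
  by unfold_locales (auto simp: fscale_def fun_eq_iff algebra_simps)

abbreviation cdim :: "('a \<Rightarrow> complex) set \<Rightarrow> nat" where
  "cdim V \<equiv> vector_space.dim fscale V"

definition mmul :: "'i set \<Rightarrow> ('i \<times> 'i \<Rightarrow> 'a::comm_semiring_1) \<Rightarrow> ('i \<times> 'i \<Rightarrow> 'a) \<Rightarrow> ('i \<times> 'i \<Rightarrow> 'a)" where
  "mmul I A B = (\<lambda>(x, z). \<Sum>y\<in>I. A (x, y) * B (y, z))"

definition mvec :: "'i set \<Rightarrow> ('i \<times> 'i \<Rightarrow> complex) \<Rightarrow> ('i \<Rightarrow> complex) \<Rightarrow> ('i \<Rightarrow> complex)" where
  "mvec I A v = (\<lambda>x. \<Sum>y\<in>I. A (x, y) * v y)"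

definition idm :: "'i set \<Rightarrow> ('i \<times> 'i \<Rightarrow> 'a::comm_semiring_1)" where
  "idm I = (\<lambda>(x, z). if x = z \<and> x \<in> I then 1 else 0)"

definition supp_on :: "'i set \<Rightarrow> ('i \<times> 'i \<Rightarrow> 'a::zero) \<Rightarrow> bool" where
  "supp_on I A \<longleftrightarrow> (\<forall>x z. (x, z) \<notin> I \<times> I \<longrightarrow> A (x, z) = 0)"

text \<open>restriction of an operator preserving the coordinate subspace spanned by I
(the image in End of that subspace)\<close>
definition restr :: "'i set \<Rightarrow> ('i \<times> 'i \<Rightarrow> complex) \<Rightarrow> ('i \<times> 'i \<Rightarrow> complex)" where
  "restr I A = (\<lambda>(x, z). if x \<in> I \<and> z \<in> I then A (x, z) else 0)"

definition vecs :: "'i set \<Rightarrow> ('i \<Rightarrow> complex) set" where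
  "vecs I = {v. \<forall>x. x \<notin> I \<longrightarrow> v x = 0}"

definition basisv :: "'i \<Rightarrow> ('i \<Rightarrow> complex)" where
  "basisv S = (\<lambda>T. if T = S then 1 else 0)"

inductive_set alg_gen :: "'i set \<Rightarrow> ('i \<times> 'i \<Rightarrow> complex) set \<Rightarrow> ('i \<times> 'i \<Rightarrow> complex) set"
  for I G where
  gen_id: "idm I \<in> alg_gen I G"
| gen_base: "g \<in> G \<Longrightarrow> g \<in> alg_gen I G"
| gen_add: "A \<in> alg_gen I G \<Longrightarrow> B \<in> alg_gen I G \<Longrightarrow> A + B \<in> alg_gen I G"
| gen_scale: "A \<in> alg_gen I G \<Longrightarrow> fscale c A \<in> alg_gen I G"
| gen_mul: "A \<in> alg_gen I G \<Longrightarrow> B \<in> alg_gen I G \<Longrightarrow> mmul I A B \<in> alg_gen I G"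

definition subalg :: "'i set \<Rightarrow> ('i \<times> 'i \<Rightarrow> complex) set \<Rightarrow> bool" where
  "subalg I D \<longleftrightarrow> (\<forall>A\<in>D. supp_on I A) \<and> idm I \<in> D \<and>
     (\<forall>A\<in>D. \<forall>B\<in>D. A + B \<in> D \<and> mmul I A B \<in> D) \<and> (\<forall>c. \<forall>A\<in>D. fscale c A \<in> D)"

definition commut :: "'i set \<Rightarrow> ('i \<times> 'i \<Rightarrow> complex) set \<Rightarrow> bool" where
  "commut I D \<longleftrightarrow> (\<forall>A\<in>D. \<forall>B\<in>D. mmul I A B = mmul I B A)"

definition frobenius :: "'i set \<Rightarrow> ('i \<times> 'i \<Rightarrow> complex) set \<Rightarrow> bool" where
  "frobenius I C \<longleftrightarrow> subalg I C \<and> commut I C \<and> (\<exists>F. finite F \<and> C \<subseteq> fvs.span F) \<and>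
    (\<exists>\<beta>. (\<forall>A\<in>C. \<forall>B\<in>C. \<forall>D\<in>C. \<beta> (A + B) D = \<beta> A D + \<beta> B D) \<and>
         (\<forall>c. \<forall>A\<in>C. \<forall>B\<in>C. \<beta> (fscale c A) B = c * \<beta> A B) \<and>
         (\<forall>A\<in>C. \<forall>B\<in>C. \<beta> A B = \<beta> B A) \<and>
         (\<forall>A\<in>C. \<forall>B\<in>C. \<forall>D\<in>C. \<beta> (mmul I A B) D = \<beta> A (mmul I B D)) \<and>
         (\<forall>A\<in>C. (\<forall>B\<in>C. \<beta> A B = 0) \<longrightarrow> A = 0))"

definition regular_iso :: "'i set \<Rightarrow> ('i \<times> 'i \<Rightarrow> complex) set \<Rightarrow> bool" where
  "regular_iso I C \<longleftrightarrow> (\<exists>f. bij_betw f C (vecs I) \<and>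
     (\<forall>A\<in>C. \<forall>B\<in>C. f (A + B) = f A + f B) \<and> (\<forall>c. \<forall>A\<in>C. f (fscale c A) = fscale c (f A)) \<and>
     (\<forall>A\<in>C. \<forall>B\<in>C. f (mmul I A B) = mvec I A (f B)))"

definition character :: "'i set \<Rightarrow> ('i \<times> 'i \<Rightarrow> complex) set \<Rightarrow> (('i \<times> 'i \<Rightarrow> complex) \<Rightarrow> complex) \<Rightarrow> bool" where
  "character I A E \<longleftrightarrow> E (idm I) = 1 \<and>
     (\<forall>X\<in>A. \<forall>Y\<in>A. E (X + Y) = E X + E Y \<and> E (mmul I X Y) = E X * E Y) \<and>
     (\<forall>c. \<forall>X\<in>A. E (fscale c X) = c * E X)"

text \<open>eigenspace / generalized eigenspace in the subspace spanned by J of an algebra A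
(whose elements preserve that subspace), for a character E\<close>
definition eigsp :: "'i set \<Rightarrow> ('i \<times> 'i \<Rightarrow> complex) set \<Rightarrow> (('i \<times> 'i \<Rightarrow> complex) \<Rightarrow> complex) \<Rightarrow> ('i \<Rightarrow> complex) set" where
  "eigsp J A E = {v \<in> vecs J. \<forall>X\<in>A. mvec J (restr J X) v = fscale (E X) v}"

definition geigsp :: "'i set \<Rightarrow> ('i \<times> 'i \<Rightarrow> complex) set \<Rightarrow> (('i \<times> 'i \<Rightarrow> complex) \<Rightarrow> complex) \<Rightarrow> ('i \<Rightarrow> complex) set" where
  "geigsp J A E = {v \<in> vecs J. \<forall>X\<in>A. \<exists>m. ((\<lambda>u. mvec J (restr J X) u - fscale (E X) u) ^^ m) v = 0}"

definition cyclic_mod :: "'i set \<Rightarrow> ('i \<times> 'i \<Rightarrow> complex) set \<Rightarrow> ('i \<Rightarrow> complex) set \<Rightarrow> bool" where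
  "cyclic_mod J A M \<longleftrightarrow> (\<exists>v\<in>M. M = {mvec J (restr J X) v | X. X \<in> A})"

text \<open>indices 0,1 stand for 1,2; the parity of index a is a.\<close>

definition poly_weight :: "complex \<times> complex \<Rightarrow> bool" where
  "poly_weight lam \<longleftrightarrow> (\<exists>a c :: nat. lam = (of_nat a, of_nat c) \<and> (a > 0 \<or> (a = 0 \<and> c = 0)))"

definition nondeg :: "complex \<times> complex \<Rightarrow> bool" where
  "nondeg lam \<longleftrightarrow> fst lam + snd lam \<noteq> 0"

text \<open>Matrix entries (output u', input u) of e_ab on L_lam (non-degenerate lam) in the
basis u=0: v_lam (even), u=1: e_21 v_lam (odd).\<close>
definition emat :: "complex \<times> complex \<Rightarrow> nat \<Rightarrow> nat \<Rightarrow> nat \<Rightarrow> nat \<Rightarrow> complex" where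
  "emat lam a b u' u =
    (if a = 0 \<and> b = 0 then (if u' = u then fst lam - of_nat u else 0)
     else if a = 1 \<and> b = 1 then (if u' = u then snd lam + of_nat u else 0)
     else if a = 0 \<and> b = 1 then (if u' = 0 \<and> u = 1 then fst lam + snd lam else 0)
     else if a = 1 \<and> b = 0 then (if u' = 1 \<and> u = 0 then 1 else 0)
     else 0)"

text \<open>(x - z)^{-1} as a power series in x^{-1}\<close>
definition geo :: "complex \<Rightarrow> complex fps" where
  "geo z = Abs_fps (\<lambda>m. if m = 0 then 0 else z ^ (m - 1))"

text \<open>matrix entry of T_ab(x) on the evaluation module L_lam(z), as series in x^{-1}\<close>
definition fac_ser :: "complex \<times> complex \<Rightarrow> complex \<Rightarrow> nat \<Rightarrow> nat \<Rightarrow> nat \<Rightarrow> nat \<Rightarrow> complex fps" where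
  "fac_ser lam z a b u' u =
     (if a = b \<and> u' = u then 1 else 0) + fps_const ((-1) ^ b * emat lam b a u' u) * geo z"

definition carrier :: "nat \<Rightarrow> nat set set" where
  "carrier k = Pow {..<k}"

definition ind :: "nat set \<Rightarrow> nat \<Rightarrow> nat" where
  "ind S s = (if s \<in> S then 1 else 0)"

text \<open>index chains of the iterated coproduct
  Delta^(k)(T_ij) = sum T_{c1 c0} (x) T_{c2 c1} (x) ... (x) T_{ck c(k-1)}, c0 = j, ck = i\<close>
definition chains :: "nat \<Rightarrow> nat \<Rightarrow> nat \<Rightarrow> (nat \<Rightarrow> nat) set" where
  "chains k i j = {c. c 0 = j \<and> c k = i \<and> (\<forall>s\<le>k. c s \<le> 1) \<and> (\<forall>s>k. c s = 0)}"

text \<open>Koszul sign of (a_0 (x) ... (x) a_{k-1}) acting on the basis vector labelled S\<close>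
definition ksign :: "nat \<Rightarrow> (nat \<Rightarrow> nat) \<Rightarrow> nat set \<Rightarrow> complex" where
  "ksign k c S = (-1) ^ (\<Sum>t<k. \<Sum>s<t. ((c (Suc t) + c t) mod 2) * ind S s)"

text \<open>T_ij(x) acting on L(lam,b) = L_{lam0}(b0) (x) ... (x) L_{lam(k-1)}(b(k-1)); basis
vectors are labelled by the set S of tensor factors carrying the odd vector.\<close>
definition Tser :: "nat \<Rightarrow> (nat \<Rightarrow> complex \<times> complex) \<Rightarrow> (nat \<Rightarrow> complex) \<Rightarrow> nat \<Rightarrow> nat
    \<Rightarrow> (nat set \<times> nat set \<Rightarrow> complex fps)" where
  "Tser k lam b i j = (\<lambda>(S', S). if S' \<in> carrier k \<and> S \<in> carrier k then
      (\<Sum>c\<in>chains k i j. fps_const (ksign k c S) *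
         (\<Prod>s<k. fac_ser (lam s) (b s) (c (Suc s)) (c s) (ind S' s) (ind S s)))
      else 0)"

definition Tco :: "nat \<Rightarrow> (nat \<Rightarrow> complex \<times> complex) \<Rightarrow> (nat \<Rightarrow> complex) \<Rightarrow> nat \<Rightarrow> nat \<Rightarrow> nat
    \<Rightarrow> (nat set \<times> nat set \<Rightarrow> complex)" where
  "Tco k lam b r i j = (\<lambda>p. fps_nth (Tser k lam b i j p) r)"

definition TQco :: "complex \<Rightarrow> complex \<Rightarrow> nat \<Rightarrow> (nat \<Rightarrow> complex \<times> complex) \<Rightarrow> (nat \<Rightarrow> complex) \<Rightarrow> nat
    \<Rightarrow> (nat set \<times> nat set \<Rightarrow> complex)" where
  "TQco q1 q2 k lam b r = fscale q1 (Tco k lam b r 0 0) - fscale q2 (Tco k lam b r 1 1)"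

text \<open>Ber^Q(x) = (q1/q2) T_11(x) (T_22(x) - T_12(x) T_11(x)^{-1} T_21(x))^{-1}, as an
operator-valued series\<close>
definition BerSer :: "complex \<Rightarrow> complex \<Rightarrow> nat \<Rightarrow> (nat \<Rightarrow> complex \<times> complex) \<Rightarrow> (nat \<Rightarrow> complex)
    \<Rightarrow> (nat set \<times> nat set \<Rightarrow> complex fps)" where
  "BerSer q1 q2 k lam b = (THE M. supp_on (carrier k) M \<and>
     (\<exists>Ci. supp_on (carrier k) Ci \<and>
        mmul (carrier k) (Tser k lam b 0 0) Ci = idm (carrier k) \<and>
        mmul (carrier k) Ci (Tser k lam b 0 0) = idm (carrier k) \<and>
        mmul (carrier k) M (Tser k lam b 1 1 -
            mmul (carrier k) (mmul (carrier k) (Tser k lam b 0 1) Ci) (Tser k lam b 1 0))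
          = (\<lambda>p. fps_const (q1 / q2) * Tser k lam b 0 0 p)))"

definition BerCo :: "complex \<Rightarrow> complex \<Rightarrow> nat \<Rightarrow> (nat \<Rightarrow> complex \<times> complex) \<Rightarrow> (nat \<Rightarrow> complex) \<Rightarrow> nat
    \<Rightarrow> (nat set \<times> nat set \<Rightarrow> complex)" where
  "BerCo q1 q2 k lam b r = (\<lambda>p. fps_nth (BerSer q1 q2 k lam b p) r)"

definition BQ :: "complex \<Rightarrow> complex \<Rightarrow> nat \<Rightarrow> (nat \<Rightarrow> complex \<times> complex) \<Rightarrow> (nat \<Rightarrow> complex)
    \<Rightarrow> (nat set \<times> nat set \<Rightarrow> complex) set" where
  "BQ q1 q2 k lam b = alg_gen (carrier k) (range (TQco q1 q2 k lam b) \<union> range (BerCo q1 q2 k lam b))"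

definition cyclicL :: "nat \<Rightarrow> (nat \<Rightarrow> complex \<times> complex) \<Rightarrow> (nat \<Rightarrow> complex) \<Rightarrow> bool" where
  "cyclicL k lam b \<longleftrightarrow>
     {mvec (carrier k) A (basisv {}) | A.
        A \<in> alg_gen (carrier k) {Tco k lam b r i j | r i j. r \<ge> 1 \<and> i \<le> 1 \<and> j \<le> 1}}
     = vecs (carrier k)"

definition e11op where "e11op k lam b = Tco k lam b 1 0 0"
definition e22op where "e22op k lam b = fscale (-1) (Tco k lam b 1 1 1)"

definition wt_carrier :: "nat \<Rightarrow> (nat \<Rightarrow> complex \<times> complex) \<Rightarrow> (nat \<Rightarrow> complex) \<Rightarrow> complex \<Rightarrow> complex
    \<Rightarrow> nat set set" where
  "wt_carrier k lam b a d = {S \<in> carrier k.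
      mvec (carrier k) (e11op k lam b) (basisv S) = fscale a (basisv S) \<and>
      mvec (carrier k) (e22op k lam b) (basisv S) = fscale d (basisv S)}"

definition phi_poly :: "nat \<Rightarrow> (nat \<Rightarrow> complex \<times> complex) \<Rightarrow> (nat \<Rightarrow> complex) \<Rightarrow> complex poly" where
  "phi_poly k lam b = (\<Prod>s<k. [:- b s + fst (lam s), 1:])"

definition psi_poly :: "nat \<Rightarrow> (nat \<Rightarrow> complex \<times> complex) \<Rightarrow> (nat \<Rightarrow> complex) \<Rightarrow> complex poly" where
  "psi_poly k lam b = (\<Prod>s<k. [:- b s - snd (lam s), 1:])"

definition D_poly :: "nat \<Rightarrow> (nat \<Rightarrow> complex) \<Rightarrow> complex poly" where
  "D_poly k b = (\<Prod>s<k. [:- b s, 1:])"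

text \<open>e(x) = P(x)/Q(x) as formal series in x^{-1}: e is the coefficient sequence of
sum_r e_r x^{-r}\<close>
definition laurent_eq :: "(nat \<Rightarrow> complex) \<Rightarrow> complex poly \<Rightarrow> complex poly \<Rightarrow> bool" where
  "laurent_eq e P Q \<longleftrightarrow> degree P \<le> degree Q \<and>
     fps_of_poly (reflect_poly Q) * Abs_fps e = fps_of_poly (monom 1 (degree Q - degree P) * reflect_poly P)"

type_synonym mpoly = "(nat \<Rightarrow>\<^sub>0 nat) \<Rightarrow>\<^sub>0 complex"

definition mvar :: "nat \<Rightarrow> mpoly" where
  "mvar i = Poly_Mapping.single (Poly_Mapping.single i 1) 1"

definition mconst :: "complex \<Rightarrow> mpoly" where
  "mconst c = Poly_Mapping.single 0 c"

definition esym :: "nat \<Rightarrow> nat \<Rightarrow> mpoly" where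
  "esym k i = (\<Sum>A\<in>{A. A \<subseteq> {..<k} \<and> card A = i}. \<Prod>a\<in>A. mvar a)"

text \<open>C[w_0..w_{k-1}]^{S_l x S_{k-l}}: S_l permutes w_0..w_{l-1}, S_{k-l} the rest\<close>
definition inv_ring :: "nat \<Rightarrow> nat \<Rightarrow> mpoly set" where
  "inv_ring k l = {p :: mpoly. (\<forall>m\<in>Poly_Mapping.keys p. Poly_Mapping.keys m \<subseteq> {..<k}) \<and>
     (\<forall>\<pi>. \<pi> permutes {..<k} \<and> \<pi> ` {..<l} = {..<l} \<longrightarrow>
        (\<forall>m :: nat \<Rightarrow>\<^sub>0 nat. Poly_Mapping.lookup p m = Poly_Mapping.lookup p (Abs_poly_mapping (\<lambda>i. Poly_Mapping.lookup m (\<pi> i)))))}"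

definition gen_ideal :: "nat \<Rightarrow> nat \<Rightarrow> (nat \<Rightarrow> complex) \<Rightarrow> mpoly set" where
  "gen_ideal k l eps = {\<Sum>i\<in>{1..k}. r i * (esym k i - mconst (eps i)) | r. \<forall>i. r i \<in> inv_ring k l}"

end

theory Submission
  imports Defs "HOL-Library.FuncSet" "HOL-Computational_Algebra.Fundamental_Theorem_Algebra"
begin

text \<open>Bosonization. In coordinates \<open>L(\<lambda>,b)\<close> is the Fock space of functions on subsets of
\<open>{0..<k}\<close>, and \<open>T\<^sub>1\<^sub>2(w)\<close> acts on wedges of the vectors \<open>v(w)\<close> created from the vacuum. The commutation
relations of \<open>T\<^sub>i\<^sub>i(t)\<close> with \<open>v(w)\<close> show that the wedge \<open>G = v(w\<^sub>0) \<and> \<dots> \<and> v(w\<^bsub>l-1\<^esub>)\<close> is an eigenvector of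
the transfer matrix modulo the Bethe equations \<open>F(w\<^sub>i) = 0\<close>, the off-shell Bethe vector. Cyclicity forces
the one-particle functions to span all polynomials of degree less than \<open>k\<close>, so that the Cauchy-Binet
expansion of the full wedge \<open>v(w\<^sub>0) \<and> \<dots> \<and> v(w\<^bsub>k-1\<^esub>)\<close> into components \<open>G\<^sub>S\<close> and complementary components
\<open>H\<^sub>S\<close> is a nonzero multiple of the Vandermonde determinant. Dividing by the partial Vandermonde
determinants yields invariants \<open>g\<^sub>S\<close>, \<open>u\<^sub>S\<close> that are dual bases of the quotient ring with respect to a trace
form \<open>lam0\<close>, and multiplication by \<open>p\<close> has the matrix \<open>lam0 (p g\<^sub>S u\<^sub>R)\<close>. The quotient ring thus acts on the
weight space by its regular representation, and the eigenvector relation identifies the image of the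
transfer matrix. The coefficients of the Berezinian are scalars. The statements on eigenspaces follow from
the structure of the quotient ring: its characters are the evaluations at the permutations of the roots
of \<open>F\<close>, and local idempotents are polynomials in one separating element.\<close>

section \<open>Polynomials, evaluation and alternation\<close>

text \<open>The roots of q1 \<phi> - q2 \<psi> may collide, so nothing can be interpolated at actual
  solutions of the Bethe equations: the w_i stay formal and all identities are congruences modulo
  the symmetric relations. Two cancellations must survive there. A factor monic in the spectral
  parameter cancels modulo any ideal, coefficient by coefficient from the top; a Vandermonde factor
  cancels by antisymmetrizing over S_l x S_(k-l), which also makes the ideal coefficients invariant.
  That \<open>g\<close> and \<open>u\<close> are dual is not computed entry by entry: the matrix of
  1 is idempotent and its trace, given by the Cauchy-Binet sum, is the number of l-subsets, so it is
  the identity. The constants in \<open>lam0\<close> have the same origin: N = l!(k-l)!, and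
  \<open>c0\<close> is the value at the roots of a unit, the full wedge divided by the Vandermonde
  determinant. The transfer matrix generates the whole ring because it supplies y(x-1)z(x) while the
  ideal fixes y(x)z(x), where y and z have the first l and the last k-l variables as roots;
  comparing the two recovers each lower coefficient y_c with the factor l - c, which is
  nonzero.\<close>

abbreviation mkeys :: "('a \<Rightarrow>\<^sub>0 'b::zero) \<Rightarrow> 'a set" where "mkeys \<equiv> Poly_Mapping.keys"
abbreviation mlook :: "('a \<Rightarrow>\<^sub>0 'b::zero) \<Rightarrow> 'a \<Rightarrow> 'b" where "mlook \<equiv> Poly_Mapping.lookup"

definition mono :: "(nat \<Rightarrow> 'a) \<Rightarrow> (nat \<Rightarrow>\<^sub>0 nat) \<Rightarrow> 'a::comm_ring_1" where
  "mono g m = (\<Prod>i\<in>mkeys m. g i ^ mlook m i)"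

text \<open>The coefficient map \<open>h\<close> is separate from the point \<open>g\<close>, so
  that one definition covers substitution of polynomials (\<open>h = mconst\<close>) and numerical
  evaluation (\<open>h\<close> the identity); \<open>ev_ev\<close> composes the two.\<close>

definition ev :: "(complex \<Rightarrow> 'a) \<Rightarrow> (nat \<Rightarrow> 'a) \<Rightarrow> mpoly \<Rightarrow> 'a::comm_ring_1" where
  "ev h g p = (\<Sum>m\<in>mkeys p. h (mlook p m) * mono g m)"

definition chom :: "(complex \<Rightarrow> 'a::comm_ring_1) \<Rightarrow> bool" where
  "chom h \<longleftrightarrow> h 1 = 1 \<and> (\<forall>a b. h (a + b) = h a + h b) \<and> (\<forall>a b. h (a * b) = h a * h b)"

lemma chom_simps:
  assumes "chom h"
  shows "h 1 = 1" "h (a + b) = h a + h b" "h (a * b) = h a * h b" "h 0 = 0"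
proof -
  show *: "h 1 = 1" "h (a + b) = h a + h b" "h (a * b) = h a * h b" for a b
    using assms by (auto simp: chom_def)
  from *(2)[of 0 0] show "h 0 = 0" by simp
qed

lemma chom_mconst [simp]: "chom mconst"
  by (auto simp: chom_def mconst_def single_add mult_single)

lemma chom_id [simp]: "chom (\<lambda>c. c)" by (auto simp: chom_def)

lemma mono_superset: "finite X \<Longrightarrow> mkeys m \<subseteq> X \<Longrightarrow> mono g m = (\<Prod>i\<in>X. g i ^ mlook m i)"
  unfolding mono_def by (rule prod.mono_neutral_left) (auto simp: in_keys_iff)

lemma mono_0 [simp]: "mono g 0 = 1" by (simp add: mono_def)

lemma mono_add: "mono g (m + m') = mono g m * mono g m'"
proof -
  let ?X = "mkeys m \<union> mkeys m'"
  have "mkeys (m + m') \<subseteq> ?X" by (rule keys_add)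
  thus ?thesis
    by (simp add: mono_superset[of ?X] lookup_add power_add prod.distrib)
qed

lemma ev_superset:
  assumes "chom h" "finite X" "mkeys p \<subseteq> X"
  shows "ev h g p = (\<Sum>m\<in>X. h (mlook p m) * mono g m)"
  unfolding ev_def
  by (rule sum.mono_neutral_left) (use assms in \<open>auto simp: in_keys_iff chom_simps\<close>)

lemma ev_add: "chom h \<Longrightarrow> ev h g (p + q) = ev h g p + ev h g q"
proof -
  assume h: "chom h"
  let ?X = "mkeys p \<union> mkeys q"
  have "mkeys (p + q) \<subseteq> ?X" by (rule keys_add)
  thus ?thesis
    by (simp add: ev_superset[OF h, of ?X] lookup_add chom_simps[OF h] sum.distrib algebra_simps)
qed

lemma ev_single: "chom h \<Longrightarrow> ev h g (Poly_Mapping.single m c) = h c * mono g m"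
  by (subst ev_superset[where X="{m}"]) auto

lemma ev_0 [simp]: "ev h g 0 = 0" by (simp add: ev_def)

lemma ev_sum: "chom h \<Longrightarrow> ev h g (sum f A) = (\<Sum>a\<in>A. ev h g (f a))"
  by (induction A rule: infinite_finite_induct) (auto simp: ev_add)

lemma sum_single:
  fixes p :: "'a \<Rightarrow>\<^sub>0 'b::comm_monoid_add"
  shows "(\<Sum>m\<in>mkeys p. Poly_Mapping.single m (mlook p m)) = p"
proof (rule poly_mapping_eqI)
  fix m
  have "mlook (\<Sum>m\<in>mkeys p. Poly_Mapping.single m (mlook p m)) m
      = (\<Sum>m'\<in>mkeys p. if m' = m then mlook p m' else 0)"
    by (simp add: lookup_sum lookup_single when_def)
  also have "\<dots> = mlook p m" by (auto simp: in_keys_iff)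
  finally show "mlook (\<Sum>m\<in>mkeys p. Poly_Mapping.single m (mlook p m)) m = mlook p m" .
qed

lemma mpoly_induct_single:
  fixes p :: "'a \<Rightarrow>\<^sub>0 'b::comm_monoid_add"
  assumes "P 0" "\<And>m c. P (Poly_Mapping.single m c)" "\<And>p q. P p \<Longrightarrow> P q \<Longrightarrow> P (p + q)"
  shows "P p"
proof -
  have "P (\<Sum>m\<in>X. Poly_Mapping.single m (mlook p m))" if "finite X" for X
    using that by (induction X rule: finite_induct) (auto intro: assms)
  from this[OF finite_keys, of p] show ?thesis by (simp only: sum_single)
qed

lemma ev_mult: "chom h \<Longrightarrow> ev h g (p * q) = ev h g p * ev h g q"
proof (induction p rule: mpoly_induct_single)
  case (2 m c)
  thus ?case
  proof (induction q rule: mpoly_induct_single)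
    case (2 m c)
    thus ?case by (simp add: mult_single ev_single mono_add chom_simps)
  qed (auto simp: ev_add algebra_simps)
qed (auto simp: ev_add algebra_simps)

lemma ev_mconst [simp]: "chom h \<Longrightarrow> ev h g (mconst c) = h c"
  by (simp add: mconst_def ev_single)

lemma mconst_1: "mconst 1 = 1" by (simp add: mconst_def)
lemma mconst_0 [simp]: "mconst 0 = 0" by (simp add: mconst_def)
lemma mconst_add: "mconst (a + b) = mconst a + mconst b" by (simp add: mconst_def single_add)
lemma mconst_mult: "mconst (a * b) = mconst a * mconst b" by (simp add: mconst_def mult_single)
lemma mconst_uminus: "mconst (- a) = - mconst a" by (simp add: mconst_def single_uminus)
lemma mconst_diff: "mconst (a - b) = mconst a - mconst b" by (simp add: mconst_def single_diff)
lemma mconst_sum: "mconst (sum f A) = (\<Sum>a\<in>A. mconst (f a))"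
  by (induction A rule: infinite_finite_induct) (auto simp: mconst_add)
lemma mconst_eq_iff [simp]: "mconst a = mconst b \<longleftrightarrow> a = b"
  by (auto simp: mconst_def dest: arg_cong[where f="\<lambda>p. mlook p 0"])
lemma mconst_power: "mconst (c ^ n) = mconst c ^ n"
  by (induction n) (auto simp: mconst_mult mconst_1)

lemma ev_1 [simp]: "chom h \<Longrightarrow> ev h g 1 = 1"
  using ev_mconst[of h g 1] by (simp add: mconst_1 chom_simps)

lemma ev_mvar [simp]: "chom h \<Longrightarrow> ev h g (mvar i) = g i"
  by (simp add: mvar_def ev_single chom_simps mono_def)

lemma ev_prod: "chom h \<Longrightarrow> ev h g (prod f A) = (\<Prod>a\<in>A. ev h g (f a))"
  by (induction A rule: infinite_finite_induct) (auto simp: ev_mult)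

lemma ev_power: "chom h \<Longrightarrow> ev h g (p ^ n) = ev h g p ^ n"
  by (induction n) (auto simp: ev_mult)

lemma ev_uminus: "chom h \<Longrightarrow> ev h g (- p) = - ev h g p"
  using ev_add[of h g p "- p"] by (simp add: eq_neg_iff_add_eq_0 add.commute)

lemma ev_diff: "chom h \<Longrightarrow> ev h g (p - q) = ev h g p - ev h g q"
  using ev_add[of h g p "- q"] by (simp add: ev_uminus)

lemma ev_of_int: "chom h \<Longrightarrow> ev h g (of_int n) = of_int n"
proof -
  assume h: "chom h"
  have nat: "ev h g (of_nat n) = of_nat n" for n by (induction n) (auto simp: h ev_add)
  show ?thesis by (cases n rule: int_cases2) (auto simp: nat ev_uminus h)
qed

lemmas ev_simps = ev_add ev_mult ev_sum ev_prod ev_power ev_uminus ev_diff ev_of_int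

lemma mono_mvar: "mono mvar m = Poly_Mapping.single m 1"
proof -
  have pow: "mvar i ^ n = Poly_Mapping.single (Poly_Mapping.single i n) 1" for i n
    by (induction n) (auto simp: mvar_def mult_single single_add[symmetric])
  have prod: "(\<Prod>i\<in>X. Poly_Mapping.single (f i) (1::complex)) = Poly_Mapping.single (\<Sum>i\<in>X. f i) 1" for X :: "nat set" and f :: "nat \<Rightarrow> nat \<Rightarrow>\<^sub>0 nat"
    by (induction X rule: infinite_finite_induct) (auto simp: mult_single)
  show ?thesis unfolding mono_def pow prod sum_single ..
qed

lemma single_eq_mono: "Poly_Mapping.single m c = mconst c * mono mvar m"
  by (simp add: mono_mvar mconst_def mult_single)

lemma mpoly_induct [case_names const var add mult]:
  assumes "\<And>c. P (mconst c)" "\<And>i. P (mvar i)" "\<And>p q. P p \<Longrightarrow> P q \<Longrightarrow> P (p + q)"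
    "\<And>p q. P p \<Longrightarrow> P q \<Longrightarrow> P (p * q)"
  shows "P p"
proof (induction p rule: mpoly_induct_single)
  case 1 show ?case using assms(1)[of 0] by simp
next
  case (2 m c)
  have pow: "P (mvar i ^ n)" for i n
    using assms(1)[of 1] by (induction n) (auto intro: assms simp: mconst_1)
  have "P (\<Prod>i\<in>X. mvar i ^ mlook m i)" if "finite X" for X
    using that assms(1)[of 1] by (induction X rule: finite_induct) (auto intro: assms pow simp: mconst_1)
  thus ?case unfolding single_eq_mono mono_def by (intro assms) auto
qed (rule assms)

lemma ev_ev:
  assumes "chom h" shows "ev h g (ev mconst g' p) = ev h (\<lambda>i. ev h g (g' i)) p"
  by (induction p rule: mpoly_induct) (auto simp: assms ev_simps)

lemma ev_mconst_mvar [simp]: "ev mconst mvar p = p"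
  by (induction p rule: mpoly_induct) (auto simp: ev_simps)

section \<open>Renaming and truncation of variables, invariants of the block group\<close>

definition rename :: "(nat \<Rightarrow> nat) \<Rightarrow> mpoly \<Rightarrow> mpoly" where
  "rename \<pi> = ev mconst (\<lambda>i. mvar (\<pi> i))"

lemma rename_simps [simp]:
  "rename \<pi> (p + q) = rename \<pi> p + rename \<pi> q" "rename \<pi> (p * q) = rename \<pi> p * rename \<pi> q"
  "rename \<pi> (p - q) = rename \<pi> p - rename \<pi> q" "rename \<pi> (- p) = - rename \<pi> p"
  "rename \<pi> (mconst c) = mconst c" "rename \<pi> (mvar i) = mvar (\<pi> i)" "rename \<pi> 0 = 0" "rename \<pi> 1 = 1"
  "rename \<pi> (of_int z) = of_int z" "rename \<pi> (p ^ n) = rename \<pi> p ^ n"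
  by (simp_all add: rename_def ev_simps)

lemma rename_sum: "rename \<pi> (sum f A) = (\<Sum>a\<in>A. rename \<pi> (f a))"
  and rename_prod: "rename \<pi> (prod f A) = (\<Prod>a\<in>A. rename \<pi> (f a))"
  by (simp_all add: rename_def ev_simps)

lemma rename_rename: "rename \<pi> (rename \<sigma> p) = rename (\<pi> \<circ> \<sigma>) p"
  by (simp add: rename_def ev_ev)

lemma rename_id [simp]: "rename id p = p" "rename (\<lambda>x. x) p = p" by (simp_all add: rename_def)

lemma ev_rename: "chom h \<Longrightarrow> ev h g (rename \<pi> p) = ev h (\<lambda>i. g (\<pi> i)) p"
  by (simp add: rename_def ev_ev)

text \<open>Translates the coefficientwise invariance in \<open>inv_ring\<close> into invariance
  under a ring homomorphism. Injectivity of \<pi> makes the reindexed exponent finitely supported,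
  so that \<open>Abs_poly_mapping\<close> has its intended value; surjectivity lets exponents be
  compared at indices of the form \<pi> i.\<close>

lemma lookup_rename:
  assumes "bij \<pi>"
  shows "mlook (rename \<pi> p) m = mlook p (Abs_poly_mapping (\<lambda>i. mlook m (\<pi> i)))"
proof (induction p rule: mpoly_induct_single)
  case (2 m0 c)
  have fin: "finite {i. mlook m (\<pi> i) \<noteq> 0}"
  proof -
    have "{i. mlook m (\<pi> i) \<noteq> 0} = \<pi> -` mkeys m" by (auto simp: in_keys_iff)
    thus ?thesis using assms by (simp add: finite_vimageI bij_is_inj)
  qed
  define m1 where "m1 = (\<Sum>i\<in>mkeys m0. Poly_Mapping.single (\<pi> i) (mlook m0 i))"
  have lm1: "mlook m1 (\<pi> j) = mlook m0 j" for j
  proof -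
    have "mlook m1 (\<pi> j) = (\<Sum>i\<in>mkeys m0. if i = j then mlook m0 i else 0)"
      unfolding m1_def lookup_sum by (intro sum.cong) (use assms in \<open>auto simp: lookup_single when_def dest: bij_is_inj injD\<close>)
    also have "\<dots> = mlook m0 j" by (auto simp: in_keys_iff)
    finally show ?thesis .
  qed
  have pow: "mvar i ^ n = Poly_Mapping.single (Poly_Mapping.single i n) 1" for i n
    by (induction n) (auto simp: mvar_def mult_single single_add[symmetric])
  have prod: "(\<Prod>i\<in>X. Poly_Mapping.single (f i) (1::complex)) = Poly_Mapping.single (\<Sum>i\<in>X. f i) 1" for X :: "nat set" and f :: "nat \<Rightarrow> nat \<Rightarrow>\<^sub>0 nat"
    by (induction X rule: infinite_finite_induct) (auto simp: mult_single)
  have "rename \<pi> (Poly_Mapping.single m0 c) = Poly_Mapping.single m1 c"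
    by (simp add: rename_def ev_single mono_def pow prod flip: m1_def) (simp add: mconst_def mult_single)
  moreover have "m1 = m \<longleftrightarrow> m0 = Abs_poly_mapping (\<lambda>i. mlook m (\<pi> i))"
  proof
    assume "m1 = m"
    thus "m0 = Abs_poly_mapping (\<lambda>i. mlook m (\<pi> i))"
      by (intro poly_mapping_eqI) (simp add: lookup_Abs_poly_mapping[OF fin] flip: lm1)
  next
    assume *: "m0 = Abs_poly_mapping (\<lambda>i. mlook m (\<pi> i))"
    show "m1 = m"
    proof (rule poly_mapping_eqI)
      fix j obtain i where "j = \<pi> i" using assms by (metis bij_pointE)
      thus "mlook m1 j = mlook m j" using lm1[of i] by (simp add: * lookup_Abs_poly_mapping[OF fin])
    qed
  qed
  ultimately show ?case by (simp add: lookup_single when_def)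
qed (auto simp: lookup_add)

text \<open>Setting the variables from \<open>k\<close> on to zero is a ring homomorphism whose
  fixed points are the polynomials in the first \<open>k\<close> variables; the support condition in
  \<open>inv_ring\<close> thereby becomes an equation.\<close>

definition trunc :: "nat \<Rightarrow> mpoly \<Rightarrow> mpoly" where
  "trunc k = ev mconst (\<lambda>i. if i < k then mvar i else 0)"

lemma trunc_simps [simp]:
  "trunc k (p + q) = trunc k p + trunc k q" "trunc k (p * q) = trunc k p * trunc k q"
  "trunc k (p - q) = trunc k p - trunc k q" "trunc k (- p) = - trunc k p"
  "trunc k (mconst c) = mconst c" "trunc k (mvar i) = (if i < k then mvar i else 0)" "trunc k 0 = 0" "trunc k 1 = 1"
  "trunc k (of_int z) = of_int z" "trunc k (p ^ n) = trunc k p ^ n"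
  by (simp_all add: trunc_def ev_simps)

lemma trunc_sum: "trunc k (sum f A) = (\<Sum>a\<in>A. trunc k (f a))"
  and trunc_prod: "trunc k (prod f A) = (\<Prod>a\<in>A. trunc k (f a))"
  by (simp_all add: trunc_def ev_simps)

lemma trunc_eq_iff: "trunc k p = p \<longleftrightarrow> (\<forall>m\<in>mkeys p. mkeys m \<subseteq> {..<k})"
proof
  assume "\<forall>m\<in>mkeys p. mkeys m \<subseteq> {..<k}"
  hence "trunc k p = ev mconst mvar p"
    unfolding trunc_def ev_def mono_def by (intro sum.cong refl arg_cong2[where f="(*)"] prod.cong) auto
  thus "trunc k p = p" by simp
next
  have "\<forall>m\<in>mkeys (trunc k p). mkeys m \<subseteq> {..<k}"
  proof (induction p rule: mpoly_induct)
    case (add p q)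
    show ?case
    proof
      fix m assume "m \<in> mkeys (trunc k (p + q))"
      hence "m \<in> mkeys (trunc k p + trunc k q)" by (simp only: trunc_simps)
      hence "m \<in> mkeys (trunc k p) \<union> mkeys (trunc k q)"
        by (rule subsetD[OF keys_add])
      thus "mkeys m \<subseteq> {..<k}" using add by blast
    qed
  next
    case (mult p q)
    show ?case
    proof
      fix m assume "m \<in> mkeys (trunc k (p * q))"
      hence "m \<in> mkeys (trunc k p * trunc k q)" by (simp only: trunc_simps)
      hence "m \<in> {a + b |a b. a \<in> mkeys (trunc k p) \<and> b \<in> mkeys (trunc k q)}"
        by (rule subsetD[OF keys_mult])
      then obtain a b where ab: "m = a + b" "a \<in> mkeys (trunc k p)" "b \<in> mkeys (trunc k q)"
        by blast
      have "mkeys m \<subseteq> mkeys a \<union> mkeys b" unfolding ab(1) by (rule keys_add)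
      thus "mkeys m \<subseteq> {..<k}" using mult ab by blast
    qed
  next
    case (const c)
    show ?case by (simp only: trunc_simps) (simp add: mconst_def)
  next
    case (var i)
    show ?case by (simp only: trunc_simps) (simp add: mvar_def)
  qed
  thus "trunc k p = p \<Longrightarrow> \<forall>m\<in>mkeys p. mkeys m \<subseteq> {..<k}" by simp
qed

definition Gp :: "nat \<Rightarrow> nat \<Rightarrow> (nat \<Rightarrow> nat) set" where
  "Gp k l = {\<pi>. \<pi> permutes {..<k} \<and> \<pi> ` {..<l} = {..<l}}"

lemma inv_ring_iff: "p \<in> inv_ring k l \<longleftrightarrow> trunc k p = p \<and> (\<forall>\<pi>\<in>Gp k l. rename \<pi> p = p)"
proof -
  have "(\<forall>m. mlook p m = mlook p (Abs_poly_mapping (\<lambda>i. mlook m (\<pi> i)))) \<longleftrightarrow> rename \<pi> p = p"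
    if "\<pi> permutes {..<k}" for \<pi>
    using that by (auto simp: poly_mapping_eq_iff fun_eq_iff lookup_rename permutes_bij simp flip: )
  thus ?thesis by (auto simp: inv_ring_def trunc_eq_iff Gp_def)
qed

lemma inv_ring_closed [intro]:
  "p \<in> inv_ring k l \<Longrightarrow> q \<in> inv_ring k l \<Longrightarrow> p + q \<in> inv_ring k l"
  "p \<in> inv_ring k l \<Longrightarrow> q \<in> inv_ring k l \<Longrightarrow> p * q \<in> inv_ring k l"
  "p \<in> inv_ring k l \<Longrightarrow> q \<in> inv_ring k l \<Longrightarrow> p - q \<in> inv_ring k l"
  "p \<in> inv_ring k l \<Longrightarrow> - p \<in> inv_ring k l"
  "mconst c \<in> inv_ring k l" "1 \<in> inv_ring k l" "0 \<in> inv_ring k l"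
  "p \<in> inv_ring k l \<Longrightarrow> p ^ n \<in> inv_ring k l"
  by (auto simp: inv_ring_iff)

lemma inv_ring_sum: "(\<And>a. a \<in> A \<Longrightarrow> f a \<in> inv_ring k l) \<Longrightarrow> sum f A \<in> inv_ring k l"
  and inv_ring_prod: "(\<And>a. a \<in> A \<Longrightarrow> f a \<in> inv_ring k l) \<Longrightarrow> prod f A \<in> inv_ring k l"
  by (induction A rule: infinite_finite_induct) auto

text \<open>Transpositions generate the group. The case \<open>e = 1\<close> serves for invariant,
  \<open>e = - 1\<close> for alternating polynomials.\<close>

lemma rename_permutes_eq:
  assumes "\<pi> permutes A" "finite A"
    and "\<And>a b. a \<in> A \<Longrightarrow> b \<in> A \<Longrightarrow> a \<noteq> b \<Longrightarrow> rename (transpose a b) p = of_int e * p" "e = 1 \<or> e = - 1"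
  shows "rename \<pi> p = (if e = 1 then 1 else of_int (sign \<pi>)) * p"
  using assms(1,2)
proof (induction rule: permutes_induct)
  case (swap a b \<pi>)
  have perm: "permutation \<pi>" using swap assms(2) by (auto simp: permutation_permutes)
  have "rename (transpose a b \<circ> \<pi>) p = rename (transpose a b) (rename \<pi> p)"
    by (simp add: rename_rename)
  also have "\<dots> = (if e = 1 then 1 else of_int (sign \<pi>)) * rename (transpose a b) p"
    by (subst swap.IH) auto
  also have "\<dots> = (if e = 1 then 1 else of_int (sign (transpose a b \<circ> \<pi>))) * p"
    using assms(4) swap perm by (auto simp: assms(3) sign_compose sign_swap_id permutation_swap_id)
  finally show ?case .
qed auto

lemma Gp_decompose:
  assumes "\<pi> \<in> Gp k l" "l \<le> k"
  obtains \<pi>1 \<pi>2 where "\<pi>1 permutes {..<l}" "\<pi>2 permutes {l..<k}" "\<pi> = \<pi>1 \<circ> \<pi>2"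
proof -
  from assms have p: "\<pi> permutes {..<k}" and im: "\<pi> ` {..<l} = {..<l}" by (auto simp: Gp_def)
  have inj: "inj \<pi>" using p by (rule permutes_inj)
  have imk: "\<pi> ` {l..<k} = {l..<k}"
  proof -
    have "{l..<k} = {..<k} - {..<l}" using assms(2) by auto
    hence "\<pi> ` {l..<k} = \<pi> ` {..<k} - \<pi> ` {..<l}" by (simp only: image_set_diff[OF inj])
    also have "\<dots> = {..<k} - {..<l}" by (simp only: im permutes_image[OF p])
    also have "\<dots> = {l..<k}" using assms(2) by auto
    finally show ?thesis .
  qed
  define \<pi>1 where "\<pi>1 = (\<lambda>i. if i < l then \<pi> i else i)"
  define \<pi>2 where "\<pi>2 = (\<lambda>i. if i \<in> {l..<k} then \<pi> i else i)"
  have "bij_betw \<pi> {..<l} {..<l}" using im inj by (auto simp: bij_betw_def intro: inj_on_subset)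
  hence "bij_betw \<pi>1 {..<l} {..<l}" by (subst bij_betw_cong[where g=\<pi>]) (auto simp: \<pi>1_def)
  hence 1: "\<pi>1 permutes {..<l}" by (rule bij_imp_permutes) (auto simp: \<pi>1_def)
  have "bij_betw \<pi> {l..<k} {l..<k}" using imk inj by (auto simp: bij_betw_def intro: inj_on_subset)
  hence "bij_betw \<pi>2 {l..<k} {l..<k}" by (subst bij_betw_cong[where g=\<pi>]) (auto simp: \<pi>2_def)
  hence 2: "\<pi>2 permutes {l..<k}" by (rule bij_imp_permutes) (auto simp: \<pi>2_def)
  have "\<pi> i = \<pi>1 (\<pi>2 i)" for i
  proof (cases "i \<in> {l..<k}")
    case True
    hence "\<pi> i \<in> {l..<k}" using imk by blast
    thus ?thesis using True by (auto simp: \<pi>1_def \<pi>2_def)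
  next
    case False
    thus ?thesis using permutes_not_in[OF p, of i] assms(2) by (auto simp: \<pi>1_def \<pi>2_def)
  qed
  with 1 2 that show ?thesis by (metis comp_apply ext)
qed

lemma inv_ring_transposeI:
  assumes "l \<le> k" "trunc k p = p"
    "\<And>a b. a < l \<Longrightarrow> b < l \<Longrightarrow> a \<noteq> b \<Longrightarrow> rename (transpose a b) p = p"
    "\<And>a b. a \<in> {l..<k} \<Longrightarrow> b \<in> {l..<k} \<Longrightarrow> a \<noteq> b \<Longrightarrow> rename (transpose a b) p = p"
  shows "p \<in> inv_ring k l"
proof -
  have "rename \<pi> p = p" if \<pi>: "\<pi> \<in> Gp k l" for \<pi>
  proof -
    from \<pi> assms(1) obtain \<pi>1 \<pi>2 where 1: "\<pi>1 permutes {..<l}" "\<pi>2 permutes {l..<k}" "\<pi> = \<pi>1 \<circ> \<pi>2"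
      by (rule Gp_decompose)
    have "rename \<pi>1 p = p" using rename_permutes_eq[OF 1(1), of p 1] assms(3) by auto
    moreover have "rename \<pi>2 p = p" using rename_permutes_eq[OF 1(2), of p 1] assms(4) by auto
    ultimately show ?thesis by (simp add: 1(3) flip: rename_rename)
  qed
  with assms(2) show ?thesis by (simp add: inv_ring_iff)
qed

section \<open>Vandermonde products and divisibility of alternating polynomials\<close>

definition VA :: "nat set \<Rightarrow> mpoly" where
  "VA A = (\<Prod>i\<in>A. \<Prod>j\<in>{j\<in>A. i < j}. (mvar i - mvar j))"

lemma mvar_eq_iff [simp]: "mvar i = mvar j \<longleftrightarrow> i = j"
proof
  assume "mvar i = mvar j"
  hence "ev (\<lambda>c. c) (\<lambda>x. if x = i then 1 else 0) (mvar i) = ev (\<lambda>c. c) (\<lambda>x. if x = i then 1 else (0::complex)) (mvar j)"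
    by simp
  thus "i = j" by (auto split: if_splits)
qed auto

lemma VA_nonzero: "finite A \<Longrightarrow> VA A \<noteq> 0"
  by (auto simp: VA_def)

text \<open>Moving the new index to the front flips one factor for each smaller index already
  present. What matters later is only that the total sign is a unit fixed by all renamings, so it is
  left unspecified.\<close>

lemma VA_insert:
  assumes "finite A" "x \<notin> A"
  obtains s where "s = 1 \<or> s = - 1" "VA (insert x A) = s * (\<Prod>c\<in>A. mvar x - mvar c) * VA A"
proof -
  let ?d = "\<lambda>i j. mvar i - mvar j"
  have inner: "(\<Prod>j\<in>{j\<in>insert x A. i < j}. ?d i j) = (if i < x then ?d i x else 1) * (\<Prod>j\<in>{j\<in>A. i < j}. ?d i j)"
    if "i \<in> A" for i
  proof (cases "i < x")
    case True
    hence eq: "{j\<in>insert x A. i < j} = insert x {j\<in>A. i < j}" by auto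
    show ?thesis unfolding eq using assms True by (subst prod.insert) auto
  next
    case False
    hence eq: "{j\<in>insert x A. i < j} = {j\<in>A. i < j}" by auto
    show ?thesis unfolding eq using False by simp
  qed
  have outer: "{j\<in>insert x A. x < j} = {j\<in>A. x < j}" by auto
  have "VA (insert x A) = (\<Prod>j\<in>{j\<in>A. x < j}. ?d x j) * ((\<Prod>i\<in>A. if i < x then ?d i x else 1) * VA A)"
    unfolding VA_def prod.insert[OF assms] outer
    by (subst prod.cong[OF refl inner]) (simp_all only: prod.distrib)
  also have "(\<Prod>j\<in>{j\<in>A. x < j}. ?d x j) = (\<Prod>i\<in>A. if x < i then ?d x i else 1)"
    using assms by (simp add: prod.inter_filter)
  finally have eq: "VA (insert x A) = (\<Prod>i\<in>A. (if x < i then ?d x i else 1) * (if i < x then ?d i x else 1)) * VA A"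
    by (simp add: prod.distrib mult.assoc)
  have "(\<Prod>i\<in>A. (if x < i then ?d x i else 1) * (if i < x then ?d i x else 1))
      = (\<Prod>i\<in>A. (if x < i then 1 else - 1) * ?d x i)"
    by (intro prod.cong) (use assms in auto)
  also have "\<dots> = (\<Prod>i\<in>A. if x < i then 1 else - 1) * (\<Prod>c\<in>A. ?d x c)" by (simp add: prod.distrib)
  finally have "VA (insert x A) = (\<Prod>i\<in>A. if x < i then 1 else - 1) * (\<Prod>c\<in>A. ?d x c) * VA A" using eq by simp
  moreover have "(\<Prod>i\<in>A. if x < i then 1 else - 1) = (1::mpoly) \<or> (\<Prod>i\<in>A. if x < i then 1 else - 1) = (- 1::mpoly)"
    using assms(1) by (induction A rule: finite_induct) auto
  ultimately show ?thesis using that by blast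
qed

lemma rename_VA_fix: "(\<And>i. i \<in> A \<Longrightarrow> \<pi> i = i) \<Longrightarrow> rename \<pi> (VA A) = VA A"
  unfolding VA_def rename_prod by (intro prod.cong) auto

text \<open>With \<open>a\<close> and \<open>b\<close> split off, the transposition negates the
  factor w_a - w_b, exchanges the two products over the remaining indices and fixes the
  rest.\<close>

lemma rename_VA_transpose:
  assumes "finite A" "a \<in> A" "b \<in> A" "a \<noteq> b"
  shows "rename (transpose a b) (VA A) = - VA A"
proof -
  let ?B = "A - {a, b}"
  have "A = insert a (insert b ?B)" using assms by auto
  moreover obtain s where s: "s = 1 \<or> s = - 1" "VA (insert a (insert b ?B)) = s * (\<Prod>c\<in>insert b ?B. mvar a - mvar c) * VA (insert b ?B)"
    by (rule VA_insert[of "insert b ?B" a]) (use assms in auto)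
  moreover obtain s' where s': "s' = 1 \<or> s' = - 1" "VA (insert b ?B) = s' * (\<Prod>c\<in>?B. mvar b - mvar c) * VA ?B"
    by (rule VA_insert[of ?B b]) (use assms in auto)
  ultimately have eq: "VA A = s * s' * (mvar a - mvar b) * ((\<Prod>c\<in>?B. mvar a - mvar c) * (\<Prod>c\<in>?B. mvar b - mvar c)) * VA ?B"
    using assms by (simp add: algebra_simps)
  have B: "rename (transpose a b) (VA ?B) = VA ?B" by (rule rename_VA_fix) auto
  have "rename (transpose a b) (\<Prod>c\<in>?B. mvar a - mvar c) = (\<Prod>c\<in>?B. mvar b - mvar c)"
    "rename (transpose a b) (\<Prod>c\<in>?B. mvar b - mvar c) = (\<Prod>c\<in>?B. mvar a - mvar c)"
    unfolding rename_prod by (auto intro!: prod.cong)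
  moreover have "rename (transpose a b) s = s" "rename (transpose a b) s' = s'" using s s' by auto
  ultimately show ?thesis unfolding eq by (simp add: B algebra_simps)
qed

lemma trunc_VA: "A \<subseteq> {..<k} \<Longrightarrow> trunc k (VA A) = VA A"
  unfolding VA_def trunc_prod by (intro prod.cong) auto

text \<open>The factor theorem in the variable w_j: if substituting w_i for w_j kills
  \<open>f\<close>, then w_i - w_j divides \<open>f\<close>.\<close>

lemma diff_dvd_subst:
  "(mvar i - mvar j) dvd (f - ev mconst (\<lambda>x. if x = j then mvar i else mvar x) f)"
proof (induction f rule: mpoly_induct)
  case (add p q)
  thus ?case by (simp add: ev_add) (metis (no_types, lifting) add_diff_add dvd_add)
next
  case (mult p q)
  let ?s = "ev mconst (\<lambda>x. if x = j then mvar i else mvar x)"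
  have "p * q - ?s (p * q) = (p - ?s p) * q + ?s p * (q - ?s q)" by (simp add: ev_mult algebra_simps)
  moreover have "(mvar i - mvar j) dvd \<dots>"
    by (intro dvd_add dvd_mult2[OF mult(1)] dvd_mult[OF mult(2)])
  ultimately show ?case by (simp only:)
next
  case (var x)
  have "mvar i - mvar j dvd mvar j - mvar i" by (metis dvd_refl dvd_minus_iff minus_diff_eq)
  thus ?case by auto
qed auto

text \<open>The factors are split off one at a time. Putting w_j = w_i in an antisymmetric
  \<open>f\<close> gives zero, while the product of the factors already removed stays nonzero, so
  the cofactor vanishes there and is divisible by w_i - w_j.\<close>

lemma pairs_dvd:
  assumes "finite P" "\<And>i j. (i, j) \<in> P \<Longrightarrow> i < j \<and> rename (transpose i j) f = - f"
  shows "(\<Prod>(i, j)\<in>P. mvar i - mvar j) dvd f"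
  using assms
proof (induction P rule: finite_induct)
  case (insert x P)
  obtain i j where x: "x = (i, j)" by (cases x)
  let ?s = "ev mconst (\<lambda>x. if x = j then mvar i else mvar x)"
  let ?D = "\<Prod>(i, j)\<in>P. mvar i - mvar j"
  have ij: "i < j" "rename (transpose i j) f = - f" using insert.prems[of i j] x by auto
  have "?D dvd f" by (rule insert.IH) (use insert.prems in auto)
  then obtain f1 where f1: "f = ?D * f1" by (elim dvdE)
  have "?s (rename (transpose i j) f) = ?s f"
    by (subst ev_rename) (auto intro!: arg_cong2[where f="ev mconst"] simp: transpose_def fun_eq_iff)
  hence "?s f = - ?s f" by (simp add: ij ev_uminus)
  hence "?s f = 0" by simp
  hence "?s ?D * ?s f1 = 0" by (simp add: f1 ev_mult)
  moreover have "?s ?D \<noteq> 0"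
  proof
    assume "?s ?D = 0"
    hence "\<exists>y\<in>P. (case y of (a, b) \<Rightarrow> ?s (mvar a - mvar b)) = 0"
      by (simp add: ev_prod insert.hyps case_prod_unfold)
    then obtain a b where ab: "(a, b) \<in> P" "?s (mvar a - mvar b) = 0" by auto
    have "a < b" using insert.prems ab(1) by auto
    \<comment> \<open>A factor for another pair vanishes under the substitution only if both of its
      indices become \<open>i\<close>; the orderings a < b and i < j then leave the pair (i, j)
      itself, which is not in \<open>P\<close>.\<close>
    with ab(2) have "a = i \<and> b = j" using ij(1) by (auto simp: ev_diff split: if_splits)
    with ab(1) x insert.hyps show False by simp
  qed
  ultimately have "?s f1 = 0" by simp
  with diff_dvd_subst[of i j f1] have "(mvar i - mvar j) dvd f1" by simp
  then obtain f2 where "f1 = (mvar i - mvar j) * f2" by (elim dvdE)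
  hence "f = (mvar i - mvar j) * ?D * f2" using f1 by (simp add: mult_ac)
  thus ?case using insert.hyps x by simp
qed auto

lemma VA_mult_dvd:
  assumes "finite A" "finite B" "A \<inter> B = {}"
    "\<And>i j. i \<in> A \<Longrightarrow> j \<in> A \<Longrightarrow> i \<noteq> j \<Longrightarrow> rename (transpose i j) f = - f"
    "\<And>i j. i \<in> B \<Longrightarrow> j \<in> B \<Longrightarrow> i \<noteq> j \<Longrightarrow> rename (transpose i j) f = - f"
  shows "VA A * VA B dvd f"
proof -
  let ?P = "\<lambda>A. SIGMA i:A. {j\<in>A. i < j}"
  have V: "VA A = (\<Prod>(i, j)\<in>?P A. mvar i - mvar j)" if "finite A" for A
    unfolding VA_def using that by (simp add: prod.Sigma)
  have "(\<Prod>(i, j)\<in>?P A \<union> ?P B. mvar i - mvar j) dvd f"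
    by (rule pairs_dvd) (use assms in auto)
  also have "(\<Prod>(i, j)\<in>?P A \<union> ?P B. mvar i - mvar j) = VA A * VA B"
    unfolding V[OF assms(1)] V[OF assms(2)] by (rule prod.union_disjoint) (use assms in auto)
  finally show ?thesis .
qed

lemma VA_dvd:
  assumes "finite A" "\<And>i j. i \<in> A \<Longrightarrow> j \<in> A \<Longrightarrow> i \<noteq> j \<Longrightarrow> rename (transpose i j) f = - f"
  shows "VA A dvd f"
  using VA_mult_dvd[of A "{}" f] assms by (simp add: VA_def)

section \<open>Antisymmetrization and division by the Vandermonde determinant\<close>

definition alt :: "nat \<Rightarrow> mpoly \<Rightarrow> mpoly" where
  "alt k f = (\<Sum>\<pi> | \<pi> permutes {..<k}. of_int (sign \<pi>) * rename \<pi> f)"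

lemma alt_add: "alt k (f + g) = alt k f + alt k g"
  by (simp add: alt_def algebra_simps sum.distrib)

lemma alt_0 [simp]: "alt k 0 = 0"
  by (simp add: alt_def)

lemma alt_mult_sym: "r \<in> inv_ring k k \<Longrightarrow> alt k (r * f) = r * alt k f"
proof -
  assume "r \<in> inv_ring k k"
  hence "rename \<pi> r = r" if "\<pi> permutes {..<k}" for \<pi>
    using that permutes_image[OF that] by (auto simp: inv_ring_iff Gp_def)
  thus ?thesis by (simp add: alt_def sum_distrib_left algebra_simps)
qed

lemma rename_alt:
  assumes "\<sigma> permutes {..<k}"
  shows "rename \<sigma> (alt k f) = of_int (sign \<sigma>) * alt k f"
proof -
  have perm: "permutation \<pi>" if "\<pi> permutes {..<k}" for \<pi> using that by (auto simp: permutation_permutes)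
  have "rename \<sigma> (alt k f) = (\<Sum>\<pi> | \<pi> permutes {..<k}. of_int (sign \<sigma>) * (of_int (sign (\<sigma> \<circ> \<pi>)) * rename (\<sigma> \<circ> \<pi>) f))"
    unfolding alt_def rename_sum
  proof (intro sum.cong refl)
    fix \<pi> assume "\<pi> \<in> {\<pi>. \<pi> permutes {..<k}}"
    hence "sign (\<sigma> \<circ> \<pi>) = sign \<sigma> * sign \<pi>" using perm assms by (simp add: sign_compose)
    hence "sign \<sigma> * sign (\<sigma> \<circ> \<pi>) = sign \<pi>" by simp
    hence "of_int (sign \<sigma>) * of_int (sign (\<sigma> \<circ> \<pi>)) = (of_int (sign \<pi>) :: mpoly)" by (metis of_int_mult)
    thus "rename \<sigma> (of_int (sign \<pi>) * rename \<pi> f) = of_int (sign \<sigma>) * (of_int (sign (\<sigma> \<circ> \<pi>)) * rename (\<sigma> \<circ> \<pi>) f)"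
      by (simp add: rename_rename flip: mult.assoc)
  qed
  also have "\<dots> = of_int (sign \<sigma>) * (\<Sum>\<pi> | \<pi> permutes {..<k}. of_int (sign (\<sigma> \<circ> \<pi>)) * rename (\<sigma> \<circ> \<pi>) f)"
    by (simp add: sum_distrib_left)
  also have "(\<Sum>\<pi> | \<pi> permutes {..<k}. of_int (sign (\<sigma> \<circ> \<pi>)) * rename (\<sigma> \<circ> \<pi>) f) = alt k f"
    unfolding alt_def using setum_permutations_compose_left[OF assms, of "\<lambda>\<pi>. of_int (sign \<pi>) * rename \<pi> f"] by simp
  finally show ?thesis .
qed

lemma trunc_rename: "\<pi> permutes {..<k} \<Longrightarrow> trunc k (rename \<pi> p) = rename \<pi> (trunc k p)"
  unfolding trunc_def rename_def
  by (simp add: ev_ev) (intro arg_cong2[where f="ev mconst"], auto simp: fun_eq_iff permutes_in_image[of \<pi> "{..<k}", simplified])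

lemma trunc_alt: "trunc k f = f \<Longrightarrow> trunc k (alt k f) = alt k f"
  unfolding alt_def trunc_sum by (intro sum.cong) (auto simp: trunc_rename)

text \<open>Numerator and denominator pick up the same sign under each transposition inside a block,
  so the sign cancels in the quotient; \<open>V\<close> can be cancelled because polynomials form an
  integral domain.\<close>

lemma quotient_inv_ring:
  assumes "V * s = f" "V \<noteq> 0" "trunc k V = V" "trunc k f = f" "l \<le> k"
    "\<And>a b. a < l \<Longrightarrow> b < l \<Longrightarrow> a \<noteq> b \<Longrightarrow> \<exists>e. (e = 1 \<or> e = - 1) \<and> rename (transpose a b) f = e * f \<and> rename (transpose a b) V = e * V"
    "\<And>a b. a \<in> {l..<k} \<Longrightarrow> b \<in> {l..<k} \<Longrightarrow> a \<noteq> b \<Longrightarrow> \<exists>e. (e = 1 \<or> e = - 1) \<and> rename (transpose a b) f = e * f \<and> rename (transpose a b) V = e * V"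
  shows "s \<in> inv_ring k l"
proof (rule inv_ring_transposeI[OF assms(5)])
  have "V * trunc k s = V * s" using assms(1,3,4) by (metis trunc_simps(2))
  thus "trunc k s = s" using assms(2) by simp
  have *: "rename \<pi> s = s" if "\<exists>e. (e = 1 \<or> e = - 1) \<and> rename \<pi> f = e * f \<and> rename \<pi> V = e * V" for \<pi>
  proof -
    from that obtain e where e: "e = 1 \<or> e = - 1" "rename \<pi> f = e * f" "rename \<pi> V = e * V" by blast
    have "e * V * rename \<pi> s = e * f" using assms(1) e by (metis rename_simps(2))
    hence "e * V * rename \<pi> s = e * V * s" using assms(1) by (simp add: mult.assoc)
    thus ?thesis using assms(2) e(1) by auto
  qed
  show "rename (transpose a b) s = s" if "a < l" "b < l" "a \<noteq> b" for a b
    using * assms(6) that by blast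
  show "rename (transpose a b) s = s" if "a \<in> {l..<k}" "b \<in> {l..<k}" "a \<noteq> b" for a b
    using * assms(7) that by blast
qed

lemma alt_transpose:
  "a < k \<Longrightarrow> b < k \<Longrightarrow> a \<noteq> b \<Longrightarrow> rename (transpose a b) (alt k f) = - alt k f"
  by (subst rename_alt) (auto simp: sign_swap_id permutes_swap_id)

lemma alt_eq_VA_mult:
  assumes "trunc k f = f"
  obtains s where "s \<in> inv_ring k k" "alt k f = VA {..<k} * s"
proof -
  have "VA {..<k} dvd alt k f"
    by (rule VA_dvd) (auto simp: alt_transpose)
  then obtain s where s: "alt k f = VA {..<k} * s" by (elim dvdE)
  have "s \<in> inv_ring k k"
    by (rule quotient_inv_ring[of "VA {..<k}" s "alt k f"])
      (use assms in \<open>auto simp: s[symmetric] VA_nonzero trunc_VA trunc_alt intro!: exI[of _ "-1"] simp: alt_transpose rename_VA_transpose\<close>)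
  with s that show ?thesis by blast
qed

section \<open>Operators on the Fock space\<close>

text \<open>The Jordan-Wigner sign: the parity of the number of odd tensor factors to the left of
  position \<open>k\<close>.\<close>

definition sg :: "nat \<Rightarrow> nat set \<Rightarrow> 'a::comm_ring_1" where
  "sg k S = (-1) ^ card (S \<inter> {..<k})"

text \<open>The monodromy entry of the first \<open>k\<close> tensor factors, acting on functions on
  subsets and peeled off from the last factor. In one factor, \<open>p\<close> and \<open>q\<close>
  are the values of T_11 and T_22 on the even vector, both lowered by \<open>e\<close> on the odd
  vector; T_12 creates the odd vector with weight \<open>- e\<close>, and T_21 annihilates it with
  weight \<open>p - q\<close>. \<open>S\<close> is the output set, which is why the Koszul sign
  appears as \<open>(-1) ^ j * sg k S\<close>; in terms of the input set it is the value of
  \<open>sg k\<close> alone. Indices 0 and 1 stand for 1 and 2.\<close>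

primrec opT :: "(nat \<Rightarrow> 'a) \<Rightarrow> (nat \<Rightarrow> 'a) \<Rightarrow> (nat \<Rightarrow> 'a) \<Rightarrow> nat \<Rightarrow> nat \<Rightarrow> nat
    \<Rightarrow> (nat set \<Rightarrow> 'a) \<Rightarrow> nat set \<Rightarrow> 'a::comm_ring_1" where
  "opT p q e 0 i j u S = (if i = j then u S else 0)"
| "opT p q e (Suc k) i j u S =
     (if i = 0 then
        (if k \<in> S then (p k - e k) * opT p q e k 0 j u S
             + e k * (-1) ^ j * sg k S * opT p q e k 1 j u (S - {k})
         else p k * opT p q e k 0 j u S)
      else
        (if k \<in> S then (q k - e k) * opT p q e k 1 j u S
         else q k * opT p q e k 1 j u S
             + (p k - q k) * (-1) ^ j * sg k S * opT p q e k 0 j u (insert k S)))"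

text \<open>Exterior multiplication by a one-particle vector, whose components
  \<open>wg_expand\<close> makes explicit. On the vacuum it agrees with T_12
  (\<open>opT_vac_01\<close>), but it anticommutes exactly with its versions at other
  parameters.\<close>

primrec wg :: "(nat \<Rightarrow> 'a) \<Rightarrow> (nat \<Rightarrow> 'a) \<Rightarrow> nat \<Rightarrow> (nat set \<Rightarrow> 'a) \<Rightarrow> nat set \<Rightarrow> 'a::comm_ring_1" where
  "wg p q 0 u S = 0"
| "wg p q (Suc k) u S = p k * wg p q k u S
     - (if k \<in> S then (\<Prod>s<k. q s) * sg k S * u (S - {k}) else 0)"

lemma sg_Diff [simp]: "k \<le> k' \<Longrightarrow> sg k (S - {k'}) = sg k S"
  unfolding sg_def by (rule arg_cong[where f="\<lambda>x. (-1) ^ card x"]) auto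

lemma sg_insert [simp]: "k \<le> k' \<Longrightarrow> sg k (insert k' S) = sg k S"
  unfolding sg_def by (rule arg_cong[where f="\<lambda>x. (-1) ^ card x"]) auto

lemma sg_sq [simp]: "sg k S * sg k S = 1"
  unfolding sg_def by (simp flip: power_mult_distrib)

lemma sg_sq' [simp]: "sg k S * (sg k S * x) = x"
  by (simp flip: mult.assoc)

lemma sg_Diff_less:
  assumes "k \<in> S" "k < k'" shows "sg k' (S - {k}) = - sg k' S"
proof -
  have "S \<inter> {..<k'} = insert k ((S - {k}) \<inter> {..<k'})" using assms by auto
  hence "card (S \<inter> {..<k'}) = Suc (card ((S - {k}) \<inter> {..<k'}))" by simp
  thus ?thesis by (simp add: sg_def)
qed

lemma sg_insert_less:
  assumes "k \<notin> S" "k < k'" shows "sg k' (insert k S) = - sg k' S"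
proof -
  have "(insert k S) \<inter> {..<k'} = insert k (S \<inter> {..<k'})" using assms by auto
  hence "card (insert k S \<inter> {..<k'}) = Suc (card (S \<inter> {..<k'}))" using assms by simp
  thus ?thesis by (simp add: sg_def)
qed

lemma opT_lin:
  "opT p q e k i j (\<lambda>S. a * u S + c * v S) S = a * opT p q e k i j u S + c * opT p q e k i j v S"
  by (induction k arbitrary: i S) (auto simp: algebra_simps)

lemma opT_zero [simp]: "opT p q e k i j (\<lambda>S. 0) S = 0"
  by (induction k arbitrary: i S) auto

lemma opT_sum: "finite X \<Longrightarrow>
  opT p q e k i j (\<lambda>S. \<Sum>x\<in>X. c x * u x S) S = (\<Sum>x\<in>X. c x * opT p q e k i j (u x) S)"
proof (induction X rule: finite_induct)
  case (insert x X)
  then show ?case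
    using opT_lin[of p q e k i j "c x" "u x" 1 "\<lambda>S. \<Sum>x\<in>X. c x * u x S" S] by simp
qed simp

text \<open>The operator changes membership of positions below \<open>k\<close> only; the positions
  from \<open>k\<close> on are spectators.\<close>

lemma opT_cong:
  "(\<And>R. R - {..<k} = S - {..<k} \<Longrightarrow> u R = v R) \<Longrightarrow> opT p q e k i j u S = opT p q e k i j v S"
proof (induction k arbitrary: i S)
  case (Suc k)
  have *: "opT p q e k i j u R = opT p q e k i j v R" if "R - {..<Suc k} = S - {..<Suc k}" for i R
  proof (rule Suc.IH)
    fix R' assume R': "R' - {..<k} = R - {..<k}"
    have "R' - {..<Suc k} = (R' - {..<k}) - {..<Suc k}" by auto
    also have "\<dots> = R - {..<Suc k}" unfolding R' by auto
    finally show "u R' = v R'" using Suc.prems that by simp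
  qed
  have "opT p q e k i j u R = opT p q e k i j v R" if "R = S \<or> R = S - {k} \<or> R = insert k S" for i R
    by (rule *) (use that in \<open>auto simp: lessThan_Suc\<close>)
  thus ?case by simp
qed auto

lemma opT_shift_Diff: "k \<le> k' \<Longrightarrow> opT p q e k i j (\<lambda>R. u (R - {k'})) S = opT p q e k i j u (S - {k'})"
proof (induction k arbitrary: i S)
  case (Suc k)
  have "S - {k} - {k'} = S - {k'} - {k}" by auto
  with Suc show ?case by (auto simp: insert_Diff_if)
qed auto

lemma opT_shift_insert:
  "k \<le> k' \<Longrightarrow> opT p q e k i j (\<lambda>R. u (insert k' R)) S = opT p q e k i j u (insert k' S)"
proof (induction k arbitrary: i S)
  case (Suc k)
  have "insert k' (insert k S) = insert k (insert k' S)" by auto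
  with Suc show ?case by (auto simp: insert_Diff_if)
qed auto

text \<open>T_ij has parity \<open>i + j\<close>, so up to that sign it commutes with the parity
  operator of an initial segment of length at least \<open>k\<close>.\<close>

lemma opT_sg:
  assumes "i \<le> 1" "j \<le> 1" "k \<le> k'"
  shows "opT p q e k i j (\<lambda>R. sg k' R * u R) S = (-1) ^ (i + j) * sg k' S * opT p q e k i j u S"
  using assms(1,3)
proof (induction k arbitrary: i S)
  case 0
  have "i = 0 \<or> i = 1" "j = 0 \<or> j = 1" using 0 assms(2) by auto
  then show ?case by auto
next
  case (Suc k)
  have i: "i = 0 \<or> i = 1" and j: "j = 0 \<or> j = 1" using Suc.prems assms(2) by auto
  have k': "k < k'" "k \<le> k'" using Suc.prems by auto
  show ?case using i j k'
    by (auto simp: Suc.IH sg_Diff_less sg_insert_less) (simp_all add: algebra_simps)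
qed

lemma wg_lin:
  "wg p q k (\<lambda>S. a * u S + c * v S) S = a * wg p q k u S + c * wg p q k v S"
  by (induction k) (auto simp: algebra_simps)

lemma wg_zero [simp]: "wg p q k (\<lambda>S. 0) S = 0"
  by (induction k) auto

lemma wg_cong:
  "(\<And>R. R - {..<k} = S - {..<k} \<Longrightarrow> u R = v R) \<Longrightarrow> wg p q k u S = wg p q k v S"
proof (induction k)
  case (Suc k)
  have "wg p q k u S = wg p q k v S"
  proof (rule Suc.IH)
    fix R' assume R': "R' - {..<k} = S - {..<k}"
    have "R' - {..<Suc k} = (R' - {..<k}) - {..<Suc k}" by auto
    also have "\<dots> = S - {..<Suc k}" unfolding R' by auto
    finally show "u R' = v R'" using Suc.prems by simp
  qed
  moreover have "u (S - {k}) = v (S - {k})" by (rule Suc.prems) auto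
  ultimately show ?case by simp
qed auto

lemma wg_shift_Diff: "k \<le> k' \<Longrightarrow> wg p q k (\<lambda>R. u (R - {k'})) S = wg p q k u (S - {k'})"
proof (induction k)
  case (Suc k)
  have "S - {k} - {k'} = S - {k'} - {k}" by auto
  with Suc show ?case by (auto simp: insert_Diff_if)
qed auto

lemma wg_shift_insert: "k \<le> k' \<Longrightarrow> wg p q k (\<lambda>R. u (insert k' R)) S = wg p q k u (insert k' S)"
proof (induction k)
  case (Suc k)
  with Suc show ?case by (auto simp: insert_Diff_if)
qed auto

lemma wg_sg: "k \<le> k' \<Longrightarrow> wg p q k (\<lambda>R. sg k' R * u R) S = - sg k' S * wg p q k u S"
  by (induction k) (auto simp: sg_Diff_less algebra_simps)

lemma opT_wg_Suc_notin:
  "k \<notin> S \<Longrightarrow> opT p q e k i j (wg p' q' (Suc k) u) S = p' k * opT p q e k i j (wg p' q' k u) S"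
proof -
  assume k: "k \<notin> S"
  have "opT p q e k i j (wg p' q' (Suc k) u) S
      = opT p q e k i j (\<lambda>S. p' k * wg p' q' k u S + 0 * wg p' q' k u S) S"
  proof (rule opT_cong)
    fix R assume "R - {..<k} = S - {..<k}"
    with k have "k \<notin> R" by auto
    thus "wg p' q' (Suc k) u R = p' k * wg p' q' k u R + 0 * wg p' q' k u R" by simp
  qed
  thus ?thesis by (simp only: opT_lin) simp
qed

lemma opT_wg_Suc_in:
  assumes "k \<in> S" "i \<le> 1" "j \<le> 1"
  shows "opT p q e k i j (wg p' q' (Suc k) u) S = p' k * opT p q e k i j (wg p' q' k u) S
     - (\<Prod>s<k. q' s) * (-1) ^ (i + j) * sg k S * opT p q e k i j u (S - {k})"
proof -
  have "opT p q e k i j (wg p' q' (Suc k) u) S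
      = opT p q e k i j (\<lambda>R. p' k * wg p' q' k u R + (- (\<Prod>s<k. q' s)) * (sg k R * u (R - {k}))) S"
  proof (rule opT_cong)
    fix R assume "R - {..<k} = S - {..<k}"
    with assms have "k \<in> R" by auto
    thus "wg p' q' (Suc k) u R = p' k * wg p' q' k u R + (- (\<Prod>s<k. q' s)) * (sg k R * u (R - {k}))" by simp
  qed
  thus ?thesis using assms by (simp only: opT_lin opT_sg opT_shift_Diff le_refl) simp
qed

lemma wg_opT_Suc_0:
  assumes "j \<le> 1"
  shows "wg p' q' k (opT p q e (Suc k) 0 j u) S =
     (if k \<in> S then (p k - e k) * wg p' q' k (opT p q e k 0 j u) S
             - e k * (-1) ^ j * sg k S * wg p' q' k (opT p q e k 1 j u) (S - {k})
         else p k * wg p' q' k (opT p q e k 0 j u) S)"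
proof (cases "k \<in> S")
  case True
  have "wg p' q' k (opT p q e (Suc k) 0 j u) S
      = wg p' q' k (\<lambda>R. (p k - e k) * opT p q e k 0 j u R + (e k * (-1) ^ j) * (sg k R * opT p q e k 1 j u (R - {k}))) S"
  proof (rule wg_cong)
    fix R assume "R - {..<k} = S - {..<k}"
    with True have "k \<in> R" by auto
    thus "opT p q e (Suc k) 0 j u R = (p k - e k) * opT p q e k 0 j u R + (e k * (-1) ^ j) * (sg k R * opT p q e k 1 j u (R - {k}))"
      by simp
  qed
  thus ?thesis using True by (simp only: wg_lin wg_sg wg_shift_Diff le_refl) (simp add: algebra_simps)
next
  case False
  have "wg p' q' k (opT p q e (Suc k) 0 j u) S
      = wg p' q' k (\<lambda>R. p k * opT p q e k 0 j u R + 0 * opT p q e k 0 j u R) S"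
  proof (rule wg_cong)
    fix R assume "R - {..<k} = S - {..<k}"
    with False have "k \<notin> R" by auto
    thus "opT p q e (Suc k) 0 j u R = p k * opT p q e k 0 j u R + 0 * opT p q e k 0 j u R"
      by simp
  qed
  thus ?thesis using False by (simp only: wg_lin) simp
qed

lemma wg_opT_Suc_1:
  assumes "j \<le> 1"
  shows "wg p' q' k (opT p q e (Suc k) 1 j u) S =
     (if k \<in> S then (q k - e k) * wg p' q' k (opT p q e k 1 j u) S
         else q k * wg p' q' k (opT p q e k 1 j u) S
           - (p k - q k) * (-1) ^ j * sg k S * wg p' q' k (opT p q e k 0 j u) (insert k S))"
proof (cases "k \<in> S")
  case True
  have "wg p' q' k (opT p q e (Suc k) 1 j u) S
      = wg p' q' k (\<lambda>R. (q k - e k) * opT p q e k 1 j u R + 0 * opT p q e k 1 j u R) S"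
  proof (rule wg_cong)
    fix R assume "R - {..<k} = S - {..<k}"
    with True have "k \<in> R" by auto
    thus "opT p q e (Suc k) 1 j u R = (q k - e k) * opT p q e k 1 j u R + 0 * opT p q e k 1 j u R"
      by simp
  qed
  thus ?thesis using True by (simp only: wg_lin) simp
next
  case False
  have "wg p' q' k (opT p q e (Suc k) 1 j u) S
      = wg p' q' k (\<lambda>R. q k * opT p q e k 1 j u R + ((p k - q k) * (-1) ^ j) * (sg k R * opT p q e k 0 j u (insert k R))) S"
  proof (rule wg_cong)
    fix R assume "R - {..<k} = S - {..<k}"
    with False have "k \<notin> R" by auto
    thus "opT p q e (Suc k) 1 j u R = q k * opT p q e k 1 j u R + ((p k - q k) * (-1) ^ j) * (sg k R * opT p q e k 0 j u (insert k R))"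
      by simp
  qed
  thus ?thesis using False by (simp only: wg_lin wg_sg wg_shift_insert le_refl) (simp add: algebra_simps)
qed

text \<open>One-particle vectors anticommute in the exterior algebra. The square is treated
  separately because the coefficients range over any commutative ring, where 2 may be a zero
  divisor.\<close>

lemma wg_anticomm: "wg p q k (wg p' q' k u) S = - wg p' q' k (wg p q k u) S"
  and wg_wg_self: "wg p q k (wg p q k u) S = 0"
proof -
  have gen: "wg p q k (wg p' q' (Suc k) u) S = p' k * wg p q k (wg p' q' k u) S
     + (if k \<in> S then (\<Prod>s<k. q' s) * sg k S * wg p q k u (S - {k}) else 0)" for p q p' q' :: "nat \<Rightarrow> 'a" and k S
  proof (cases "k \<in> S")
    case True
    have "wg p q k (wg p' q' (Suc k) u) S
      = wg p q k (\<lambda>R. p' k * wg p' q' k u R + (- (\<Prod>s<k. q' s)) * (sg k R * u (R - {k}))) S"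
      by (rule wg_cong) (use True in auto)
    thus ?thesis using True by (simp only: wg_lin wg_sg wg_shift_Diff le_refl) (simp add: algebra_simps)
  next
    case False
    have "wg p q k (wg p' q' (Suc k) u) S
      = wg p q k (\<lambda>R. p' k * wg p' q' k u R + 0 * u R) S"
      by (rule wg_cong) (use False in auto)
    thus ?thesis using False by (simp only: wg_lin) simp
  qed
  show "wg p q k (wg p' q' k u) S = - wg p' q' k (wg p q k u) S"
  proof (induction k arbitrary: S)
    case (Suc k)
    show ?case by (subst (1 2) wg.simps, simp only: gen)  (simp add: Suc[of S] algebra_simps)
  qed simp
  show "wg p q k (wg p q k u) S = 0"
  proof (induction k arbitrary: S)
    case (Suc k)
    show ?case by (subst wg.simps, simp only: gen) (simp add: Suc algebra_simps)
  qed simp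
qed

text \<open>\<open>d\<close> is the difference t - w of the spectral parameters, and these are the
  exchange relations of T_ij(t) with the wedge by v(w). The unwanted terms carry the scalars
  \<Prod>pw and \<Prod>qw times operators at t, never an operator at w; in the combination q1 T_11 -
  q2 T_22 the scalars assemble to the Bethe polynomial at w. The four relations are proved together
  because splitting off the last factor mixes the entries; each inductive step is then a polynomial
  identity.\<close>

lemma fermion_relations:
  fixes pt qt pw qw :: "nat \<Rightarrow> 'a::idom"
  assumes p: "\<And>s. pt s = pw s + d" and q: "\<And>s. qt s = qw s + d"
  defines "T \<equiv> opT pt qt (\<lambda>_. 1)" and "V \<equiv> wg pw qw"
  shows "d * T k 0 1 (V k u) S = - (d - 1) * V k (T k 0 1 u) S"
    and "d * T k 1 1 (V k u) S = (d - 1) * V k (T k 1 1 u) S + (\<Prod>s<k. qw s) * T k 0 1 u S"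
    and "d * T k 0 0 (V k u) S = (d - 1) * V k (T k 0 0 u) S + (\<Prod>s<k. pw s) * T k 0 1 u S"
    and "d * T k 1 0 (V k u) S = - (d - 1) * V k (T k 1 0 u) S
           + (\<Prod>s<k. qw s) * T k 0 0 u S - (\<Prod>s<k. pw s) * T k 1 1 u S"
  unfolding T_def V_def
proof (induction k arbitrary: S)
  case (Suc k)
  let ?T = "opT pt qt (\<lambda>_. 1) (Suc k)" and ?V = "wg pw qw (Suc k)"
  have pd: "pt k = pw k + d" "qt k = qw k + d" using p q by auto
  have minus1: "(-1) ^ (0 + 1) = (-1::'a)" "(-1) ^ (1 + 0) = (-1::'a)" "(-1) ^ (1 + 1) = (1::'a)" "(-1) ^ (0 + 0) = (1::'a)"
     "(-1) ^ 1 = (-1::'a)" "(-1) ^ 0 = (1::'a)" by auto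
  have main: "d * ?T 0 1 (?V u) S = - (d - 1) * ?V (?T 0 1 u) S
    \<and> d * ?T 1 1 (?V u) S = (d - 1) * ?V (?T 1 1 u) S + (\<Prod>s<Suc k. qw s) * ?T 0 1 u S
    \<and> d * ?T 0 0 (?V u) S = (d - 1) * ?V (?T 0 0 u) S + (\<Prod>s<Suc k. pw s) * ?T 0 1 u S
    \<and> d * ?T 1 0 (?V u) S = - (d - 1) * ?V (?T 1 0 u) S
           + (\<Prod>s<Suc k. qw s) * ?T 0 0 u S - (\<Prod>s<Suc k. pw s) * ?T 1 1 u S" for S
  proof -
  note e1 = opT.simps(2)[of pt qt "\<lambda>_. 1" k _ _ "wg pw qw (Suc k) u" S]
    and e2 = wg.simps(2)[of pw qw k "opT pt qt (\<lambda>_. 1) (Suc k) i j u" S for i j]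
    and e3 = opT.simps(2)[of pt qt "\<lambda>_. 1" k _ _ u S]
    and e4 = opT.simps(2)[of pt qt "\<lambda>_. 1" k _ _ u "S - {k}"]
  note r1 = opT_wg_Suc_in[of k S _ _ pt qt "\<lambda>_. 1" pw qw u]
      opT_wg_Suc_in[of k "insert k S" _ _ pt qt "\<lambda>_. 1" pw qw u]
      opT_wg_Suc_notin[of k S pt qt "\<lambda>_. 1" _ _ pw qw u]
      opT_wg_Suc_notin[of k "S - {k}" pt qt "\<lambda>_. 1" _ _ pw qw u]
      wg_opT_Suc_0[of _ pw qw k pt qt "\<lambda>_. 1" u S] wg_opT_Suc_1[of _ pw qw k pt qt "\<lambda>_. 1" u S]
  have S: "k \<notin> S \<Longrightarrow> insert k S - {k} = S" "k \<in> S \<Longrightarrow> insert k (S - {k}) = S"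
      "sg k (S - {k}) = (sg k S :: 'a)" "sg k (insert k S) = (sg k S :: 'a)" by auto
  note simps = e1 e2 e3 e4 r1 pd minus1 S Diff_insert_absorb prod.lessThan_Suc insertI1 if_True if_False zero_neq_one[symmetric] zero_neq_one le_refl zero_le_one refl
      Diff_iff singletonI simp_thms
  have ss: "sg k S * sg k S = (1::'a)" by (rule sg_sq)
    show ?thesis
    proof (cases "k \<in> S")
      case True
      show ?thesis
        apply (simp only: True simps, intro conjI)
        subgoal using Suc(1)[of S] Suc(2)[of "S - {k}"] by algebra
        subgoal using Suc(2)[of S] ss by algebra
        subgoal using Suc(3)[of S] Suc(4)[of "S - {k}"] by algebra
        subgoal using Suc(4)[of S] ss by algebra
        done
    next
      case False
      show ?thesis
        apply (simp only: False simps, intro conjI)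
        subgoal using Suc(1)[of S] by algebra
        subgoal using Suc(2)[of S] Suc(1)[of "insert k S"] ss by algebra
        subgoal using Suc(3)[of S] by algebra
        subgoal using Suc(4)[of S] Suc(3)[of "insert k S"] ss by algebra
        done
    qed
  qed
  {
    case 1 show ?case using main by blast
  next
    case 2 show ?case using main by blast
  next
    case 3 show ?case using main by blast
  next
    case 4 show ?case using main by blast
  }
qed auto

section \<open>Generators of the invariant ring\<close>

definition psum :: "nat set \<Rightarrow> nat \<Rightarrow> mpoly" where
  "psum A m = (\<Sum>i\<in>A. mvar i ^ m)"

definition subring :: "mpoly set \<Rightarrow> bool" where
  "subring R \<longleftrightarrow> (\<forall>c. mconst c \<in> R) \<and> (\<forall>p\<in>R. \<forall>q\<in>R. p + q \<in> R \<and> p * q \<in> R)"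

lemma subringD:
  assumes "subring R"
  shows "mconst c \<in> R" "1 \<in> R" "0 \<in> R"
    "p \<in> R \<Longrightarrow> q \<in> R \<Longrightarrow> p + q \<in> R" "p \<in> R \<Longrightarrow> q \<in> R \<Longrightarrow> p * q \<in> R"
    "p \<in> R \<Longrightarrow> - p \<in> R" "p \<in> R \<Longrightarrow> q \<in> R \<Longrightarrow> p - q \<in> R" "p \<in> R \<Longrightarrow> p ^ n \<in> R"
proof -
  have c: "mconst c \<in> R" for c using assms by (auto simp: subring_def)
  have a: "p + q \<in> R" if "p \<in> R" "q \<in> R" for p q using assms that by (auto simp: subring_def)
  have m: "p * q \<in> R" if "p \<in> R" "q \<in> R" for p q using assms that by (auto simp: subring_def)
  have u: "- p \<in> R" if "p \<in> R" for p
  proof -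
    have "- p = mconst (- 1) * p" by (simp add: mconst_uminus mconst_1)
    thus ?thesis using m[OF c that] by simp
  qed
  have one: "1 \<in> R" using c[of 1] by (simp add: mconst_1)
  show "mconst c \<in> R" "1 \<in> R" "0 \<in> R" using c[of 0] c one by auto
  show "p \<in> R \<Longrightarrow> q \<in> R \<Longrightarrow> p + q \<in> R" "p \<in> R \<Longrightarrow> q \<in> R \<Longrightarrow> p * q \<in> R" "p \<in> R \<Longrightarrow> - p \<in> R"
    by (auto intro: a m u)
  show "p \<in> R \<Longrightarrow> q \<in> R \<Longrightarrow> p - q \<in> R" using a[of p "- q"] u[of q] by simp
  show "p \<in> R \<Longrightarrow> p ^ n \<in> R" by (induction n) (auto intro: m one)
qed

lemma subring_sum: "subring R \<Longrightarrow> (\<And>a. a \<in> A \<Longrightarrow> f a \<in> R) \<Longrightarrow> sum f A \<in> R"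
  by (induction A rule: infinite_finite_induct) (auto intro: subringD)

text \<open>Augmented monomial symmetric functions: the values \<open>f j\<close> are required to be
  distinct, which is the only difference from a product of power sums.\<close>

definition isum :: "nat set \<Rightarrow> nat set \<Rightarrow> (nat \<Rightarrow> nat) \<Rightarrow> mpoly" where
  "isum A J a = (\<Sum>f | f \<in> J \<rightarrow>\<^sub>E A \<and> inj_on f J. \<Prod>j\<in>J. mvar (f j) ^ a j)"

text \<open>Let the new index take any value in \<open>A\<close>. Values already used by some
  \<open>j\<close> are subtracted again, and such a coincidence merges the exponents
  \<open>a j\<close> and \<open>a x\<close>. Recursion on \<open>J\<close> thus expresses
  \<open>isum\<close> through power sums.\<close>

lemma isum_insert:
  assumes "finite A" "finite J" "x \<notin> J"
  shows "isum A (insert x J) a = psum A (a x) * isum A J a - (\<Sum>j\<in>J. isum A J (a(j := a j + a x)))"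
proof -
  let ?I = "\<lambda>J. {f. f \<in> J \<rightarrow>\<^sub>E A \<and> inj_on f J}"
  let ?w = "\<lambda>f. \<Prod>j\<in>J. mvar (f j) ^ a j"
  have finI: "finite (?I J)"
    by (rule finite_subset[of _ "J \<rightarrow>\<^sub>E A"]) (use assms in \<open>auto intro: finite_PiE\<close>)
  have 1: "isum A (insert x J) a = (\<Sum>(f, i)\<in>(SIGMA f:?I J. A - f ` J). mvar i ^ a x * ?w f)"
    unfolding isum_def
  proof (rule sum.reindex_bij_witness[of _ "\<lambda>(f, i). f(x := i)" "\<lambda>f. (f(x := undefined), f x)"], goal_cases)
    case (1 f)
    thus ?case by simp
  next
    case (2 f)
    hence f: "f \<in> insert x J \<rightarrow>\<^sub>E A" "inj_on f (insert x J)" by auto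
    have "f(x := undefined) \<in> J \<rightarrow>\<^sub>E A" using f(1) assms(3) by (auto simp: PiE_def extensional_def)
    moreover have "inj_on (f(x := undefined)) J"
      using f(2) assms(3) by (auto simp: inj_on_def)
    moreover have "f x \<in> A - f(x := undefined) ` J"
      using f assms(3) by (auto simp: inj_on_def)
    ultimately show ?case by auto
  next
    case (3 b)
    thus ?case using assms(3) by (auto simp: fun_eq_iff PiE_def extensional_def)
  next
    case (4 b)
    then obtain f i where b: "b = (f, i)" "f \<in> J \<rightarrow>\<^sub>E A" "inj_on f J" "i \<in> A" "i \<notin> f ` J" by auto
    have "f(x := i) \<in> insert x J \<rightarrow>\<^sub>E A" using b by (auto simp: PiE_def extensional_def)
    moreover have "inj_on (f(x := i)) (insert x J)"
      using b assms(3) by (auto simp: inj_on_def)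
    ultimately show ?case by (simp add: b)
  next
    case (5 f)
    have "(\<Prod>j\<in>J. mvar ((f(x := undefined)) j) ^ a j) = (\<Prod>j\<in>J. mvar (f j) ^ a j)"
      by (intro prod.cong) (use assms(3) in auto)
    thus ?case using assms by simp
  qed
  have 2: "(\<Sum>j\<in>J. isum A J (a(j := a j + a x))) = (\<Sum>f\<in>?I J. \<Sum>i\<in>f ` J. mvar i ^ a x * ?w f)"
  proof -
    have "(\<Sum>j\<in>J. isum A J (a(j := a j + a x)))
        = (\<Sum>f\<in>?I J. \<Sum>j\<in>J. \<Prod>j'\<in>J. mvar (f j') ^ (a(j := a j + a x)) j')"
      unfolding isum_def by (rule sum.swap)
    also have "\<dots> = (\<Sum>f\<in>?I J. \<Sum>i\<in>f ` J. mvar i ^ a x * ?w f)"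
    proof (rule sum.cong[OF refl])
      fix f assume f: "f \<in> ?I J"
      have "(\<Prod>j'\<in>J. mvar (f j') ^ (a(j := a j + a x)) j') = mvar (f j) ^ a x * ?w f" if "j \<in> J" for j
      proof -
        have 1: "(\<Prod>j'\<in>J. mvar (f j') ^ (a(j := a j + a x)) j') = mvar (f j) ^ (a j + a x) * (\<Prod>j'\<in>J - {j}. mvar (f j') ^ a j')"
          using that assms(2) by (subst prod.remove[of _ j]) (auto intro!: arg_cong2[where f="(*)"] prod.cong)
        have 2: "?w f = mvar (f j) ^ a j * (\<Prod>j'\<in>J - {j}. mvar (f j') ^ a j')"
          using that assms(2) by (subst prod.remove[of _ j]) auto
        show ?thesis unfolding 1 2 by (simp add: power_add mult_ac)
      qed
      hence "(\<Sum>j\<in>J. \<Prod>j'\<in>J. mvar (f j') ^ (a(j := a j + a x)) j') = (\<Sum>j\<in>J. mvar (f j) ^ a x * ?w f)" by simp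
      also have "\<dots> = (\<Sum>i\<in>f ` J. mvar i ^ a x * ?w f)"
        using f by (subst sum.reindex) auto
      finally show "(\<Sum>j\<in>J. \<Prod>j'\<in>J. mvar (f j') ^ (a(j := a j + a x)) j') = (\<Sum>i\<in>f ` J. mvar i ^ a x * ?w f)" .
    qed
    finally show ?thesis .
  qed
  have "psum A (a x) * isum A J a = (\<Sum>f\<in>?I J. \<Sum>i\<in>A. mvar i ^ a x * ?w f)"
    unfolding psum_def isum_def by (simp add: sum_product sum.swap[of _ A])
  also have "\<dots> = (\<Sum>f\<in>?I J. (\<Sum>i\<in>A - f ` J. mvar i ^ a x * ?w f) + (\<Sum>i\<in>f ` J. mvar i ^ a x * ?w f))"
  proof (intro sum.cong refl)
    fix f assume "f \<in> ?I J"
    hence "f ` J \<subseteq> A" by auto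
    thus "(\<Sum>i\<in>A. mvar i ^ a x * ?w f) = (\<Sum>i\<in>A - f ` J. mvar i ^ a x * ?w f) + (\<Sum>i\<in>f ` J. mvar i ^ a x * ?w f)"
      using assms(1) by (rule sum.subset_diff)
  qed
  also have "\<dots> = isum A (insert x J) a + (\<Sum>j\<in>J. isum A J (a(j := a j + a x)))"
    unfolding 1 2 sum.distrib using finI assms by (subst sum.Sigma) auto
  finally show ?thesis by simp
qed

lemma isum_in_subring:
  assumes "subring R" "finite A" "\<And>m. psum A m \<in> R" "finite J"
  shows "isum A J a \<in> R"
  using assms(4)
proof (induction J arbitrary: a rule: finite_induct)
  case empty
  show ?case using subringD(2)[OF assms(1)] by (simp add: isum_def)
next
  case (insert x J)
  show ?case unfolding isum_insert[OF assms(2) insert.hyps]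
    by (intro subringD[OF assms(1)] subring_sum[OF assms(1)] assms(3) insert.IH)
qed

lemma permutes_sum_in_subring:
  assumes "subring R" "finite A" "\<And>m. psum A m \<in> R"
  shows "(\<Sum>\<pi> | \<pi> permutes A. \<Prod>i\<in>A. mvar (\<pi> i) ^ a i) \<in> R"
proof -
  have "(\<Sum>\<pi> | \<pi> permutes A. \<Prod>i\<in>A. mvar (\<pi> i) ^ a i) = isum A A a"
    unfolding isum_def
  proof (rule sum.reindex_bij_witness[of _ "\<lambda>f i. if i \<in> A then f i else i" "\<lambda>\<pi>. restrict \<pi> A"], goal_cases)
    case (1 \<pi>)
    thus ?case by (auto simp: fun_eq_iff permutes_not_in)
  next
    case (2 \<pi>)
    hence "\<pi> permutes A" by simp
    thus ?case using permutes_in_image[of \<pi> A] permutes_inj_on[of \<pi> A A] by (auto simp: inj_on_def)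
  next
    case (3 f)
    thus ?case by (auto simp: fun_eq_iff PiE_def extensional_def)
  next
    case (4 f)
    hence f: "f \<in> A \<rightarrow>\<^sub>E A" "inj_on f A" by auto
    have "f ` A = A" by (rule endo_inj_surj) (use assms(2) f in auto)
    hence "bij_betw f A A" using f by (auto simp: bij_betw_def)
    hence "bij_betw (\<lambda>i. if i \<in> A then f i else i) A A" by (subst bij_betw_cong[where g=f]) auto
    thus ?case by (auto intro!: bij_imp_permutes)
  next
    case (5 \<pi>)
    thus ?case by (intro prod.cong) auto
  qed
  thus ?thesis using isum_in_subring[OF assms assms(2)] by simp
qed

text \<open>Summing over the block group replaces \<open>p\<close> by a nonzero multiple of itself
  and turns each monomial into a product of two sums over permutations, one per block, which are
  polynomials in the power sums.\<close>

lemma inv_ring_generated: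
  assumes R: "subring R" and l: "l \<le> k"
    and ps: "\<And>m. psum {..<l} m \<in> R" "\<And>m. psum {l..<k} m \<in> R"
    and p: "p \<in> inv_ring k l"
  shows "p \<in> R"
proof -
  let ?P1 = "{\<pi>. \<pi> permutes {..<l}}" and ?P2 = "{\<pi>. \<pi> permutes {l..<k}}"
  let ?S = "\<lambda>p. \<Sum>\<pi>1\<in>?P1. \<Sum>\<pi>2\<in>?P2. rename (\<pi>1 \<circ> \<pi>2) p"
  have mem: "\<pi>1 \<circ> \<pi>2 \<in> Gp k l" if "\<pi>1 \<in> ?P1" "\<pi>2 \<in> ?P2" for \<pi>1 \<pi>2
  proof -
    from that have *: "\<pi>1 permutes {..<l}" "\<pi>2 permutes {l..<k}" by auto
    have "\<pi>1 permutes {..<k}" "\<pi>2 permutes {..<k}"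
      using * l by (auto intro: permutes_subset)
    hence "\<pi>1 \<circ> \<pi>2 permutes {..<k}" by (intro permutes_compose)
    moreover have "\<pi>2 i = i" if "i < l" for i using * that by (auto intro: permutes_not_in)
    hence "(\<pi>1 \<circ> \<pi>2) ` {..<l} = \<pi>1 ` {..<l}" by (intro image_cong) auto
    hence "(\<pi>1 \<circ> \<pi>2) ` {..<l} = {..<l}" using permutes_image[OF *(1)] by simp
    ultimately show ?thesis by (simp add: Gp_def)
  qed
  define N where "N = (of_nat (card ?P1) * of_nat (card ?P2) :: complex)"
  have N: "N \<noteq> 0" unfolding N_def using card_permutations[OF refl, of "{..<l}"] card_permutations[OF refl, of "{l..<k}"] by simp
  have "?S p = (\<Sum>\<pi>1\<in>?P1. \<Sum>\<pi>2\<in>?P2. p)"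
    using p mem by (intro sum.cong refl) (auto simp: inv_ring_iff)
  also have "\<dots> = of_nat (card ?P1) * (of_nat (card ?P2) * p)" by simp
  also have "\<dots> = mconst N * p" unfolding N_def mconst_mult by (simp add: mconst_def)
  finally have Sp: "mconst N * p = ?S p" ..
  have "?S p \<in> R"
  proof -
    have "?S p = ?S (\<Sum>m\<in>mkeys p. Poly_Mapping.single m (mlook p m))" by (simp only: sum_single)
    also have "\<dots> = (\<Sum>m\<in>mkeys p. ?S (Poly_Mapping.single m (mlook p m)))"
      unfolding rename_sum by (subst sum.swap, subst (2) sum.swap, simp only: sum.swap[of _ ?P2 "mkeys p"])
         (simp add: sum.swap[of _ "mkeys p" ?P1])
    also have "\<dots> \<in> R"
    proof (rule subring_sum[OF R])
      fix m assume m: "m \<in> mkeys p"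
      have km: "mkeys m \<subseteq> {..<k}" using p m by (auto simp: inv_ring_iff trunc_eq_iff)
      have mm: "mono mvar m = (\<Prod>i<l. mvar i ^ mlook m i) * (\<Prod>i\<in>{l..<k}. mvar i ^ mlook m i)"
      proof -
        have "mono mvar m = (\<Prod>i<k. mvar i ^ mlook m i)" by (rule mono_superset) (use km in auto)
        also have "{..<k} = {..<l} \<union> {l..<k}" using l by auto
        finally show ?thesis by (subst (asm) prod.union_disjoint) auto
      qed
      have "rename (\<pi>1 \<circ> \<pi>2) (Poly_Mapping.single m (mlook p m))
          = mconst (mlook p m) * ((\<Prod>i<l. mvar (\<pi>1 i) ^ mlook m i) * (\<Prod>i\<in>{l..<k}. mvar (\<pi>2 i) ^ mlook m i))"
        if "\<pi>1 \<in> ?P1" "\<pi>2 \<in> ?P2" for \<pi>1 \<pi>2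
      proof -
        from that have *: "\<pi>1 permutes {..<l}" "\<pi>2 permutes {l..<k}" by auto
        have "(\<Prod>i<l. rename (\<pi>1 \<circ> \<pi>2) (mvar i ^ mlook m i)) = (\<Prod>i<l. mvar (\<pi>1 i) ^ mlook m i)"
          using permutes_not_in[OF *(2)] by (intro prod.cong) auto
        moreover have "(\<Prod>i\<in>{l..<k}. rename (\<pi>1 \<circ> \<pi>2) (mvar i ^ mlook m i)) = (\<Prod>i\<in>{l..<k}. mvar (\<pi>2 i) ^ mlook m i)"
        proof (intro prod.cong refl)
          fix i assume "i \<in> {l..<k}"
          hence "\<pi>2 i \<in> {l..<k}" using permutes_in_image[OF *(2)] by blast
          hence "\<pi>1 (\<pi>2 i) = \<pi>2 i" using permutes_not_in[OF *(1)] by auto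
          thus "rename (\<pi>1 \<circ> \<pi>2) (mvar i ^ mlook m i) = mvar (\<pi>2 i) ^ mlook m i" by simp
        qed
        ultimately show ?thesis by (simp add: single_eq_mono mm rename_prod)
      qed
      hence "?S (Poly_Mapping.single m (mlook p m))
        = (\<Sum>\<pi>1\<in>?P1. \<Sum>\<pi>2\<in>?P2. mconst (mlook p m) * ((\<Prod>i<l. mvar (\<pi>1 i) ^ mlook m i) * (\<Prod>i\<in>{l..<k}. mvar (\<pi>2 i) ^ mlook m i)))"
        by (intro sum.cong refl) auto
      also have "\<dots> = mconst (mlook p m) * ((\<Sum>\<pi>1\<in>?P1. \<Prod>i<l. mvar (\<pi>1 i) ^ mlook m i) * (\<Sum>\<pi>2\<in>?P2. \<Prod>i\<in>{l..<k}. mvar (\<pi>2 i) ^ mlook m i))"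
        unfolding sum_product unfolding sum_distrib_left ..
      also have "\<dots> \<in> R"
        by (intro subringD[OF R] permutes_sum_in_subring[OF R] ps) auto
      finally show "?S (Poly_Mapping.single m (mlook p m)) \<in> R" .
    qed
    finally show ?thesis .
  qed
  hence "mconst (1 / N) * (mconst N * p) \<in> R" using Sp subringD[OF R] by metis
  also have "mconst (1 / N) * (mconst N * p) = p" using N by (simp add: mconst_1 flip: mult.assoc mconst_mult)
  finally show ?thesis .
qed

text \<open>Synthetic division by x - a, read from the top coefficient downwards; \<open>n\<close>
  may exceed the degree.\<close>

lemma coeff_linear_factor:
  fixes y Q :: "'a::idom poly"
  assumes "y = [:- a, 1:] * Q" "degree y \<le> n"
  shows "coeff Q j = (\<Sum>r<n - j. coeff y (j + 1 + r) * a ^ r)"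
proof (induction "n - j" arbitrary: j)
  case 0
  have "coeff Q j = 0"
  proof (cases "Q = 0")
    case False
    hence "degree y = Suc (degree Q)" unfolding assms(1) by (subst degree_mult_eq) auto
    thus ?thesis using assms(2) 0 by (intro coeff_eq_0) auto
  qed auto
  thus ?case using 0 by simp
next
  case (Suc d)
  have "coeff y (Suc j) = coeff Q j - a * coeff Q (Suc j)" by (simp add: assms(1))
  hence "coeff Q j = coeff y (Suc j) + a * coeff Q (Suc j)" by simp
  also have "coeff Q (Suc j) = (\<Sum>r<n - Suc j. coeff y (Suc j + 1 + r) * a ^ r)"
    by (rule Suc.hyps(1)) (use Suc.hyps(2) in auto)
  also have "coeff y (Suc j) + a * \<dots> = (\<Sum>r<Suc (n - Suc j). coeff y (j + 1 + r) * a ^ r)"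
    by (subst sum.lessThan_Suc_shift) (simp add: sum_distrib_left mult_ac)
  also have "Suc (n - Suc j) = n - j" using Suc.hyps(2) by auto
  finally show ?case .
qed

text \<open>Newton's identities, with \<open>y\<close> the monic polynomial whose roots are the
  variables in \<open>A\<close>.\<close>

lemma psum_in_subring:
  assumes R: "subring R" and A: "finite A"
    and c: "\<And>j. coeff (\<Prod>i\<in>A. [:- mvar i, 1:]) j \<in> R"
  shows "psum A m \<in> R"
proof (induction m rule: less_induct)
  case (less s)
  define y where "y = (\<Prod>i\<in>A. [:- mvar i, 1:])"
  define n where "n = card A"
  have deg: "degree y = n" unfolding y_def n_def by (subst degree_prod_eq_sum_degree) auto
  have lc: "coeff y n = 1"
    using lead_coeff_prod[of "\<lambda>i. [:- mvar i, 1:]" A] by (simp add: deg flip: y_def)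
  have cy: "coeff y j \<in> R" for j using c by (simp add: y_def)
  show ?case
  proof (cases "s < n")
    case True
    define Q where "Q = (\<lambda>i. \<Prod>j\<in>A - {i}. [:- mvar j, 1:])"
    have yQ: "y = [:- mvar i, 1:] * Q i" if "i \<in> A" for i
      unfolding y_def Q_def using that A by (subst prod.remove[of _ i]) auto
    \<comment> \<open>Below the degree the identity comes from y' = \<Sum> y / (x - w_i): in the
      coefficient n - 1 - s the s-th power sum occurs with the leading coefficient 1 of y.\<close>
    have "pderiv y = (\<Sum>i\<in>A. Q i)"
      unfolding y_def pderiv_prod Q_def by (intro sum.cong refl) (simp add: pderiv_pCons)
    hence "of_nat (Suc (n - 1 - s)) * coeff y (Suc (n - 1 - s)) = (\<Sum>i\<in>A. coeff (Q i) (n - 1 - s))"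
      using coeff_pderiv[of y "n - 1 - s"] by (simp add: coeff_sum)
    also have "Suc (n - 1 - s) = n - s" using True by auto
    also have "(\<Sum>i\<in>A. coeff (Q i) (n - 1 - s)) = (\<Sum>i\<in>A. \<Sum>r<n - (n - 1 - s). coeff y (n - 1 - s + 1 + r) * mvar i ^ r)"
      by (intro sum.cong refl coeff_linear_factor[OF yQ]) (auto simp: deg)
    also have "n - (n - 1 - s) = Suc s" using True by auto
    also have "(\<Sum>i\<in>A. \<Sum>r<Suc s. coeff y (n - 1 - s + 1 + r) * mvar i ^ r)
        = (\<Sum>i\<in>A. \<Sum>r<Suc s. coeff y (n - s + r) * mvar i ^ r)"
      by (intro sum.cong refl arg_cong2[where f="(*)"] arg_cong[where f="coeff y"]) (use True in auto)
    also have "\<dots> = (\<Sum>r<Suc s. coeff y (n - s + r) * psum A r)"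
      unfolding psum_def by (subst sum.swap) (simp only: sum_distrib_left)
    also have "\<dots> = (\<Sum>r<s. coeff y (n - s + r) * psum A r) + psum A s" using True by (simp add: lc)
    finally have "psum A s = of_nat (n - s) * coeff y (n - s) - (\<Sum>r<s. coeff y (n - s + r) * psum A r)" by simp
    also have "of_nat (n - s) = mconst (of_nat (n - s))" by (simp add: mconst_def)
    also have "mconst (of_nat (n - s)) * coeff y (n - s) - (\<Sum>r<s. coeff y (n - s + r) * psum A r) \<in> R"
      by (intro subringD[OF R] subring_sum[OF R] cy less.IH) auto
    finally show ?thesis .
  next
    case False
    \<comment> \<open>From the degree on, y(w_i) = 0 multiplied by w_i^(s-n) and summed over i is a
      recursion.\<close>
    have root: "mvar i ^ (s - n) * poly y (mvar i) = 0" if "i \<in> A" for i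
      using that A by (auto simp: y_def poly_prod)
    have "(\<Sum>i\<in>A. mvar i ^ (s - n) * poly y (mvar i)) = (\<Sum>i\<in>A. 0)" by (intro sum.cong refl root)
    hence "0 = (\<Sum>i\<in>A. mvar i ^ (s - n) * poly y (mvar i))" by simp
    also have "\<dots> = (\<Sum>i\<in>A. \<Sum>r\<le>n. coeff y r * mvar i ^ (s - n + r))"
      by (simp add: poly_altdef deg sum_distrib_left power_add mult_ac)
    also have "\<dots> = (\<Sum>r\<le>n. coeff y r * psum A (s - n + r))"
      unfolding psum_def by (subst sum.swap) (simp add: sum_distrib_left)
    also have "\<dots> = (\<Sum>r<n. coeff y r * psum A (s - n + r)) + psum A s"
      using False by (simp add: lc flip: lessThan_Suc_atMost)
    finally have "psum A s = - (\<Sum>r<n. coeff y r * psum A (s - n + r))" by (simp add: eq_neg_iff_add_eq_0 add.commute)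
    also have "\<dots> \<in> R"
      by (intro subringD[OF R] subring_sum[OF R] cy less.IH) (use False in auto)
    finally show ?thesis .
  qed
qed

section \<open>The ideal of the symmetric relations\<close>

lemma coeff_prod_linear:
  fixes x :: "'i \<Rightarrow> 'a::comm_ring_1"
  assumes "finite A" "j \<le> card A"
  shows "coeff (\<Prod>i\<in>A. [:- x i, 1:]) (card A - j) = (- 1) ^ j * (\<Sum>B\<in>{B. B \<subseteq> A \<and> card B = j}. \<Prod>i\<in>B. x i)"
proof -
  have "(\<Prod>i\<in>A. [:- x i, 1:]) = (\<Prod>i\<in>A. [:- x i:] + [:0, 1:])" by simp
  also have "\<dots> = (\<Sum>B\<in>Pow A. (\<Prod>i\<in>B. [:- x i:]) * (\<Prod>i\<in>A - B. [:0, 1:]))"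
    by (rule prod_add[OF assms(1)])
  also have "\<dots> = (\<Sum>B\<in>Pow A. smult (\<Prod>i\<in>B. - x i) (monom 1 (card (A - B))))"
  proof (intro sum.cong refl arg_cong2[where f="(*)"])
    fix B assume "B \<in> Pow A"
    have "(\<Prod>i\<in>B. [:- x i:]) = [:\<Prod>i\<in>B. - x i:]" for B
      by (induction B rule: infinite_finite_induct) (auto simp: mult.commute)
    moreover have "(\<Prod>i\<in>A - B. [:0, 1:]) = monom (1::'a) (card (A - B))"
      by (simp add: monom_altdef)
    ultimately show "(\<Prod>i\<in>B. [:- x i:]) * (\<Prod>i\<in>A - B. [:0, 1:]) = smult (\<Prod>i\<in>B. - x i) (monom 1 (card (A - B)))"
      by simp
  qed
  finally have "coeff (\<Prod>i\<in>A. [:- x i, 1:]) (card A - j)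
      = (\<Sum>B\<in>Pow A. (\<Prod>i\<in>B. - x i) * coeff (monom 1 (card (A - B))) (card A - j))"
    by (simp only: coeff_sum coeff_smult)
  also have "\<dots> = (\<Sum>B\<in>Pow A. if card B = j then \<Prod>i\<in>B. - x i else 0)"
  proof (rule sum.cong[OF refl])
    fix B assume B: "B \<in> Pow A"
    hence "card (A - B) = card A - card B" "card B \<le> card A"
      using assms(1) by (auto simp: card_Diff_subset finite_subset card_mono)
    thus "(\<Prod>i\<in>B. - x i) * coeff (monom 1 (card (A - B))) (card A - j) = (if card B = j then \<Prod>i\<in>B. - x i else 0)"
      using assms(2) by auto
  qed
  also have "\<dots> = (\<Sum>B\<in>{B. B \<subseteq> A \<and> card B = j}. \<Prod>i\<in>B. - x i)"
    by (rule sum.mono_neutral_cong_right) (use assms(1) in auto)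
  also have "\<dots> = (\<Sum>B\<in>{B. B \<subseteq> A \<and> card B = j}. (- 1) ^ j * (\<Prod>i\<in>B. x i))"
    by (intro sum.cong refl) (auto simp: prod_uminus)
  finally show ?thesis by (simp add: sum_distrib_left)
qed

text \<open>The ring \<open>R\<close> of coefficients is a parameter because membership is obtained
  with arbitrary or truncated coefficients and only afterwards brought down to invariant ones, where
  it becomes membership in \<open>gen_ideal\<close>.\<close>

definition gideal :: "mpoly set \<Rightarrow> nat \<Rightarrow> (nat \<Rightarrow> complex) \<Rightarrow> mpoly set" where
  "gideal R k eps = {\<Sum>i\<in>{1..k}. r i * (esym k i - mconst (eps i)) | r. \<forall>i. r i \<in> R}"

definition truncs :: "nat \<Rightarrow> mpoly set" where
  "truncs k = {p. trunc k p = p}"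

lemma gen_ideal_eq: "gen_ideal k l eps = gideal (inv_ring k l) k eps"
  by (simp add: gen_ideal_def gideal_def)

lemma subring_inv_ring [simp]: "subring (inv_ring k l)"
  by (auto simp: subring_def)

lemma subring_truncs [simp]: "subring (truncs k)"
  by (auto simp: subring_def truncs_def)

lemma inv_ring_truncs: "inv_ring k l \<subseteq> truncs k"
  by (auto simp: inv_ring_iff truncs_def)

lemma gideal_mono: "R \<subseteq> R' \<Longrightarrow> gideal R k eps \<subseteq> gideal R' k eps"
  by (auto simp: gideal_def)

lemma gideal_add:
  assumes "subring R" "p \<in> gideal R k eps" "q \<in> gideal R k eps" shows "p + q \<in> gideal R k eps"
proof -
  from assms(2,3) obtain r r' where "p = (\<Sum>i\<in>{1..k}. r i * (esym k i - mconst (eps i)))" "\<forall>i. r i \<in> R"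
    "q = (\<Sum>i\<in>{1..k}. r' i * (esym k i - mconst (eps i)))" "\<forall>i. r' i \<in> R" by (auto simp: gideal_def)
  thus ?thesis unfolding gideal_def
    by (intro CollectI exI[of _ "\<lambda>i. r i + r' i"]) (auto simp: distrib_right sum.distrib intro: subringD[OF assms(1)])
qed

lemma gideal_mult:
  assumes "subring R" "p \<in> R" "q \<in> gideal R k eps" shows "p * q \<in> gideal R k eps"
proof -
  from assms(3) obtain r' where
    "q = (\<Sum>i\<in>{1..k}. r' i * (esym k i - mconst (eps i)))" "\<forall>i. r' i \<in> R" by (auto simp: gideal_def)
  thus ?thesis unfolding gideal_def
    by (intro CollectI exI[of _ "\<lambda>i. p * r' i"]) (auto simp: sum_distrib_left mult.assoc intro: subringD[OF assms(1)] assms(2))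
qed

lemma gideal_0: "subring R \<Longrightarrow> 0 \<in> gideal R k eps"
  unfolding gideal_def by (intro CollectI exI[of _ "\<lambda>_. 0"]) (auto intro: subringD)

lemma gideal_uminus: "subring R \<Longrightarrow> p \<in> gideal R k eps \<Longrightarrow> - p \<in> gideal R k eps"
  using gideal_mult[of R "- 1" p k eps] subringD(6)[OF _ subringD(2)] by auto

lemma gideal_diff: "subring R \<Longrightarrow> p \<in> gideal R k eps \<Longrightarrow> q \<in> gideal R k eps \<Longrightarrow> p - q \<in> gideal R k eps"
  using gideal_add[of R p k eps "- q"] gideal_uminus[of R q] by simp

lemma gideal_sum: "subring R \<Longrightarrow> (\<And>a. a \<in> A \<Longrightarrow> f a \<in> gideal R k eps) \<Longrightarrow> sum f A \<in> gideal R k eps"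
  by (induction A rule: infinite_finite_induct) (auto intro: gideal_add gideal_0)

lemma gideal_gen:
  assumes "subring R" "i \<in> {1..k}" shows "esym k i - mconst (eps i) \<in> gideal R k eps"
proof -
  have "(\<Sum>j\<in>{1..k}. (if j = i then 1 else 0) * (esym k j - mconst (eps j))) = (\<Sum>j\<in>{1..k}. if j = i then esym k j - mconst (eps j) else 0)"
    by (intro sum.cong) auto
  also have "\<dots> = esym k i - mconst (eps i)" using assms(2) by simp
  finally show ?thesis unfolding gideal_def
    by (intro CollectI exI[of _ "\<lambda>j. if j = i then 1 else 0"]) (auto intro: subringD[OF assms(1)])
qed

lemma Gp_mono: "l \<le> k \<Longrightarrow> Gp k l \<subseteq> Gp k k"
  by (auto simp: Gp_def dest: permutes_image)

lemma inv_ring_mono: "l \<le> k \<Longrightarrow> inv_ring k k \<subseteq> inv_ring k l"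
  by (auto simp: inv_ring_iff) (meson Gp_mono subsetD)

lemma inv_ring_k_iff: "p \<in> inv_ring k k \<longleftrightarrow> trunc k p = p \<and> (\<forall>\<pi>. \<pi> permutes {..<k} \<longrightarrow> rename \<pi> p = p)"
  by (auto simp: inv_ring_iff Gp_def dest: permutes_image)

lemma esym_inv_ring: "esym k i \<in> inv_ring k k"
proof -
  have "trunc k (esym k i) = esym k i"
    unfolding esym_def trunc_sum trunc_prod by (intro sum.cong prod.cong refl) auto
  moreover have "rename \<pi> (esym k i) = esym k i" if p: "\<pi> permutes {..<k}" for \<pi>
  proof -
    have "rename \<pi> (esym k i) = (\<Sum>A\<in>{A. A \<subseteq> {..<k} \<and> card A = i}. \<Prod>a\<in>A. mvar (\<pi> a))"
      unfolding esym_def rename_sum rename_prod by simp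
    also have "\<dots> = (\<Sum>A\<in>{A. A \<subseteq> {..<k} \<and> card A = i}. \<Prod>a\<in>\<pi> ` A. mvar a)"
      using permutes_inj[OF p] by (intro sum.cong refl prod.reindex[symmetric, unfolded o_def]) (auto intro: inj_on_subset)
    also have "\<dots> = (\<Sum>A\<in>(`) \<pi> ` {A. A \<subseteq> {..<k} \<and> card A = i}. \<Prod>a\<in>A. mvar a)"
      using permutes_inj[OF p] by (subst sum.reindex) (auto intro: inj_on_subset[OF inj_on_image[of \<pi> UNIV]] simp: inj_image_eq_iff inj_on_def)
    also have "(`) \<pi> ` {A. A \<subseteq> {..<k} \<and> card A = i} = {A. A \<subseteq> {..<k} \<and> card A = i}"
    proof safe
      fix A x assume "A \<subseteq> {..<k}" "x \<in> A"
      thus "\<pi> x < k" using permutes_in_image[OF p, of x] by auto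
    next
      fix A assume "A \<subseteq> {..<k}" "i = card A"
      show "card (\<pi> ` A) = card A" by (rule card_image) (use permutes_inj[OF p] in \<open>auto intro: inj_on_subset\<close>)
    next
      fix A assume A: "A \<subseteq> {..<k}" "i = card A"
      have "A = \<pi> ` (inv \<pi> ` A)" using permutes_surj[OF p] by (simp add: image_image surj_f_inv_f)
      moreover have "inv \<pi> ` A \<subseteq> {..<k}" using A permutes_in_image[OF permutes_inv[OF p]] by auto
      moreover have "card (inv \<pi> ` A) = card A" by (rule card_image) (use permutes_inj[OF permutes_inv[OF p]] in \<open>auto intro: inj_on_subset\<close>)
      ultimately show "A \<in> (`) \<pi> ` {A'. A' \<subseteq> {..<k} \<and> card A' = card A}" by blast
    qed
    finally show ?thesis by (simp add: esym_def)
  qed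
  ultimately show ?thesis by (simp add: inv_ring_k_iff)
qed

lemma coeff_wpoly: "i \<le> k \<Longrightarrow> coeff (\<Prod>i<k. [:- mvar i, 1:]) (k - i) = (- 1) ^ i * esym k i"
  using coeff_prod_linear[of "{..<k}" i mvar] by (simp add: esym_def)

lemma degree_prod_linear:
  fixes x :: "'i \<Rightarrow> 'a::idom"
  shows "finite A \<Longrightarrow> degree (\<Prod>i\<in>A. [:- x i, 1:]) = card A"
  by (subst degree_prod_eq_sum_degree) auto

lemma coeff_prod_linear_card:
  fixes x :: "'i \<Rightarrow> 'a::idom"
  shows "finite A \<Longrightarrow> coeff (\<Prod>i\<in>A. [:- x i, 1:]) (card A) = 1"
  using lead_coeff_prod[of "\<lambda>i. [:- x i, 1:]" A] by (simp add: degree_prod_linear)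

lemma ev_coeff_prod_linear:
  fixes g :: "nat \<Rightarrow> 'a::idom"
  assumes "chom h" "finite A"
  shows "ev h g (coeff (\<Prod>i\<in>A. [:- mvar i, 1:]) j) = coeff (\<Prod>i\<in>A. [:- g i, 1:]) j"
proof (cases "j \<le> card A")
  case True
  hence "j = card A - (card A - j)" by simp
  with coeff_prod_linear[of A "card A - j" mvar] coeff_prod_linear[of A "card A - j" g] assms
  show ?thesis by (simp add: ev_simps)
next
  case False
  thus ?thesis using assms by (simp add: coeff_eq_0 degree_prod_linear)
qed

lemma altG_sum_left:
  assumes "\<sigma> \<in> Gp k l"
  shows "(\<Sum>\<pi>\<in>Gp k l. f (\<sigma> \<circ> \<pi>)) = (\<Sum>\<pi>\<in>Gp k l. f \<pi>)"
proof -
  from assms have \<sigma>: "\<sigma> permutes {..<k}" "\<sigma> ` {..<l} = {..<l}" by (auto simp: Gp_def)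
  have inv: "inv \<sigma> ` {..<l} = {..<l}"
    by (metis \<sigma> image_inv_f_f permutes_inj)
  show ?thesis
  proof (rule sum.reindex_bij_witness[of _ "\<lambda>\<pi>. inv \<sigma> \<circ> \<pi>" "\<lambda>\<pi>. \<sigma> \<circ> \<pi>"])
    fix \<pi> assume "\<pi> \<in> Gp k l"
    hence \<pi>: "\<pi> permutes {..<k}" "\<pi> ` {..<l} = {..<l}" by (auto simp: Gp_def)
    show "inv \<sigma> \<circ> (\<sigma> \<circ> \<pi>) = \<pi>" "\<sigma> \<circ> (inv \<sigma> \<circ> \<pi>) = \<pi>"
      unfolding o_assoc using permutes_inv_o[OF \<sigma>(1)] by simp_all
    have "(\<sigma> \<circ> \<pi>) ` {..<l} = {..<l}" "(inv \<sigma> \<circ> \<pi>) ` {..<l} = {..<l}"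
      using \<pi> \<sigma> inv by (metis image_comp)+
    thus "\<sigma> \<circ> \<pi> \<in> Gp k l" "inv \<sigma> \<circ> \<pi> \<in> Gp k l"
      unfolding Gp_def using \<pi>(1) \<sigma>(1) by (blast intro: permutes_compose permutes_inv)+
  qed auto
qed

lemma finite_Gp [simp]: "finite (Gp k l)"
  by (rule finite_subset[OF _ finite_permutations[of "{..<k}"]]) (auto simp: Gp_def)

lemma id_in_Gp [simp]: "id \<in> Gp k l" by (auto simp: Gp_def permutes_id)

lemma card_Gp_pos: "card (Gp k l) > 0" by (auto simp: card_gt_0_iff intro: exI[of _ id] id_in_Gp)

lemma block_transpose_Gp:
  assumes "l \<le> k" "(a < l \<and> b < l) \<or> (a \<in> {l..<k} \<and> b \<in> {l..<k})"
  shows "transpose a b \<in> Gp k l"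
proof -
  have "transpose a b permutes {..<k}" using assms by (intro permutes_swap_id) auto
  moreover have "transpose a b ` {..<l} = {..<l}"
  proof (cases "a < l \<and> b < l")
    case True
    hence "transpose a b permutes {..<l}" by (intro permutes_swap_id) auto
    thus ?thesis by (rule permutes_image)
  next
    case False
    thus ?thesis using assms by (intro image_cong[where g=id, simplified]) (auto simp: transpose_def)
  qed
  ultimately show ?thesis by (simp add: Gp_def)
qed

lemma block_alternating_rename:
  assumes l: "l \<le> k" and pi: "\<pi> \<in> Gp k l"
    and "\<And>a b. a < l \<Longrightarrow> b < l \<Longrightarrow> a \<noteq> b \<Longrightarrow> rename (transpose a b) p = - p"
    and "\<And>a b. a \<in> {l..<k} \<Longrightarrow> b \<in> {l..<k} \<Longrightarrow> a \<noteq> b \<Longrightarrow> rename (transpose a b) p = - p"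
  shows "rename \<pi> p = of_int (sign \<pi>) * p"
proof -
  from pi l obtain \<pi>1 \<pi>2 where 1: "\<pi>1 permutes {..<l}" "\<pi>2 permutes {l..<k}" "\<pi> = \<pi>1 \<circ> \<pi>2"
    by (rule Gp_decompose)
  have "rename \<pi>1 p = of_int (sign \<pi>1) * p" using rename_permutes_eq[OF 1(1), of p "- 1"] assms(3) by auto
  moreover have "rename \<pi>2 p = of_int (sign \<pi>2) * p" using rename_permutes_eq[OF 1(2), of p "- 1"] assms(4) by auto
  moreover have "sign \<pi> = sign \<pi>1 * sign \<pi>2"
    unfolding 1(3) by (rule sign_compose) (use 1 in \<open>auto simp: permutation_permutes\<close>)
  ultimately show ?thesis by (simp add: 1(3) flip: rename_rename)
qed

definition VB :: "nat \<Rightarrow> nat \<Rightarrow> mpoly" where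
  "VB k l = VA {..<l} * VA {l..<k}"

lemma rename_VB_transpose:
  assumes "(a < l \<and> b < l) \<or> (a \<in> {l..<k} \<and> b \<in> {l..<k})" "a \<noteq> b"
  shows "rename (transpose a b) (VB k l) = - VB k l"
  using assms(1)
proof
  assume *: "a < l \<and> b < l"
  hence "rename (transpose a b) (VA {l..<k}) = VA {l..<k}" by (intro rename_VA_fix) (auto simp: transpose_def)
  thus ?thesis using * assms(2) by (simp add: VB_def rename_VA_transpose)
next
  assume *: "a \<in> {l..<k} \<and> b \<in> {l..<k}"
  hence "rename (transpose a b) (VA {..<l}) = VA {..<l}" by (intro rename_VA_fix) (auto simp: transpose_def)
  thus ?thesis using * assms(2) by (simp add: VB_def rename_VA_transpose)
qed

lemma VB_nonzero: "VB k l \<noteq> 0" by (simp add: VB_def VA_nonzero)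

lemma trunc_VB: "l \<le> k \<Longrightarrow> trunc k (VB k l) = VB k l"
  using trunc_VA[of "{..<l}" k] trunc_VA[of "{l..<k}" k] by (simp add: VB_def ivl_subset subset_eq)

text \<open>Antisymmetrize both sides over the block group. The left side is multiplied by the group
  order; on the right the symmetric generators pass through, and each antisymmetrized coefficient is
  \<open>VB k l\<close> times an invariant. Cancelling \<open>VB k l\<close> in the polynomial ring
  leaves an expression with invariant coefficients.\<close>

lemma gideal_cancel_VB:
  assumes l: "l \<le> k" and p: "p \<in> inv_ring k l" and pV: "p * VB k l \<in> gideal (truncs k) k eps"
  shows "p \<in> gen_ideal k l eps"
proof -
  define al where "al = (\<lambda>f. \<Sum>\<pi>\<in>Gp k l. of_int (sign \<pi>) * rename \<pi> f)"
  have perm: "permutation \<pi>" if "\<pi> \<in> Gp k l" for \<pi> using that by (auto simp: permutation_permutes Gp_def)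
  have al_rename: "rename \<sigma> (al f) = of_int (sign \<sigma>) * al f" if "\<sigma> \<in> Gp k l" for \<sigma> f
  proof -
    have "rename \<sigma> (al f) = (\<Sum>\<pi>\<in>Gp k l. of_int (sign \<sigma>) * (of_int (sign (\<sigma> \<circ> \<pi>)) * rename (\<sigma> \<circ> \<pi>) f))"
      unfolding al_def rename_sum
    proof (intro sum.cong refl)
      fix \<pi> assume "\<pi> \<in> Gp k l"
      hence "sign (\<sigma> \<circ> \<pi>) = sign \<sigma> * sign \<pi>" using perm that by (simp add: sign_compose)
      hence "sign \<sigma> * sign (\<sigma> \<circ> \<pi>) = sign \<pi>" by simp
      hence "of_int (sign \<sigma>) * of_int (sign (\<sigma> \<circ> \<pi>)) = (of_int (sign \<pi>) :: mpoly)" by (metis of_int_mult)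
      thus "rename \<sigma> (of_int (sign \<pi>) * rename \<pi> f) = of_int (sign \<sigma>) * (of_int (sign (\<sigma> \<circ> \<pi>)) * rename (\<sigma> \<circ> \<pi>) f)"
        by (simp add: rename_rename flip: mult.assoc)
    qed
    also have "\<dots> = of_int (sign \<sigma>) * (\<Sum>\<pi>\<in>Gp k l. of_int (sign (\<sigma> \<circ> \<pi>)) * rename (\<sigma> \<circ> \<pi>) f)"
      by (simp add: sum_distrib_left)
    also have "(\<Sum>\<pi>\<in>Gp k l. of_int (sign (\<sigma> \<circ> \<pi>)) * rename (\<sigma> \<circ> \<pi>) f) = al f"
      unfolding al_def by (rule altG_sum_left[OF that])
    finally show ?thesis .
  qed
  have al_tr: "rename (transpose a b) (al f) = - al f"
    if "(a < l \<and> b < l) \<or> (a \<in> {l..<k} \<and> b \<in> {l..<k})" "a \<noteq> b" for a b f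
    using al_rename[OF block_transpose_Gp[OF l that(1)]] that(2) by (simp add: sign_swap_id)
  have quot: "\<exists>s\<in>inv_ring k l. al f = VB k l * s" if f: "f \<in> truncs k" for f
  proof -
    have tr: "trunc k (al f) = al f" unfolding al_def trunc_sum
      by (intro sum.cong refl) (use f in \<open>auto simp: truncs_def trunc_rename Gp_def\<close>)
    have "VB k l dvd al f" unfolding VB_def
      by (rule VA_mult_dvd) (auto simp: al_tr)
    then obtain s where s: "al f = VB k l * s" by (elim dvdE)
    have "s \<in> inv_ring k l"
    proof (rule quotient_inv_ring[OF s[symmetric] VB_nonzero trunc_VB[OF l] tr l])
      show "\<exists>e. (e = 1 \<or> e = - 1) \<and> rename (transpose a b) (al f) = e * al f \<and> rename (transpose a b) (VB k l) = e * VB k l"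
        if "a < l" "b < l" "a \<noteq> b" for a b
        using that al_tr[of a b f] rename_VB_transpose[of a l b k] by (intro exI[of _ "- 1"]) simp
      show "\<exists>e. (e = 1 \<or> e = - 1) \<and> rename (transpose a b) (al f) = e * al f \<and> rename (transpose a b) (VB k l) = e * VB k l"
        if "a \<in> {l..<k}" "b \<in> {l..<k}" "a \<noteq> b" for a b
        using that al_tr[of a b f] rename_VB_transpose[of a l b k] by (intro exI[of _ "- 1"]) simp
    qed
    with s show ?thesis by blast
  qed
  from pV obtain r where r: "p * VB k l = (\<Sum>i\<in>{1..k}. r i * (esym k i - mconst (eps i)))" "\<And>i. r i \<in> truncs k"
    by (auto simp: gideal_def)
  from quot[OF r(2)] obtain s where s: "\<And>i. s i \<in> inv_ring k l" "\<And>i. al (r i) = VB k l * s i" by metis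
  have "al (p * VB k l) = (\<Sum>\<pi>\<in>Gp k l. p * VB k l)"
    unfolding al_def
  proof (intro sum.cong refl)
    fix \<pi> assume \<pi>: "\<pi> \<in> Gp k l"
    have "rename \<pi> (VB k l) = of_int (sign \<pi>) * VB k l"
      by (rule block_alternating_rename[OF l \<pi>]) (auto simp: rename_VB_transpose)
    moreover have "of_int (sign \<pi>) * of_int (sign \<pi>) = (1 :: mpoly)" by (metis of_int_1 of_int_mult sign_idempotent)
    moreover have "rename \<pi> p = p" using p \<pi> by (auto simp: inv_ring_iff)
    moreover have "of_int (sign \<pi>) * (p * (of_int (sign \<pi>) * VB k l)) = of_int (sign \<pi>) * of_int (sign \<pi>) * (p * VB k l)"
      by (simp only: mult_ac)
    ultimately show "of_int (sign \<pi>) * rename \<pi> (p * VB k l) = p * VB k l" by simp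
  qed
  also have "\<dots> = mconst (of_nat (card (Gp k l))) * p * VB k l" by (simp add: mconst_def)
  finally have 1: "al (p * VB k l) = VB k l * (mconst (of_nat (card (Gp k l))) * p)" by (simp add: mult_ac)
  have "al (p * VB k l) = (\<Sum>i\<in>{1..k}. al (r i) * (esym k i - mconst (eps i)))"
    unfolding r(1) al_def rename_sum
    unfolding sum_distrib_left sum_distrib_right
  proof (subst sum.swap, intro sum.cong refl)
    fix i \<pi> assume "\<pi> \<in> Gp k l"
    hence "rename \<pi> (esym k i) = esym k i" using esym_inv_ring[of k i] by (auto simp: inv_ring_k_iff Gp_def)
    thus "of_int (sign \<pi>) * rename \<pi> (r i * (esym k i - mconst (eps i))) = of_int (sign \<pi>) * rename \<pi> (r i) * (esym k i - mconst (eps i))"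
      by simp
  qed
  also have "\<dots> = VB k l * (\<Sum>i\<in>{1..k}. s i * (esym k i - mconst (eps i)))"
    by (simp add: s(2) sum_distrib_left mult.assoc)
  finally have "mconst (of_nat (card (Gp k l))) * p = (\<Sum>i\<in>{1..k}. s i * (esym k i - mconst (eps i)))"
    using 1 VB_nonzero by simp
  hence "mconst (of_nat (card (Gp k l))) * p \<in> gen_ideal k l eps"
    unfolding gen_ideal_def using s(1) by blast
  hence "mconst (1 / of_nat (card (Gp k l))) * (mconst (of_nat (card (Gp k l))) * p) \<in> gen_ideal k l eps"
    unfolding gen_ideal_eq by (rule gideal_mult[rotated 2]) auto
  moreover have "mconst (1 / of_nat (card (Gp k l))) * (mconst (of_nat (card (Gp k l))) * p) = p"
    using id_in_Gp[of k l] by (subst mult.assoc[symmetric], subst mconst_mult[symmetric]) (auto simp: mconst_1 simp del: id_in_Gp) 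
  ultimately show ?thesis by simp
qed

definition Wset :: "nat \<Rightarrow> nat \<Rightarrow> nat set set" where
  "Wset k l = {S. S \<subseteq> {..<k} \<and> card S = l}"

lemma finite_Wset [simp]: "finite (Wset k l)"
  by (rule finite_subset[of _ "Pow {..<k}"]) (auto simp: Wset_def)

lemma card_Wset: "card (Wset k l) = k choose l"
  using n_subsets[of "{..<k}" l] by (simp add: Wset_def)

lemma permutes_onto_subset:
  assumes "S \<in> Wset k l"
  obtains \<sigma> where "\<sigma> permutes {..<k}" "\<sigma> ` {..<l} = S"
proof -
  have S: "S \<subseteq> {..<k}" "card S = l" "finite S" using assms by (auto simp: Wset_def intro: finite_subset)
  have lk: "l \<le> k" using card_mono[OF _ S(1)] S(2) by simp
  obtain f where f: "bij_betw f {..<l} S" using finite_same_card_bij[of "{..<l}" S] S by auto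
  have "card {l..<k} = card ({..<k} - S)" using S by (simp add: card_Diff_subset)
  then obtain g where g: "bij_betw g {l..<k} ({..<k} - S)" using finite_same_card_bij[of "{l..<k}" "{..<k} - S"] by auto
  define h where "h = (\<lambda>i. if i < l then f i else if i < k then g i else i)"
  have "bij_betw h {..<l} S" using f by (subst bij_betw_cong[where g=f]) (auto simp: h_def)
  moreover have "bij_betw h {l..<k} ({..<k} - S)" using g by (subst bij_betw_cong[where g=g]) (auto simp: h_def)
  ultimately have "bij_betw h ({..<l} \<union> {l..<k}) (S \<union> ({..<k} - S))" by (rule bij_betw_combine) auto
  also have "{..<l} \<union> {l..<k} = {..<k}" using lk by auto
  also have "S \<union> ({..<k} - S) = {..<k}" using S by auto
  finally have "h permutes {..<k}" by (rule bij_imp_permutes) (use lk in \<open>auto simp: h_def\<close>)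
  moreover have "h ` {..<l} = S" using \<open>bij_betw h {..<l} S\<close> by (rule bij_betw_imp_surj_on)
  ultimately show ?thesis using that by blast
qed

text \<open>The block group is the stabilizer of the set of the first \<open>l\<close> indices, so
  the l-subsets are its cosets in S_k, each reached as often as the group has elements.\<close>

lemma sum_over_cosets:
  fixes f :: "nat set \<Rightarrow> 'a::comm_ring_1"
  assumes "l \<le> k"
  shows "(\<Sum>\<pi> | \<pi> permutes {..<k}. f (\<pi> ` {..<l})) = of_nat (card (Gp k l)) * (\<Sum>S\<in>Wset k l. f S)"
proof -
  let ?P = "{\<pi>. \<pi> permutes {..<k}}"
  have im: "(\<lambda>\<pi>. \<pi> ` {..<l}) ` ?P \<subseteq> Wset k l"
  proof safe
    fix \<pi> assume p: "\<pi> permutes {..<k}"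
    have "\<pi> ` {..<l} \<subseteq> \<pi> ` {..<k}" using assms by auto
    thus "\<pi> ` {..<l} \<in> Wset k l"
      using permutes_image[OF p] card_image[OF inj_on_subset[OF permutes_inj[OF p] subset_UNIV], of "{..<l}"]
      by (simp add: Wset_def)
  qed
  have "(\<Sum>\<pi>\<in>?P. f (\<pi> ` {..<l})) = (\<Sum>S\<in>Wset k l. \<Sum>\<pi>\<in>{\<pi>\<in>?P. \<pi> ` {..<l} = S}. f (\<pi> ` {..<l}))"
    by (rule sum.group[symmetric]) (auto simp: finite_permutations im)
  also have "\<dots> = (\<Sum>S\<in>Wset k l. of_nat (card (Gp k l)) * f S)"
  proof (intro sum.cong refl)
    fix S assume S: "S \<in> Wset k l"
    obtain \<sigma> where \<sigma>: "\<sigma> permutes {..<k}" "\<sigma> ` {..<l} = S" by (rule permutes_onto_subset[OF S])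
    have "bij_betw (\<lambda>\<pi>. \<sigma> \<circ> \<pi>) (Gp k l) {\<pi>\<in>?P. \<pi> ` {..<l} = S}"
    proof (rule bij_betw_byWitness[where f'="\<lambda>\<pi>. inv \<sigma> \<circ> \<pi>"])
      show "\<forall>a\<in>Gp k l. inv \<sigma> \<circ> (\<sigma> \<circ> a) = a" "\<forall>a'\<in>{\<pi>\<in>?P. \<pi> ` {..<l} = S}. \<sigma> \<circ> (inv \<sigma> \<circ> a') = a'"
        using permutes_inv_o[OF \<sigma>(1)] by (simp_all add: o_assoc)
      show "(\<lambda>\<pi>. \<sigma> \<circ> \<pi>) ` Gp k l \<subseteq> {\<pi>\<in>?P. \<pi> ` {..<l} = S}"
      proof (rule image_subsetI)
        fix \<pi> assume "\<pi> \<in> Gp k l"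
        hence \<pi>: "\<pi> permutes {..<k}" "\<pi> ` {..<l} = {..<l}" by (auto simp: Gp_def)
        have "\<sigma> \<circ> \<pi> permutes {..<k}" using \<pi> \<sigma> by (blast intro: permutes_compose)
        moreover have "(\<sigma> \<circ> \<pi>) ` {..<l} = S" using \<pi> \<sigma> by (metis image_comp)
        ultimately show "\<sigma> \<circ> \<pi> \<in> {\<pi>\<in>?P. \<pi> ` {..<l} = S}" by blast
      qed
      have "inv \<sigma> ` S = {..<l}" using \<sigma> permutes_inj[OF \<sigma>(1)] by (metis image_inv_f_f)
      hence i: "inv \<sigma> ` S = {..<l}" .
      show "(\<lambda>\<pi>. inv \<sigma> \<circ> \<pi>) ` {\<pi>\<in>?P. \<pi> ` {..<l} = S} \<subseteq> Gp k l"
      proof (rule image_subsetI)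
        fix \<pi> assume "\<pi> \<in> {\<pi>\<in>?P. \<pi> ` {..<l} = S}"
        hence \<pi>: "\<pi> permutes {..<k}" "S = \<pi> ` {..<l}" by auto
        hence "(inv \<sigma> \<circ> \<pi>) ` {..<l} = {..<l}" using i by (metis image_comp)
        thus "inv \<sigma> \<circ> \<pi> \<in> Gp k l"
          unfolding Gp_def using \<pi>(1) \<sigma>(1) by (blast intro: permutes_compose permutes_inv)
      qed
    qed
    hence "card {\<pi>\<in>?P. \<pi> ` {..<l} = S} = card (Gp k l)" by (simp add: bij_betw_same_card)
    thus "(\<Sum>\<pi>\<in>{\<pi>\<in>?P. \<pi> ` {..<l} = S}. f (\<pi> ` {..<l})) = of_nat (card (Gp k l)) * f S" by simp
  qed
  finally show ?thesis by (simp add: sum_distrib_left)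
qed

section \<open>The alternating functional and evaluation at the roots\<close>

lemma mconst_eq_0_iff [simp]: "mconst c = 0 \<longleftrightarrow> c = 0"
  using mconst_eq_iff[of c 0] by simp

text \<open>The longest divided difference (antisymmetrize, divide by the Vandermonde determinant)
  followed by evaluation at the roots. The division takes place among polynomials, so repeated roots
  cause no difficulty.\<close>

definition Lam :: "nat \<Rightarrow> (nat \<Rightarrow> complex) \<Rightarrow> mpoly \<Rightarrow> complex" where
  "Lam k \<rho> f = ev (\<lambda>c. c) \<rho> (THE s. alt k f = VA {..<k} * s)"

lemma Lam_eqI: "alt k f = VA {..<k} * s \<Longrightarrow> Lam k \<rho> f = ev (\<lambda>c. c) \<rho> s"
  unfolding Lam_def using VA_nonzero[of "{..<k}"] by (subst the_equality[where a=s]) auto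

lemma Lam_add:
  assumes "f \<in> truncs k" "g \<in> truncs k" shows "Lam k \<rho> (f + g) = Lam k \<rho> f + Lam k \<rho> g"
proof -
  have fg: "trunc k f = f" "trunc k g = g" using assms by (simp_all add: truncs_def)
  obtain s where 1: "alt k f = VA {..<k} * s" by (rule alt_eq_VA_mult[OF fg(1)])
  obtain t where 2: "alt k g = VA {..<k} * t" by (rule alt_eq_VA_mult[OF fg(2)])
  have 3: "alt k (f + g) = VA {..<k} * (s + t)" unfolding alt_add 1 2 by (simp add: distrib_left)
  show ?thesis unfolding Lam_eqI[OF 1] Lam_eqI[OF 2] Lam_eqI[OF 3] by (simp add: ev_simps)
qed

text \<open>Linearity over symmetric polynomials, each replaced by its value at the roots; this
  makes the functional vanish on the ideal.\<close>

lemma Lam_sym_mult: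
  assumes "r \<in> inv_ring k k" "f \<in> truncs k" shows "Lam k \<rho> (r * f) = ev (\<lambda>c. c) \<rho> r * Lam k \<rho> f"
proof -
  have f: "trunc k f = f" using assms by (simp add: truncs_def)
  obtain s where 1: "alt k f = VA {..<k} * s" by (rule alt_eq_VA_mult[OF f])
  hence 2: "alt k (r * f) = VA {..<k} * (r * s)" unfolding alt_mult_sym[OF assms(1)] by (simp add: mult_ac)
  show ?thesis unfolding Lam_eqI[OF 1] Lam_eqI[OF 2] by (simp add: ev_simps)
qed

lemma Lam_cmult: "f \<in> truncs k \<Longrightarrow> Lam k \<rho> (mconst c * f) = c * Lam k \<rho> f"
  by (subst Lam_sym_mult) (simp_all add: inv_ring_closed(5))

lemma Lam_0 [simp]: "Lam k \<rho> 0 = 0"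
  by (subst Lam_eqI[where s=0]) auto

lemma Lam_sum: "(\<And>a. a \<in> A \<Longrightarrow> f a \<in> truncs k) \<Longrightarrow> Lam k \<rho> (sum f A) = (\<Sum>a\<in>A. Lam k \<rho> (f a))"
proof (induction A rule: infinite_finite_induct)
  case (insert x A)
  have fx: "f x \<in> truncs k" and fA: "a \<in> A \<Longrightarrow> f a \<in> truncs k" for a by (rule insert.prems, simp)+
  have "sum f A \<in> truncs k" by (rule subring_sum[OF subring_truncs fA])
  note 1 = Lam_add[OF fx this]
  have 2: "Lam k \<rho> (sum f A) = (\<Sum>a\<in>A. Lam k \<rho> (f a))" by (rule insert.IH) (rule fA)
  show ?case unfolding sum.insert[OF insert.hyps] 1 2 ..
next
  case (infinite A)
  show ?case using infinite.hyps by simp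
qed simp

text \<open>By Vieta's formulas \<open>eps i\<close> is the i-th elementary symmetric function of
  the roots \<rho>, listed with multiplicity.\<close>

definition roots_of :: "nat \<Rightarrow> (nat \<Rightarrow> complex) \<Rightarrow> (nat \<Rightarrow> complex) \<Rightarrow> bool" where
  "roots_of k eps \<rho> \<longleftrightarrow> (\<forall>i\<in>{1..k}. eps i = (- 1) ^ i * coeff (\<Prod>i<k. [:- \<rho> i, 1:]) (k - i))"

lemma ev_esym:
  assumes "roots_of k eps \<rho>" "\<pi> permutes {..<k}" "i \<in> {1..k}"
  shows "ev (\<lambda>c. c) (\<lambda>i. \<rho> (\<pi> i)) (esym k i) = eps i"
proof -
  have "(\<Prod>i<k. [:- \<rho> (\<pi> i), 1:]) = (\<Prod>i<k. [:- \<rho> i, 1:])"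
    using prod.permute[OF assms(2), of "\<lambda>i. [:- \<rho> i, 1:]"] by (simp add: o_def)
  moreover have "ev (\<lambda>c. c) (\<lambda>i. \<rho> (\<pi> i)) (coeff (\<Prod>i<k. [:- mvar i, 1:]) (k - i)) = coeff (\<Prod>i<k. [:- \<rho> (\<pi> i), 1:]) (k - i)"
    by (rule ev_coeff_prod_linear) auto
  ultimately have "(- 1) ^ i * ev (\<lambda>c. c) (\<lambda>i. \<rho> (\<pi> i)) (esym k i) = coeff (\<Prod>i<k. [:- \<rho> i, 1:]) (k - i)"
    using assms(3) by (simp add: coeff_wpoly ev_simps)
  hence "(- 1) ^ i * ((- 1) ^ i * ev (\<lambda>c. c) (\<lambda>i. \<rho> (\<pi> i)) (esym k i)) = eps i"
    using assms(1,3) by (simp add: roots_of_def)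
  thus ?thesis by simp
qed

lemma ev_gideal:
  assumes "roots_of k eps \<rho>" "\<pi> permutes {..<k}" "p \<in> gideal R k eps"
  shows "ev (\<lambda>c. c) (\<lambda>i. \<rho> (\<pi> i)) p = 0"
proof -
  from assms(3) obtain r where "p = (\<Sum>i\<in>{1..k}. r i * (esym k i - mconst (eps i)))" by (auto simp: gideal_def)
  thus ?thesis by (simp add: ev_simps ev_esym[OF assms(1,2)])
qed

lemma Lam_gideal:
  assumes "roots_of k eps \<rho>" "p \<in> gideal (truncs k) k eps"
  shows "Lam k \<rho> p = 0"
proof -
  from assms(2) obtain r where r: "p = (\<Sum>i\<in>{1..k}. r i * (esym k i - mconst (eps i)))" "\<And>i. r i \<in> truncs k"
    by (auto simp: gideal_def)
  have e: "esym k i - mconst (eps i) \<in> inv_ring k k" for i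
    by (rule inv_ring_closed(3)[OF esym_inv_ring inv_ring_closed(5)])
  have p: "p = (\<Sum>i\<in>{1..k}. (esym k i - mconst (eps i)) * r i)"
    unfolding r(1) by (intro sum.cong refl mult.commute)
  have "Lam k \<rho> p = (\<Sum>i\<in>{1..k}. Lam k \<rho> ((esym k i - mconst (eps i)) * r i))"
    unfolding p by (rule Lam_sum) (rule subringD(5)[OF subring_truncs subsetD[OF inv_ring_truncs e] r(2)])
  also have "\<dots> = (\<Sum>i\<in>{1..k}. 0)"
  proof (intro sum.cong refl)
    fix i assume i: "i \<in> {1..k}"
    have "ev (\<lambda>c. c) \<rho> (esym k i) = eps i"
      using ev_esym[OF assms(1) permutes_id i] by simp
    thus "Lam k \<rho> ((esym k i - mconst (eps i)) * r i) = 0"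
      by (simp add: Lam_sym_mult[OF e r(2)] ev_simps)
  qed
  finally show ?thesis by simp
qed

text \<open>Below degree \<open>k\<close> the difference of the coefficients is, up to sign, a
  generator of the ideal; from \<open>k\<close> on both coefficients are the same constant.\<close>

lemma coeff_wpoly_gideal:
  assumes "subring R" "roots_of k eps \<rho>"
  shows "coeff (\<Prod>i<k. [:- mvar i, 1:]) j - mconst (coeff (\<Prod>i<k. [:- \<rho> i, 1:]) j) \<in> gideal R k eps"
proof (cases "j < k")
  case True
  define i where "i = k - j"
  have i: "i \<in> {1..k}" "j = k - i" using True by (auto simp: i_def)
  have "coeff (\<Prod>i<k. [:- \<rho> i, 1:]) j = (- 1) ^ i * eps i"
    using assms(2) i by (simp add: roots_of_def)
  moreover have "coeff (\<Prod>i<k. [:- mvar i, 1:]) j = (- 1) ^ i * esym k i"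
    using i by (simp add: coeff_wpoly)
  ultimately have "coeff (\<Prod>i<k. [:- mvar i, 1:]) j - mconst (coeff (\<Prod>i<k. [:- \<rho> i, 1:]) j)
      = (- 1) ^ i * (esym k i - mconst (eps i))"
    by (simp add: mconst_mult mconst_power mconst_uminus mconst_1 algebra_simps)
  also have "\<dots> \<in> gideal R k eps"
    by (intro gideal_mult gideal_gen assms i subringD(8)[OF assms(1)] subringD(6)[OF assms(1)] subringD(2)[OF assms(1)])
  finally show ?thesis .
next
  case False
  hence "j = k \<or> j > k" by auto
  hence "coeff (\<Prod>i<k. [:- mvar i, 1:]) j = mconst (coeff (\<Prod>i<k. [:- \<rho> i, 1:]) j)"
    using coeff_prod_linear_card[of "{..<k}" mvar] coeff_prod_linear_card[of "{..<k}" \<rho>]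
    by (auto simp: mconst_1 coeff_eq_0 degree_prod_linear)
  thus ?thesis using gideal_0[OF assms(1)] by simp
qed

text \<open>The symmetric polynomials congruent to constants form a subring containing the
  elementary ones, hence all of them; evaluation at the roots kills the ideal and identifies the
  constant.\<close>

lemma sym_const:
  assumes "roots_of k eps \<rho>" "s \<in> inv_ring k k" "l \<le> k"
  shows "s - mconst (ev (\<lambda>c. c) \<rho> s) \<in> gen_ideal k l eps"
proof -
  let ?I = "gideal (inv_ring k k) k eps"
  define R where "R = {p \<in> inv_ring k k. \<exists>c. p - mconst c \<in> ?I}"
  have R: "subring R" unfolding subring_def
  proof safe
    fix c show "mconst c \<in> R" unfolding R_def
      using gideal_0[OF subring_inv_ring, of k k k eps] by (auto intro!: exI[of _ c])
  next
    fix p q assume "p \<in> R" "q \<in> R"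
    then obtain c d where pq: "p \<in> inv_ring k k" "p - mconst c \<in> ?I" "q \<in> inv_ring k k" "q - mconst d \<in> ?I"
      by (auto simp: R_def)
    have "p + q - mconst (c + d) = (p - mconst c) + (q - mconst d)" by (simp add: mconst_add)
    also have "\<dots> \<in> ?I" by (intro gideal_add pq subring_inv_ring)
    finally show "p + q \<in> R" using pq unfolding R_def by blast
    have "p * q - mconst (c * d) = q * (p - mconst c) + mconst c * (q - mconst d)" by (simp add: mconst_mult algebra_simps)
    also have "\<dots> \<in> ?I" by (intro gideal_add gideal_mult pq subring_inv_ring inv_ring_closed)
    finally show "p * q \<in> R" using pq unfolding R_def by blast
  qed
  have cR: "coeff (\<Prod>i<k. [:- mvar i, 1:]) j \<in> R" for j
  proof -
    have "coeff (\<Prod>i<k. [:- mvar i, 1:]) j \<in> inv_ring k k"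
    proof (cases "j \<le> k")
      case True
      hence eq: "coeff (\<Prod>i<k. [:- mvar i, 1:]) j = (- 1) ^ (k - j) * esym k (k - j)"
        using coeff_wpoly[of "k - j" k] by (simp only: diff_le_self diff_diff_cancel True_implies_equals)
      show ?thesis unfolding eq
        by (rule inv_ring_closed(2)[OF inv_ring_closed(8)[OF inv_ring_closed(4)[OF inv_ring_closed(6)]] esym_inv_ring])
    next
      case False
      hence "coeff (\<Prod>i<k. [:- mvar i, 1:]) j = 0" by (simp add: coeff_eq_0 degree_prod_linear)
      thus ?thesis by (simp only: inv_ring_closed(7))
    qed
    with coeff_wpoly_gideal[OF subring_inv_ring[of k k] assms(1), of j] show ?thesis
      unfolding R_def by (intro CollectI conjI exI)
  qed
  have ps: "psum {..<k} m \<in> R" for m by (rule psum_in_subring[OF R finite_lessThan cR])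
  \<comment> \<open>\<open>inv_ring_generated\<close> is applied with both block parameters equal to
    \<open>k\<close>, so the second block is empty.\<close>
  have ps': "psum {k..<k} m \<in> R" for m using subringD(3)[OF R] by (simp add: psum_def)
  have "s \<in> R" by (rule inv_ring_generated[OF R le_refl ps ps' assms(2)])
  then obtain c where c: "s - mconst c \<in> ?I" by (auto simp: R_def)
  hence "ev (\<lambda>c. c) \<rho> (s - mconst c) = 0"
    using ev_gideal[OF assms(1) permutes_id] by simp
  hence "c = ev (\<lambda>c. c) \<rho> s" by (simp add: ev_simps)
  with c gideal_mono[OF inv_ring_mono[OF assms(3)], of k eps] show ?thesis by (auto simp: gen_ideal_eq)
qed

lemma hom_coeff_prod_linear:
  fixes h :: "'a::comm_ring_1 \<Rightarrow> 'b::idom"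
  assumes h: "h 0 = 0" "\<And>a b. h (a + b) = h a + h b" "\<And>a b. h (a * b) = h a * h b" "h 1 = 1"
    and "finite P"
  shows "h (coeff (\<Prod>x\<in>P. [:- g x, 1:]) j) = coeff (\<Prod>x\<in>P. [:- h (g x), 1:]) j"
proof -
  have hm: "h (- a) = - h a" for a using h(2)[of a "- a"] h(1) by (simp add: eq_neg_iff_add_eq_0 add.commute)
  have hd: "h (a - b) = h a - h b" for a b using h(2)[of a "- b"] hm by simp
  show ?thesis using assms(5)
  proof (induction P arbitrary: j rule: finite_induct)
    case empty
    show ?case by (auto simp: h(1,4) coeff_1 split: if_splits)
  next
    case (insert x P)
    thus ?case by (auto simp: coeff_pCons h hm hd split: nat.splits)
  qed
qed

lemma prod_diff_mconst_expand:
  assumes "finite A"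
  shows "(\<Prod>x\<in>A. p - mconst (e x)) = (\<Sum>j\<le>card A. mconst (coeff (\<Prod>x\<in>A. [:- e x, 1:]) j) * p ^ j)"
proof -
  define q where "q = (\<Prod>x\<in>A. [:- mconst (e x), 1:])"
  have "degree q = card A" unfolding q_def by (rule degree_prod_linear[OF assms])
  moreover have "coeff q j = mconst (coeff (\<Prod>x\<in>A. [:- e x, 1:]) j)" for j
    unfolding q_def by (rule hom_coeff_prod_linear[symmetric]) (simp_all add: assms mconst_add mconst_mult mconst_1)
  moreover have "poly q p = (\<Prod>x\<in>A. p - mconst (e x))"
    unfolding q_def poly_prod by simp
  ultimately show ?thesis by (simp add: poly_altdef)
qed

text \<open>The orbit polynomial of \<open>p\<close> under S_k has symmetric coefficients and
  vanishes at \<open>p\<close>, the identity being one of the permutations. Modulo the ideal its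
  coefficients become those of the polynomial whose roots are the values of \<open>p\<close> at the
  permuted \<rho>. The product thus plays the part of a characteristic polynomial of multiplication
  by \<open>p\<close>.\<close>

lemma resolvent:
  assumes "roots_of k eps \<rho>" "p \<in> inv_ring k l" "l \<le> k"
  shows "(\<Prod>\<pi> | \<pi> permutes {..<k}. p - mconst (ev (\<lambda>c. c) (\<lambda>i. \<rho> (\<pi> i)) p)) \<in> gen_ideal k l eps"
proof -
  let ?P = "{\<pi>. \<pi> permutes {..<k}}"
  define T where "T = (\<Prod>\<pi>\<in>?P. [:- rename \<pi> p, 1:])"
  define T0 where "T0 = (\<Prod>\<pi>\<in>?P. [:- ev (\<lambda>c. c) (\<lambda>i. \<rho> (\<pi> i)) p, 1:])"
  have fin: "finite ?P" by (simp add: finite_permutations)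
  have tr: "trunc k p = p" using assms(2) by (simp add: inv_ring_iff)
  note coeffT = hom_coeff_prod_linear[OF _ _ _ _ fin, of _ "\<lambda>\<pi>. rename \<pi> p", folded T_def]
  have inv: "coeff T j \<in> inv_ring k k" for j
  proof -
    have "trunc k (coeff T j) = coeff T j"
      by (subst coeffT) (auto simp: T_def tr trunc_rename intro!: prod.cong arg_cong[where f="\<lambda>x. coeff x j"])
    moreover have "rename \<sigma> (coeff T j) = coeff T j" if \<sigma>: "\<sigma> permutes {..<k}" for \<sigma>
    proof -
      have "inj_on ((\<circ>) \<sigma>) ?P"
        using permutes_inj[OF \<sigma>] by (auto simp: inj_on_def fun_eq_iff dest: injD)
      moreover have "(\<circ>) \<sigma> ` ?P = ?P"
        using image_compose_permutations_left[OF \<sigma>] by (auto simp: image_def)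
      ultimately have bij: "bij_betw ((\<circ>) \<sigma>) ?P ?P" by (simp add: bij_betw_def)
      have "rename \<sigma> (coeff T j) = coeff (\<Prod>\<pi>\<in>?P. [:- rename (\<sigma> \<circ> \<pi>) p, 1:]) j"
        by (subst coeffT) (auto simp: rename_rename)
      also have "(\<Prod>\<pi>\<in>?P. [:- rename (\<sigma> \<circ> \<pi>) p, 1:]) = T"
        unfolding T_def by (rule prod.reindex_bij_betw[OF bij])
      finally show ?thesis .
    qed
    ultimately show ?thesis by (simp add: inv_ring_k_iff)
  qed
  have evT: "ev (\<lambda>c. c) \<rho> (coeff T j) = coeff T0 j" for j
    by (subst coeffT) (auto simp: T0_def ev_simps ev_rename)
  have "poly T p = 0"
  proof -
    have "poly T p = (\<Prod>\<pi>\<in>?P. p - rename \<pi> p)" by (simp add: T_def poly_prod)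
    also have "\<dots> = 0" by (rule prod_zero[OF fin bexI[of _ id]]) (simp_all add: permutes_id)
    finally show ?thesis .
  qed
  define N where "N = card ?P"
  have deg: "degree T = N" "degree T0 = N" using fin by (simp_all add: T_def T0_def N_def degree_prod_linear)
  have "(\<Prod>\<pi>\<in>?P. p - mconst (ev (\<lambda>c. c) (\<lambda>i. \<rho> (\<pi> i)) p)) = (\<Sum>j\<le>N. mconst (coeff T0 j) * p ^ j)"
    unfolding N_def T0_def by (rule prod_diff_mconst_expand[OF fin])
  also have "\<dots> = (\<Sum>j\<le>N. mconst (coeff T0 j) * p ^ j) - poly T p" by (simp add: \<open>poly T p = 0\<close>)
  also have "\<dots> = (\<Sum>j\<le>N. p ^ j * - (coeff T j - mconst (coeff T0 j)))"
    unfolding poly_altdef deg sum_subtractf[symmetric] by (intro sum.cong refl) (simp add: algebra_simps)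
  also have "\<dots> \<in> gideal (inv_ring k l) k eps"
  proof (intro gideal_sum gideal_mult gideal_uminus subring_inv_ring)
    show "p ^ j \<in> inv_ring k l" for j using assms(2) by auto
    show "coeff T j - mconst (coeff T0 j) \<in> gideal (inv_ring k l) k eps" for j
      using sym_const[OF assms(1) inv[of j] assms(3)] by (simp add: evT gen_ideal_eq)
  qed
  finally show ?thesis unfolding gen_ideal_eq .
qed

section \<open>Wedge products and the transfer operator\<close>

abbreviation wv :: "(nat \<Rightarrow> 'a) \<Rightarrow> (nat \<Rightarrow> 'a) \<Rightarrow> nat \<Rightarrow> 'a \<Rightarrow> (nat set \<Rightarrow> 'a) \<Rightarrow> nat set \<Rightarrow> 'a::comm_ring_1" where
  "wv P Q k w \<equiv> wg (\<lambda>s. w + P s) (\<lambda>s. w + Q s) k"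

definition Gl :: "(nat \<Rightarrow> 'a) \<Rightarrow> (nat \<Rightarrow> 'a) \<Rightarrow> nat \<Rightarrow> (nat set \<Rightarrow> 'a) \<Rightarrow> 'a list \<Rightarrow> nat set \<Rightarrow> 'a::comm_ring_1" where
  "Gl P Q k u ws = foldr (wv P Q k) ws u"

definition delta :: "nat set \<Rightarrow> nat set \<Rightarrow> 'a::comm_ring_1" where
  "delta S = (\<lambda>R. if R = S then 1 else 0)"

abbreviation vac :: "nat set \<Rightarrow> 'a::comm_ring_1" where "vac \<equiv> delta {}"

lemma Gl_simps [simp]: "Gl P Q k u [] = u" "Gl P Q k u (w # ws) = wv P Q k w (Gl P Q k u ws)"
  "Gl P Q k u (ws @ ws') = Gl P Q k (Gl P Q k u ws') ws"
  by (simp_all add: Gl_def)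

lemma wg_sum: "finite X \<Longrightarrow> wg p q k (\<lambda>S. \<Sum>x\<in>X. c x * u x S) S = (\<Sum>x\<in>X. c x * wg p q k (u x) S)"
proof (induction X rule: finite_induct)
  case (insert x X)
  then show ?case
    using wg_lin[of p q k "c x" "u x" 1 "\<lambda>S. \<Sum>x\<in>X. c x * u x S" S] by simp
qed simp

lemma wg_cmult: "wg p q k (\<lambda>S. c * u S) S = c * wg p q k u S"
  using wg_lin[of p q k c u 0 u S] by simp

lemma wg_add: "wg p q k (\<lambda>S. u S + v S) S = wg p q k u S + wg p q k v S"
  using wg_lin[of p q k 1 u 1 v S] by simp

lemma opT_cmult: "opT p q e k i j (\<lambda>S. c * u S) S = c * opT p q e k i j u S"
  using opT_lin[of p q e k i j c u 0 u S] by simp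

lemma wg_support:
  "wg p q k u S \<noteq> 0 \<Longrightarrow> \<exists>s\<in>S. s < k \<and> u (S - {s}) \<noteq> 0"
proof (induction k)
  case (Suc k)
  show ?case
  proof (cases "wg p q k u S = 0")
    case True
    hence "k \<in> S" "u (S - {k}) \<noteq> 0" using Suc.prems by (auto split: if_splits)
    thus ?thesis by (intro bexI[of _ k]) auto
  next
    case False
    with Suc.IH show ?thesis by (auto intro: less_SucI)
  qed
qed simp

lemma Gl_support:
  assumes "Gl P Q k (delta R) ws S \<noteq> 0" "R \<subseteq> {..<k}"
  shows "S \<subseteq> {..<k} \<and> card S = card R + length ws"
  using assms
proof (induction ws arbitrary: S)
  case Nil
  thus ?case by (auto simp: delta_def split: if_splits)
next
  case (Cons w ws)
  from Cons.prems(1) obtain s where s: "s \<in> S" "s < k" "Gl P Q k (delta R) ws (S - {s}) \<noteq> 0"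
    by (auto dest: wg_support)
  from Cons.IH[OF s(3) Cons.prems(2)] have "S - {s} \<subseteq> {..<k}" "card (S - {s}) = card R + length ws" by auto
  moreover have "S = insert s (S - {s})" "finite S" using s calculation
    by (auto intro: finite_subset[of _ "insert s {..<k}"])
  ultimately show ?case using s by (metis (no_types) card_Suc_Diff1 add_Suc_right length_Cons insert_subset lessThan_iff)
qed

lemma Gl_sum: "finite X \<Longrightarrow> Gl P Q k (\<lambda>S. \<Sum>x\<in>X. c x * u x S) ws S = (\<Sum>x\<in>X. c x * Gl P Q k (u x) ws S)"
proof (induction ws arbitrary: S)
  case (Cons w ws)
  have "Gl P Q k (\<lambda>S. \<Sum>x\<in>X. c x * u x S) ws = (\<lambda>S. \<Sum>x\<in>X. c x * Gl P Q k (u x) ws S)"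
    using Cons by auto
  thus ?case using Cons.prems by (simp add: wg_sum)
qed simp

lemma Gl_uminus: "Gl P Q k (\<lambda>S. - u S) ws S = - Gl P Q k u ws S"
  using Gl_sum[of "{0::nat}" P Q k "\<lambda>_. - 1" "\<lambda>_. u" ws S] by simp

lemma Gl_move: "wv P Q k w (Gl P Q k u ws) S = (- 1) ^ length ws * Gl P Q k (wv P Q k w u) ws S"
proof (induction ws arbitrary: S)
  case (Cons a ws)
  have "wv P Q k w (Gl P Q k u (a # ws)) S = - wv P Q k a (wv P Q k w (Gl P Q k u ws)) S"
    unfolding Gl_simps by (rule wg_anticomm)
  also have "wv P Q k w (Gl P Q k u ws) = (\<lambda>S. (- 1) ^ length ws * Gl P Q k (wv P Q k w u) ws S)"
    using Cons by auto
  finally show ?case by (simp add: wg_cmult)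
qed simp

lemma Gl_swap: "Gl P Q k u (xs @ a # ys @ b # zs) S = - Gl P Q k u (xs @ b # ys @ a # zs) S"
proof -
  let ?z = "Gl P Q k u zs" and ?v = "wv P Q k"
  have "Gl P Q k (?v b ?z) ys = (\<lambda>S. (- 1) ^ length ys * ?v b (Gl P Q k ?z ys) S)" for b
    by (simp add: Gl_move fun_eq_iff)
  hence "?v a (Gl P Q k (?v b ?z) ys) R = - ?v b (Gl P Q k (?v a ?z) ys) R" for R
    by (simp add: wg_cmult wg_anticomm[of "\<lambda>s. a + P s" "\<lambda>s. a + Q s" k "\<lambda>s. b + P s" "\<lambda>s. b + Q s"])
  hence "?v a (Gl P Q k (?v b ?z) ys) = (\<lambda>R. - ?v b (Gl P Q k (?v a ?z) ys) R)" by auto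
  thus ?thesis by (simp add: Gl_uminus)
qed

lemma Gl_transpose:
  assumes "distinct ns" "a \<in> set ns" "b \<in> set ns" "a \<noteq> b"
  shows "Gl P Q k u (map (\<lambda>x. w (transpose a b x)) ns) S = - Gl P Q k u (map w ns) S"
proof -
  have *: "Gl P Q k u (map (\<lambda>x. w (transpose a b x)) ns) S = - Gl P Q k u (map w ns) S"
    if ns: "ns = xs @ a # ys @ b # zs" for a b xs ys zs
  proof -
    have "map (\<lambda>x. w (transpose a b x)) xs = map w xs"
      "map (\<lambda>x. w (transpose a b x)) ys = map w ys"
      "map (\<lambda>x. w (transpose a b x)) zs = map w zs"
      using assms(1) ns by (auto simp: transpose_def)
    hence "map (\<lambda>x. w (transpose a b x)) ns = map w xs @ w b # map w ys @ w a # map w zs"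
      "map w ns = map w xs @ w a # map w ys @ w b # map w zs"
      unfolding ns by simp_all
    thus ?thesis using Gl_swap[of P Q k u "map w xs" "w a" "map w ys" "w b" "map w zs" S] by (simp only: minus_minus)
  qed
  obtain xs rest where ns: "ns = xs @ a # rest" using assms(2) by (meson split_list)
  show ?thesis
  proof (cases "b \<in> set rest")
    case True
    then obtain ys zs where "rest = ys @ b # zs" by (meson split_list)
    thus ?thesis using ns by (intro *[of xs a ys b zs]) simp
  next
    case False
    hence "b \<in> set xs" using assms(3,4) ns by auto
    then obtain ys zs where "xs = ys @ b # zs" by (meson split_list)
    hence "Gl P Q k u (map (\<lambda>x. w (transpose b a x)) ns) S = - Gl P Q k u (map w ns) S"
      using ns by (intro *[of ys b zs a rest]) simp
    thus ?thesis by (simp only: transpose_commute)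
  qed
qed

text \<open>Exchanging the two equal entries changes the sign, so twice the wedge vanishes;
  characteristic zero enters here.\<close>

lemma Gl_repeat:
  fixes P :: "nat \<Rightarrow> 'a::{idom,ring_char_0}"
  assumes "\<not> distinct ws"
  shows "Gl P Q k u ws S = 0"
proof -
  obtain xs ys zs y where "ws = xs @ [y] @ ys @ [y] @ zs"
    using not_distinct_decomp[OF assms] by blast
  hence "ws = xs @ y # ys @ y # zs" by simp
  thus ?thesis using Gl_swap[of P Q k u xs y ys y zs S] by simp
qed

section \<open>Components of the wedge and contraction by covectors\<close>

lemma wg_expand:
  "wg p q k u S = (\<Sum>s\<in>{s\<in>S. s < k}. sg s S * (- (\<Prod>t<s. q t) * (\<Prod>t\<in>{s<..<k}. p t)) * u (S - {s}))"
proof (induction k)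
  case (Suc k)
  let ?c = "\<lambda>k s. - (\<Prod>t<s. q t) * (\<Prod>t\<in>{s<..<k}. p t)"
  have c: "prod p {s<..<Suc k} = p k * prod p {s<..<k}" if "s < k" for s
  proof -
    have "{s<..<Suc k} = insert k {s<..<k}" using that by auto
    thus ?thesis by simp
  qed
  have fin: "finite {s\<in>S. s < k}" by (rule finite_subset[of _ "{..<k}"]) auto
  have "(\<Sum>s\<in>{s\<in>S. s < k}. sg s S * ?c (Suc k) s * u (S - {s})) = p k * wg p q k u S"
    unfolding Suc sum_distrib_left by (intro sum.cong refl) (auto simp: c mult_ac)
  moreover have "{s\<in>S. s < Suc k} = (if k \<in> S then insert k {s\<in>S. s < k} else {s\<in>S. s < k})"
    by (auto simp: less_Suc_eq)
  moreover have "{k<..<Suc k} = {}" by auto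
  ultimately show ?case using fin by (auto simp: mult_ac)
qed simp

text \<open>The components of v(w) from \<open>wg_expand\<close>, by position \<open>s\<close>; for
  s < k each is a polynomial of degree k - 1 in w.\<close>

definition chi :: "(nat \<Rightarrow> 'a) \<Rightarrow> (nat \<Rightarrow> 'a) \<Rightarrow> nat \<Rightarrow> 'a \<Rightarrow> nat \<Rightarrow> 'a::comm_ring_1" where
  "chi P Q k w s = - (\<Prod>t<s. w + Q t) * (\<Prod>t\<in>{s<..<k}. w + P t)"

definition ct :: "nat \<Rightarrow> (nat \<Rightarrow> 'a) \<Rightarrow> (nat set \<Rightarrow> 'a) \<Rightarrow> nat set \<Rightarrow> 'a::comm_ring_1" where
  "ct k \<theta> u S = (\<Sum>s\<in>{..<k} - S. sg s S * \<theta> s * u (insert s S))"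

text \<open>Contraction with a covector is an antiderivation. The terms in which the contracted
  position is the created one add up, over both orders, to the pairing of \<theta> with v(w); the
  remaining terms of the two orders cancel because their Jordan-Wigner signs are opposite.\<close>

lemma ct_wv:
  assumes "S \<subseteq> {..<k}"
  shows "ct k \<theta> (wv P Q k w u) S = (\<Sum>s<k. \<theta> s * chi P Q k w s) * u S - wv P Q k w (ct k \<theta> u) S"
proof -
  let ?x = "chi P Q k w"
  let ?C = "{..<k} - S"
  have wvS: "wv P Q k w u R = (\<Sum>s\<in>R. sg s R * ?x s * u (R - {s}))" if "R \<subseteq> {..<k}" for R u
  proof -
    have "{s\<in>R. s < k} = R" using that by auto
    thus ?thesis unfolding wg_expand chi_def by simp
  qed
  have fin: "finite S" using assms by (rule finite_subset) simp
  let ?D = "\<lambda>s r. sg s S * \<theta> s * (sg r (insert s S) * ?x r * u (insert s (S - {r})))"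
  have "ct k \<theta> (wv P Q k w u) S = (\<Sum>s\<in>?C. \<theta> s * ?x s * u S + (\<Sum>r\<in>S. ?D s r))"
    unfolding ct_def
  proof (intro sum.cong refl)
    fix s assume s: "s \<in> ?C"
    hence sub: "insert s S \<subseteq> {..<k}" "s \<notin> S" using assms by auto
    have ins: "insert s S - {r} = insert s (S - {r})" if "r \<in> S" for r using that sub by auto
    have "wv P Q k w u (insert s S) = sg s (insert s S) * ?x s * u (insert s S - {s}) + (\<Sum>r\<in>S. sg r (insert s S) * ?x r * u (insert s S - {r}))"
      unfolding wvS[OF sub(1)] by (rule sum.insert[OF fin sub(2)])
    also have "insert s S - {s} = S" using sub by auto
    also have "sg s (insert s S) = (sg s S :: 'a)" by simp
    also have "(\<Sum>r\<in>S. sg r (insert s S) * ?x r * u (insert s S - {r})) = (\<Sum>r\<in>S. sg r (insert s S) * ?x r * u (insert s (S - {r})))"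
      by (intro sum.cong refl) (simp add: ins)
    finally have "sg s S * \<theta> s * wv P Q k w u (insert s S) = sg s S * \<theta> s * (sg s S * ?x s * u S + (\<Sum>r\<in>S. sg r (insert s S) * ?x r * u (insert s (S - {r}))))"
      by (simp only:)
    also have "\<dots> = (sg s S * sg s S) * (\<theta> s * ?x s * u S) + (\<Sum>r\<in>S. ?D s r)"
      by (simp only: distrib_left sum_distrib_left mult_ac)
    finally show "sg s S * \<theta> s * wv P Q k w u (insert s S) = \<theta> s * ?x s * u S + (\<Sum>r\<in>S. ?D s r)" by simp
  qed
  hence 1: "ct k \<theta> (wv P Q k w u) S = (\<Sum>s\<in>?C. \<theta> s * ?x s * u S) + (\<Sum>s\<in>?C. \<Sum>r\<in>S. ?D s r)"
    by (simp add: sum.distrib)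
  let ?E = "\<lambda>r s. sg r S * ?x r * (sg s (S - {r}) * \<theta> s * u (insert s (S - {r})))"
  have "wv P Q k w (ct k \<theta> u) S = (\<Sum>r\<in>S. \<theta> r * ?x r * u S + (\<Sum>s\<in>?C. ?E r s))"
    unfolding wvS[OF assms]
  proof (intro sum.cong refl)
    fix r assume r: "r \<in> S"
    have set: "{..<k} - (S - {r}) = insert r ?C" using r assms by auto
    have "ct k \<theta> u (S - {r}) = sg r (S - {r}) * \<theta> r * u (insert r (S - {r})) + (\<Sum>s\<in>?C. sg s (S - {r}) * \<theta> s * u (insert s (S - {r})))"
      unfolding ct_def set by (rule sum.insert) (use r in auto)
    also have "insert r (S - {r}) = S" using r by auto
    also have "sg r (S - {r}) = (sg r S :: 'a)" by simp
    finally have "sg r S * ?x r * ct k \<theta> u (S - {r}) = sg r S * ?x r * (sg r S * \<theta> r * u S + (\<Sum>s\<in>?C. sg s (S - {r}) * \<theta> s * u (insert s (S - {r}))))"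
      by (simp only:)
    also have "\<dots> = (sg r S * sg r S) * (\<theta> r * ?x r * u S) + (\<Sum>s\<in>?C. ?E r s)"
      by (simp only: distrib_left sum_distrib_left mult_ac)
    finally show "sg r S * ?x r * ct k \<theta> u (S - {r}) = \<theta> r * ?x r * u S + (\<Sum>s\<in>?C. ?E r s)" by simp
  qed
  hence 2: "wv P Q k w (ct k \<theta> u) S = (\<Sum>r\<in>S. \<theta> r * ?x r * u S) + (\<Sum>s\<in>?C. \<Sum>r\<in>S. ?E r s)"
    by (simp add: sum.distrib sum.swap[of _ ?C])
  have "?D s r = - ?E r s" if "s \<in> ?C" "r \<in> S" for s r
  proof -
    have "sg s S * sg r (insert s S) = - (sg r S * sg s (S - {r}) :: 'a)"
    proof (cases "r < s")
      case True
      thus ?thesis using that by (simp add: sg_Diff_less mult.commute)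
    next
      case False
      hence "s < r" using that by (metis DiffD2 linorder_neqE_nat)
      thus ?thesis using that by (simp add: sg_insert_less mult.commute)
    qed
    hence "(sg s S * sg r (insert s S)) * (\<theta> s * ?x r * u (insert s (S - {r}))) = - ((sg r S * sg s (S - {r})) * (\<theta> s * ?x r * u (insert s (S - {r}))))"
      by simp
    thus ?thesis by (simp only: mult_ac)
  qed
  hence "(\<Sum>s\<in>?C. \<Sum>r\<in>S. ?D s r) = (\<Sum>s\<in>?C. \<Sum>r\<in>S. - ?E r s)" by (intro sum.cong refl) auto
  hence 3: "(\<Sum>s\<in>?C. \<Sum>r\<in>S. ?D s r) = - (\<Sum>s\<in>?C. \<Sum>r\<in>S. ?E r s)" by (simp add: sum_negf)
  have "(\<Sum>s<k. \<theta> s * ?x s) = (\<Sum>s\<in>?C. \<theta> s * ?x s) + (\<Sum>s\<in>S. \<theta> s * ?x s)"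
    using assms by (intro sum.subset_diff) auto
  hence 4: "(\<Sum>s<k. \<theta> s * ?x s) * u S = (\<Sum>s\<in>?C. \<theta> s * ?x s * u S) + (\<Sum>s\<in>S. \<theta> s * ?x s * u S)"
    by (simp add: distrib_right sum_distrib_right)
  show ?thesis unfolding 1 2 3 4 by simp
qed

lemma wg_hom:
  assumes "h 0 = 0" "h 1 = 1" "\<And>a b. h (a + b) = h a + h b" "\<And>a b. h (a * b) = h a * h b"
  shows "h (wg p q k u S) = wg (\<lambda>s. h (p s)) (\<lambda>s. h (q s)) k (\<lambda>S. h (u S)) S"
proof -
  have hm: "h (- a) = - h a" for a using assms(3)[of a "- a"] assms(1) by (simp add: eq_neg_iff_add_eq_0 add.commute)
  have hd: "h (a - b) = h a - h b" for a b using assms(3)[of a "- b"] hm by simp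
  have hp: "h (a ^ n) = h a ^ n" for a n by (induction n) (auto simp: assms)
  have hprod: "h (\<Prod>s<n. q s) = (\<Prod>s<n. h (q s))" for n by (induction n) (auto simp: assms)
  have hs: "h (sg k S) = sg k S" for k S by (simp add: sg_def hp hm assms(2))
  show ?thesis by (induction k) (auto simp: assms(1,3,4) hd hs hprod)
qed

lemma Gl_hom:
  assumes "h 0 = 0" "h 1 = 1" "\<And>a b. h (a + b) = h a + h b" "\<And>a b. h (a * b) = h a * h b"
  shows "h (Gl P Q k (delta R) ws S) = Gl (\<lambda>s. h (P s)) (\<lambda>s. h (Q s)) k (delta R) (map h ws) S"
proof (induction ws arbitrary: S)
  case Nil
  thus ?case by (auto simp: delta_def assms)
next
  case (Cons w ws)
  have "(\<lambda>S. h (Gl P Q k (delta R) ws S)) = Gl (\<lambda>s. h (P s)) (\<lambda>s. h (Q s)) k (delta R) (map h ws)"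
    using Cons by auto
  thus ?case by (simp add: wg_hom[of h, OF assms] assms(3))
qed

lemma opT_hom:
  assumes "h 0 = 0" "h 1 = 1" "\<And>a b. h (a + b) = h a + h b" "\<And>a b. h (a * b) = h a * h b"
  shows "h (opT p q e k i j u S) = opT (\<lambda>s. h (p s)) (\<lambda>s. h (q s)) (\<lambda>s. h (e s)) k i j (\<lambda>S. h (u S)) S"
proof -
  have hm: "h (- a) = - h a" for a using assms(3)[of a "- a"] assms(1) by (simp add: eq_neg_iff_add_eq_0 add.commute)
  have hd: "h (a - b) = h a - h b" for a b using assms(3)[of a "- b"] hm by simp
  have hp: "h (a ^ n) = h a ^ n" for a n by (induction n) (auto simp: assms)
  have hs: "h (sg k S) = sg k S" for k S by (simp add: sg_def hp hm assms(2))
  show ?thesis by (induction k arbitrary: i S) (auto simp: assms hd hs hp hm)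
qed

section \<open>The transfer operator on off-shell Bethe vectors\<close>

lemma opT_vac_zero: "S - {..<k} \<noteq> {} \<Longrightarrow> opT p q e k i j vac S = 0"
proof -
  assume "S - {..<k} \<noteq> {}"
  hence "opT p q e k i j vac S = opT p q e k i j (\<lambda>S. 0) S"
    by (intro opT_cong) (auto simp: delta_def)
  thus ?thesis by simp
qed

lemma opT_vac:
  "opT p q e k 0 0 vac S = (\<Prod>s<k. p s) * vac S" "opT p q e k 1 0 vac S = 0"
  "opT p q e k 1 1 vac S = (\<Prod>s<k. q s) * vac S"
proof (induction k arbitrary: S)
  case (Suc k)
  have z: "k \<in> S \<Longrightarrow> vac S = (0::'a)" for S :: "nat set" by (auto simp: delta_def)
  have z': "opT p q e k 0 1 vac (insert k S) = 0" for S by (rule opT_vac_zero) auto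
  { case 1 show ?case using Suc z by auto }
  { case 2 show ?case using Suc z by auto }
  { case 3 show ?case using Suc z z' by auto }
qed (auto simp: delta_def)

definition tauop :: "'a \<Rightarrow> 'a \<Rightarrow> (nat \<Rightarrow> 'a) \<Rightarrow> (nat \<Rightarrow> 'a) \<Rightarrow> nat \<Rightarrow> 'a \<Rightarrow> (nat set \<Rightarrow> 'a) \<Rightarrow> nat set \<Rightarrow> 'a::comm_ring_1" where
  "tauop q1 q2 P Q k t u S = q1 * opT (\<lambda>s. t + P s) (\<lambda>s. t + Q s) (\<lambda>_. 1) k 0 0 u S
     - q2 * opT (\<lambda>s. t + P s) (\<lambda>s. t + Q s) (\<lambda>_. 1) k 1 1 u S"

definition Fval :: "'a \<Rightarrow> 'a \<Rightarrow> (nat \<Rightarrow> 'a) \<Rightarrow> (nat \<Rightarrow> 'a) \<Rightarrow> nat \<Rightarrow> 'a \<Rightarrow> 'a::comm_ring_1" where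
  "Fval q1 q2 P Q k t = q1 * (\<Prod>s<k. t + P s) - q2 * (\<Prod>s<k. t + Q s)"

lemma wg_ideal:
  assumes "0 \<in> J" "\<And>a b. a \<in> J \<Longrightarrow> b \<in> J \<Longrightarrow> a - b \<in> J" "\<And>a b. b \<in> J \<Longrightarrow> a * b \<in> J" "\<And>S. u S \<in> J"
  shows "wg p q k u S \<in> J"
  by (induction k) (auto intro: assms)

text \<open>Induction on the creating parameters. Moving the transfer operator past v(w) yields the
  factor (t - w - 1)/(t - w) and one unwanted term proportional to the Bethe polynomial at w;
  \<open>J\<close> is any ideal containing these values, and the wedge preserves it. Denominators
  are cleared throughout since t - w need not be invertible.\<close>

lemma tauop_Gl_mod:
  fixes t :: "'a::idom"
  assumes J: "0 \<in> J" "\<And>a b. a \<in> J \<Longrightarrow> b \<in> J \<Longrightarrow> a - b \<in> J" "\<And>a b. b \<in> J \<Longrightarrow> a * b \<in> J"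
    and "\<And>w. w \<in> set ws \<Longrightarrow> Fval q1 q2 P Q k w \<in> J"
  shows "(\<Prod>w\<leftarrow>ws. t - w) * tauop q1 q2 P Q k t (Gl P Q k vac ws) S
      - Fval q1 q2 P Q k t * (\<Prod>w\<leftarrow>ws. t - w - 1) * Gl P Q k vac ws S \<in> J"
  using assms(4)
proof (induction ws arbitrary: S)
  case Nil
  thus ?case using J(1) by (simp add: tauop_def Fval_def opT_vac[simplified] algebra_simps)
next
  case (Cons w ws)
  let ?T = "opT (\<lambda>s. t + P s) (\<lambda>s. t + Q s) (\<lambda>_. 1) k" and ?v = "wv P Q k w" and ?G = "Gl P Q k vac ws"
  let ?tau = "tauop q1 q2 P Q k t" and ?d = "t - w"
  have Jadd: "a + b \<in> J" if "a \<in> J" "b \<in> J" for a b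
    using J(2)[OF that(1) J(2)[OF J(1) that(2)]] by simp
  have pq: "t + P s = w + P s + ?d" "t + Q s = w + Q s + ?d" for s by simp_all
  note rel = fermion_relations(2,3)[of "\<lambda>s. t + P s" "\<lambda>s. w + P s" ?d "\<lambda>s. t + Q s" "\<lambda>s. w + Q s" k ?G S, OF pq]
  have "?tau ?G = (\<lambda>S. q1 * ?T 0 0 ?G S + (- q2) * ?T 1 1 ?G S)"
    by (auto simp: tauop_def)
  hence vtau: "?v (?tau ?G) S = q1 * ?v (?T 0 0 ?G) S - q2 * ?v (?T 1 1 ?G) S"
    by (simp only: wg_lin) simp
  have step: "?d * ?tau (?v ?G) S = (?d - 1) * ?v (?tau ?G) S + Fval q1 q2 P Q k w * ?T 0 1 ?G S"
    using rel unfolding vtau by (simp only: tauop_def Fval_def) algebra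
  define y where "y = (\<Prod>w\<leftarrow>ws. t - w)"
  define z where "z = Fval q1 q2 P Q k t * (\<Prod>w\<leftarrow>ws. t - w - 1)"
  \<comment> \<open>The error of the shorter Bethe vector; it lies in \<open>J\<close> by induction,
    and so does its wedge with v(w).\<close>
  define r where "r = (\<lambda>S. y * ?tau ?G S - z * ?G S)"
  have rJ: "r R \<in> J" for R using Cons.IH[of R] Cons.prems by (simp add: r_def y_def z_def)
  have vr: "?v r S \<in> J" by (rule wg_ideal[of J r, OF J rJ])
  have "r = (\<lambda>S. y * ?tau ?G S + (- z) * ?G S)" by (simp add: r_def)
  hence vr_eq: "?v r S = y * ?v (?tau ?G) S - z * ?v ?G S" by (simp only: wg_lin) simp
  have "(\<Prod>w\<leftarrow>w # ws. t - w) * ?tau (Gl P Q k vac (w # ws)) S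
      - Fval q1 q2 P Q k t * (\<Prod>w\<leftarrow>w # ws. t - w - 1) * Gl P Q k vac (w # ws) S
      = y * (?d * ?tau (?v ?G) S) - (?d - 1) * z * ?v ?G S"
    by (simp add: y_def z_def algebra_simps)
  also have "\<dots> = (?d - 1) * ?v r S + (y * ?T 0 1 ?G S) * Fval q1 q2 P Q k w"
    unfolding step vr_eq by (simp add: algebra_simps)
  also have "\<dots> \<in> J"
    using Cons.prems by (intro Jadd J(3) vr) auto
  finally show ?case .
qed

section \<open>The reproducing kernel\<close>

primrec VL :: "nat list \<Rightarrow> mpoly" where
  "VL [] = 1"
| "VL (n # ns) = (\<Prod>m\<in>set ns. mvar n - mvar m) * VL ns"

lemma VL_VA: "distinct ns \<Longrightarrow> \<exists>e. (e = 1 \<or> e = - 1) \<and> VL ns = e * VA (set ns)"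
proof (induction ns)
  case Nil
  show ?case by (intro exI[of _ 1]) (simp add: VA_def)
next
  case (Cons n ns)
  then obtain e where e: "e = 1 \<or> e = - 1" "VL ns = e * VA (set ns)" by auto
  obtain s where s: "s = 1 \<or> s = - 1" "VA (insert n (set ns)) = s * (\<Prod>m\<in>set ns. mvar n - mvar m) * VA (set ns)"
    by (rule VA_insert[of "set ns" n]) (use Cons.prems in auto)
  have ss: "s * s = 1" using s(1) by auto
  have "s * VA (set (n # ns)) = (s * s) * (\<Prod>m\<in>set ns. mvar n - mvar m) * VA (set ns)"
    using s(2) by (simp add: mult.assoc)
  hence "VL (n # ns) = e * s * VA (set (n # ns))"
    using e(2) ss by (simp add: mult.left_commute mult.assoc)
  moreover have "e * s = 1 \<or> e * s = - 1" using e(1) s(1) by auto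
  ultimately show ?case by blast
qed

lemma ct_cmult: "ct k \<theta> (\<lambda>S. c * u S) S = c * ct k \<theta> u S"
  by (simp add: ct_def sum_distrib_left mult_ac)

lemma ct_cong: "S \<subseteq> {..<k} \<Longrightarrow> (\<And>S. S \<subseteq> {..<k} \<Longrightarrow> u S = v S) \<Longrightarrow> ct k \<theta> u S = ct k \<theta> v S"
  unfolding ct_def by (intro sum.cong refl) auto

lemma wv_cong: "S \<subseteq> {..<k} \<Longrightarrow> (\<And>S. S \<subseteq> {..<k} \<Longrightarrow> u S = v S) \<Longrightarrow> wg p q k u S = wg p q k v S"
  by (rule wg_cong) auto

lemma VA_cancel: "finite A \<Longrightarrow> VA A * p = VA A * q \<Longrightarrow> p = q"
  using mult_cancel_left[of "VA A" p q] VA_nonzero[of A] by blast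

text \<open>\<open>eta j\<close> is a covector whose pairing with v(x) is x^j. Such covectors exist
  for all j < k when the k components of v(x), which have degree below k, span all polynomials of
  degree below k; this is the form in which cyclicity enters.\<close>

locale frame =
  fixes k l :: nat and P0 Q0 :: "nat \<Rightarrow> complex" and eta :: "nat \<Rightarrow> nat \<Rightarrow> complex"
    and \<rho> :: "nat \<Rightarrow> complex" and eps :: "nat \<Rightarrow> complex"
  assumes lk: "l \<le> k"
    and eta: "\<And>j x. j < k \<Longrightarrow> (\<Sum>s<k. mconst (eta j s) * chi (\<lambda>s. mconst (P0 s)) (\<lambda>s. mconst (Q0 s)) k x s) = x ^ j"
    and roots: "roots_of k eps \<rho>"
begin

abbreviation "Pm \<equiv> \<lambda>s. mconst (P0 s)"
abbreviation "Qm \<equiv> \<lambda>s. mconst (Q0 s)"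
abbreviation "G \<equiv> Gl Pm Qm k"
abbreviation "fl \<equiv> {..<k}"
abbreviation "ns \<equiv> [l..<k] @ [0..<l]"
abbreviation "W \<equiv> Wset k l"
abbreviation "II \<equiv> gideal (truncs k) k eps"
abbreviation "N \<equiv> (of_nat (card (Gp k l)) :: complex)"

text \<open>The parameters w_0, ..., w_(l-1) create from the vacuum, the others lead from the basis
  vector of \<open>S\<close> up to the full set. So \<open>Gs\<close> and \<open>Hs\<close> are
  complementary minors of one k x k determinant \<open>X\<close>, whose list \<open>ns\<close> puts
  the first block innermost.\<close>

definition Gs :: "nat set \<Rightarrow> mpoly" where "Gs S = G vac (map mvar [0..<l]) S"
definition Hs :: "nat set \<Rightarrow> mpoly" where "Hs S = G (delta S) (map mvar [l..<k]) fl"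
definition X :: mpoly where "X = G vac (map mvar ns) fl"

lemma set_ns: "set ns = fl" and distinct_ns: "distinct ns" and length_ns: "length ns = k"
  using lk by auto

lemma rename_G: "rename \<pi> (G (delta R) (map mvar xs) S) = G (delta R) (map (\<lambda>x. mvar (\<pi> x)) xs) S"
proof -
  have "rename \<pi> (G (delta R) (map mvar xs) S) = Gl (\<lambda>s. rename \<pi> (Pm s)) (\<lambda>s. rename \<pi> (Qm s)) k (delta R) (map (rename \<pi>) (map mvar xs)) S"
    by (rule Gl_hom) simp_all
  thus ?thesis by (simp add: o_def)
qed

lemma trunc_G: "set xs \<subseteq> fl \<Longrightarrow> trunc k (G (delta R) (map mvar xs) S) = G (delta R) (map mvar xs) S"
proof -
  assume xs: "set xs \<subseteq> fl"
  have "trunc k (G (delta R) (map mvar xs) S) = Gl (\<lambda>s. trunc k (Pm s)) (\<lambda>s. trunc k (Qm s)) k (delta R) (map (trunc k) (map mvar xs)) S"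
    by (rule Gl_hom) simp_all
  also have "map (trunc k) (map mvar xs) = map mvar xs" using xs by auto
  finally show ?thesis by simp
qed

lemma transpose_G:
  assumes "distinct xs" "a \<in> set xs" "b \<in> set xs" "a \<noteq> b"
  shows "rename (transpose a b) (G (delta R) (map mvar xs) S) = - G (delta R) (map mvar xs) S"
  unfolding rename_G by (rule Gl_transpose[OF assms])

lemma fix_G:
  assumes "\<And>x. x \<in> set xs \<Longrightarrow> \<pi> x = x"
  shows "rename \<pi> (G (delta R) (map mvar xs) S) = G (delta R) (map mvar xs) S"
  unfolding rename_G using assms by (metis (mono_tags, lifting) map_eq_conv)

lemma Gs_expand: "G vac (map mvar [0..<l]) = (\<lambda>R. \<Sum>S\<in>W. Gs S * delta S R)"
proof
  fix R
  show "G vac (map mvar [0..<l]) R = (\<Sum>S\<in>W. Gs S * delta S R)"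
  proof (cases "R \<in> W")
    case True
    have "(\<Sum>S\<in>W. Gs S * delta S R) = (\<Sum>S\<in>W. if S = R then Gs S else 0)"
      by (intro sum.cong refl) (auto simp: delta_def)
    thus ?thesis using True by (simp add: Gs_def)
  next
    case False
    hence "(\<Sum>S\<in>W. Gs S * delta S R) = 0" by (intro sum.neutral) (auto simp: delta_def)
    moreover have "G vac (map mvar [0..<l]) R = 0"
      using Gl_support[of Pm Qm k "{}" "map mvar [0..<l]" R] False by (auto simp: Wset_def)
    ultimately show ?thesis by simp
  qed
qed

text \<open>Laplace expansion along the two blocks of creating vectors. The outer parameters
  \<open>w\<close> stay arbitrary because \<open>reproduce\<close> inserts permuted
  variables.\<close>

lemma X_expand:
  "G vac (map w [l..<k] @ map mvar [0..<l]) fl = (\<Sum>S\<in>W. Gs S * G (delta S) (map w [l..<k]) fl)"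
  unfolding Gl_simps Gs_expand by (rule Gl_sum) simp

lemma X_eq: "X = (\<Sum>S\<in>W. Gs S * Hs S)"
  unfolding X_def Hs_def map_append by (rule X_expand)

text \<open>The combination of the covectors \<open>eta j\<close> whose pairing with v(x) is the
  monic polynomial in x with roots w_m for m in \<open>xs\<close>.\<close>

definition theta :: "nat list \<Rightarrow> nat \<Rightarrow> mpoly" where
  "theta xs s = (\<Sum>j<k. coeff (\<Prod>m\<in>set xs. [:- mvar m, 1:]) j * mconst (eta j s))"

lemma theta_chi:
  assumes "card (set xs) < k"
  shows "(\<Sum>s<k. theta xs s * chi Pm Qm k x s) = (\<Prod>m\<in>set xs. x - mvar m)"
proof -
  let ?h = "\<Prod>m\<in>set xs. [:- mvar m, 1:]"
  have "(\<Sum>s<k. theta xs s * chi Pm Qm k x s) = (\<Sum>s<k. \<Sum>j<k. coeff ?h j * (mconst (eta j s) * chi Pm Qm k x s))"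
    by (simp add: theta_def sum_distrib_right mult.assoc)
  also have "\<dots> = (\<Sum>j<k. coeff ?h j * (\<Sum>s<k. mconst (eta j s) * chi Pm Qm k x s))"
    unfolding sum_distrib_left by (rule sum.swap)
  also have "\<dots> = (\<Sum>j<k. coeff ?h j * x ^ j)" by (simp add: eta)
  also have "\<dots> = (\<Sum>j\<le>degree ?h. coeff ?h j * x ^ j)"
    by (rule sum.mono_neutral_right) (use assms in \<open>auto simp: degree_prod_linear coeff_eq_0\<close>)
  also have "\<dots> = poly ?h x" by (simp add: poly_altdef)
  also have "\<dots> = (\<Prod>m\<in>set xs. x - mvar m)" by (simp add: poly_prod)
  finally show ?thesis .
qed

primrec Phi :: "nat list \<Rightarrow> (nat set \<Rightarrow> mpoly) \<Rightarrow> mpoly" where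
  "Phi [] u = u {}"
| "Phi (n # xs) u = Phi xs (ct k (theta xs) u)"

lemma Phi_cmult: "Phi xs (\<lambda>S. c * u S) = c * Phi xs u"
proof (induction xs arbitrary: u)
  case (Cons n xs)
  have "ct k (theta xs) (\<lambda>S. c * u S) = (\<lambda>S. c * ct k (theta xs) u S)" by (rule ext) (rule ct_cmult)
  thus ?case using Cons by simp
qed simp

lemma Phi_cong: "(\<And>S. S \<subseteq> fl \<Longrightarrow> u S = v S) \<Longrightarrow> Phi xs u = Phi xs v"
proof (induction xs arbitrary: u v)
  case (Cons n xs)
  show ?case unfolding Phi.simps
    by (rule Cons.IH, rule ct_cong, assumption, rule Cons.prems)
qed simp

lemma ct_G_zero:
  assumes "\<And>x. x \<in> set xs \<Longrightarrow> (\<Sum>s<k. \<theta> s * chi Pm Qm k x s) = 0" "S \<subseteq> fl"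
  shows "ct k \<theta> (G vac xs) S = 0"
  using assms
proof (induction xs arbitrary: S)
  case Nil
  show ?case unfolding ct_def by (auto simp: delta_def)
next
  case (Cons x xs)
  have "wv Pm Qm k x (ct k \<theta> (G vac xs)) S = wv Pm Qm k x (\<lambda>S. 0) S"
    by (rule wv_cong[OF Cons.prems(2)]) (rule Cons.IH, use Cons.prems in auto)
  moreover have "(\<Sum>s<k. \<theta> s * chi Pm Qm k x s) = 0" by (rule Cons.prems(1)) simp
  ultimately show ?case unfolding Gl_simps ct_wv[OF Cons.prems(2)] by simp
qed

text \<open>The covector for the tail of the list vanishes on every v(w_m) of that tail, so
  contraction removes just the head and leaves the factor \<Prod>(w_n - w_m). Iteration produces the
  Vandermonde product.\<close>

lemma Phi_G: "distinct xs \<Longrightarrow> length xs \<le> k \<Longrightarrow> Phi xs (G vac (map mvar xs)) = VL xs"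
proof (induction xs)
  case Nil
  show ?case by (simp add: delta_def)
next
  case (Cons n xs)
  let ?c = "\<Prod>m\<in>set xs. mvar n - mvar m"
  have card: "card (set xs) < k" using Cons.prems distinct_card[of xs] by auto
  have z: "ct k (theta xs) (G vac (map mvar xs)) S = 0" if "S \<subseteq> fl" for S
  proof (rule ct_G_zero[OF _ that])
    fix x assume "x \<in> set (map mvar xs)"
    then obtain m where "m \<in> set xs" "x = mvar m" by auto
    thus "(\<Sum>s<k. theta xs s * chi Pm Qm k x s) = 0"
      unfolding theta_chi[OF card] by (intro prod_zero) auto
  qed
  have "Phi (n # xs) (G vac (map mvar (n # xs))) = Phi xs (\<lambda>S. ?c * G vac (map mvar xs) S)"
    unfolding Phi.simps
  proof (rule Phi_cong)
    fix S assume S: "S \<subseteq> fl"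
    have "wv Pm Qm k (mvar n) (ct k (theta xs) (G vac (map mvar xs))) S = wv Pm Qm k (mvar n) (\<lambda>S. 0) S"
      by (rule wv_cong[OF S z])
    thus "ct k (theta xs) (G vac (map mvar (n # xs))) S = ?c * G vac (map mvar xs) S"
      unfolding list.map Gl_simps ct_wv[OF S] theta_chi[OF card] by simp
  qed
  also have "\<dots> = ?c * VL xs" unfolding Phi_cmult using Cons by simp
  finally show ?case by simp
qed

text \<open>Only the top component of a full wedge is nonzero, so iterated contraction multiplies
  \<open>X\<close> by a polynomial, and the result is the Vandermonde product up to sign. Since
  \<open>X\<close> is also divisible by that product (\<open>sX\<close>), the quotient is a
  unit.\<close>

lemma X_mult_eq_VA: "\<exists>d. X * d = VA fl"
proof -
  have "Phi ns (G vac (map mvar ns)) = Phi ns (\<lambda>S. X * delta fl S)"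
  proof (rule Phi_cong)
    fix S :: "nat set" assume S: "S \<subseteq> fl"
    show "G vac (map mvar ns) S = X * delta fl S"
    proof (cases "S = fl")
      case True thus ?thesis by (simp add: X_def delta_def)
    next
      case False
      have "G vac (map mvar ns) S = 0"
      proof (rule ccontr)
        assume "G vac (map mvar ns) S \<noteq> 0"
        hence "card S = k" using Gl_support[of Pm Qm k "{}" "map mvar ns" S] lk by simp
        thus False using card_subset_eq[OF _ S] False by simp
      qed
      thus ?thesis using False by (simp add: delta_def)
    qed
  qed
  hence "X * Phi ns (delta fl) = VL ns"
    using Phi_G[of ns] distinct_ns length_ns by (simp only: Phi_cmult le_refl)
  moreover obtain e where e: "e = 1 \<or> e = - 1" "VL ns = e * VA fl"
    using VL_VA[OF distinct_ns] set_ns by auto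
  ultimately have "X * (e * Phi ns (delta fl)) = (e * e) * VA fl" by (simp add: mult_ac)
  moreover have "e * e = 1" using e by auto
  ultimately show ?thesis by auto
qed

lemma transpose_X: "a < k \<Longrightarrow> b < k \<Longrightarrow> a \<noteq> b \<Longrightarrow> rename (transpose a b) X = - X"
  unfolding X_def by (rule transpose_G[OF distinct_ns]) (use lk in auto)

lemma trunc_X: "trunc k X = X"
  unfolding X_def by (rule trunc_G) (use lk in auto)

lemma rename_X: "\<pi> permutes fl \<Longrightarrow> rename \<pi> X = of_int (sign \<pi>) * X"
  using rename_permutes_eq[of \<pi> fl X "- 1"] transpose_X by auto

definition sX :: mpoly where "sX = (SOME s. s \<in> inv_ring k k \<and> X = VA fl * s)"

lemma sX: "sX \<in> inv_ring k k" "X = VA fl * sX"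
proof -
  have "VA fl dvd X" by (rule VA_dvd) (auto simp: transpose_X)
  then obtain s where s: "X = VA fl * s" by (elim dvdE)
  have "s \<in> inv_ring k k"
  proof (rule quotient_inv_ring[OF s[symmetric] VA_nonzero trunc_VA trunc_X])
    show "\<exists>e. (e = 1 \<or> e = - 1) \<and> rename (transpose a b) X = e * X \<and> rename (transpose a b) (VA fl) = e * VA fl"
      if "a < k" "b < k" "a \<noteq> b" for a b
      using that transpose_X rename_VA_transpose[of fl a b] by (intro exI[of _ "- 1"]) simp
  qed auto
  with s have "\<exists>s. s \<in> inv_ring k k \<and> X = VA fl * s" by blast
  thus "sX \<in> inv_ring k k" "X = VA fl * sX" unfolding sX_def by (rule someI2_ex, blast)+
qed

text \<open>The constant to which the unit \<open>sX\<close> is congruent modulo the ideal.\<close>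

definition c0 :: complex where "c0 = ev (\<lambda>c. c) \<rho> sX"

lemma c0_nonzero: "c0 \<noteq> 0"
proof
  assume c0: "c0 = 0"
  obtain d where "X * d = VA fl" using X_mult_eq_VA by blast
  hence "VA fl * (sX * d) = VA fl * 1" using sX(2) by (simp add: mult.assoc)
  hence "sX * d = 1" by (rule VA_cancel[OF finite_lessThan])
  hence "ev (\<lambda>c. c) \<rho> (sX * d) = 1" by simp
  thus False using c0 by (simp add: ev_simps c0_def)
qed

lemma N_nonzero: "N \<noteq> 0"
  using card_Gp_pos[of k l] by (metis less_numeral_extra(3) of_nat_eq_0_iff)

lemma truncs_intros:
  "Gs S \<in> truncs k" "Hs S \<in> truncs k" "X \<in> truncs k" "VB k l \<in> truncs k" "VA {..<l} \<in> truncs k" "VA {l..<k} \<in> truncs k"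
proof -
  show "Gs S \<in> truncs k" unfolding truncs_def Gs_def mem_Collect_eq by (rule trunc_G) (use lk in auto)
  show "Hs S \<in> truncs k" unfolding truncs_def Hs_def mem_Collect_eq by (rule trunc_G) auto
  show "X \<in> truncs k" unfolding truncs_def mem_Collect_eq by (rule trunc_X)
  show "VB k l \<in> truncs k" unfolding truncs_def mem_Collect_eq by (rule trunc_VB[OF lk])
  show "VA {..<l} \<in> truncs k" unfolding truncs_def mem_Collect_eq by (rule trunc_VA) (use lk in auto)
  show "VA {l..<k} \<in> truncs k" unfolding truncs_def mem_Collect_eq by (rule trunc_VA) auto
qed

lemma Gs_transpose:
  "a < l \<Longrightarrow> b < l \<Longrightarrow> a \<noteq> b \<Longrightarrow> rename (transpose a b) (Gs S) = - Gs S"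
  "a \<in> {l..<k} \<Longrightarrow> b \<in> {l..<k} \<Longrightarrow> rename (transpose a b) (Gs S) = Gs S"
  unfolding Gs_def
  by (rule transpose_G, auto)[1] (rule fix_G, auto simp: transpose_def)

lemma Hs_transpose:
  "a < l \<Longrightarrow> b < l \<Longrightarrow> rename (transpose a b) (Hs S) = Hs S"
  "a \<in> {l..<k} \<Longrightarrow> b \<in> {l..<k} \<Longrightarrow> a \<noteq> b \<Longrightarrow> rename (transpose a b) (Hs S) = - Hs S"
  unfolding Hs_def
  by (rule fix_G, auto simp: transpose_def)[1] (rule transpose_G, auto)

text \<open>Expanding the antisymmetrization and summing over \<open>S\<close> inside rebuilds, for
  each \<pi>, a full wedge in the variables w_(\<pi> x), x \<ge> l, together with the first block.
  If \<pi> sends some x \<ge> l into the first block, a variable is repeated and the wedge vanishes;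
  otherwise \<pi> lies in the block group and the term is \<open>B * X\<close>. Just
  \<open>N\<close> equal terms survive.\<close>

lemma reproduce:
  assumes B: "trunc k B = B"
    and B1: "\<And>a b. a < l \<Longrightarrow> b < l \<Longrightarrow> a \<noteq> b \<Longrightarrow> rename (transpose a b) B = - B"
    and B2: "\<And>a b. a \<in> {l..<k} \<Longrightarrow> b \<in> {l..<k} \<Longrightarrow> a \<noteq> b \<Longrightarrow> rename (transpose a b) B = B"
  shows "mconst N * (B * X) = (\<Sum>S\<in>W. Gs S * alt k (B * Hs S))"
proof -
  let ?P = "{\<pi>. \<pi> permutes fl}"
  define Z where "Z = (\<lambda>\<pi>. G vac (map (\<lambda>x. mvar (\<pi> x)) [l..<k] @ map mvar [0..<l]) fl)"
  have "(\<Sum>S\<in>W. Gs S * alt k (B * Hs S)) = (\<Sum>S\<in>W. \<Sum>\<pi>\<in>?P. of_int (sign \<pi>) * rename \<pi> B * (Gs S * rename \<pi> (Hs S)))"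
    by (simp add: alt_def sum_distrib_left mult_ac)
  also have "\<dots> = (\<Sum>\<pi>\<in>?P. of_int (sign \<pi>) * rename \<pi> B * (\<Sum>S\<in>W. Gs S * rename \<pi> (Hs S)))"
    unfolding sum_distrib_left by (rule sum.swap)
  also have "\<dots> = (\<Sum>\<pi>\<in>?P. of_int (sign \<pi>) * rename \<pi> B * Z \<pi>)"
    unfolding Z_def X_expand Hs_def rename_G ..
  also have "\<dots> = (\<Sum>\<pi>\<in>?P. if \<pi> \<in> Gp k l then B * X else 0)"
  proof (intro sum.cong refl)
    fix \<pi> assume "\<pi> \<in> ?P"
    hence \<pi>: "\<pi> permutes fl" by simp
    show "of_int (sign \<pi>) * rename \<pi> B * Z \<pi> = (if \<pi> \<in> Gp k l then B * X else 0)"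
    proof (cases "\<pi> \<in> Gp k l")
      case True
      obtain \<pi>1 \<pi>2 where d: "\<pi>1 permutes {..<l}" "\<pi>2 permutes {l..<k}" "\<pi> = \<pi>1 \<circ> \<pi>2"
        by (rule Gp_decompose[OF True lk])
      have s: "sign \<pi> = sign \<pi>1 * sign \<pi>2"
        unfolding d(3) by (rule sign_compose) (use d in \<open>auto simp: permutation_permutes\<close>)
      have "rename \<pi>2 B = B" using rename_permutes_eq[OF d(2), of B 1] B2 by auto
      moreover have "rename \<pi>1 B = of_int (sign \<pi>1) * B" using rename_permutes_eq[OF d(1), of B "- 1"] B1 by auto
      ultimately have rB: "rename \<pi> B = of_int (sign \<pi>1) * B" by (simp add: d(3) flip: rename_rename)
      have "\<pi>2 permutes fl" by (rule permutes_subset[OF d(2)]) auto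
      hence "of_int (sign \<pi>2) * X = rename \<pi>2 X" by (simp add: rename_X)
      also have "\<dots> = Z \<pi>"
      proof -
        have "\<pi>2 x = \<pi> x" if "x \<in> {l..<k}" for x
        proof -
          have "\<pi>2 x \<in> {l..<k}" using permutes_in_image[OF d(2)] that by blast
          thus ?thesis using permutes_not_in[OF d(1)] by (simp add: d(3))
        qed
        hence m1: "map (\<lambda>x. mvar (\<pi>2 x)) [l..<k] = map (\<lambda>x. mvar (\<pi> x)) [l..<k]" by auto
        have "\<pi>2 x = x" if "x < l" for x using permutes_not_in[OF d(2)] that by auto
        hence m2: "map (\<lambda>x. mvar (\<pi>2 x)) [0..<l] = map mvar [0..<l]" by auto
        have "rename \<pi>2 X = G vac (map (\<lambda>x. mvar (\<pi>2 x)) ns) fl" unfolding X_def rename_G ..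
        thus ?thesis unfolding Z_def map_append m1 m2 .
      qed
      \<comment> \<open>The sign of \<pi>1 comes back from \<open>B\<close> and that of \<pi>2 from
        \<open>X\<close>, so both occur squared.\<close>
      finally have "of_int (sign \<pi>) * rename \<pi> B * Z \<pi> = of_int (sign \<pi>1 * sign \<pi>1) * (of_int (sign \<pi>2 * sign \<pi>2) * (B * X))"
        unfolding s rB by (simp only: of_int_mult mult_ac)
      thus ?thesis using True by simp
    next
      case False
      have "\<exists>x\<in>{l..<k}. \<pi> x < l"
      proof (rule ccontr)
        assume "\<not> (\<exists>x\<in>{l..<k}. \<pi> x < l)"
        hence nl: "\<not> \<pi> x < l" if "x \<in> {l..<k}" for x using that by blast
        have sub: "\<pi> ` {l..<k} \<subseteq> {l..<k}"
        proof (rule image_subsetI)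
          fix x assume x: "x \<in> {l..<k}"
          show "\<pi> x \<in> {l..<k}" using nl[OF x] permutes_in_image[OF \<pi>, of x] x by auto
        qed
        have "\<pi> ` {l..<k} = {l..<k}"
          by (rule endo_inj_surj[OF _ sub]) (auto intro: inj_on_subset[OF permutes_inj[OF \<pi>]])
        have "{..<l} = fl - {l..<k}" using lk by auto
        hence "\<pi> ` {..<l} = \<pi> ` fl - \<pi> ` {l..<k}"
          by (simp only: image_set_diff[OF permutes_inj[OF \<pi>]])
        also have "\<dots> = fl - {l..<k}" by (simp only: \<open>\<pi> ` {l..<k} = {l..<k}\<close> permutes_image[OF \<pi>])
        also have "\<dots> = {..<l}" using lk by auto
        finally show False using False \<pi> by (simp add: Gp_def)
      qed
      then obtain x where x: "x \<in> {l..<k}" "\<pi> x < l" by blast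
      have "mvar (\<pi> x) \<in> set (map (\<lambda>x. mvar (\<pi> x)) [l..<k]) \<inter> set (map mvar [0..<l])" using x by auto
      hence "\<not> distinct (map (\<lambda>x. mvar (\<pi> x)) [l..<k] @ map mvar [0..<l])" by (simp only: distinct_append) blast
      hence "Z \<pi> = 0" unfolding Z_def by (rule Gl_repeat)
      thus ?thesis using False by simp
    qed
  qed
  also have "\<dots> = (\<Sum>\<pi>\<in>Gp k l. B * X)"
    by (rule sum.mono_neutral_cong_right) (auto simp: finite_permutations Gp_def)
  also have "\<dots> = mconst N * (B * X)" by (simp add: mconst_def)
  finally show ?thesis ..
qed

text \<open>The trace form: multiplication by \<open>VB k l\<close> restores the two Vandermonde
  factors divided out of \<open>g\<close> and \<open>u\<close>, and \<open>N * c0\<close> normalizes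
  the reproducing formula.\<close>

definition lam0 :: "mpoly \<Rightarrow> complex" where "lam0 p = Lam k \<rho> (p * VB k l) / (N * c0)"

lemma g_exists: "\<exists>g\<in>inv_ring k l. Gs S = VA {..<l} * g"
proof -
  have "VA {..<l} dvd Gs S" by (rule VA_dvd) (auto simp: Gs_transpose)
  then obtain g where g: "Gs S = VA {..<l} * g" by (elim dvdE)
  have "g \<in> inv_ring k l"
  proof (rule quotient_inv_ring[OF g[symmetric] VA_nonzero trunc_VA _ lk])
    show "trunc k (Gs S) = Gs S" using truncs_intros(1) by (simp add: truncs_def)
    show "\<exists>e. (e = 1 \<or> e = - 1) \<and> rename (transpose a b) (Gs S) = e * Gs S \<and> rename (transpose a b) (VA {..<l}) = e * VA {..<l}"
      if "a < l" "b < l" "a \<noteq> b" for a b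
      using that Gs_transpose(1)[OF that] rename_VA_transpose[of "{..<l}" a b] by (intro exI[of _ "- 1"]) simp
    show "\<exists>e. (e = 1 \<or> e = - 1) \<and> rename (transpose a b) (Gs S) = e * Gs S \<and> rename (transpose a b) (VA {..<l}) = e * VA {..<l}"
      if "a \<in> {l..<k}" "b \<in> {l..<k}" "a \<noteq> b" for a b
    proof -
      have "rename (transpose a b) (VA {..<l}) = VA {..<l}"
        by (rule rename_VA_fix) (use that in \<open>auto simp: transpose_def\<close>)
      thus ?thesis using Gs_transpose(2)[OF that(1,2)] by (intro exI[of _ 1]) simp
    qed
  qed (use lk in auto)
  with g show ?thesis by blast
qed

lemma u_exists: "\<exists>u\<in>inv_ring k l. Hs S = VA {l..<k} * u"
proof -
  have "VA {l..<k} dvd Hs S" by (rule VA_dvd) (auto simp: Hs_transpose)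
  then obtain g where g: "Hs S = VA {l..<k} * g" by (elim dvdE)
  have "g \<in> inv_ring k l"
  proof (rule quotient_inv_ring[OF g[symmetric] VA_nonzero trunc_VA _ lk])
    show "trunc k (Hs S) = Hs S" using truncs_intros(2) by (simp add: truncs_def)
    show "\<exists>e. (e = 1 \<or> e = - 1) \<and> rename (transpose a b) (Hs S) = e * Hs S \<and> rename (transpose a b) (VA {l..<k}) = e * VA {l..<k}"
      if "a < l" "b < l" "a \<noteq> b" for a b
    proof -
      have "rename (transpose a b) (VA {l..<k}) = VA {l..<k}"
        by (rule rename_VA_fix) (use that in \<open>auto simp: transpose_def\<close>)
      thus ?thesis using Hs_transpose(1)[OF that(1,2)] by (intro exI[of _ 1]) simp
    qed
    show "\<exists>e. (e = 1 \<or> e = - 1) \<and> rename (transpose a b) (Hs S) = e * Hs S \<and> rename (transpose a b) (VA {l..<k}) = e * VA {l..<k}"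
      if "a \<in> {l..<k}" "b \<in> {l..<k}" "a \<noteq> b" for a b
      using that Hs_transpose(2)[OF that] rename_VA_transpose[of "{l..<k}" a b] by (intro exI[of _ "- 1"]) simp
  qed auto
  with g show ?thesis by blast
qed

definition g :: "nat set \<Rightarrow> mpoly" where "g S = (SOME g. g \<in> inv_ring k l \<and> Gs S = VA {..<l} * g)"
definition u :: "nat set \<Rightarrow> mpoly" where "u S = (SOME g. g \<in> inv_ring k l \<and> Hs S = VA {l..<k} * g)"

lemma g: "g S \<in> inv_ring k l" "Gs S = VA {..<l} * g S"
  using g_exists[of S] unfolding g_def by (metis (mono_tags, lifting) someI_ex)+

lemma u: "u S \<in> inv_ring k l" "Hs S = VA {l..<k} * u S"
  using u_exists[of S] unfolding u_def by (metis (mono_tags, lifting) someI_ex)+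

lemma inv_trunc: "p \<in> inv_ring k l \<Longrightarrow> p \<in> truncs k" using inv_ring_truncs by blast

lemma lam0_add: "p \<in> inv_ring k l \<Longrightarrow> q \<in> inv_ring k l \<Longrightarrow> lam0 (p + q) = lam0 p + lam0 q"
  unfolding lam0_def distrib_right
  by (subst Lam_add) (auto simp: add_divide_distrib intro: subringD(5)[OF subring_truncs] inv_trunc truncs_intros)

lemma lam0_cmult: "p \<in> inv_ring k l \<Longrightarrow> lam0 (mconst c * p) = c * lam0 p"
  unfolding lam0_def mult.assoc[of "mconst c"]
  by (subst Lam_cmult) (auto intro: subringD(5)[OF subring_truncs] inv_trunc truncs_intros)

lemma lam0_ideal: "p \<in> gen_ideal k l eps \<Longrightarrow> lam0 p = 0"
proof -
  assume "p \<in> gen_ideal k l eps"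
  hence "p \<in> II" unfolding gen_ideal_eq using gideal_mono[OF inv_ring_truncs] by blast
  hence "VB k l * p \<in> II" by (rule gideal_mult[OF subring_truncs truncs_intros(4)])
  hence "Lam k \<rho> (VB k l * p) = 0" by (rule Lam_gideal[OF roots])
  thus ?thesis by (simp add: lam0_def mult.commute)
qed

text \<open>\<open>reproduce\<close> for \<open>B = p * VA {..<l}\<close>, divided by the full
  Vandermonde determinant, writes a multiple of \<open>B * sX\<close> as a combination of the
  \<open>Gs S\<close> with symmetric coefficients. Modulo the ideal these become constants,
  \<open>sX\<close> becomes \<open>c0\<close>, and \<open>gideal_cancel_VB\<close> removes the
  remaining Vandermonde factors.\<close>

lemma H2:
  assumes p: "p \<in> inv_ring k l"
  shows "p - (\<Sum>S\<in>W. mconst (lam0 (p * u S)) * g S) \<in> gen_ideal k l eps"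
proof -
  let ?B = "p * VA {..<l}"
  have Bt: "?B \<in> truncs k" by (intro subringD(5)[OF subring_truncs] inv_trunc p truncs_intros)
  have inv: "rename (transpose a b) p = p" if "(a < l \<and> b < l) \<or> (a \<in> {l..<k} \<and> b \<in> {l..<k})" for a b
    using p block_transpose_Gp[OF lk that] by (simp add: inv_ring_iff)
  have rep: "mconst N * (?B * X) = (\<Sum>S\<in>W. Gs S * alt k (?B * Hs S))"
  proof (rule reproduce)
    show "trunc k ?B = ?B" using Bt by (simp add: truncs_def)
    show "rename (transpose a b) ?B = - ?B" if "a < l" "b < l" "a \<noteq> b" for a b
      using that inv[of a b] rename_VA_transpose[of "{..<l}" a b] by simp
    show "rename (transpose a b) ?B = ?B" if "a \<in> {l..<k}" "b \<in> {l..<k}" "a \<noteq> b" for a b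
    proof -
      have "rename (transpose a b) (VA {..<l}) = VA {..<l}"
        by (rule rename_VA_fix) (use that in \<open>auto simp: transpose_def\<close>)
      thus ?thesis using inv[of a b] that by simp
    qed
  qed
  have BH: "?B * Hs S \<in> truncs k" for S by (intro subringD(5)[OF subring_truncs] Bt truncs_intros)
  have "\<forall>S. \<exists>t. t \<in> inv_ring k k \<and> alt k (?B * Hs S) = VA fl * t"
  proof
    fix S
    have tr: "trunc k (?B * Hs S) = ?B * Hs S" using BH[of S] unfolding truncs_def mem_Collect_eq .
    obtain t where "t \<in> inv_ring k k" "alt k (?B * Hs S) = VA fl * t" by (rule alt_eq_VA_mult[OF tr])
    thus "\<exists>t. t \<in> inv_ring k k \<and> alt k (?B * Hs S) = VA fl * t" by blast
  qed
  from choice[OF this] obtain t where "\<forall>S. t S \<in> inv_ring k k \<and> alt k (?B * Hs S) = VA fl * t S" ..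
  hence t: "t S \<in> inv_ring k k" "alt k (?B * Hs S) = VA fl * t S" for S by simp_all
  have "VA fl * (mconst N * (?B * sX)) = mconst N * (?B * X)"
    unfolding sX(2) by (simp only: mult_ac)
  also have "\<dots> = VA fl * (\<Sum>S\<in>W. Gs S * t S)"
    unfolding rep t(2) sum_distrib_left by (intro sum.cong refl) (simp only: mult_ac)
  finally have eq: "mconst N * (?B * sX) = (\<Sum>S\<in>W. Gs S * t S)"
    by (rule VA_cancel[OF finite_lessThan])
  let ?t = "\<lambda>S. Lam k \<rho> (?B * Hs S)"
  have tev: "ev (\<lambda>c. c) \<rho> (t S) = ?t S" for S by (rule Lam_eqI[OF t(2), symmetric])
  have sym: "s - mconst (ev (\<lambda>c. c) \<rho> s) \<in> II" if "s \<in> inv_ring k k" for s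
    using sym_const[OF roots that lk] gideal_mono[OF inv_ring_truncs] unfolding gen_ideal_eq by blast
  have lam: "?t S = N * c0 * lam0 (p * u S)" for S
  proof -
    have BHu: "?B * Hs S = p * u S * VB k l" unfolding u(2) VB_def by (simp only: mult_ac)
    have "N * c0 \<noteq> 0" using N_nonzero c0_nonzero by (simp only: mult_eq_0_iff) simp
    have cancel: "M \<noteq> 0 \<Longrightarrow> x = M * (x / M)" for M x :: complex by simp
    show ?thesis unfolding BHu lam0_def by (rule cancel[OF \<open>N * c0 \<noteq> 0\<close>])
  qed
  have 1: "mconst N * ?B * (sX - mconst c0) \<in> II"
    unfolding c0_def by (rule gideal_mult[OF subring_truncs _ sym[OF sX(1)]])
      (intro subringD(5)[OF subring_truncs] Bt subringD(1)[OF subring_truncs])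
  have 2: "(\<Sum>S\<in>W. Gs S * (t S - mconst (?t S))) \<in> II"
    unfolding tev[symmetric]
    by (intro gideal_sum[OF subring_truncs] gideal_mult[OF subring_truncs] truncs_intros sym t)
  have "(\<Sum>S\<in>W. Gs S * (t S - mconst (?t S))) - mconst N * ?B * (sX - mconst c0) \<in> II"
    by (rule gideal_diff[OF subring_truncs 2 1])
  also have "(\<Sum>S\<in>W. Gs S * (t S - mconst (?t S))) - mconst N * ?B * (sX - mconst c0)
      = mconst N * (mconst c0 * ?B) - (\<Sum>S\<in>W. Gs S * mconst (?t S))"
    using eq by (simp add: right_diff_distrib sum_subtractf mult_ac)
  also have "\<dots> = mconst (N * c0) * (VA {..<l} * (p - (\<Sum>S\<in>W. mconst (lam0 (p * u S)) * g S)))"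
  proof -
    have "Gs S * mconst (?t S) = mconst (N * c0) * (VA {..<l} * (mconst (lam0 (p * u S)) * g S))" for S
      unfolding lam g(2) mconst_mult by (simp only: mult_ac)
    hence "(\<Sum>S\<in>W. Gs S * mconst (?t S)) = mconst (N * c0) * (VA {..<l} * (\<Sum>S\<in>W. mconst (lam0 (p * u S)) * g S))"
      by (simp add: sum_distrib_left)
    thus ?thesis by (simp add: right_diff_distrib mconst_mult mult_ac)
  qed
  finally have 3: "mconst (N * c0) * (VA {..<l} * (p - (\<Sum>S\<in>W. mconst (lam0 (p * u S)) * g S))) \<in> II" .
  let ?q = "p - (\<Sum>S\<in>W. mconst (lam0 (p * u S)) * g S)"
  \<comment> \<open>The Vandermonde product of the first block is present; multiplying by that of
    the second completes it to \<open>VB k l\<close>, which can be cancelled.\<close>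
  have "mconst (1 / (N * c0)) * VA {l..<k} * (mconst (N * c0) * (VA {..<l} * ?q)) \<in> II"
    by (rule gideal_mult[OF subring_truncs _ 3])
      (intro subringD(5)[OF subring_truncs] truncs_intros subringD(1)[OF subring_truncs])
  also have "mconst (1 / (N * c0)) * VA {l..<k} * (mconst (N * c0) * (VA {..<l} * ?q))
      = mconst (1 / (N * c0) * (N * c0)) * (?q * VB k l)" unfolding VB_def mconst_mult by (simp only: mult_ac)
  also have "\<dots> = ?q * VB k l" using N_nonzero c0_nonzero by (simp add: mconst_1)
  finally have "?q * VB k l \<in> II" .
  moreover have "?q \<in> inv_ring k l" by (intro inv_ring_closed p inv_ring_sum g)
  ultimately show ?thesis by (intro gideal_cancel_VB[OF lk])
qed

text \<open>The left side is the trace of the matrix that \<open>phi\<close> assigns to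
  \<open>p\<close>. Summed over \<open>S\<close>, the products of \<open>g S\<close>,
  \<open>u S\<close> and \<open>VB k l\<close> recombine to \<open>X\<close> by Cauchy-Binet; since
  \<open>X\<close> is alternating, antisymmetrizing \<open>p * X\<close> symmetrizes
  \<open>p\<close>, and \<open>c0\<close> cancels.\<close>

lemma H4:
  assumes p: "p \<in> inv_ring k l"
  shows "(\<Sum>S\<in>W. lam0 (p * g S * u S)) = (\<Sum>\<pi> | \<pi> permutes fl. ev (\<lambda>c. c) (\<lambda>i. \<rho> (\<pi> i)) p) / N"
proof -
  let ?P = "{\<pi>. \<pi> permutes fl}"
  have t: "p * g S * u S * VB k l \<in> truncs k" for S
    by (intro subringD(5)[OF subring_truncs] inv_trunc p g u truncs_intros)
  have "(\<Sum>S\<in>W. lam0 (p * g S * u S)) = (\<Sum>S\<in>W. Lam k \<rho> (p * g S * u S * VB k l)) / (N * c0)"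
    by (simp add: lam0_def sum_divide_distrib)
  also have "(\<Sum>S\<in>W. Lam k \<rho> (p * g S * u S * VB k l)) = Lam k \<rho> (\<Sum>S\<in>W. p * g S * u S * VB k l)"
    by (rule Lam_sum[symmetric]) (rule t)
  also have "(\<Sum>S\<in>W. p * g S * u S * VB k l) = p * X"
    unfolding X_eq g(2) u(2) VB_def sum_distrib_left by (intro sum.cong refl) (simp only: mult_ac)
  finally have eq: "(\<Sum>S\<in>W. lam0 (p * g S * u S)) = Lam k \<rho> (p * X) / (N * c0)" .
  have "alt k (p * X) = VA fl * ((\<Sum>\<pi>\<in>?P. rename \<pi> p) * sX)"
  proof -
    have "alt k (p * X) = (\<Sum>\<pi>\<in>?P. rename \<pi> p * X)"
      unfolding alt_def
    proof (intro sum.cong refl)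
      fix \<pi> assume "\<pi> \<in> ?P"
      hence "rename \<pi> (p * X) = rename \<pi> p * (of_int (sign \<pi>) * X)" by (simp add: rename_X)
      hence "of_int (sign \<pi>) * rename \<pi> (p * X) = of_int (sign \<pi> * sign \<pi>) * (rename \<pi> p * X)"
        by (simp only: of_int_mult mult_ac)
      thus "of_int (sign \<pi>) * rename \<pi> (p * X) = rename \<pi> p * X" by simp
    qed
    also have "\<dots> = (\<Sum>\<pi>\<in>?P. rename \<pi> p) * (VA fl * sX)" by (simp only: sum_distrib_right sX(2)[symmetric])
    finally show ?thesis by (simp only: mult_ac)
  qed
  hence "Lam k \<rho> (p * X) = (\<Sum>\<pi>\<in>?P. ev (\<lambda>c. c) (\<lambda>i. \<rho> (\<pi> i)) p) * c0"
    unfolding c0_def by (subst Lam_eqI, assumption) (simp add: ev_simps ev_rename)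
  thus ?thesis using c0_nonzero eq by simp
qed

end

section \<open>The transfer relation\<close>

lemma map_poly_hom:
  fixes h :: "'a::comm_ring_1 \<Rightarrow> 'b::comm_ring_1"
  assumes h: "h 0 = 0" "h 1 = 1" "\<And>a b. h (a + b) = h a + h b" "\<And>a b. h (a * b) = h a * h b"
  shows "map_poly h 0 = 0" "map_poly h 1 = 1" "map_poly h (p + q) = map_poly h p + map_poly h q"
    "map_poly h (p * q) = map_poly h p * map_poly h q" "map_poly h (prod f A) = (\<Prod>a\<in>A. map_poly h (f a))"
    "map_poly h [:a, 1:] = [:h a, 1:]"
proof -
  have hs: "h (sum f A) = (\<Sum>a\<in>A. h (f a))" for f and A :: "nat set"
    by (induction A rule: infinite_finite_induct) (auto simp: h)
  show zero: "map_poly h 0 = 0" by simp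
  show one: "map_poly h 1 = 1" by (rule poly_eqI) (simp add: coeff_map_poly h coeff_1)
  show "map_poly h (p + q) = map_poly h p + map_poly h q" by (rule poly_eqI) (simp add: coeff_map_poly h)
  have mult: "map_poly h (p * q) = map_poly h p * map_poly h q" for p q
    by (rule poly_eqI) (simp add: coeff_map_poly h coeff_mult hs)
  show "map_poly h (p * q) = map_poly h p * map_poly h q" by (rule mult)
  show "map_poly h (prod f A) = (\<Prod>a\<in>A. map_poly h (f a))"
    by (induction A rule: infinite_finite_induct) (simp_all only: prod.infinite prod.empty one prod.insert mult not_False_eq_True)
  show "map_poly h [:a, 1:] = [:h a, 1:]"
    by (rule poly_eqI) (simp add: coeff_map_poly h coeff_pCons split: nat.splits)
qed

text \<open>Descending induction: the coefficient of \<open>y * r\<close> at position deg y + j is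
  the j-th coefficient of \<open>r\<close> plus multiples of higher coefficients of
  \<open>r\<close>.\<close>

lemma monic_cancel_ideal:
  fixes y r :: "'a::comm_ring_1 poly"
  assumes J: "0 \<in> J" "\<And>a b. a \<in> J \<Longrightarrow> b \<in> J \<Longrightarrow> a - b \<in> J" "\<And>a b. b \<in> J \<Longrightarrow> a * b \<in> J"
    and y: "coeff y (degree y) = 1" and yr: "\<And>j. coeff (y * r) j \<in> J"
  shows "coeff r j \<in> J"
proof (induction "degree r - j" arbitrary: j rule: less_induct)
  case less
  have Jadd: "a + b \<in> J" if "a \<in> J" "b \<in> J" for a b
    using J(2)[OF that(1) J(2)[OF J(1) that(2)]] by simp
  have Jsum: "sum f A \<in> J" if "\<And>a. a \<in> A \<Longrightarrow> f a \<in> J" for f and A :: "nat set"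
    using that by (induction A rule: infinite_finite_induct) (auto intro: J(1) Jadd)
  show ?case
  proof (cases "j \<le> degree r")
    case False
    thus ?thesis using J(1) by (simp add: coeff_eq_0)
  next
    case True
    let ?d = "degree y"
    have "coeff (y * r) (?d + j) = (\<Sum>i\<le>?d + j. coeff y i * coeff r (?d + j - i))" by (rule coeff_mult)
    also have "\<dots> = (\<Sum>i\<le>?d. coeff y i * coeff r (?d + j - i))"
      by (rule sum.mono_neutral_right) (auto simp: coeff_eq_0)
    also have "\<dots> = (\<Sum>i<?d. coeff y i * coeff r (?d + j - i)) + coeff r j"
      by (simp add: y flip: lessThan_Suc_atMost)
    finally have eq: "coeff r j = coeff (y * r) (?d + j) - (\<Sum>i<?d. coeff y i * coeff r (?d + j - i))" by simp
    have "(\<Sum>i<?d. coeff y i * coeff r (?d + j - i)) \<in> J"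
    proof (intro Jsum J(3))
      fix i assume "i \<in> {..<?d}"
      hence i: "i < ?d" by simp
      show "coeff r (?d + j - i) \<in> J"
      proof (cases "degree r < ?d + j - i")
        case True thus ?thesis using J(1) by (simp add: coeff_eq_0)
      next
        case False
        show ?thesis by (rule less.hyps) (use i False in linarith)
      qed
    qed
    thus ?thesis unfolding eq by (intro J(2) yr)
  qed
qed

text \<open>Setting the variables from \<open>k\<close> on to zero fixes \<open>p\<close> and the
  generators and truncates the coefficients.\<close>

lemma gideal_UNIV_trunc: "p \<in> gideal UNIV k eps \<Longrightarrow> trunc k p = p \<Longrightarrow> p \<in> gideal (truncs k) k eps"
proof -
  assume p: "p \<in> gideal UNIV k eps" and r2: "trunc k p = p"
  obtain r where r1: "p = (\<Sum>i\<in>{1..k}. r i * (esym k i - mconst (eps i)))"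
    using p unfolding gideal_def by (elim CollectE exE conjE)
  have e: "trunc k (esym k i) = esym k i" for i using esym_inv_ring[of k i] by (simp add: inv_ring_iff)
  have tt: "trunc k (trunc k p) = trunc k p" for p
    unfolding trunc_def ev_ev[OF chom_mconst] by (intro arg_cong2[where f="ev mconst"]) auto
  have "trunc k p = (\<Sum>i\<in>{1..k}. trunc k (r i) * (esym k i - mconst (eps i)))"
    unfolding r1 trunc_sum by (simp add: e)
  hence "p = (\<Sum>i\<in>{1..k}. trunc k (r i) * (esym k i - mconst (eps i)))" unfolding r2 .
  thus ?thesis unfolding gideal_def truncs_def using tt
    by (intro CollectI exI[of _ "\<lambda>i. trunc k (r i)"] conjI allI) simp_all
qed

lemma subring_UNIV: "subring UNIV" by (simp add: subring_def)

section \<open>The polynomials y(x), z(x), y(x-1), and recovery of y from the transfer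
  eigenvalue\<close>

definition yp :: "nat \<Rightarrow> mpoly poly" where "yp l = (\<Prod>i<l. [:- mvar i, 1:])"
definition zp :: "nat \<Rightarrow> nat \<Rightarrow> mpoly poly" where "zp k l = (\<Prod>j\<in>{l..<k}. [:- mvar j, 1:])"
definition ysp :: "nat \<Rightarrow> mpoly poly" where "ysp l = (\<Prod>i<l. [:- mvar i - 1, 1:])"

lemma yp_zp: "l \<le> k \<Longrightarrow> yp l * zp k l = (\<Prod>i<k. [:- mvar i, 1:])"
proof -
  assume "l \<le> k"
  hence e: "{..<l} \<union> {l..<k} = {..<k}" by auto
  show ?thesis unfolding yp_def zp_def e[symmetric] by (rule prod.union_disjoint[symmetric]) auto
qed

lemma degree_ysp: "degree (ysp l) = l" "coeff (ysp l) l = 1"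
  using degree_prod_linear[of "{..<l}" "\<lambda>i. mvar i + 1"] coeff_prod_linear_card[of "{..<l}" "\<lambda>i. mvar i + 1"]
  by (simp_all add: ysp_def)

lemma degree_yp: "degree (yp l) = l" "coeff (yp l) l = 1"
  using degree_prod_linear[of "{..<l}" "mvar"] coeff_prod_linear_card[of "{..<l}" mvar] by (simp_all add: yp_def)

lemma degree_zp: "degree (zp k l) = k - l" "coeff (zp k l) (k - l) = 1"
  using degree_prod_linear[of "{l..<k}" "mvar"] coeff_prod_linear_card[of "{l..<k}" mvar] by (simp_all add: zp_def)

lemma coeff_shift_power: "coeff ([:- 1, 1:] ^ i) j = (of_nat (i choose j) * (- 1) ^ (i - j) :: 'a::idom)"
proof (cases "j \<le> i")
  case True
  thus ?thesis by (simp add: coeff_linear_poly_power)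
next
  case False
  hence "degree ([:- 1, 1:] ^ i :: 'a poly) < j" by (simp add: degree_power_eq)
  thus ?thesis using False by (simp add: coeff_eq_0 binomial_eq_0)
qed

lemma coeff_ysp: "coeff (ysp l) j = (\<Sum>i\<le>l. coeff (yp l) i * (of_nat (i choose j) * (- 1) ^ (i - j)))"
proof -
  have "ysp l = pcompose (yp l) [:- 1, 1:]"
    unfolding ysp_def yp_def pcompose_prod by (intro prod.cong refl) (simp add: pcompose_pCons)
  also have "\<dots> = (\<Sum>i\<le>l. smult (coeff (yp l) i) ([:- 1, 1:] ^ i))"
  proof -
    have "degree (map_poly (\<lambda>x. [:x:]) (yp l)) = l" by (subst degree_map_poly) (auto simp: degree_yp)
    thus ?thesis by (simp add: pcompose_altdef poly_altdef coeff_map_poly)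
  qed
  finally show ?thesis by (simp add: coeff_sum coeff_shift_power)
qed

text \<open>With \<open>r = y(x) - y(x - 1)\<close> one has \<open>(w - y(x - 1) z) y = r w\<close> for \<open>w = y z\<close>; comparing
coefficients from the top gives \<open>(l - c) y\<^sub>c\<close> in terms of higher coefficients of \<open>y\<close>.\<close>

lemma coeff_yp_in_subring:
  assumes R: "subring R" and l: "l \<le> k"
    and w: "\<And>j. coeff (yp l * zp k l) j \<in> R" and p: "\<And>j. coeff (ysp l * zp k l) j \<in> R"
  shows "coeff (yp l) c \<in> R"
proof (induction "l - c" arbitrary: c rule: less_induct)
  case less
  define s where "s = yp l * zp k l - ysp l * zp k l"
  define r where "r = yp l - ysp l"
  \<comment> \<open>The factor x makes the coefficient of y(x) - y(x-1) at l - 1, which is l, sit at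
    position l; the case l = 0 then fits the same pattern.\<close>
  define r' where "r' = pCons 0 r"
  have sR: "coeff s j \<in> R" for j unfolding s_def coeff_diff by (intro subringD(7)[OF R] w p)
  have int: "of_nat n * (- 1) ^ m \<in> R" for n m
  proof -
    have "(of_nat n * (- 1) ^ m :: mpoly) = mconst (of_nat n * (- 1) ^ m)"
      by (simp add: mconst_mult mconst_power mconst_uminus mconst_1) (simp add: mconst_def)
    thus ?thesis using subringD(1)[OF R] by simp
  qed
  show ?case
  proof (cases "c < l")
    case False
    hence "coeff (yp l) c = 1 \<or> coeff (yp l) c = 0" using degree_yp[of l] by (cases "c = l") (auto simp: coeff_eq_0)
    thus ?thesis using subringD(2,3)[OF R] by auto
  next
    case c: True
    have yR: "coeff (yp l) j \<in> R" if "j > c" for j by (rule less.hyps) (use that c in linarith)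
    have rc: "coeff r j = - (\<Sum>i\<in>{Suc j..l}. coeff (yp l) i * (of_nat (i choose j) * (- 1) ^ (i - j)))" if "j \<le> l" for j
    proof -
      have "(\<Sum>i\<le>l. coeff (yp l) i * (of_nat (i choose j) * (- 1) ^ (i - j)))
          = (\<Sum>i\<in>{j..l}. coeff (yp l) i * (of_nat (i choose j) * (- 1) ^ (i - j)))"
        by (rule sum.mono_neutral_right) (auto simp: binomial_eq_0)
      also have "{j..l} = insert j {Suc j..l}" using that by auto
      also have "(\<Sum>i\<in>insert j {Suc j..l}. coeff (yp l) i * (of_nat (i choose j) * (- 1) ^ (i - j)))
          = coeff (yp l) j + (\<Sum>i\<in>{Suc j..l}. coeff (yp l) i * (of_nat (i choose j) * (- 1) ^ (i - j)))"
        by (subst sum.insert) auto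
      finally show ?thesis unfolding r_def coeff_diff coeff_ysp by simp
    qed
    have r'_top: "coeff r' l = of_nat l"
    proof (cases l)
      case (Suc l')
      have "{Suc l'..l} = {l}" using Suc by auto
      thus ?thesis using Suc degree_yp(2)[of l] by (simp add: r'_def rc)
    qed (simp add: r'_def)
    have r'_high: "coeff r' j \<in> R" if "j > c" for j
    proof (cases j)
      case (Suc j')
      show ?thesis
      proof (cases "j' \<le> l")
        case True
        show ?thesis unfolding r'_def Suc coeff_pCons_Suc rc[OF True]
          by (intro subringD(6)[OF R] subring_sum[OF R] subringD(5)[OF R] int yR) (use that Suc in auto)
      next
        case False
        hence "coeff r j' = 0" unfolding r_def using degree_yp(1)[of l] degree_ysp(1)[of l] by (simp add: coeff_eq_0)
        thus ?thesis using subringD(3)[OF R] by (simp add: r'_def Suc)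
      qed
    qed (use that in simp)
    have r'_c: "of_nat c * coeff (yp l) c - coeff r' c \<in> R"
    proof (cases c)
      case 0
      thus ?thesis using subringD(3)[OF R] by (simp add: r'_def)
    next
      case (Suc c')
      have "{Suc c'..l} = insert c {Suc c..l}" using Suc c by auto
      hence "(\<Sum>i\<in>{Suc c'..l}. coeff (yp l) i * (of_nat (i choose c') * (- 1) ^ (i - c')))
         = coeff (yp l) c * (of_nat (c choose c') * (- 1) ^ (c - c')) + (\<Sum>i\<in>{Suc c..l}. coeff (yp l) i * (of_nat (i choose c') * (- 1) ^ (i - c')))"
        by (subst sum.insert[symmetric]) (auto simp only: finite_atLeastAtMost atLeastAtMost_iff)
      moreover have "coeff r' c = coeff r c'" by (simp add: r'_def Suc)
      ultimately have "of_nat c * coeff (yp l) c - coeff r' c = (\<Sum>i\<in>{Suc c..l}. coeff (yp l) i * (of_nat (i choose c') * (- 1) ^ (i - c')))"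
        using rc[of c'] Suc c by (simp add: algebra_simps)
      also have "\<dots> \<in> R" by (intro subring_sum[OF R] subringD(5)[OF R] int yR) auto
      finally show ?thesis .
    qed
    have k0: "k > 0" using c l by simp
    have degw: "coeff (yp l * zp k l) k = 1" "\<And>j. j > k \<Longrightarrow> coeff (yp l * zp k l) j = 0"
      unfolding yp_zp[OF l] using coeff_prod_linear_card[of "{..<k}" mvar] by (auto simp: coeff_eq_0 degree_prod_linear)
    have degp: "coeff (ysp l * zp k l) k = 1" "\<And>j. j > k \<Longrightarrow> coeff (ysp l * zp k l) j = 0"
    proof -
      have ne: "ysp l \<noteq> 0" "zp k l \<noteq> 0" by (auto simp: ysp_def zp_def)
      hence d: "degree (ysp l * zp k l) = k" using l by (simp add: degree_mult_eq degree_ysp degree_zp)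
      have "coeff (ysp l * zp k l) (degree (ysp l) + degree (zp k l)) = 1"
        unfolding coeff_mult_degree_sum using degree_ysp[of l] degree_zp[of k l] by simp
      thus "coeff (ysp l * zp k l) k = 1" using l by (simp add: degree_ysp degree_zp)
      show "\<And>j. j > k \<Longrightarrow> coeff (ysp l * zp k l) j = 0" by (simp add: coeff_eq_0 d)
    qed
    have s_high: "coeff s j = 0" if "j \<ge> k" for j
      unfolding s_def coeff_diff using degw degp that by (cases "j = k") auto
    have eq: "pCons 0 s * yp l = r' * (yp l * zp k l)"
      unfolding s_def r'_def r_def by (simp add: algebra_simps)
    have lhs: "coeff (pCons 0 s * yp l) (k + j) = (\<Sum>b\<in>{Suc j..l}. coeff (pCons 0 s) (k + j - b) * coeff (yp l) b) + coeff s (k - 1) * coeff (yp l) j"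
      if "j \<le> l" for j
    proof -
      have "coeff (pCons 0 s * yp l) (k + j) = (\<Sum>b\<le>k + j. coeff (yp l) b * coeff (pCons 0 s) (k + j - b))"
        unfolding mult.commute[of "pCons 0 s"] by (rule coeff_mult)
      also have "\<dots> = (\<Sum>b\<in>{j..l}. coeff (yp l) b * coeff (pCons 0 s) (k + j - b))"
      proof (rule sum.mono_neutral_right)
        show "\<forall>b\<in>{..k + j} - {j..l}. coeff (yp l) b * coeff (pCons 0 s) (k + j - b) = 0"
        proof
          fix b assume "b \<in> {..k + j} - {j..l}"
          hence "b > l \<or> b < j" by auto
          thus "coeff (yp l) b * coeff (pCons 0 s) (k + j - b) = 0"
          proof
            assume "b > l" thus ?thesis by (simp add: coeff_eq_0 degree_yp)
          next
            assume b: "b < j"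
            hence "k + j - b = Suc (k + j - b - 1)" by simp
            hence "coeff (pCons 0 s) (k + j - b) = coeff s (k + j - b - 1)" by (metis coeff_pCons_Suc)
            thus ?thesis using b s_high[of "k + j - b - 1"] by simp
          qed
        qed
      qed (use that l in auto)
      also have "{j..l} = insert j {Suc j..l}" using that by auto
      also have "(\<Sum>b\<in>insert j {Suc j..l}. coeff (yp l) b * coeff (pCons 0 s) (k + j - b))
         = coeff (yp l) j * coeff (pCons 0 s) k + (\<Sum>b\<in>{Suc j..l}. coeff (yp l) b * coeff (pCons 0 s) (k + j - b))"
        by (subst sum.insert) auto
      also have "coeff (pCons 0 s) k = coeff s (k - 1)" using k0 by (cases k) auto
      finally show ?thesis by (simp add: mult.commute add.commute)
    qed
    have rhs: "coeff (r' * (yp l * zp k l)) (k + j) = coeff r' j + (\<Sum>i\<in>{Suc j..k + j}. coeff r' i * coeff (yp l * zp k l) (k + j - i))" for j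
    proof -
      have "coeff (r' * (yp l * zp k l)) (k + j) = (\<Sum>i\<le>k + j. coeff r' i * coeff (yp l * zp k l) (k + j - i))" by (rule coeff_mult)
      also have "\<dots> = (\<Sum>i\<in>{j..k + j}. coeff r' i * coeff (yp l * zp k l) (k + j - i))"
        by (rule sum.mono_neutral_right) (auto simp: degw(2))
      also have "{j..k + j} = insert j {Suc j..k + j}" by auto
      finally show ?thesis by (simp add: degw(1))
    qed
    have s_top: "coeff s (k - 1) = of_nat l"
    proof -
      have z: "coeff r' i = 0" if "i > l" for i
      proof (cases i)
        case (Suc i')
        hence "i' > l \<or> i' = l" using that by auto
        hence "coeff r i' = 0" unfolding r_def using degree_yp[of l] degree_ysp[of l] by (auto simp: coeff_eq_0)
        thus ?thesis by (simp add: r'_def Suc)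
      qed (use that in simp)
      have "(\<Sum>i\<in>{Suc l..k + l}. coeff r' i * coeff (yp l * zp k l) (k + l - i)) = 0"
        by (rule sum.neutral) (auto simp: z)
      hence "coeff (r' * (yp l * zp k l)) (k + l) = of_nat l" using rhs[of l] r'_top by simp
      moreover have "coeff (pCons 0 s * yp l) (k + l) = coeff s (k - 1)" using lhs[of l] degree_yp(2)[of l] by simp
      ultimately show ?thesis using eq by simp
    qed
    let ?A = "\<Sum>b\<in>{Suc c..l}. coeff (pCons 0 s) (k + c - b) * coeff (yp l) b"
    let ?B = "\<Sum>i\<in>{Suc c..k + c}. coeff r' i * coeff (yp l * zp k l) (k + c - i)"
    have sR': "coeff (pCons 0 s) j \<in> R" for j using sR subringD(3)[OF R] by (cases j) auto
    have A: "?A \<in> R" by (intro subring_sum[OF R] subringD(5)[OF R] sR' yR) auto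
    have B: "?B \<in> R" by (intro subring_sum[OF R] subringD(5)[OF R] r'_high w) auto
    \<comment> \<open>The coefficient of x^(k+c) in \<open>eq\<close>. \<open>?A\<close> and
      \<open>?B\<close> lie in the ring, and \<open>r'_c\<close> replaces the coefficient of
      \<open>r'\<close> at c by c y_c up to an element of the ring; what remains is (l - c)
      y_c.\<close>
    have "?A + of_nat l * coeff (yp l) c = coeff r' c + ?B"
      using lhs[of c] rhs[of c] eq c s_top by simp
    hence "of_nat l * coeff (yp l) c - of_nat c * coeff (yp l) c = ?B - ?A - (of_nat c * coeff (yp l) c - coeff r' c)"
      by (simp add: algebra_simps)
    also have "\<dots> \<in> R" by (intro subringD(7)[OF R] A B r'_c)
    finally have "of_nat l * coeff (yp l) c - of_nat c * coeff (yp l) c \<in> R" .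
    also have "of_nat l * coeff (yp l) c - of_nat c * coeff (yp l) c = mconst (of_nat l - of_nat c) * coeff (yp l) c"
      by (simp add: mconst_diff left_diff_distrib) (simp add: mconst_def)
    finally have mR: "mconst (of_nat l - of_nat c) * coeff (yp l) c \<in> R" .
    have "mconst (1 / (of_nat l - of_nat c)) * (mconst (of_nat l - of_nat c) * coeff (yp l) c) \<in> R"
      by (rule subringD(5)[OF R subringD(1)[OF R] mR])
    moreover have "mconst (1 / (of_nat l - of_nat c)) * (mconst (of_nat l - of_nat c) * coeff (yp l) c) = coeff (yp l) c"
    proof -
      have "(of_nat l - of_nat c :: complex) \<noteq> 0" using c by simp
      hence "mconst (1 / (of_nat l - of_nat c) * (of_nat l - of_nat c)) = 1" by (simp add: mconst_1 del: of_nat_diff)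
      thus ?thesis unfolding mult.assoc[symmetric] mconst_mult[symmetric] by (simp only: mult_1_left)
    qed
    ultimately show ?thesis by (simp only:)
  qed
qed

text \<open>The ideal contributes yz, so \<open>R\<close> contains y and with it the power sums of
  the first block. Those of all variables come from yz, and the difference gives the second
  block.\<close>

lemma inv_ring_generated_by_transfer:
  assumes R: "subring R" and l: "l \<le> k" and roots: "roots_of k eps \<rho>"
    and I: "gen_ideal k l eps \<subseteq> R" and p: "\<And>j. coeff (ysp l * zp k l) j \<in> R"
  shows "inv_ring k l \<subseteq> R"
proof
  fix q assume q: "q \<in> inv_ring k l"
  have w: "coeff (yp l * zp k l) j \<in> R" for j
  proof -
    have "coeff (yp l * zp k l) j - mconst (coeff (\<Prod>i<k. [:- \<rho> i, 1:]) j) \<in> R"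
      using coeff_wpoly_gideal[OF subring_inv_ring[of k l] roots, of j] I unfolding yp_zp[OF l] gen_ideal_eq by blast
    from subringD(4)[OF R this subringD(1)[OF R, of "coeff (\<Prod>i<k. [:- \<rho> i, 1:]) j"]] show ?thesis by simp
  qed
  have ps1: "psum {..<l} m \<in> R" for m
    by (rule psum_in_subring[OF R finite_lessThan]) (fold yp_def, rule coeff_yp_in_subring[OF R l w p])
  have "psum {..<k} m \<in> R" for m
    by (rule psum_in_subring[OF R finite_lessThan]) (fold yp_zp[OF l], rule w)
  moreover have "psum {..<k} m = psum {..<l} m + psum {l..<k} m" for m
  proof -
    have e: "{..<l} \<union> {l..<k} = {..<k}" using l by auto
    show ?thesis unfolding psum_def e[symmetric] by (rule sum.union_disjoint) auto
  qed
  ultimately have ps2: "psum {l..<k} m \<in> R" for m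
    using subringD(7)[OF R, of "psum {..<k} m" "psum {..<l} m" for m] ps1 by (metis add_diff_cancel_left')
  show "q \<in> R" by (rule inv_ring_generated[OF R l ps1 ps2 q])
qed

locale tframe = frame +
  fixes q1 q2 :: complex
  assumes F: "smult q1 (\<Prod>s<k. [:P0 s, 1:]) - smult q2 (\<Prod>s<k. [:Q0 s, 1:]) = smult (q1 - q2) (\<Prod>i<k. [:- \<rho> i, 1:])"
    and qne: "q1 \<noteq> q2"
begin

text \<open>The matrix entry from \<open>S\<close> to \<open>S'\<close> of the transfer matrix with
  denominators cleared, as a polynomial in the spectral parameter.\<close>

definition taup :: "nat set \<Rightarrow> nat set \<Rightarrow> complex poly" where
  "taup S' S = tauop [:q1:] [:q2:] (\<lambda>s. [:P0 s:]) (\<lambda>s. [:Q0 s:]) k [:0, 1:] (delta S) S'"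

definition RHS :: "mpoly poly" where
  "RHS = [:mconst (q1 - q2):] * ysp l * zp k l"

abbreviation "\<iota> \<equiv> map_poly mconst"

lemma iota_hom: "\<iota> 0 = 0" "\<iota> 1 = 1" "\<iota> (p + q) = \<iota> p + \<iota> q" "\<iota> (p * q) = \<iota> p * \<iota> q"
  "\<iota> (prod f A) = (\<Prod>a\<in>A. \<iota> (f a))" "\<iota> [:a, 1:] = [:mconst a, 1:]"
  using map_poly_hom[of mconst] by (simp_all add: mconst_add mconst_mult mconst_1)

lemma RHS_inv: "coeff RHS m \<in> inv_ring k l"
proof -
  have perm: "(\<Prod>i\<in>A. [:f (\<pi> i), 1:]) = (\<Prod>i\<in>A. [:f i, 1:])" if "\<pi> ` A = A" "inj \<pi>" for f :: "nat \<Rightarrow> mpoly" and A \<pi>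
    using prod.reindex[of \<pi> A "\<lambda>i. [:f i, 1:]"] that by (simp add: inj_on_subset)
  have "coeff RHS m = mconst (q1 - q2) * coeff (ysp l * zp k l) m" by (simp add: RHS_def mult.assoc)
  moreover have "coeff (ysp l * zp k l) m \<in> inv_ring k l"
    unfolding inv_ring_iff
  proof (intro conjI ballI)
    have "map_poly (trunc k) (ysp l * zp k l) = ysp l * zp k l"
      unfolding ysp_def zp_def using lk by (simp add: map_poly_hom[of "trunc k"])
    thus "trunc k (coeff (ysp l * zp k l) m) = coeff (ysp l * zp k l) m"
      using coeff_map_poly[of "trunc k" "ysp l * zp k l" m] by simp
    fix \<pi> assume \<pi>: "\<pi> \<in> Gp k l"
    hence inj: "inj \<pi>" and im: "\<pi> ` {..<l} = {..<l}" and imk: "\<pi> ` fl = fl"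
      by (auto simp: Gp_def permutes_inj permutes_image)
    have "\<pi> ` {l..<k} = \<pi> ` fl - \<pi> ` {..<l}"
      unfolding image_set_diff[OF inj, symmetric] by (rule arg_cong[where f="(`) \<pi>"]) (use lk in auto)
    also have "\<dots> = fl - {..<l}" by (simp only: im imk)
    also have "\<dots> = {l..<k}" using lk by auto
    finally have im2: "\<pi> ` {l..<k} = {l..<k}" .
    have "map_poly (rename \<pi>) (ysp l * zp k l) = (\<Prod>i<l. [:- mvar (\<pi> i) - 1, 1:]) * (\<Prod>j\<in>{l..<k}. [:- mvar (\<pi> j), 1:])"
      unfolding ysp_def zp_def by (simp add: map_poly_hom[of "rename \<pi>"])
    also have "\<dots> = ysp l * zp k l"
      unfolding ysp_def zp_def using perm[OF im inj, of "\<lambda>i. - mvar i - 1"] perm[OF im2 inj, of "\<lambda>i. - mvar i"] by simp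
    finally show "rename \<pi> (coeff (ysp l * zp k l) m) = coeff (ysp l * zp k l) m"
      using coeff_map_poly[of "rename \<pi>" "ysp l * zp k l" m] by simp
  qed
  ultimately show ?thesis by (simp only: inv_ring_closed)
qed

text \<open>The off-shell Bethe vector is an eigenvector modulo the ideal because F(w_i) lies there:
  F is congruent to (q1 - q2) y z, which vanishes at w_i. The cleared denominators leave a factor
  y(t); y is monic, so it cancels coefficientwise, and the Vandermonde factor between
  \<open>Gs\<close> and \<open>g\<close> is cancelled last.\<close>

lemma transfer_relation:
  assumes S': "S' \<in> W"
  shows "(\<Sum>S\<in>W. mconst (coeff (taup S' S) m) * g S) - coeff RHS m * g S' \<in> gen_ideal k l eps"
proof -
  let ?c = "\<lambda>p::mpoly. [:p:]"
  let ?I = "gideal UNIV k eps"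
  \<comment> \<open>Polynomials in the spectral parameter with coefficients in the ideal, whose own
    coefficient ring stays unrestricted until \<open>gideal_UNIV_trunc\<close>.\<close>
  define J where "J = {r :: mpoly poly. \<forall>j. coeff r j \<in> ?I}"
  note Iadd = gideal_add[OF subring_UNIV] and Imult = gideal_mult[OF subring_UNIV UNIV_I]
    and Idiff = gideal_diff[OF subring_UNIV] and I0 = gideal_0[OF subring_UNIV] and Isum = gideal_sum[OF subring_UNIV]
  have J0: "0 \<in> J" unfolding J_def using I0 by simp
  have Jd: "a - b \<in> J" if "a \<in> J" "b \<in> J" for a b using that unfolding J_def by (auto intro: Idiff)
  have Jm: "a * b \<in> J" if "b \<in> J" for a b using that unfolding J_def by (auto simp: coeff_mult intro: Isum Imult)
  have Ja: "a + b \<in> J" if "a \<in> J" "b \<in> J" for a b using that unfolding J_def by (auto intro: Iadd)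
  let ?F0 = "\<Prod>i<k. [:- \<rho> i, 1:]"
  let ?wp = "yp l * zp k l"
  have wpF: "?wp - \<iota> ?F0 \<in> J"
    unfolding J_def mem_Collect_eq coeff_diff yp_zp[OF lk]
    using coeff_wpoly_gideal[OF subring_UNIV roots] by (simp add: coeff_map_poly)
  let ?P = "\<lambda>s. ?c (Pm s)" and ?Q = "\<lambda>s. ?c (Qm s)" and ?t = "[:0, 1:] :: mpoly poly"
  have Fv: "Fval (?c (mconst q1)) (?c (mconst q2)) ?P ?Q k x = pcompose (\<iota> (smult q1 (\<Prod>s<k. [:P0 s, 1:]) - smult q2 (\<Prod>s<k. [:Q0 s, 1:]))) x" for x
  proof -
    have sm: "\<iota> (smult a p) = smult (mconst a) (\<iota> p)" for a p
      by (rule poly_eqI) (simp add: coeff_map_poly mconst_mult)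
    have df: "\<iota> (p - q) = \<iota> p - \<iota> q" for p q
      by (rule poly_eqI) (simp add: coeff_map_poly mconst_diff)
    show ?thesis unfolding Fval_def df sm iota_hom pcompose_diff pcompose_smult pcompose_prod
      by (simp add: pcompose_pCons add.commute)
  qed
  have sm: "\<iota> (smult a p) = smult (mconst a) (\<iota> p)" for a p
    by (rule poly_eqI) (simp add: coeff_map_poly mconst_mult)
  have Fv': "Fval (?c (mconst q1)) (?c (mconst q2)) ?P ?Q k x = smult (mconst (q1 - q2)) (pcompose (\<iota> ?F0) x)" for x
    unfolding Fv F sm pcompose_smult ..
  have Ft: "Fval (?c (mconst q1)) (?c (mconst q2)) ?P ?Q k ?t = smult (mconst (q1 - q2)) (\<iota> ?F0)"
    unfolding Fv' by simp
  have FJ: "Fval (?c (mconst q1)) (?c (mconst q2)) ?P ?Q k (?c (mvar i)) \<in> J" if "i < l" for i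
  proof -
    have "poly ?wp (mvar i) = 0" unfolding yp_zp[OF lk] poly_prod
      using that lk by (intro prod_zero) (auto intro!: bexI[of _ i])
    have pc: "pcompose p (?c x) = ?c (poly p x)" for p :: "mpoly poly" and x
      by (induction p) (simp_all add: pcompose_pCons)
    have "poly (\<iota> ?F0) (mvar i) = - poly (?wp - \<iota> ?F0) (mvar i)" using \<open>poly ?wp (mvar i) = 0\<close> by simp
    also have "\<dots> = - (\<Sum>j\<le>degree (?wp - \<iota> ?F0). mvar i ^ j * coeff (?wp - \<iota> ?F0) j)"
      by (simp add: poly_altdef mult.commute)
    also have "\<dots> \<in> ?I"
      by (intro gideal_uminus[OF subring_UNIV] Isum Imult) (use wpF in \<open>simp add: J_def\<close>)
    finally have "mconst (q1 - q2) * poly (\<iota> ?F0) (mvar i) \<in> ?I" by (rule Imult)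
    thus ?thesis unfolding Fv' pc J_def using I0 by (auto simp: coeff_pCons split: nat.splits)
  qed
  let ?ws = "map ?c (map mvar [0..<l])"
  have GlA: "Gl ?P ?Q k vac ?ws = (\<lambda>S. ?c (G vac (map mvar [0..<l]) S))"
  proof
    fix S
    show "Gl ?P ?Q k vac ?ws S = ?c (G vac (map mvar [0..<l]) S)"
      by (rule Gl_hom[of ?c, symmetric]) (simp_all add: one_pCons)
  qed
  have main: "(\<Prod>w\<leftarrow>?ws. ?t - w) * tauop (?c (mconst q1)) (?c (mconst q2)) ?P ?Q k ?t (Gl ?P ?Q k vac ?ws) S'
      - Fval (?c (mconst q1)) (?c (mconst q2)) ?P ?Q k ?t * (\<Prod>w\<leftarrow>?ws. ?t - w - 1) * Gl ?P ?Q k vac ?ws S' \<in> J"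
    by (rule tauop_Gl_mod[OF J0 Jd Jm]) (use FJ in auto)
  have y: "(\<Prod>w\<leftarrow>?ws. ?t - w) = yp l"
  proof -
    have "(\<Prod>w\<leftarrow>?ws. ?t - w) = (\<Prod>i\<leftarrow>[0..<l]. [:- mvar i, 1:])"
      by (simp add: o_def)
    thus ?thesis unfolding yp_def prod.distinct_set_conv_list[OF distinct_upt, symmetric] by (simp add: atLeast0LessThan)
  qed
  have ys: "(\<Prod>w\<leftarrow>?ws. ?t - w - 1) = ysp l"
  proof -
    have "(\<Prod>w\<leftarrow>?ws. ?t - w - 1) = (\<Prod>i\<leftarrow>[0..<l]. [:- mvar i - 1, 1:])"
      by (simp add: o_def one_pCons)
    thus ?thesis unfolding ysp_def prod.distinct_set_conv_list[OF distinct_upt, symmetric] by (simp add: atLeast0LessThan)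
  qed
  have tauA: "tauop (?c (mconst q1)) (?c (mconst q2)) ?P ?Q k ?t (delta S) S' = \<iota> (taup S' S)" for S
  proof -
    have opd: "\<iota> (opT (\<lambda>s. [:0, 1:] + [:P0 s:]) (\<lambda>s. [:0, 1:] + [:Q0 s:]) (\<lambda>_. 1) k i i (delta S) S')
      = opT (\<lambda>s. ?t + ?P s) (\<lambda>s. ?t + ?Q s) (\<lambda>_. 1) k i i (delta S) S'" for i
    proof -
      have dl: "(\<lambda>R. \<iota> (delta S R)) = (delta S :: nat set \<Rightarrow> mpoly poly)" by (auto simp: delta_def iota_hom fun_eq_iff)
      show ?thesis by (subst opT_hom[of \<iota>]) (simp_all add: iota_hom dl)
    qed
    have df: "\<iota> (p - q) = \<iota> p - \<iota> q" for p q
      by (rule poly_eqI) (simp add: coeff_map_poly mconst_diff)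
    have cc: "\<iota> [:a:] = ?c (mconst a)" for a by (rule poly_eqI) (simp add: coeff_map_poly coeff_pCons split: nat.splits)
    show ?thesis unfolding taup_def tauop_def df iota_hom(4) opd cc ..
  qed
  have tauG: "tauop (?c (mconst q1)) (?c (mconst q2)) ?P ?Q k ?t (Gl ?P ?Q k vac ?ws) S' = (\<Sum>S\<in>W. ?c (Gs S) * \<iota> (taup S' S))"
  proof -
    have "Gl ?P ?Q k vac ?ws = (\<lambda>R. \<Sum>S\<in>W. ?c (Gs S) * delta S R)"
    proof
      fix R
      have cs: "?c (sum f A) = (\<Sum>a\<in>A. ?c (f a))" for f :: "nat set \<Rightarrow> mpoly" and A
      proof (induction A rule: infinite_finite_induct)
        case (insert x A)
        have "?c (f x + sum f A) = ?c (f x) + ?c (sum f A)" by simp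
        thus ?case using insert by (simp only: sum.insert not_False_eq_True)
      qed auto
      show "Gl ?P ?Q k vac ?ws R = (\<Sum>S\<in>W. ?c (Gs S) * delta S R)"
        unfolding GlA Gs_expand cs by (intro sum.cong refl) (simp add: delta_def)
    qed
    hence "tauop (?c (mconst q1)) (?c (mconst q2)) ?P ?Q k ?t (Gl ?P ?Q k vac ?ws) S'
      = (\<Sum>S\<in>W. ?c (Gs S) * tauop (?c (mconst q1)) (?c (mconst q2)) ?P ?Q k ?t (delta S) S')"
      unfolding tauop_def by (simp only: opT_sum[OF finite_Wset] right_diff_distrib sum_subtractf sum_distrib_left mult.left_commute)
    thus ?thesis unfolding tauA .
  qed
  define r where "r = (\<Sum>S\<in>W. ?c (Gs S) * \<iota> (taup S' S)) - RHS * ?c (Gs S')"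
  have "yp l * r \<in> J"
  proof -
    have "yp l * r = (yp l * (\<Sum>S\<in>W. ?c (Gs S) * \<iota> (taup S' S)) - smult (mconst (q1 - q2)) (\<iota> ?F0) * ysp l * ?c (Gs S'))
      - (?c (mconst (q1 - q2)) * ysp l * ?c (Gs S')) * (?wp - \<iota> ?F0)"
      unfolding r_def RHS_def by (simp add: algebra_simps)
    also have "\<dots> \<in> J"
      by (rule Jd[OF main[unfolded y ys tauG Ft, unfolded GlA, folded Gs_def] Jm[OF wpF]])
    finally show ?thesis .
  qed
  hence "coeff (yp l * r) j \<in> ?I" for j by (simp add: J_def)
  hence rI: "coeff r m \<in> ?I"
    by (intro monic_cancel_ideal[of ?I "yp l" r] I0 Idiff Imult) (simp_all add: degree_yp)
  have rm: "coeff r m = VA {..<l} * ((\<Sum>S\<in>W. mconst (coeff (taup S' S) m) * g S) - coeff RHS m * g S')"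
  proof -
    have "coeff r m = (\<Sum>S\<in>W. Gs S * mconst (coeff (taup S' S) m)) - coeff RHS m * Gs S'"
      unfolding r_def by (simp add: coeff_sum coeff_map_poly mult.commute)
    thus ?thesis unfolding g(2) by (simp add: right_diff_distrib sum_distrib_left mult_ac)
  qed
  let ?q = "(\<Sum>S\<in>W. mconst (coeff (taup S' S) m) * g S) - coeff RHS m * g S'"
  have q: "?q \<in> inv_ring k l" by (intro inv_ring_closed(2,3,5) inv_ring_sum g RHS_inv)
  have "trunc k (coeff r m) = coeff r m"
    using subringD(5)[OF subring_truncs truncs_intros(5) inv_trunc[OF q]] unfolding rm truncs_def by simp
  hence "VA {..<l} * ?q \<in> II" using gideal_UNIV_trunc[OF rI] unfolding rm by simp
  hence "VA {l..<k} * (VA {..<l} * ?q) \<in> II" by (rule gideal_mult[OF subring_truncs truncs_intros(6)])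
  hence "?q * VB k l \<in> II" unfolding VB_def by (simp only: mult_ac)
  thus ?thesis by (rule gideal_cancel_VB[OF lk q])
qed

end

section \<open>The Yangian action in coordinates\<close>

abbreviation fps_coeff :: "'a fps \<Rightarrow> nat \<Rightarrow> 'a" (infixl "$" 75) where "f $ n \<equiv> fps_nth f n"

text \<open>The entries p, q, e of \<open>opT\<close> for an evaluation module, expanded in x^(-1):
  1 + \<lambda>_1/(x-b), 1 - \<lambda>_2/(x-b) and 1/(x-b).\<close>

definition "pf lam b s = 1 + fps_const (fst (lam s :: complex \<times> complex)) * geo (b s)"
definition "qf lam b s = 1 - fps_const (snd (lam s :: complex \<times> complex)) * geo (b s)"
definition "ef b s = geo (b s)"

lemma fac_ser_simps:
  "fac_ser (lam s) (b s) 0 0 0 0 = pf lam b s" "fac_ser (lam s) (b s) 0 0 (Suc 0) (Suc 0) = pf lam b s - ef b s"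
  "fac_ser (lam s) (b s) 0 0 0 (Suc 0) = 0" "fac_ser (lam s) (b s) 0 0 (Suc 0) 0 = 0"
  "fac_ser (lam s) (b s) (Suc 0) (Suc 0) 0 0 = qf lam b s" "fac_ser (lam s) (b s) (Suc 0) (Suc 0) (Suc 0) (Suc 0) = qf lam b s - ef b s"
  "fac_ser (lam s) (b s) (Suc 0) (Suc 0) 0 (Suc 0) = 0" "fac_ser (lam s) (b s) (Suc 0) (Suc 0) (Suc 0) 0 = 0"
  "fac_ser (lam s) (b s) 0 (Suc 0) (Suc 0) 0 = - ef b s" "fac_ser (lam s) (b s) 0 (Suc 0) 0 0 = 0"
  "fac_ser (lam s) (b s) 0 (Suc 0) 0 (Suc 0) = 0" "fac_ser (lam s) (b s) 0 (Suc 0) (Suc 0) (Suc 0) = 0"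
  "fac_ser (lam s) (b s) (Suc 0) 0 0 (Suc 0) = pf lam b s - qf lam b s" "fac_ser (lam s) (b s) (Suc 0) 0 0 0 = 0"
  "fac_ser (lam s) (b s) (Suc 0) 0 (Suc 0) 0 = 0" "fac_ser (lam s) (b s) (Suc 0) 0 (Suc 0) (Suc 0) = 0"
  by (rule fps_ext; simp add: fac_ser_def emat_def pf_def qf_def ef_def algebra_simps)+

lemma chains_Suc:
  assumes "i \<le> 1"
  shows "chains (Suc k) i j = (\<lambda>c. c(Suc k := i)) ` chains k 0 j \<union> (\<lambda>c. c(Suc k := i)) ` chains k 1 j"
proof (intro equalityI subsetI)
  fix c assume c: "c \<in> chains (Suc k) i j"
  hence ck: "c k \<le> 1" and i: "c (Suc k) = i" by (auto simp: chains_def)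
  have "c(Suc k := 0) \<in> chains k (c k) j" using c by (auto simp: chains_def)
  moreover have "c = (c(Suc k := 0))(Suc k := i)" using i by auto
  moreover have "c k = 0 \<or> c k = 1" using ck by auto
  ultimately show "c \<in> (\<lambda>c. c(Suc k := i)) ` chains k 0 j \<union> (\<lambda>c. c(Suc k := i)) ` chains k 1 j"
    by (metis UnI1 UnI2 image_eqI)
qed (use assms in \<open>auto simp: chains_def le_Suc_eq\<close>)

lemma chains_0: "j \<le> 1 \<Longrightarrow> chains 0 i j = (if i = j then {\<lambda>s. if s = 0 then j else 0} else {})"
  by (auto simp: chains_def fun_eq_iff)

lemma finite_chains: "i \<le> 1 \<Longrightarrow> j \<le> 1 \<Longrightarrow> finite (chains k i j)"
proof (induction k arbitrary: i)
  case 0 thus ?case by (simp add: chains_0)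
next
  case (Suc k) thus ?case by (simp add: chains_Suc[OF Suc.prems(1)])
qed

lemma sum_chains_Suc:
  assumes "i \<le> 1" "j \<le> 1"
  shows "(\<Sum>c\<in>chains (Suc k) i j. f c) = (\<Sum>c\<in>chains k 0 j. f (c(Suc k := i))) + (\<Sum>c\<in>chains k 1 j. f (c(Suc k := i)))"
proof -
  have inj: "inj_on (\<lambda>c. c(Suc k := i)) (chains k r j)" for r
  proof (rule inj_onI)
    fix c c' assume "c \<in> chains k r j" "c' \<in> chains k r j" and eq: "c(Suc k := i) = c'(Suc k := i)"
    hence "c (Suc k) = 0" "c' (Suc k) = 0" by (auto simp: chains_def)
    moreover have "c s = c' s" if "s \<noteq> Suc k" for s using fun_cong[OF eq, of s] that by simp
    ultimately show "c = c'" by (metis ext)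
  qed
  have disj: "(\<lambda>c. c(Suc k := i)) ` chains k 0 j \<inter> (\<lambda>c. c(Suc k := i)) ` chains k 1 j = {}"
  proof -
    have "c k = 0" if "c \<in> (\<lambda>c. c(Suc k := i)) ` chains k 0 j" for c using that by (auto simp: chains_def)
    moreover have "c k = 1" if "c \<in> (\<lambda>c. c(Suc k := i)) ` chains k 1 j" for c using that by (auto simp: chains_def)
    ultimately show ?thesis by (metis disjoint_iff zero_neq_one)
  qed
  show ?thesis unfolding chains_Suc[OF assms(1)]
    by (subst sum.union_disjoint) (use assms finite_chains disj in \<open>auto simp: sum.reindex[OF inj] o_def\<close>)
qed

text \<open>The global Koszul sign factors over the tensor positions: an odd operator in position
  \<open>t\<close> contributes \<open>sg t S\<close> for the input set \<open>S\<close>.\<close>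

definition chain_wt :: "(nat \<Rightarrow> complex \<times> complex) \<Rightarrow> (nat \<Rightarrow> complex) \<Rightarrow> nat set \<Rightarrow> nat set \<Rightarrow> nat \<Rightarrow> nat \<Rightarrow> nat \<Rightarrow> complex fps" where
  "chain_wt lam b S' S t a a' = (if a = a' then 1 else sg t S) * fac_ser (lam t) (b t) a a' (ind S' t) (ind S t)"

lemma ksign_prod:
  assumes "c \<in> chains k i j"
  shows "fps_const (ksign k c S) = (\<Prod>t<k. if c (Suc t) = c t then 1 else sg t S :: complex fps)"
proof -
  have e: "(\<Sum>s<t. ind S s) = card (S \<inter> {..<t})" for t
  proof -
    have "(\<Sum>s<t. ind S s) = (\<Sum>s\<in>{..<t}. if s \<in> S then 1 else 0)" by (simp add: ind_def)
    also have "\<dots> = card ({..<t} \<inter> S)" by (subst sum.inter_restrict[symmetric]) simp_all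
    finally show ?thesis by (simp add: Int_commute)
  qed
  have "(\<Prod>t<k. if c (Suc t) = c t then 1 else sg t S :: complex fps) = (\<Prod>t<k. fps_const ((-1) ^ (((c (Suc t) + c t) mod 2) * card (S \<inter> {..<t}))))"
  proof (intro prod.cong refl)
    fix t assume "t \<in> {..<k}"
    hence "c t \<le> 1" "c (Suc t) \<le> 1" using assms by (auto simp: chains_def)
    hence ct: "c t = 0 \<or> c t = 1" "c (Suc t) = 0 \<or> c (Suc t) = 1" by auto
    have m: "fps_const ((- 1) ^ n :: complex) = (- 1) ^ n" for n
      by (metis fps_const_1_eq_1 fps_const_neg fps_const_power)
    show "(if c (Suc t) = c t then 1 else sg t S :: complex fps) = fps_const ((-1) ^ (((c (Suc t) + c t) mod 2) * card (S \<inter> {..<t})))"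
      using ct by (auto simp: sg_def m)
  qed
  also have "\<dots> = fps_const (\<Prod>t<k. (-1) ^ (((c (Suc t) + c t) mod 2) * card (S \<inter> {..<t})))"
    by (induction k) (simp_all add: fps_const_mult)
  also have "(\<Prod>t<k. (-1 :: complex) ^ (((c (Suc t) + c t) mod 2) * card (S \<inter> {..<t}))) = ksign k c S"
    unfolding ksign_def sum_distrib_left[symmetric] e by (rule power_sum[symmetric])
  finally show ?thesis ..
qed

lemma Tser_chain_wt:
  assumes "S' \<in> carrier k" "S \<in> carrier k"
  shows "Tser k lam b i j (S', S) = (\<Sum>c\<in>chains k i j. \<Prod>t<k. chain_wt lam b S' S t (c (Suc t)) (c t))"
  using assms by (auto simp: Tser_def ksign_prod chain_wt_def prod.distrib intro!: sum.cong)

lemma chain_wt_cong: "t \<noteq> k \<Longrightarrow> chain_wt lam b (S' - {k}) S t a a' = chain_wt lam b S' S t a a'"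
  "t \<noteq> k \<Longrightarrow> chain_wt lam b (insert k S') S t a a' = chain_wt lam b S' S t a a'"
  by (auto simp: chain_wt_def ind_def)

text \<open>Converts between the sign of the input set, used in \<open>ksign\<close>, and that of
  the output set, used in \<open>opT\<close>.\<close>

lemma opT_delta_sg:
  assumes "i \<le> 1" "j \<le> 1"
  shows "sg k S * opT p q e k i j (delta S) S' = (-1) ^ (i + j) * sg k S' * opT p q e k i j (delta S) S'"
proof -
  have "(\<lambda>R. sg k R * delta S R) = (\<lambda>R. sg k S * delta S R)" by (auto simp: delta_def)
  from opT_sg[OF assms order_refl, of p q e k "delta S" S', unfolded this opT_cmult] show ?thesis .
qed

text \<open>Unfolding the recursion of \<open>opT\<close> lists the intermediate indices of the
  coproduct. For a basis input the output must agree with it from position \<open>k\<close> on; the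
  four cases of the inductive step record whether position \<open>k\<close> is occupied in the
  output and in the input.\<close>

lemma opT_chains:
  assumes "i \<le> 1" "j \<le> 1"
  shows "opT (pf lam b) (qf lam b) (ef b) k i j (delta S) S' =
    (if S' - {..<k} = S - {..<k} then \<Sum>c\<in>chains k i j. \<Prod>t<k. chain_wt lam b S' S t (c (Suc t)) (c t) else 0)"
  using assms(1)
proof (induction k arbitrary: i S')
  case 0
  show ?case using assms(2) by (auto simp: chains_0 delta_def)
next
  case (Suc k)
  let ?T = "\<lambda>r S'. opT (pf lam b) (qf lam b) (ef b) k r j (delta S) S'"
  let ?C = "\<lambda>r S'. \<Sum>c\<in>chains k r j. \<Prod>t<k. chain_wt lam b S' S t (c (Suc t)) (c t)"
  have CD: "?C r (S' - {k}) = ?C r S'" "?C r (insert k S') = ?C r S'" for r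
    by (intro sum.cong prod.cong refl chain_wt_cong; simp)+
  have step: "(\<Sum>c\<in>chains k r j. \<Prod>t<Suc k. chain_wt lam b S' S t ((c(Suc k := i)) (Suc t)) ((c(Suc k := i)) t))
      = chain_wt lam b S' S k i r * ?C r S'" for r
  proof -
    have "(\<Prod>t<Suc k. chain_wt lam b S' S t ((c(Suc k := i)) (Suc t)) ((c(Suc k := i)) t))
      = chain_wt lam b S' S k i r * (\<Prod>t<k. chain_wt lam b S' S t (c (Suc t)) (c t))" if "c \<in> chains k r j" for c
    proof -
      have "c k = r" using that by (simp add: chains_def)
      thus ?thesis by (simp add: mult.commute)
    qed
    thus ?thesis unfolding sum_distrib_left by (intro sum.cong refl)
  qed
  have rhs: "(\<Sum>c\<in>chains (Suc k) i j. \<Prod>t<Suc k. chain_wt lam b S' S t (c (Suc t)) (c t))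
     = chain_wt lam b S' S k i 0 * ?C 0 S' + chain_wt lam b S' S k i 1 * ?C 1 S'"
    unfolding sum_chains_Suc[OF Suc.prems assms(2)] step ..
  have IH: "?T r R = (if R - {..<k} = S - {..<k} then ?C r R else 0)" if "r \<le> 1" for r R
    using Suc.IH[OF that] .
  have sgi: "sg k S * ?T r R = (-1) ^ (r + j) * sg k R * ?T r R" if "r \<le> 1" for r R
    by (rule opT_delta_sg[OF that assms(2)])
  have sets: "S' - {..<Suc k} = S - {..<Suc k} \<longleftrightarrow> S' - {..<k} - {k} = S - {..<k} - {k}"
    by (auto simp: lessThan_Suc)
  have i: "i = 0 \<or> i = 1" using Suc.prems by auto
  let ?L = "opT (pf lam b) (qf lam b) (ef b) (Suc k)"
  let ?p = "pf lam b k" and ?q = "qf lam b k" and ?e = "ef b k" and ?w = "chain_wt lam b S' S k"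
  have fin: ?case if X: "S' - {..<Suc k} = S - {..<Suc k} \<longleftrightarrow> X"
    and L: "?L i j (delta S) S' = (if X then ?w i 0 * ?C 0 S' + ?w i 1 * ?C 1 S' else 0)" for X
    unfolding rhs X L ..
  have T: "?T r R = ?C r R" if "R - {..<k} = S - {..<k}" "r \<le> 1" for r R unfolding IH[OF that(2)] by (rule if_P[OF that(1)])
  have T0: "?T r R = 0" if "R - {..<k} \<noteq> S - {..<k}" "r \<le> 1" for r R unfolding IH[OF that(2)] by (rule if_not_P[OF that(1)])
  note ws = chain_wt_def ind_def fac_ser_simps
  have L0: "?L 0 j (delta S) S' = (if k \<in> S' then (?p - ?e) * ?T 0 S' + ?e * ((-1) ^ j * sg k S' * ?T 1 (S' - {k})) else ?p * ?T 0 S')"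
    by (simp only: opT.simps if_True mult.assoc simp_thms)
  have L1: "?L 1 j (delta S) S' = (if k \<in> S' then (?q - ?e) * ?T 1 S' else ?q * ?T 1 S' + (?p - ?q) * ((-1) ^ j * sg k S' * ?T 0 (insert k S')))"
    by (simp only: opT.simps if_False one_neq_zero mult.assoc simp_thms)
  consider (a) "k \<in> S'" "k \<in> S" | (b) "k \<in> S'" "k \<notin> S" | (c) "k \<notin> S'" "k \<in> S" | (d) "k \<notin> S'" "k \<notin> S" by blast
  thus ?case
  proof cases
    case a
    let ?X = "S' - {..<k} = S - {..<k}"
    have z: "?T r (S' - {k}) = 0" if "r \<le> 1" for r by (rule T0[OF _ that]) (use a in blast)
    have w: "?w 0 0 = ?p - ?e" "?w 0 1 = 0" "?w 1 1 = ?q - ?e" "?w 1 0 = 0" using a by (simp_all add: ws)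
    show ?thesis
    proof (rule fin[of ?X])
      show "S' - {..<Suc k} = S - {..<Suc k} \<longleftrightarrow> ?X" unfolding sets using a by blast
      show "?L i j (delta S) S' = (if ?X then ?w i 0 * ?C 0 S' + ?w i 1 * ?C 1 S' else 0)"
        using i a
        by (cases ?X; elim disjE; simp only: L0 L1 z T T0 w if_True if_False mult_zero_left mult_zero_right add_0_left add_0_right order_refl zero_le_one simp_thms)
    qed
  next
    case b
    let ?X = "S' - {k} - {..<k} = S - {..<k}"
    have z: "?T r S' = 0" if "r \<le> 1" for r by (rule T0[OF _ that]) (use b in blast)
    have w: "?w 0 0 = 0" "?w 0 1 = - (?e * sg k S)" "?w 1 1 = 0" "?w 1 0 = 0" using b by (simp_all add: ws)
    have s: "(-1) ^ j * sg k S' * ?T 1 (S' - {k}) = - (sg k S * ?T 1 (S' - {k}))"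
      using sgi[of 1 "S' - {k}"] by simp
    have t: "?T 1 (S' - {k}) = (if ?X then ?C 1 S' else 0)" unfolding IH[OF order_refl] CD ..
    have st: "(-1) ^ j * (sg k S' * ?T 1 (S' - {k})) = (if ?X then - (sg k S * ?C 1 S') else 0)"
      unfolding mult.assoc[symmetric] s unfolding t by (simp only: mult_zero_right minus_zero split: if_split) simp
    show ?thesis
    proof (rule fin[of ?X])
      show "S' - {..<Suc k} = S - {..<Suc k} \<longleftrightarrow> ?X" unfolding sets using b by blast
      show "?L i j (delta S) S' = (if ?X then ?w i 0 * ?C 0 S' + ?w i 1 * ?C 1 S' else 0)"
        using i b
        by (cases ?X; elim disjE; simp only: L0 L1 st z w if_True if_False mult_zero_left mult_zero_right add_0_left add_0_right minus_zero order_refl zero_le_one simp_thms mult_minus_left mult_minus_right mult.assoc)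
    qed
  next
    case c
    let ?X = "insert k S' - {..<k} = S - {..<k}"
    have z: "?T r S' = 0" if "r \<le> 1" for r by (rule T0[OF _ that]) (use c in blast)
    have w: "?w 0 0 = 0" "?w 0 1 = 0" "?w 1 1 = 0" "?w 1 0 = (?p - ?q) * sg k S" using c by (simp_all add: ws)
    have s: "(-1) ^ j * sg k S' * ?T 0 (insert k S') = sg k S * ?T 0 (insert k S')"
      using sgi[OF zero_le_one, of "insert k S'"] unfolding add_0 sg_insert[OF order_refl] by (rule sym)
    have t: "?T 0 (insert k S') = (if ?X then ?C 0 S' else 0)" unfolding IH[OF zero_le_one] CD ..
    have st: "(-1) ^ j * (sg k S' * ?T 0 (insert k S')) = (if ?X then sg k S * ?C 0 S' else 0)"
      unfolding mult.assoc[symmetric] s unfolding t by (simp only: mult_zero_right split: if_split) simp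
    show ?thesis
    proof (rule fin[of ?X])
      show "S' - {..<Suc k} = S - {..<Suc k} \<longleftrightarrow> ?X" unfolding sets using c by auto
      show "?L i j (delta S) S' = (if ?X then ?w i 0 * ?C 0 S' + ?w i 1 * ?C 1 S' else 0)"
        using i c
        by (cases ?X; elim disjE; simp only: L0 L1 st z w if_True if_False mult_zero_left mult_zero_right add_0_left add_0_right order_refl zero_le_one simp_thms mult.assoc)
    qed
  next
    case d
    let ?X = "S' - {..<k} = S - {..<k}"
    have z: "?T r (insert k S') = 0" if "r \<le> 1" for r by (rule T0[OF _ that]) (use d in auto)
    have w: "?w 0 0 = ?p" "?w 0 1 = 0" "?w 1 1 = ?q" "?w 1 0 = 0" using d by (simp_all add: ws)
    show ?thesis
    proof (rule fin[of ?X])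
      show "S' - {..<Suc k} = S - {..<Suc k} \<longleftrightarrow> ?X" unfolding sets using d by blast
      show "?L i j (delta S) S' = (if ?X then ?w i 0 * ?C 0 S' + ?w i 1 * ?C 1 S' else 0)"
        using i d
        by (cases ?X; elim disjE; simp only: L0 L1 z T T0 w if_True if_False mult_zero_left mult_zero_right add_0_left add_0_right order_refl zero_le_one simp_thms)
    qed
  qed
qed

lemma Tser_opT:
  assumes "S' \<in> carrier k" "S \<in> carrier k" "i \<le> 1" "j \<le> 1"
  shows "Tser k lam b i j (S', S) = opT (pf lam b) (qf lam b) (ef b) k i j (delta S) S'"
proof -
  have "S' - {..<k} = S - {..<k}" using assms by (auto simp: carrier_def)
  thus ?thesis unfolding Tser_chain_wt[OF assms(1,2)] opT_chains[OF assms(3,4)] by (rule if_P[symmetric])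
qed

lemma opT_delta_card:
  assumes "opT p q e k i j (delta S) S' \<noteq> 0" "finite S'" "i \<le> 1" "j \<le> 1"
  shows "card S' + i = card S + j"
  using assms(1-3)
proof (induction k arbitrary: i S')
  case 0
  thus ?case by (auto simp: delta_def split: if_splits)
next
  case (Suc k)
  have i: "i = 0 \<or> i = 1" using Suc.prems by auto
  show ?case
  proof (cases "opT p q e k i j (delta S) S' = 0")
    case False
    thus ?thesis using Suc.IH Suc.prems by blast
  next
    case True
    show ?thesis
    proof (cases "i = 0")
      case i0: True
      hence "k \<in> S'" "opT p q e k 1 j (delta S) (S' - {k}) \<noteq> 0"
        using Suc.prems(1) True by (auto split: if_splits)
      with Suc.IH[of 1 "S' - {k}"] Suc.prems(2) show ?thesis using i0 card_Suc_Diff1[of S' k] by simp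
    next
      case False
      hence i1: "i = 1" using i by simp
      hence "k \<notin> S'" "opT p q e k 0 j (delta S) (insert k S') \<noteq> 0"
        using Suc.prems(1) True by (auto split: if_splits)
      with Suc.IH[of 0 "insert k S'"] Suc.prems(2) show ?thesis using i1 by simp
    qed
  qed
qed

section \<open>Clearing denominators and weights\<close>

lemma opT_scale:
  "opT (\<lambda>s. c s * p s) (\<lambda>s. c s * q s) (\<lambda>s. c s * e s) k i j u S = (\<Prod>s<k. c s) * opT p q e k i j u S"
  by (induction k arbitrary: i S) (auto simp: algebra_simps)

lemma geo_mult: "(1 - fps_const z * fps_X) * geo z = fps_X"
proof (rule fps_ext)
  fix n show "((1 - fps_const z * fps_X) * geo z) $ n = fps_X $ n"
    by (cases n rule: nat.exhaust[case_names 0 Suc]; cases "n - 1")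
      (auto simp: left_diff_distrib mult.assoc fps_X_mult_nth geo_def)
qed

text \<open>\<open>f\<close> is \<open>P\<close> read backwards as a polynomial of formal degree \<open>k\<close>, i.e. \<open>f = x\<^sup>-\<^sup>k P(x)\<close>
in the variable \<open>x\<^sup>-\<^sup>1\<close>.\<close>

definition rev_of :: "nat \<Rightarrow> complex fps \<Rightarrow> complex poly \<Rightarrow> bool" where
  "rev_of k f P \<longleftrightarrow> degree P \<le> k \<and> (\<forall>m. f $ m = (if m \<le> k then coeff P (k - m) else 0))"

lemma rev_of_lin:
  assumes "rev_of k f P"
  shows "rev_of (Suc k) ((fps_const c + fps_const a * fps_X) * f) ([:a, c:] * P)"
  unfolding rev_of_def
proof (intro conjI allI)
  have "degree ([:a, c:] * P) \<le> degree [:a, c:] + degree P" by (rule degree_mult_le)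
  also have "\<dots> \<le> 1 + k" using assms by (intro add_mono) (auto simp: rev_of_def)
  finally show "degree ([:a, c:] * P) \<le> Suc k" by simp
  fix m
  have Pk: "coeff P (Suc k) = 0" using assms by (simp add: rev_of_def coeff_eq_0)
  have f: "f $ m = (if m \<le> k then coeff P (k - m) else 0)" for m using assms by (simp add: rev_of_def)
  have c: "coeff ([:a, c:] * P) n = a * coeff P n + (if n = 0 then 0 else c * coeff P (n - 1))" for n
    by (cases n) auto
  have "((fps_const c + fps_const a * fps_X) * f) $ m = c * f $ m + (if m = 0 then 0 else a * f $ (m - 1))"
    by (simp add: distrib_right mult.assoc fps_X_mult_nth)
  thus "((fps_const c + fps_const a * fps_X) * f) $ m = (if m \<le> Suc k then coeff ([:a, c:] * P) (Suc k - m) else 0)"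
    unfolding f c using Pk by (cases m) (auto simp: Suc_diff_le)
qed

lemma rev_of_add: "rev_of k f P \<Longrightarrow> rev_of k g R \<Longrightarrow> rev_of k (f + g) (P + R)"
  by (auto simp: rev_of_def intro: degree_add_le)

lemma rev_of_sg: "rev_of k f P \<Longrightarrow> rev_of k ((-1) ^ j * sg n S * f) ((-1) ^ j * sg n S * P)"
  by (auto simp: rev_of_def sg_def minus_one_power_iff)

text \<open>After the scaling in \<open>Dser_Tser\<close> every entry of a tensor factor is linear
  in x^(-1), so each factor raises the formal degree by one; the entries on the polynomial side are
  the same ones multiplied by x.\<close>

lemma rev_of_opT:
  "rev_of k (opT (\<lambda>s. 1 + fps_const (P0 s) * fps_X) (\<lambda>s. 1 + fps_const (Q0 s) * fps_X) (\<lambda>s. fps_X) k i j (delta S) S')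
     (opT (\<lambda>s. [:P0 s, 1:]) (\<lambda>s. [:Q0 s, 1:]) (\<lambda>s. 1) k i j (delta S) S')"
proof (induction k arbitrary: i S')
  case 0
  show ?case by (auto simp: rev_of_def delta_def)
next
  case (Suc k)
  let ?f = "\<lambda>i S'. opT (\<lambda>s. 1 + fps_const (P0 s) * fps_X) (\<lambda>s. 1 + fps_const (Q0 s) * fps_X) (\<lambda>s. fps_X) k i j (delta S) S'"
  let ?P = "\<lambda>i S'. opT (\<lambda>s. [:P0 s, 1:]) (\<lambda>s. [:Q0 s, 1:]) (\<lambda>s. 1) k i j (delta S) S'"
  have *: "rev_of (Suc k) ((1 + fps_const a * fps_X) * ?f i R) ([:a, 1:] * ?P i R)" for a i R
    using rev_of_lin[OF Suc.IH, of 1 a i R] by simp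
  have **: "rev_of (Suc k) ((1 + fps_const a * fps_X - fps_X) * ?f i R) (([:a, 1:] - 1) * ?P i R)" for a i R
  proof -
    have e: "1 + fps_const a * fps_X - fps_X = 1 + fps_const (a - 1) * (fps_X :: complex fps)" by (simp add: algebra_simps flip: fps_const_sub)
    have e': "[:a, 1:] - 1 = [:a - 1, 1:]" by (simp add: one_pCons)
    show ?thesis unfolding e e' by (rule *)
  qed
  have ***: "rev_of (Suc k) (fps_X * (-1) ^ j * sg k S' * ?f i R) (1 * (-1) ^ j * sg k S' * ?P i R)" for i R
  proof -
    have "rev_of (Suc k) (fps_X * ?f i R) (?P i R)" using rev_of_lin[OF Suc.IH, of 0 1 i R] by (simp add: one_pCons[symmetric])
    from rev_of_sg[OF this, of j k S'] show ?thesis by (simp add: mult_ac)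
  qed
  have ****: "rev_of (Suc k) ((1 + fps_const a * fps_X - (1 + fps_const c * fps_X)) * (-1) ^ j * sg k S' * ?f i R)
      (([:a, 1:] - [:c, 1:]) * (-1) ^ j * sg k S' * ?P i R)" for a c i R
  proof -
    have e: "1 + fps_const a * fps_X - (1 + fps_const c * fps_X) = fps_const 0 + fps_const (a - c) * (fps_X :: complex fps)"
      by (simp add: algebra_simps flip: fps_const_sub)
    have e': "[:a, 1:] - [:c, 1:] = [:a - c, 0:]" by simp
    have "rev_of (Suc k) ((fps_const 0 + fps_const (a - c) * fps_X) * ?f i R) ([:a - c, 0:] * ?P i R)" by (rule rev_of_lin[OF Suc.IH])
    from rev_of_sg[OF this, of j k S'] show ?thesis unfolding e e' by (simp only: mult_ac)
  qed
  show ?case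
    by (cases "i = 0"; cases "k \<in> S'"; simp only: opT.simps if_True if_False simp_thms)
      (intro rev_of_add * ** *** ****)+
qed

lemma rev_of_prod: "rev_of k (\<Prod>s<k. 1 + fps_const (a s) * fps_X) (\<Prod>s<k. [:a s, 1:])"
proof (induction k)
  case 0 show ?case by (simp add: rev_of_def)
next
  case (Suc k)
  from rev_of_lin[OF this, of 1 "a k"] show ?case by (simp add: mult.commute)
qed

definition Tpoly :: "nat \<Rightarrow> (nat \<Rightarrow> complex \<times> complex) \<Rightarrow> (nat \<Rightarrow> complex) \<Rightarrow> nat \<Rightarrow> nat \<Rightarrow> nat set \<Rightarrow> nat set \<Rightarrow> complex poly" where
  "Tpoly k lam b i j S' S = opT (\<lambda>s. [:- b s + fst (lam s), 1:]) (\<lambda>s. [:- b s - snd (lam s), 1:]) (\<lambda>s. 1) k i j (delta S) S'"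

definition Dser :: "nat \<Rightarrow> (nat \<Rightarrow> complex) \<Rightarrow> complex fps" where
  "Dser k b = (\<Prod>s<k. 1 - fps_const (b s) * fps_X)"

lemma Dser: "rev_of k (Dser k b) (D_poly k b)"
  using rev_of_prod[of k "\<lambda>s. - b s"] by (simp add: Dser_def D_poly_def flip: fps_const_neg)

lemma Dser_0: "Dser k b $ 0 = 1"
  by (induction k) (auto simp: Dser_def)

lemma Dser_Tser:
  assumes "S' \<in> carrier k" "S \<in> carrier k" "i \<le> 1" "j \<le> 1"
  shows "rev_of k (Dser k b * Tser k lam b i j (S', S)) (Tpoly k lam b i j S' S)"
proof -
  let ?c = "\<lambda>s. 1 - fps_const (b s) * fps_X"
  have e: "?c s * ef b s = fps_X" for s unfolding ef_def by (rule geo_mult)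
  have p: "?c s * pf lam b s = 1 + fps_const (- b s + fst (lam s)) * fps_X" for s
  proof -
    have "?c s * pf lam b s = ?c s + fps_const (fst (lam s)) * (?c s * geo (b s))" unfolding pf_def by (simp add: algebra_simps)
    also have "\<dots> = 1 + (fps_const (- b s) + fps_const (fst (lam s))) * fps_X" unfolding geo_mult by (simp add: algebra_simps flip: fps_const_neg)
    finally show ?thesis by (simp only: fps_const_add)
  qed
  have q: "?c s * qf lam b s = 1 + fps_const (- b s - snd (lam s)) * fps_X" for s
  proof -
    have "?c s * qf lam b s = ?c s - fps_const (snd (lam s)) * (?c s * geo (b s))" unfolding qf_def by (simp add: algebra_simps)
    also have "\<dots> = 1 + (fps_const (- b s) - fps_const (snd (lam s))) * fps_X" unfolding geo_mult by (simp add: algebra_simps flip: fps_const_neg)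
    finally show ?thesis by (simp only: fps_const_sub)
  qed
  have "Dser k b * Tser k lam b i j (S', S) = opT (\<lambda>s. ?c s * pf lam b s) (\<lambda>s. ?c s * qf lam b s) (\<lambda>s. ?c s * ef b s) k i j (delta S) S'"
    unfolding Tser_opT[OF assms] opT_scale Dser_def ..
  thus ?thesis unfolding e p q Tpoly_def using rev_of_opT by simp
qed

lemma geo_01: "geo z $ 0 = 0" "geo z $ Suc 0 = 1" by (simp_all add: geo_def)

lemma pqf_01: "pf lam b s $ 0 = 1" "pf lam b s $ Suc 0 = fst (lam s)" "qf lam b s $ 0 = 1" "qf lam b s $ Suc 0 = - snd (lam s)"
  "ef b s $ 0 = 0" "ef b s $ Suc 0 = 1"
  by (simp_all add: pf_def qf_def ef_def geo_01)

lemma fps_mult_nth_Suc_0: "(f * g) $ Suc 0 = f $ 0 * g $ Suc 0 + f $ Suc 0 * (g :: complex fps) $ 0"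
  by (simp add: fps_mult_nth)

lemma fps_mult_nth_00: "(f * g) $ 0 = f $ 0 * (g :: complex fps) $ 0" by simp

lemma opT_nth_0: "opT (pf lam b) (qf lam b) (ef b) k i j (delta S) S' $ 0 = (if i = j then delta S S' else 0)" if "i \<le> 1"
  using that
proof (induction k arbitrary: i j S')
  case 0 thus ?case by (auto simp: delta_def)
next
  case (Suc k)
  have "i = 0 \<or> i = 1" using Suc.prems by auto
  thus ?case by (auto simp: Suc.IH pqf_01)
qed

lemma opT_nth_1:
  "opT (pf lam b) (qf lam b) (ef b) k 0 0 (delta S) S' $ Suc 0 = ((\<Sum>s<k. fst (lam s)) - of_nat (card (S' \<inter> {..<k}))) * delta S S'"
  "opT (pf lam b) (qf lam b) (ef b) k 1 1 (delta S) S' $ Suc 0 = (- (\<Sum>s<k. snd (lam s)) - of_nat (card (S' \<inter> {..<k}))) * delta S S'"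
proof -
  have c: "card (S' \<inter> {..<Suc k}) = (if k \<in> S' then 1 else 0) + card (S' \<inter> {..<k})" for S' k
    by (simp add: lessThan_Suc Int_insert_right)
  note d = opT_nth_0[of 0] opT_nth_0[of "Suc 0"]
  show "opT (pf lam b) (qf lam b) (ef b) k 0 0 (delta S) S' $ Suc 0 = ((\<Sum>s<k. fst (lam s)) - of_nat (card (S' \<inter> {..<k}))) * delta S S'"
  proof (induction k arbitrary: S')
    case (Suc k)
    show ?case unfolding opT.simps
      by (simp add: Suc[unfolded One_nat_def] c fps_mult_nth_Suc_0 fps_mult_nth_00 pqf_01 d algebra_simps del: opT.simps fps_mult_nth_0 fps_mult_nth_1)
  qed (auto simp: delta_def)
  show "opT (pf lam b) (qf lam b) (ef b) k 1 1 (delta S) S' $ Suc 0 = (- (\<Sum>s<k. snd (lam s)) - of_nat (card (S' \<inter> {..<k}))) * delta S S'"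
  proof (induction k arbitrary: S')
    case (Suc k)
    show ?case unfolding opT.simps
      by (simp add: Suc[unfolded One_nat_def] c fps_mult_nth_Suc_0 fps_mult_nth_00 pqf_01 d algebra_simps del: opT.simps fps_mult_nth_0 fps_mult_nth_1)
  qed (auto simp: delta_def)
qed

lemma mvec_basisv: "finite I \<Longrightarrow> S \<in> I \<Longrightarrow> mvec I A (basisv S) = (\<lambda>x. A (x, S))"
  by (auto simp: mvec_def basisv_def if_distrib cong: if_cong)

lemma finite_carrier [simp]: "finite (carrier k)" by (simp add: carrier_def)

lemma Tser_outside: "S' \<notin> carrier k \<or> S \<notin> carrier k \<Longrightarrow> Tser k lam b i j (S', S) = 0"
  by (auto simp: Tser_def)

lemma Tser_nth_1:
  assumes S: "S \<in> carrier k"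
  shows "Tser k lam b 0 0 (x, S) $ 1 = ((\<Sum>s<k. fst (lam s)) - of_nat (card S)) * (if x = S then 1 else 0)"
    "Tser k lam b 1 1 (x, S) $ 1 = (- (\<Sum>s<k. snd (lam s)) - of_nat (card S)) * (if x = S then 1 else 0)"
proof -
  have c: "S \<inter> {..<k} = S" using S by (auto simp: carrier_def)
  show "Tser k lam b 0 0 (x, S) $ 1 = ((\<Sum>s<k. fst (lam s)) - of_nat (card S)) * (if x = S then 1 else 0)"
  proof (cases "x \<in> carrier k")
    case True
    show ?thesis unfolding Tser_opT[OF True S zero_le_one zero_le_one] One_nat_def opT_nth_1 using c by (simp add: delta_def)
  next
    case False
    hence "x \<noteq> S" using S by blast
    thus ?thesis using False by (simp add: Tser_outside)
  qed
  show "Tser k lam b 1 1 (x, S) $ 1 = (- (\<Sum>s<k. snd (lam s)) - of_nat (card S)) * (if x = S then 1 else 0)"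
  proof (cases "x \<in> carrier k")
    case True
    have "Tser k lam b 1 1 (x, S) $ 1 = (- (\<Sum>s<k. snd (lam s)) - of_nat (card (x \<inter> {..<k}))) * delta S x"
      unfolding Tser_opT[OF True S order_refl order_refl] using opT_nth_1(2) by (simp only: One_nat_def)
    thus ?thesis using c by (simp add: delta_def)
  next
    case False
    hence "x \<noteq> S" using S by blast
    thus ?thesis using False by (simp add: Tser_outside)
  qed
qed

text \<open>The coefficients of x^(-1) in T_11 and T_22 are diagonal in the basis: each occupied
  factor lowers e_11 and raises e_22 by one.\<close>

lemma wt_carrier_eq:
  "wt_carrier k lam b ((\<Sum>s<k. fst (lam s)) - of_nat l) ((\<Sum>s<k. snd (lam s)) + of_nat l) = Wset k l"
proof (intro set_eqI)
  fix S :: "nat set"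
  have sc: "fscale a (basisv S) = fscale a' (basisv S) \<longleftrightarrow> a = a'" for a a'
    by (auto simp: fscale_def basisv_def fun_eq_iff)
  show "S \<in> wt_carrier k lam b ((\<Sum>s<k. fst (lam s)) - of_nat l) ((\<Sum>s<k. snd (lam s)) + of_nat l) \<longleftrightarrow> S \<in> Wset k l"
  proof (cases "S \<in> carrier k")
    case True
    have e1: "mvec (carrier k) (e11op k lam b) (basisv S) = fscale ((\<Sum>s<k. fst (lam s)) - of_nat (card S)) (basisv S)"
      unfolding mvec_basisv[OF finite_carrier True] e11op_def Tco_def
      unfolding Tser_nth_1[OF True] fscale_def basisv_def ..
    have e2: "mvec (carrier k) (e22op k lam b) (basisv S) = fscale ((\<Sum>s<k. snd (lam s)) + of_nat (card S)) (basisv S)"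
      unfolding mvec_basisv[OF finite_carrier True] e22op_def Tco_def
      unfolding fscale_def Tser_nth_1[OF True] basisv_def
      by (rule ext) (simp add: algebra_simps)
    show ?thesis unfolding wt_carrier_def Wset_def mem_Collect_eq e1 e2 sc using True by (simp add: carrier_def)
  qed (simp add: wt_carrier_def Wset_def carrier_def)
qed

text \<open>The block form of the quantum Berezinian: eliminating \<open>y\<close> from \<open>T\<^sub>1\<^sub>1 y = T\<^sub>2\<^sub>1 z\<close> one tensor
factor at a time shows that \<open>T\<^sub>2\<^sub>2 - T\<^sub>1\<^sub>2 T\<^sub>1\<^sub>1\<^sup>-\<^sup>1 T\<^sub>2\<^sub>1\<close> is \<open>T\<^sub>1\<^sub>1\<close> times the scalar \<open>\<psi>/\<phi>\<close>, without
inverting anything.\<close>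

lemma berezinian_elimination:
  fixes p q e :: "nat \<Rightarrow> 'a::comm_ring_1"
  assumes "\<And>R. R - {..<k} = S - {..<k} \<Longrightarrow> opT p q e k 0 0 y R = opT p q e k 1 0 z R"
  shows "(\<Prod>s<k. p s) * (opT p q e k 1 1 z S - opT p q e k 0 1 y S) = (\<Prod>s<k. q s) * opT p q e k 0 0 z S"
  using assms
proof (induction k arbitrary: y z S)
  case 0
  have "y S = 0" using 0[of S] by simp
  thus ?case by simp
next
  case (Suc k)
  let ?A = "opT p q e k 0 0" and ?Y = "opT p q e k 1 0" and ?D = "opT p q e k 1 1" and ?X = "opT p q e k 0 1"
  let ?ph = "\<Prod>s<k. p s" and ?ps = "\<Prod>s<k. q s"
  have notin: "p k * ?A y R = q k * ?Y z R + (p k - q k) * (sg k R * ?A z (insert k R))"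
    if "R - {..<Suc k} = S - {..<Suc k}" "k \<notin> R" for R
    using Suc.prems[OF that(1)] that(2) by (simp add: mult_ac)
  have isin: "(p k - e k) * ?A y R + e k * (sg k R * ?Y y (R - {k})) = (q k - e k) * ?Y z R"
    if "R - {..<Suc k} = S - {..<Suc k}" "k \<in> R" for R
    using Suc.prems[OF that(1)] that(2) by (simp add: mult_ac)
  have lin: "opT p q e k i j (\<lambda>R. a * v R + c * (sg k R * w R)) R = a * opT p q e k i j v R + c * ((-1) ^ (i + j) * sg k R * opT p q e k i j w R)"
    if "i \<le> 1" "j \<le> 1" for i j a c v w R
    using opT_lin[of p q e k i j a v c "\<lambda>R. sg k R * w R" R] opT_sg[OF that order_refl, of p q e k w R] by simp
  have same: "R - {..<Suc k} = S - {..<Suc k} \<and> (k \<in> R \<longleftrightarrow> k \<in> S)" if "R - {..<k} = S - {..<k}" for R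
    using that by (auto simp: set_eq_iff less_Suc_eq; metis linorder_neq_iff)
  show ?case
  proof (cases "k \<in> S")
    case False
    \<comment> \<open>Position \<open>k\<close> is empty: the hypothesis for k + 1 factors becomes
      the one for k factors, with the T_21 contribution of the last factor absorbed into
      \<open>y'\<close> and \<open>z\<close> scaled by \<open>q k\<close>.\<close>
    define y' where "y' = (\<lambda>R. p k * y R + (- (p k - q k)) * (sg k R * z (insert k R)))"
    have IH: "?ph * (?D (\<lambda>R. q k * z R) S - ?X y' S) = ?ps * ?A (\<lambda>R. q k * z R) S"
    proof (rule Suc.IH)
      fix R assume "R - {..<k} = S - {..<k}"
      with same[OF this] False have R: "R - {..<Suc k} = S - {..<Suc k}" "k \<notin> R" by auto
      show "?A y' R = ?Y (\<lambda>R. q k * z R) R"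
        unfolding y'_def lin[OF zero_le_one zero_le_one] opT_cmult opT_shift_insert[OF order_refl]
        using notin[OF R] by (simp add: algebra_simps)
    qed
    have X: "?X y' S = p k * ?X y S + (p k - q k) * (sg k S * ?X z (insert k S))"
      unfolding y'_def lin[OF zero_le_one order_refl] opT_shift_insert[OF order_refl] by (simp add: algebra_simps)
    have "opT p q e (Suc k) 1 1 z S - opT p q e (Suc k) 0 1 y S = ?D (\<lambda>R. q k * z R) S - ?X y' S"
      unfolding X opT_cmult using False by (simp add: algebra_simps)
    moreover have "opT p q e (Suc k) 0 0 z S = p k * ?A z S" using False by simp
    moreover have "p k * (?ph * (?D (\<lambda>R. q k * z R) S - ?X y' S)) = p k * (?ps * (q k * ?A z S))"
      unfolding IH unfolding opT_cmult ..
    ultimately show ?thesis by (simp add: mult_ac del: opT.simps)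
  next
    case True
    \<comment> \<open>Position \<open>k\<close> is occupied: here the T_12 contribution of
      \<open>y\<close> moves into \<open>z'\<close>. The hypothesis at the set without
      \<open>k\<close> (fact \<open>n\<close>) is what later turns \<open>p k\<close> times T_11 of
      \<open>z'\<close> back into T_11 of \<open>z\<close> on k + 1 factors.\<close>
    define z' where "z' = (\<lambda>R. (q k - e k) * z R + e k * (sg k R * y (R - {k})))"
    have IH: "?ph * (?D z' S - ?X (\<lambda>R. (p k - e k) * y R) S) = ?ps * ?A z' S"
    proof (rule Suc.IH)
      fix R assume "R - {..<k} = S - {..<k}"
      with same[OF this] True have R: "R - {..<Suc k} = S - {..<Suc k}" "k \<in> R" by auto
      show "?A (\<lambda>R. (p k - e k) * y R) R = ?Y z' R"
        unfolding z'_def lin[OF order_refl zero_le_one] opT_cmult opT_shift_Diff[OF order_refl]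
        using isin[OF R] by (simp add: algebra_simps)
    qed
    have SS: "(S - {k}) - {..<Suc k} = S - {..<Suc k}" "insert k (S - {k}) = S" using True by (auto simp: lessThan_Suc)
    have n: "p k * ?A y (S - {k}) = q k * ?Y z (S - {k}) + (p k - q k) * (sg k S * ?A z S)"
      using notin[OF SS(1)] SS(2) by simp
    have Dz: "?D z' S = (q k - e k) * ?D z S + e k * (sg k S * ?D y (S - {k}))"
      unfolding z'_def lin[OF order_refl order_refl] opT_shift_Diff[OF order_refl] by simp
    have Az: "?A z' S = (q k - e k) * ?A z S + e k * (sg k S * ?A y (S - {k}))"
      unfolding z'_def lin[OF zero_le_one zero_le_one] opT_shift_Diff[OF order_refl] by simp
    have l: "opT p q e (Suc k) 1 1 z S - opT p q e (Suc k) 0 1 y S = ?D z' S - ?X (\<lambda>R. (p k - e k) * y R) S"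
      unfolding Dz opT_cmult using True by (simp add: algebra_simps)
    have "p k * ?A z' S = p k * (q k - e k) * ?A z S + e k * (sg k S * (p k * ?A y (S - {k})))"
      unfolding Az by (simp add: algebra_simps)
    also have "\<dots> = q k * ((p k - e k) * ?A z S + e k * (sg k S * ?Y z (S - {k})))"
      unfolding n using sg_sq'[of k S "?A z S"] by (simp add: algebra_simps)
    also have "\<dots> = q k * opT p q e (Suc k) 0 0 z S" using True by (simp add: algebra_simps)
    finally have r: "p k * ?A z' S = q k * opT p q e (Suc k) 0 0 z S" .
    have "p k * (?ph * (opT p q e (Suc k) 1 1 z S - opT p q e (Suc k) 0 1 y S)) = ?ps * (p k * ?A z' S)"
      unfolding l IH by (simp add: mult_ac)
    thus ?thesis unfolding r by (simp add: mult_ac del: opT.simps)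
  qed
qed

lemma mmul_assoc: "finite I \<Longrightarrow> mmul I (mmul I A B) C = mmul I A (mmul I B C)"
  unfolding mmul_def
  by (rule ext, clarsimp simp: sum_distrib_left sum_distrib_right mult.assoc) (rule sum.swap)

lemma mmul_idm: "finite I \<Longrightarrow> supp_on I A \<Longrightarrow> mmul I (idm I) A = A" "finite I \<Longrightarrow> supp_on I A \<Longrightarrow> mmul I A (idm I) = A"
proof -
  assume I: "finite I" and A: "supp_on I A"
  have "mmul I (idm I) A (x, z) = A (x, z)" for x z
  proof -
    have "mmul I (idm I) A (x, z) = (\<Sum>y\<in>I. if x = y then A (y, z) else 0)"
      unfolding mmul_def by (auto simp: idm_def intro!: sum.cong)
    thus ?thesis using I A by (auto simp: supp_on_def)
  qed
  thus "mmul I (idm I) A = A" by (auto simp: fun_eq_iff)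
  have "mmul I A (idm I) (x, z) = A (x, z)" for x z
  proof -
    have "mmul I A (idm I) (x, z) = (\<Sum>y\<in>I. if y = z then A (x, y) else 0)"
      unfolding mmul_def by (auto simp: idm_def intro!: sum.cong)
    thus ?thesis using I A by (auto simp: supp_on_def)
  qed
  thus "mmul I A (idm I) = A" by (auto simp: fun_eq_iff)
qed

lemma supp_on_mmul: "supp_on I A \<Longrightarrow> supp_on I B \<Longrightarrow> supp_on I (mmul I A B)"
  by (fastforce simp: supp_on_def mmul_def intro!: sum.neutral)

lemma supp_on_idm: "supp_on I (idm I)" by (auto simp: supp_on_def idm_def)

primrec mpow :: "'i set \<Rightarrow> ('i \<times> 'i \<Rightarrow> 'a::comm_semiring_1) \<Rightarrow> nat \<Rightarrow> ('i \<times> 'i \<Rightarrow> 'a)" where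
  "mpow I A 0 = idm I"
| "mpow I A (Suc n) = mmul I A (mpow I A n)"

lemma supp_on_mpow: "supp_on I A \<Longrightarrow> supp_on I (mpow I A n)"
  by (induction n) (auto simp: supp_on_idm supp_on_mmul)

lemma mpow_Suc_right:
  assumes "finite I" "supp_on I A" shows "mpow I A (Suc n) = mmul I (mpow I A n) A"
proof (induction n)
  case 0 show ?case using assms by (simp add: mmul_idm)
next
  case (Suc n)
  have "mpow I A (Suc (Suc n)) = mmul I A (mmul I (mpow I A n) A)" using Suc by simp
  thus ?case using assms(1) by (simp add: mmul_assoc)
qed

text \<open>The inverse is the geometric series, which converges coefficientwise.\<close>

lemma fps_matrix_inverse:
  fixes A :: "'i \<times> 'i \<Rightarrow> complex fps"
  assumes I: "finite I" and A: "supp_on I A" and A0: "\<And>x y. x \<in> I \<Longrightarrow> y \<in> I \<Longrightarrow> A (x, y) $ 0 = (if x = y then 1 else 0)"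
  shows "\<exists>C. supp_on I C \<and> mmul I A C = idm I \<and> mmul I C A = idm I"
proof -
  define M where "M = (\<lambda>p. idm I p - A p)"
  have M: "supp_on I M" using A supp_on_idm[of I] unfolding M_def supp_on_def by simp
  have M0: "M p $ 0 = 0" for p
  proof (cases p)
    case (Pair x y)
    show ?thesis
    proof (cases "x \<in> I \<and> y \<in> I")
      case True thus ?thesis using A0[of x y] by (auto simp: Pair M_def idm_def)
    next
      case False thus ?thesis using M by (auto simp: supp_on_def Pair)
    qed
  qed
  have low: "mpow I M n p $ r = 0" if "r < n" for n p r
    using that
  proof (induction n arbitrary: p r)
    case (Suc n)
    obtain x z where p: "p = (x, z)" by (cases p)
    have "(M (x, y) * mpow I M n (y, z)) $ r = 0" for y
      unfolding fps_mult_nth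
    proof (rule sum.neutral, rule ballI)
      fix i assume i: "i \<in> {0..r}"
      have "i \<noteq> 0 \<Longrightarrow> r - i < n" using i Suc.prems by auto
      show "M (x, y) $ i * mpow I M n (y, z) $ (r - i) = 0"
        using M0[of "(x, y)"] Suc.IH[of "r - i" "(y, z)"] \<open>i \<noteq> 0 \<Longrightarrow> r - i < n\<close> by (cases "i = 0") simp_all
    qed
    thus ?case by (simp add: p mmul_def fps_sum_nth)
  qed simp
  define G where "G = (\<lambda>n p. \<Sum>m\<le>n. mpow I M m p)"
  define C where "C = (\<lambda>p. Abs_fps (\<lambda>r. G r p $ r))"
  have GC: "G n p $ r = C p $ r" if "r \<le> n" for n p r
  proof -
    have "G n p $ r = (\<Sum>m\<le>n. mpow I M m p $ r)" by (simp add: G_def fps_sum_nth)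
    also have "\<dots> = (\<Sum>m\<le>r. mpow I M m p $ r)" by (rule sum.mono_neutral_right) (use that low in auto)
    finally show ?thesis by (simp add: C_def G_def fps_sum_nth)
  qed
  have suppC: "supp_on I C"
    using supp_on_mpow[OF M] by (auto simp: supp_on_def C_def G_def intro!: fps_ext)
  have MG: "mmul I M (G n) = (\<lambda>p. \<Sum>m\<le>n. mpow I M (Suc m) p)" "mmul I (G n) M = (\<lambda>p. \<Sum>m\<le>n. mpow I M (Suc m) p)" for n
  proof -
    show "mmul I M (G n) = (\<lambda>p. \<Sum>m\<le>n. mpow I M (Suc m) p)"
      unfolding G_def mpow.simps mmul_def by (rule ext, clarsimp simp: sum_distrib_left) (rule sum.swap)
    show "mmul I (G n) M = (\<lambda>p. \<Sum>m\<le>n. mpow I M (Suc m) p)"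
      unfolding mpow_Suc_right[OF I M] unfolding G_def mmul_def by (rule ext, clarsimp simp: sum_distrib_right) (rule sum.swap)
  qed
  have tele: "G n p - (\<Sum>m\<le>n. mpow I M (Suc m) p) = idm I p - mpow I M (Suc n) p" for n p
  proof -
    have aux: "a - s = i - y" if "a + y = i + s" for a s i y :: "complex fps"
      using that by (simp add: diff_eq_eq eq_diff_eq algebra_simps)
    have "(\<Sum>m\<le>Suc n. mpow I M m p) = mpow I M 0 p + (\<Sum>m\<le>n. mpow I M (Suc m) p)" by (rule sum.atMost_Suc_shift)
    thus ?thesis unfolding G_def sum.atMost_Suc mpow.simps(1) by (rule aux)
  qed
  have AG: "mmul I A (G n) p = idm I p - mpow I M (Suc n) p" "mmul I (G n) A p = idm I p - mpow I M (Suc n) p" for n p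
  proof -
    have Gs: "supp_on I (G n)" using supp_on_mpow[OF M] by (auto simp: supp_on_def G_def)
    have AM: "A = (\<lambda>p. idm I p - M p)" by (simp add: M_def)
    have "mmul I A (G n) p = mmul I (idm I) (G n) p - mmul I M (G n) p"
      unfolding AM by (cases p) (simp add: mmul_def left_diff_distrib sum_subtractf)
    thus "mmul I A (G n) p = idm I p - mpow I M (Suc n) p" using tele by (simp add: mmul_idm[OF I Gs] MG)
    have "mmul I (G n) A p = mmul I (G n) (idm I) p - mmul I (G n) M p"
      unfolding AM by (cases p) (simp add: mmul_def right_diff_distrib sum_subtractf)
    thus "mmul I (G n) A p = idm I p - mpow I M (Suc n) p" using tele by (simp add: mmul_idm[OF I Gs] MG)
  qed
  have "mmul I A C p = idm I p" for p
  proof (rule fps_ext)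
    fix r
    obtain x z where p: "p = (x, z)" by (cases p)
    have "mmul I A C p $ r = mmul I A (G r) p $ r"
      unfolding p mmul_def by (auto simp: fps_sum_nth fps_mult_nth GC intro!: sum.cong)
    also have "\<dots> = idm I p $ r" unfolding AG by (simp add: low del: mpow.simps)
    finally show "mmul I A C p $ r = idm I p $ r" .
  qed
  moreover have "mmul I C A p = idm I p" for p
  proof (rule fps_ext)
    fix r
    obtain x z where p: "p = (x, z)" by (cases p)
    have "mmul I C A p $ r = mmul I (G r) A p $ r"
      unfolding p mmul_def by (auto simp: fps_sum_nth fps_mult_nth GC intro!: sum.cong)
    also have "\<dots> = idm I p $ r" unfolding AG by (simp add: low del: mpow.simps)
    finally show "mmul I C A p $ r = idm I p $ r" .
  qed
  ultimately show ?thesis using suppC by (intro exI[of _ C]) auto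
qed

lemma Tser_supp: "supp_on (carrier k) (Tser k lam b i j)"
  by (auto simp: supp_on_def Tser_outside)

text \<open>\<open>berezinian_elimination\<close>, with \<open>y\<close> a column of T_11^(-1) T_21,
  shows that the Schur complement is T_11 times the scalar \<psi>/\<phi>, so the Berezinian is q1
  \<phi> / (q2 \<psi>) times the identity. Both scalar products have constant term 1 and are
  invertible series; uniqueness of the inverse of T_11 and of the solution justifies the definite
  description.\<close>

lemma BerSer_scalar:
  "\<exists>f. BerSer q1 q2 k lam b = (\<lambda>p. f * idm (carrier k) p)"
proof -
  let ?I = "carrier k" and ?T = "Tser k lam b"
  let ?p = "pf lam b" and ?q = "qf lam b" and ?e = "ef b"
  have fin: "finite ?I" by simp
  have T0: "?T 0 0 (x, y) $ 0 = (if x = y then 1 else 0)" if "x \<in> ?I" "y \<in> ?I" for x y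
    using that unfolding Tser_opT[OF that zero_le_one zero_le_one] opT_nth_0[OF zero_le_one] by (simp add: delta_def)
  obtain Ci where Ci: "supp_on ?I Ci" "mmul ?I (?T 0 0) Ci = idm ?I" "mmul ?I Ci (?T 0 0) = idm ?I"
    using fps_matrix_inverse[OF fin Tser_supp T0] by blast
  define ph ps where "ph = (\<Prod>s<k. ?p s)" and "ps = (\<Prod>s<k. ?q s)"
  have n0: "ph $ 0 = 1" "ps $ 0 = 1" unfolding ph_def ps_def by (induction k) (simp_all add: pqf_01)
  have ph: "inverse ph * ph = 1" by (rule inverse_mult_eq_1) (simp add: n0)
  have ps: "inverse ps * ps = 1" by (rule inverse_mult_eq_1) (simp add: n0)
  define S where "S = ?T 1 1 - mmul ?I (mmul ?I (?T 0 1) Ci) (?T 1 0)"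
  have act: "opT ?p ?q ?e k i j u R = (\<Sum>y\<in>?I. ?T i j (R, y) * u y)" if "R \<in> ?I" "i \<le> 1" "j \<le> 1" for R i j u
  proof -
    have "opT ?p ?q ?e k i j u R = opT ?p ?q ?e k i j (\<lambda>R. \<Sum>y\<in>?I. u y * delta y R) R"
    proof (rule opT_cong)
      fix R' assume "R' - {..<k} = R - {..<k}"
      hence "R' \<in> ?I" using that by (auto simp: carrier_def)
      thus "u R' = (\<Sum>y\<in>?I. u y * delta y R')" by (simp add: delta_def if_distrib cong: if_cong)
    qed
    also have "\<dots> = (\<Sum>y\<in>?I. u y * opT ?p ?q ?e k i j (delta y) R)" by (rule opT_sum[OF fin])
    finally show ?thesis using that by (simp add: Tser_opT mult.commute)
  qed
  have S: "ph * S (x, z) = ps * ?T 0 0 (x, z)" if x: "x \<in> ?I" and z: "z \<in> ?I" for x z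
  proof -
    define y where "y = (\<lambda>R. mmul ?I Ci (?T 1 0) (R, z))"
    have "(\<Prod>s<k. ?p s) * (opT ?p ?q ?e k 1 1 (delta z) x - opT ?p ?q ?e k 0 1 y x) = (\<Prod>s<k. ?q s) * opT ?p ?q ?e k 0 0 (delta z) x"
    proof (rule berezinian_elimination)
      fix R assume "R - {..<k} = x - {..<k}"
      hence R: "R \<in> ?I" using x by (auto simp: carrier_def)
      have "opT ?p ?q ?e k 0 0 y R = mmul ?I (?T 0 0) (mmul ?I Ci (?T 1 0)) (R, z)"
        unfolding act[OF R zero_le_one zero_le_one] y_def by (subst (2) mmul_def) simp
      also have "\<dots> = ?T 1 0 (R, z)" unfolding mmul_assoc[OF fin, symmetric] Ci mmul_idm[OF fin Tser_supp] ..
      also have "\<dots> = opT ?p ?q ?e k 1 0 (delta z) R" using R z by (simp add: Tser_opT)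
      finally show "opT ?p ?q ?e k 0 0 y R = opT ?p ?q ?e k 1 0 (delta z) R" .
    qed
    moreover have "opT ?p ?q ?e k 0 1 y x = mmul ?I (mmul ?I (?T 0 1) Ci) (?T 1 0) (x, z)"
      unfolding mmul_assoc[OF fin] act[OF x zero_le_one order_refl] y_def by (subst (2) mmul_def) simp
    ultimately show ?thesis using x z by (simp add: S_def ph_def ps_def Tser_opT)
  qed
  have "supp_on ?I (mmul ?I (mmul ?I (?T 0 1) Ci) (?T 1 0))" by (intro supp_on_mmul Tser_supp Ci)
  hence Ssupp: "supp_on ?I S"
    unfolding S_def using Tser_supp[of k lam b 1 1] by (simp add: supp_on_def)
  define h where "h = inverse ph * ps"
  define f where "f = fps_const (q1 / q2) * (inverse ps * ph)"
  have Sh: "S = (\<lambda>p. h * ?T 0 0 p)"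
  proof
    fix p :: "nat set \<times> nat set"
    obtain x z where p: "p = (x, z)" by (cases p)
    show "S p = h * ?T 0 0 p"
    proof (cases "x \<in> ?I \<and> z \<in> ?I")
      case True
      have "S (x, z) = (inverse ph * ph) * S (x, z)" by (simp add: ph)
      also have "\<dots> = inverse ph * (ph * S (x, z))" by (rule mult.assoc)
      also have "\<dots> = h * ?T 0 0 (x, z)" using True by (simp add: S h_def mult.assoc)
      finally show ?thesis by (simp add: p)
    next
      case False thus ?thesis using Ssupp Tser_supp[of k lam b 0 0] by (auto simp: supp_on_def p)
    qed
  qed
  have hf: "f * h = fps_const (q1 / q2)"
  proof -
    have "f * h = fps_const (q1 / q2) * (inverse ps * ps) * (inverse ph * ph)" by (simp add: f_def h_def mult_ac)
    thus ?thesis by (simp add: ps ph)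
  qed
  have sc: "mmul ?I (\<lambda>p. a * A p) B = (\<lambda>p. a * mmul ?I A B p)" "mmul ?I A (\<lambda>p. a * B p) = (\<lambda>p. a * mmul ?I A B p)"
    for a :: "complex fps" and A B
    by (auto simp: mmul_def sum_distrib_left mult_ac fun_eq_iff)
  have Ciu: "C = Ci" if C: "supp_on ?I C" "mmul ?I (?T 0 0) C = idm ?I" "mmul ?I C (?T 0 0) = idm ?I" for C
  proof -
    have "C = mmul ?I (mmul ?I Ci (?T 0 0)) C" unfolding Ci(3) mmul_idm[OF fin C(1)] ..
    also have "\<dots> = Ci" unfolding mmul_assoc[OF fin] C(2) mmul_idm[OF fin Ci(1)] ..
    finally show ?thesis .
  qed
  have "BerSer q1 q2 k lam b = (\<lambda>p. f * idm ?I p)"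
    unfolding BerSer_def
  proof (rule the_equality)
    have "mmul ?I (\<lambda>p. f * idm ?I p) S = (\<lambda>p. fps_const (q1 / q2) * ?T 0 0 p)"
      unfolding sc mmul_idm[OF fin Ssupp] unfolding Sh hf[symmetric] by (simp add: mult.assoc)
    moreover have "supp_on ?I (\<lambda>p. f * idm ?I p)" by (auto simp: supp_on_def idm_def)
    ultimately show "supp_on ?I (\<lambda>p. f * idm ?I p) \<and> (\<exists>Ci. supp_on ?I Ci \<and>
        mmul ?I (?T 0 0) Ci = idm ?I \<and> mmul ?I Ci (?T 0 0) = idm ?I \<and>
        mmul ?I (\<lambda>p. f * idm ?I p) (?T 1 1 - mmul ?I (mmul ?I (?T 0 1) Ci) (?T 1 0)) = (\<lambda>p. fps_const (q1 / q2) * ?T 0 0 p))"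
      using Ci unfolding S_def by blast
  next
    fix M assume "supp_on ?I M \<and> (\<exists>Ci. supp_on ?I Ci \<and>
        mmul ?I (?T 0 0) Ci = idm ?I \<and> mmul ?I Ci (?T 0 0) = idm ?I \<and>
        mmul ?I M (?T 1 1 - mmul ?I (mmul ?I (?T 0 1) Ci) (?T 1 0)) = (\<lambda>p. fps_const (q1 / q2) * ?T 0 0 p))"
    then obtain C where M: "supp_on ?I M" and C: "supp_on ?I C" "mmul ?I (?T 0 0) C = idm ?I" "mmul ?I C (?T 0 0) = idm ?I"
      and eq: "mmul ?I M (?T 1 1 - mmul ?I (mmul ?I (?T 0 1) C) (?T 1 0)) = (\<lambda>p. fps_const (q1 / q2) * ?T 0 0 p)" by blast
    have "mmul ?I M S = (\<lambda>p. fps_const (q1 / q2) * ?T 0 0 p)" using eq unfolding Ciu[OF C] S_def .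
    hence "mmul ?I (mmul ?I M S) Ci = (\<lambda>p. fps_const (q1 / q2) * idm ?I p)" by (simp add: sc Ci)
    hence "(\<lambda>p. h * M p) = (\<lambda>p. fps_const (q1 / q2) * idm ?I p)"
      unfolding Sh mmul_assoc[OF fin] sc Ci mmul_idm[OF fin M] .
    hence hM: "h * M p = fps_const (q1 / q2) * idm ?I p" for p by (rule fun_cong)
    have hinv: "(inverse ps * ph) * h = 1"
    proof -
      have "(inverse ps * ph) * h = (inverse ps * ps) * (inverse ph * ph)" by (simp add: h_def mult_ac)
      thus ?thesis by (simp add: ps ph)
    qed
    show "M = (\<lambda>p. f * idm ?I p)"
    proof
      fix p :: "nat set \<times> nat set"
      have "M p = ((inverse ps * ph) * h) * M p" by (simp add: hinv)
      also have "\<dots> = (inverse ps * ph) * (h * M p)" by (rule mult.assoc)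
      also have "\<dots> = f * idm ?I p" unfolding hM f_def by (simp add: mult_ac)
      finally show "M p = f * idm ?I p" .
    qed
  qed
  thus ?thesis by blast
qed

lemma BerCo_scalar: "\<exists>c. BerCo q1 q2 k lam b r = fscale c (idm (carrier k))"
proof -
  obtain f where "BerSer q1 q2 k lam b = (\<lambda>p. f * idm (carrier k) p)" using BerSer_scalar by blast
  hence "BerCo q1 q2 k lam b r = fscale (f $ r) (idm (carrier k))"
    by (auto simp: BerCo_def fscale_def idm_def fun_eq_iff)
  thus ?thesis by blast
qed

section \<open>Idempotent matrices\<close>

lemma sum_fun_apply: "(sum f A) x = (\<Sum>a\<in>A. f a x)"
  by (induction A rule: infinite_finite_induct) auto

lemma fscale_apply: "fscale c f x = c * f x" by (simp add: fscale_def)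

lemma vecs_expand: "finite J \<Longrightarrow> v \<in> vecs J \<Longrightarrow> v = (\<Sum>z\<in>J. fscale (v z) (basisv z))"
proof
  fix x assume J: "finite J" "v \<in> vecs J"
  have "(\<Sum>z\<in>J. fscale (v z) (basisv z)) x = (\<Sum>z\<in>J. if z = x then v z else 0)"
    unfolding sum_fun_apply fscale_apply basisv_def by (intro sum.cong) auto
  thus "v x = (\<Sum>z\<in>J. fscale (v z) (basisv z)) x" using J by (auto simp: vecs_def)
qed

lemma vecs_span: "finite J \<Longrightarrow> vecs J \<subseteq> fvs.span (basisv ` J)"
proof
  fix v :: "'a \<Rightarrow> complex" assume J: "finite J" "v \<in> vecs J"
  have "(\<Sum>z\<in>J. fscale (v z) (basisv z)) \<in> fvs.span (basisv ` J)"
    by (intro fvs.span_sum fvs.span_scale fvs.span_base) auto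
  thus "v \<in> fvs.span (basisv ` J)" using vecs_expand[OF J] by simp
qed

lemma mvec_in_vecs: "supp_on J A \<Longrightarrow> mvec J A v \<in> vecs J"
  by (auto simp: vecs_def mvec_def supp_on_def)

lemma mvec_lin: "mvec J A (u + v) = mvec J A u + mvec J A v" "mvec J A (fscale c v) = fscale c (mvec J A v)"
  "mvec J (A + B) v = mvec J A v + mvec J B v" "mvec J (fscale c A) v = fscale c (mvec J A v)" "mvec J A 0 = 0"
  by (auto simp: mvec_def fun_eq_iff fscale_apply distrib_left distrib_right sum.distrib sum_distrib_left mult_ac)

lemma mvec_mmul: "finite J \<Longrightarrow> mvec J (mmul J A B) v = mvec J A (mvec J B v)"
  unfolding mvec_def mmul_def
  by (rule ext) (simp add: sum_distrib_left sum_distrib_right mult.assoc, rule sum.swap)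

lemma mvec_idm: "finite J \<Longrightarrow> v \<in> vecs J \<Longrightarrow> mvec J (idm J) v = v"
proof
  fix x assume J: "finite J" "v \<in> vecs J"
  have "mvec J (idm J) v x = (\<Sum>y\<in>J. if x = y then v y else 0)"
    unfolding mvec_def by (auto simp: idm_def intro!: sum.cong)
  thus "mvec J (idm J) v x = v x" using J by (auto simp: vecs_def)
qed

lemma mvec_basisv_col: "finite J \<Longrightarrow> z \<in> J \<Longrightarrow> mvec J A (basisv z) = (\<lambda>x. A (x, z))"
  by (auto simp: mvec_def basisv_def if_distrib cong: if_cong)

lemma basisv_in_vecs: "z \<in> J \<Longrightarrow> basisv z \<in> vecs J"
  by (auto simp: basisv_def vecs_def)

text \<open>Write the columns of \<open>E\<close> in a basis of its image. Idempotence makes the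
  coordinate functionals dual to that basis, so the trace counts the basis vectors.\<close>

lemma trace_idempotent:
  fixes E :: "'i \<times> 'i \<Rightarrow> complex"
  assumes J: "finite J" and E: "supp_on J E" "mmul J E E = E"
  obtains B where "finite B" "{mvec J E v | v. v \<in> vecs J} \<subseteq> fvs.span B" "(\<Sum>x\<in>J. E (x, x)) = of_nat (card B)"
    "card B = cdim {mvec J E v | v. v \<in> vecs J}"
proof -
  let ?R = "{mvec J E v | v. v \<in> vecs J}"
  obtain B where B: "B \<subseteq> ?R" "fvs.independent B" "?R \<subseteq> fvs.span B" "card B = cdim ?R"
    by (rule fvs.basis_exists)
  have "B \<subseteq> fvs.span (basisv ` J)" using B(1) vecs_span[OF J] mvec_in_vecs[OF E(1)] by auto
  hence fB: "finite B" using fvs.independent_span_bound[of "basisv ` J" B] J B(2) by auto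
  define c where "c = (\<lambda>z b. fvs.representation B (\<lambda>x. E (x, z)) b)"
  have col: "(\<lambda>x. E (x, z)) = (\<Sum>b\<in>B. fscale (c z b) b)" if "z \<in> J" for z
  proof -
    have "(\<lambda>x. E (x, z)) \<in> ?R" using mvec_basisv_col[OF J that, of E] basisv_in_vecs[OF that] by (metis (mono_tags, lifting) mem_Collect_eq)
    hence "(\<lambda>x. E (x, z)) \<in> fvs.span B" using B(3) by blast
    thus ?thesis unfolding c_def using fvs.sum_representation_eq[OF B(2) _ fB order_refl] by metis
  qed
  have dual: "(\<Sum>z\<in>J. c z b' * b z) = (if b' = b then 1 else 0)" if b: "b \<in> B" "b' \<in> B" for b b'
  proof -
    obtain v where v: "b = mvec J E v" using b(1) B(1) by blast
    have fixb: "mvec J E b = b" unfolding v mvec_mmul[OF J, symmetric] E(2) ..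
    have "b x = (\<Sum>d\<in>B. fscale (\<Sum>z\<in>J. c z d * b z) d) x" for x
    proof -
      have "b x = (\<Sum>z\<in>J. (\<lambda>x. E (x, z)) x * b z)" using fun_cong[OF fixb, of x] by (simp add: mvec_def)
      also have "\<dots> = (\<Sum>z\<in>J. (\<Sum>d\<in>B. fscale (c z d) d) x * b z)"
        by (rule sum.cong[OF refl], rule arg_cong[where f="\<lambda>y. y * _"], rule fun_cong[OF col])
      also have "\<dots> = (\<Sum>z\<in>J. \<Sum>d\<in>B. c z d * b z * d x)"
        unfolding sum_fun_apply fscale_apply sum_distrib_right by (intro sum.cong refl) (simp only: mult_ac)
      also have "\<dots> = (\<Sum>d\<in>B. \<Sum>z\<in>J. c z d * b z * d x)" by (rule sum.swap)
      finally show ?thesis by (simp add: sum_fun_apply fscale_apply sum_distrib_right)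
    qed
    hence e: "b = (\<Sum>d\<in>B. fscale (\<Sum>z\<in>J. c z d * b z) d)" by (rule ext)
    have e2: "b = (\<Sum>d\<in>B. fscale (if d = b then 1 else 0) d)"
    proof
      fix x
      have "(\<Sum>d\<in>B. fscale (if d = b then 1 else 0) d) x = (\<Sum>d\<in>B. if d = b then d x else 0)"
        unfolding sum_fun_apply fscale_apply by (intro sum.cong) auto
      thus "b x = (\<Sum>d\<in>B. fscale (if d = b then 1 else 0) d) x" using b(1) fB by simp
    qed
    have "(\<Sum>d\<in>B. fscale ((\<Sum>z\<in>J. c z d * b z) - (if d = b then 1 else 0)) d) = 0"
      unfolding fvs.scale_left_diff_distrib sum_subtractf using e e2 by simp
    from fvs.independentD[OF B(2) fB order_refl this b(2)] show ?thesis by simp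
  qed
  have "(\<Sum>x\<in>J. E (x, x)) = (\<Sum>x\<in>J. (\<Sum>b\<in>B. fscale (c x b) b) x)" by (rule sum.cong[OF refl], rule fun_cong[OF col])
  also have "\<dots> = (\<Sum>b\<in>B. \<Sum>x\<in>J. c x b * b x)"
    unfolding sum_fun_apply fscale_apply by (rule sum.swap)
  also have "\<dots> = (\<Sum>b\<in>B. 1)" by (intro sum.cong refl) (simp add: dual)
  also have "\<dots> = of_nat (card B)" by simp
  finally have "(\<Sum>x\<in>J. E (x, x)) = of_nat (card B)" .
  from that[OF fB B(3) this B(4)] show thesis .
qed

text \<open>The complementary idempotent has trace zero, so its image is spanned by the empty
  set.\<close>

lemma idempotent_full_trace:
  fixes E :: "'i \<times> 'i \<Rightarrow> complex"
  assumes J: "finite J" and E: "supp_on J E" "mmul J E E = E" "(\<Sum>x\<in>J. E (x, x)) = of_nat (card J)"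
  shows "E = idm J"
proof -
  define E' where "E' = (\<lambda>p. idm J p - E p)"
  have "supp_on J (idm J :: 'i \<times> 'i \<Rightarrow> complex)" by (rule supp_on_idm)
  hence s: "supp_on J E'" using E(1) unfolding supp_on_def E'_def by simp
  have dl: "mmul J (\<lambda>p. A p - B p) C = (\<lambda>p. mmul J A C p - mmul J B C p)"
    and dr: "mmul J C (\<lambda>p. A p - B p) = (\<lambda>p. mmul J C A p - mmul J C B p)" for A B C :: "'i \<times> 'i \<Rightarrow> complex"
    by (auto simp: mmul_def left_diff_distrib right_diff_distrib sum_subtractf)
  have i: "mmul J E' E' = E'"
    unfolding E'_def dl dr mmul_idm[OF J E(1)] mmul_idm[OF J supp_on_idm] E(2) by simp
  obtain B where B: "finite B" "{mvec J E' v | v. v \<in> vecs J} \<subseteq> fvs.span B" "(\<Sum>x\<in>J. E' (x, x)) = of_nat (card B)"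
    "card B = cdim {mvec J E' v | v. v \<in> vecs J}" by (rule trace_idempotent[OF J s i])
  have "(\<Sum>x\<in>J. E' (x, x)) = 0" unfolding E'_def sum_subtractf E(3) by (simp add: idm_def)
  hence "B = {}" using B(1,3) by simp
  hence z: "mvec J E' (basisv z) = 0" if "z \<in> J" for z using B(2) basisv_in_vecs[OF that] by auto
  have "E' p = 0" for p
  proof (cases p)
    case (Pair x z)
    show ?thesis
    proof (cases "z \<in> J")
      case True
      show ?thesis using fun_cong[OF z[OF True], of x] unfolding mvec_basisv_col[OF J True] Pair by simp
    next
      case False thus ?thesis using s by (simp add: supp_on_def Pair)
    qed
  qed
  thus ?thesis by (auto simp: E'_def fun_eq_iff)
qed

text \<open>The reversed product is idempotent and has the same trace as the identity.\<close>

lemma left_inverse_is_right: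
  fixes M B :: "'i \<times> 'i \<Rightarrow> complex"
  assumes J: "finite J" and s: "supp_on J M" "supp_on J B" and MB: "mmul J M B = idm J"
  shows "mmul J B M = idm J"
proof (rule idempotent_full_trace[OF J supp_on_mmul[OF s(2,1)]])
  have "mmul J (mmul J B M) (mmul J B M) = mmul J B (mmul J (mmul J M B) M)" using J by (simp add: mmul_assoc)
  also have "\<dots> = mmul J B M" unfolding MB mmul_idm[OF J s(1)] ..
  finally show "mmul J (mmul J B M) (mmul J B M) = mmul J B M" .
  have "(\<Sum>x\<in>J. mmul J B M (x, x)) = (\<Sum>x\<in>J. \<Sum>y\<in>J. B (x, y) * M (y, x))" by (simp add: mmul_def)
  also have "\<dots> = (\<Sum>y\<in>J. \<Sum>x\<in>J. B (x, y) * M (y, x))" by (rule sum.swap)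
  also have "\<dots> = (\<Sum>y\<in>J. mmul J M B (y, y))" by (simp add: mmul_def mult.commute)
  also have "\<dots> = of_nat (card J)" unfolding MB by (simp add: idm_def)
  finally show "(\<Sum>x\<in>J. mmul J B M (x, x)) = of_nat (card J)" .
qed

section \<open>Consequences of cyclicity\<close>

lemma opT_vac_01: "opT p q (\<lambda>_. 1) k 0 1 vac S = wg p q k vac S"
proof (induction k arbitrary: S)
  case (Suc k)
  show ?case
  proof (cases "k \<in> S")
    case True
    hence ne: "S - {..<k} \<noteq> {}" by auto
    have z: "opT p q (\<lambda>_. 1) k 0 1 vac S = 0" by (rule opT_vac_zero[OF ne])
    have w: "wg p q k vac S = 0" using z Suc.IH[of S] by simp
    have "opT p q (\<lambda>_. 1) (Suc k) 0 1 vac S = - sg k S * opT p q (\<lambda>_. 1) k 1 1 vac (S - {k})"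
      using True z by simp
    thus ?thesis using True w unfolding opT_vac by (simp add: mult_ac)
  next
    case False
    thus ?thesis using Suc.IH[of S] by simp
  qed
qed simp

text \<open>The span of all wedges of vectors v(x) at complex parameters. It is stable under the
  Yangian generators and contains the vacuum, so cyclicity forces it to contain the whole
  space.\<close>

definition wsp :: "(nat \<Rightarrow> complex) \<Rightarrow> (nat \<Rightarrow> complex) \<Rightarrow> nat \<Rightarrow> (nat set \<Rightarrow> complex) set" where
  "wsp P Q k = fvs.span (range (Gl P Q k vac))"

lemma wsp_closed: "u \<in> wsp P Q k \<Longrightarrow> v \<in> wsp P Q k \<Longrightarrow> (\<lambda>S. u S + v S) \<in> wsp P Q k"
  "u \<in> wsp P Q k \<Longrightarrow> (\<lambda>S. c * u S) \<in> wsp P Q k" "(\<lambda>S. 0) \<in> wsp P Q k" "Gl P Q k vac xs \<in> wsp P Q k"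
proof -
  show "(\<lambda>S. u S + v S) \<in> wsp P Q k" if "u \<in> wsp P Q k" "v \<in> wsp P Q k"
    using fvs.span_add[OF that[unfolded wsp_def]] by (simp add: wsp_def plus_fun_def)
  show "(\<lambda>S. c * u S) \<in> wsp P Q k" if "u \<in> wsp P Q k"
    using fvs.span_scale[OF that[unfolded wsp_def], of c] by (simp add: wsp_def fscale_def)
  show "(\<lambda>S. 0) \<in> wsp P Q k" using fvs.span_zero by (simp add: wsp_def zero_fun_def)
  show "Gl P Q k vac xs \<in> wsp P Q k" unfolding wsp_def by (rule fvs.span_base) simp
qed

lemma wsp_sum: "(\<And>a. a \<in> A \<Longrightarrow> f a \<in> wsp P Q k) \<Longrightarrow> (\<lambda>S. \<Sum>a\<in>A. c a * f a S) \<in> wsp P Q k"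
proof (induction A rule: infinite_finite_induct)
  case (insert x A)
  have "(\<lambda>S. c x * f x S + (\<Sum>a\<in>A. c a * f a S)) \<in> wsp P Q k"
    by (rule wsp_closed(1)[OF wsp_closed(2)]) (use insert in auto)
  thus ?case using insert by simp
qed (simp_all add: wsp_closed(3))

lemma wsp_induct [consumes 1, case_names gen zero add scale]:
  assumes "v \<in> wsp P Q k" "\<And>xs. Pr (Gl P Q k vac xs)" "Pr (\<lambda>S. 0)"
    "\<And>u v. Pr u \<Longrightarrow> Pr v \<Longrightarrow> Pr (\<lambda>S. u S + v S)" "\<And>c u. Pr u \<Longrightarrow> Pr (\<lambda>S. c * u S)"
  shows "Pr v"
proof -
  have "wsp P Q k \<subseteq> Collect Pr" unfolding wsp_def
    by (rule fvs.span_minimal) (auto intro!: fvs.subspaceI simp: assms(2) zero_fun_def assms(3) plus_fun_def assms(4) fscale_def assms(5))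
  thus ?thesis using assms(1) by auto
qed

lemma wsp_wv: "v \<in> wsp P Q k \<Longrightarrow> wv P Q k w v \<in> wsp P Q k"
proof (induction v rule: wsp_induct)
  case (gen xs)
  show ?case unfolding Gl_simps(2)[symmetric] by (rule wsp_closed(4))
next
  case zero
  have e: "wv P Q k w (\<lambda>S. 0) = (\<lambda>S. 0)" by auto
  show ?case unfolding e by (rule wsp_closed(3))
next
  case (add u v)
  have "wv P Q k w (\<lambda>S. u S + v S) = (\<lambda>S. wv P Q k w u S + wv P Q k w v S)" by (rule ext) (rule wg_add)
  thus ?case using wsp_closed(1)[OF add] by simp
next
  case (scale c u)
  have "wv P Q k w (\<lambda>S. c * u S) = (\<lambda>S. c * wv P Q k w u S)" by (rule ext) (rule wg_cmult)
  thus ?case using wsp_closed(2)[OF scale] by simp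
qed

lemma wsp_vecs: "v \<in> wsp P Q k \<Longrightarrow> v \<in> vecs (carrier k)"
proof (induction v rule: wsp_induct)
  case (gen xs)
  show ?case unfolding vecs_def carrier_def using Gl_support[of P Q k "{}" xs] by auto
qed (auto simp: vecs_def)

text \<open>The exchange relations express T_ij(t) on a longer wedge through shorter ones after
  division by t - w; hence the restriction to parameters \<open>t\<close> outside the list.\<close>

lemma wsp_opT_Gl:
  assumes "t \<notin> set xs" "i \<le> 1" "j \<le> 1"
  shows "opT (\<lambda>s. t + P s) (\<lambda>s. t + Q s) (\<lambda>_. 1) k i j (Gl P Q k vac xs) \<in> wsp P Q k"
  using assms
proof (induction xs arbitrary: i j)
  case Nil
  let ?T = "\<lambda>i j. opT (\<lambda>s. t + P s) (\<lambda>s. t + Q s) (\<lambda>_. 1) k i j vac"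
  have v: "vac \<in> wsp P Q k" using wsp_closed(4)[of P Q k "[]"] by simp
  have "?T 0 0 \<in> wsp P Q k" using wsp_closed(2)[OF v] by (simp add: opT_vac(1)[abs_def])
  moreover have "?T 1 1 \<in> wsp P Q k" using wsp_closed(2)[OF v] by (simp only: opT_vac(3)[abs_def])
  moreover have "?T 1 0 \<in> wsp P Q k" using wsp_closed(3) by (simp only: opT_vac(2)[abs_def])
  moreover have "?T 0 1 \<in> wsp P Q k" using wsp_closed(4)[of P Q k "[t]"] by (simp add: opT_vac_01[abs_def, unfolded One_nat_def])
  moreover have "(i = 0 \<or> i = 1) \<and> (j = 0 \<or> j = 1)" using Nil by auto
  ultimately show ?case by auto
next
  case (Cons w xs)
  let ?T = "\<lambda>i j u. opT (\<lambda>s. t + P s) (\<lambda>s. t + Q s) (\<lambda>_. 1) k i j u"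
  define d where "d = t - w"
  let ?u = "Gl P Q k vac xs" and ?V = "wv P Q k w"
  let ?fp = "\<Prod>s<k. w + P s" and ?fq = "\<Prod>s<k. w + Q s"
  have d0: "d \<noteq> 0" using Cons.prems by (auto simp: d_def)
  have shift: "t + P s = (w + P s) + d" "t + Q s = (w + Q s) + d" for s by (simp_all add: d_def)
  note rel = fermion_relations[of "\<lambda>s. t + P s" "\<lambda>s. w + P s" d "\<lambda>s. t + Q s" "\<lambda>s. w + Q s" k ?u, OF shift]
  have TI: "?T i j ?u \<in> wsp P Q k" if "i \<le> 1" "j \<le> 1" for i j using Cons.IH[OF _ that] Cons.prems by auto
  have VI: "?V (?T i j ?u) \<in> wsp P Q k" if "i \<le> 1" "j \<le> 1" for i j by (rule wsp_wv[OF TI[OF that]])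
  have div: "f \<in> wsp P Q k" if "\<And>S. d * f S = h S" "h \<in> wsp P Q k" for f h
  proof -
    have e: "f = (\<lambda>S. (1 / d) * h S)" using d0 by (auto simp: that(1)[symmetric])
    show ?thesis unfolding e by (rule wsp_closed(2)[OF that(2)])
  qed
  have sub: "(\<lambda>S. u S - v S) \<in> wsp P Q k" if "u \<in> wsp P Q k" "v \<in> wsp P Q k" for u v
    using wsp_closed(1)[OF that(1) wsp_closed(2)[OF that(2), of "-1"]] by simp
  have "?T 0 1 (?V ?u) \<in> wsp P Q k" by (rule div[OF rel(1)]) (intro wsp_closed VI, auto)
  moreover have "?T 1 1 (?V ?u) \<in> wsp P Q k" by (rule div[OF rel(2)]) (intro wsp_closed VI TI, auto)
  moreover have "?T 0 0 (?V ?u) \<in> wsp P Q k" by (rule div[OF rel(3)]) (intro wsp_closed VI TI, auto)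
  moreover have "?T 1 0 (?V ?u) \<in> wsp P Q k" by (rule div[OF rel(4)]) (intro sub wsp_closed VI TI, auto)
  moreover have "(i = 0 \<or> i = 1) \<and> (j = 0 \<or> j = 1)" using Cons.prems by auto
  ultimately show ?case unfolding Gl_simps by (elim conjE disjE) (simp_all only:)
qed

text \<open>Lagrange interpolation at arbitrary nodes, which can therefore avoid the finitely many
  parameters excluded in \<open>wsp_opT_Gl\<close>.\<close>

lemma lagrange_coeff:
  fixes A :: "complex set"
  assumes "card A = Suc n"
  shows "\<exists>c. \<forall>p. degree p \<le> n \<longrightarrow> coeff p m = (\<Sum>a\<in>A. c a * poly p a)"
proof -
  have A: "finite A" by (rule card_ge_0_finite) (simp add: assms)
  define L where "L = (\<lambda>a. smult (1 / (\<Prod>b\<in>A - {a}. a - b)) (\<Prod>b\<in>A - {a}. [:- b, 1:]))"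
  have degL: "degree (L a) \<le> n" if "a \<in> A" for a
  proof -
    have "degree (\<Prod>b\<in>A - {a}. [:- b, 1:]) \<le> (\<Sum>b\<in>A - {a}. (degree \<circ> (\<lambda>b. [:- b, 1:])) b)"
      by (rule degree_prod_sum_le) (use A in simp)
    also have "\<dots> = n" using A that assms by simp
    finally have d: "degree (\<Prod>b\<in>A - {a}. [:- b, 1:]) \<le> n" .
    show ?thesis unfolding L_def by (rule order_trans[OF degree_smult_le d])
  qed
  have L: "poly (L a) a' = (if a = a' then 1 else 0)" if "a \<in> A" "a' \<in> A" for a a'
  proof (cases "a = a'")
    case True
    have "(\<Prod>b\<in>A - {a}. a - b) \<noteq> 0" using A by auto
    thus ?thesis using True by (simp add: L_def poly_prod)
  next
    case False
    have "(\<Prod>b\<in>A - {a}. a' - b) = 0" using that False A by (intro prod_zero) auto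
    thus ?thesis using False by (simp add: L_def poly_prod)
  qed
  have "coeff p m = (\<Sum>a\<in>A. coeff (L a) m * poly p a)" if p: "degree p \<le> n" for p
  proof -
    have "p = (\<Sum>a\<in>A. smult (poly p a) (L a))"
    proof (rule poly_eqI_degree[of A])
      fix x assume x: "x \<in> A"
      have "poly (\<Sum>a\<in>A. smult (poly p a) (L a)) x = (\<Sum>a\<in>A. if a = x then poly p a else 0)"
        unfolding poly_sum by (intro sum.cong refl) (use x L in auto)
      thus "poly p x = poly (\<Sum>a\<in>A. smult (poly p a) (L a)) x" using x A by simp
    next
      show "degree p < card A" using p assms by simp
      have "degree (\<Sum>a\<in>A. smult (poly p a) (L a)) \<le> n"
      proof (rule degree_sum_le[OF A])
        fix a assume "a \<in> A"
        show "degree (smult (poly p a) (L a)) \<le> n" by (rule order_trans[OF degree_smult_le degL[OF \<open>a \<in> A\<close>]])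
      qed
      thus "degree (\<Sum>a\<in>A. smult (poly p a) (L a)) < card A" using assms by simp
    qed
    hence "coeff p m = coeff (\<Sum>a\<in>A. smult (poly p a) (L a)) m" by simp
    thus ?thesis by (simp only: coeff_sum coeff_smult mult.commute)
  qed
  thus ?thesis by (intro exI[of _ "\<lambda>a. coeff (L a) m"]) simp
qed

lemma opT_expand:
  fixes u :: "nat set \<Rightarrow> complex"
  assumes "u \<in> vecs (carrier k)"
  shows "opT p q e k i j u R = (\<Sum>y\<in>carrier k. u y * opT p q e k i j (delta y) R)"
proof -
  have "u R' = (\<Sum>y\<in>carrier k. u y * delta y R')" for R'
  proof -
    have "(\<Sum>y\<in>carrier k. u y * delta y R') = (\<Sum>y\<in>carrier k. if y = R' then u y else 0)"
      by (intro sum.cong) (auto simp: delta_def)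
    thus ?thesis using assms by (auto simp: vecs_def)
  qed
  hence "u = (\<lambda>R. \<Sum>y\<in>carrier k. u y * delta y R)" by (rule ext)
  hence "opT p q e k i j u R = opT p q e k i j (\<lambda>R. \<Sum>y\<in>carrier k. u y * delta y R) R"
    by (rule arg_cong[where f="\<lambda>v. opT p q e k i j v R"])
  also have "\<dots> = (\<Sum>y\<in>carrier k. u y * opT p q e k i j (delta y) R)" by (rule opT_sum[OF finite_carrier])
  finally show ?thesis .
qed

abbreviation "Pb lam b \<equiv> \<lambda>s::nat. - b s + fst (lam s :: complex \<times> complex)"
abbreviation "Qb lam b \<equiv> \<lambda>s::nat. - b s - snd (lam s :: complex \<times> complex)"

lemma poly_Tpoly: "poly (Tpoly k lam b i j S' S) t = opT (\<lambda>s. t + Pb lam b s) (\<lambda>s. t + Qb lam b s) (\<lambda>_. 1) k i j (delta S) S'"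
proof -
  have "(\<lambda>R. poly (delta S R) t) = delta S" by (auto simp: delta_def)
  thus ?thesis unfolding Tpoly_def by (subst opT_hom[of "\<lambda>p. poly p t"]) (simp_all add: add.commute add_diff_eq)
qed

lemma wsp_Tpoly_coeff:
  assumes "i \<le> 1" "j \<le> 1"
  shows "(\<lambda>S'. \<Sum>S\<in>carrier k. Gl (Pb lam b) (Qb lam b) k vac xs S * coeff (Tpoly k lam b i j S' S) m) \<in> wsp (Pb lam b) (Qb lam b) k"
proof -
  let ?P = "Pb lam b" and ?Q = "Qb lam b"
  let ?v = "Gl ?P ?Q k vac xs"
  have "infinite (UNIV - set xs :: complex set)" by (simp add: infinite_UNIV_char_0)
  \<comment> \<open>Sample points outside the list, one more than the degree bound, at which every
    T_ij may be applied.\<close>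
  then obtain A :: "complex set" where A: "card A = Suc k" "A \<subseteq> UNIV - set xs" "finite A"
    by (meson infinite_arbitrarily_large)
  obtain c where c: "\<And>p. degree p \<le> k \<Longrightarrow> coeff p m = (\<Sum>a\<in>A. c a * poly p a)" using lagrange_coeff[OF A(1), of m] by blast
  have dg: "degree (Tpoly k lam b i j S' S) \<le> k" for S S'
    unfolding Tpoly_def using rev_of_opT by (simp add: rev_of_def)
  have "(\<Sum>S\<in>carrier k. ?v S * coeff (Tpoly k lam b i j S' S) m)
     = (\<Sum>a\<in>A. c a * opT (\<lambda>s. a + ?P s) (\<lambda>s. a + ?Q s) (\<lambda>_. 1) k i j ?v S')" for S'
  proof -
    have "(\<Sum>S\<in>carrier k. ?v S * coeff (Tpoly k lam b i j S' S) m)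
      = (\<Sum>S\<in>carrier k. \<Sum>a\<in>A. c a * (?v S * poly (Tpoly k lam b i j S' S) a))"
      unfolding c[OF dg] sum_distrib_left by (intro sum.cong refl) (rule mult.left_commute)
    also have "\<dots> = (\<Sum>a\<in>A. \<Sum>S\<in>carrier k. c a * (?v S * poly (Tpoly k lam b i j S' S) a))" by (rule sum.swap)
    finally show ?thesis unfolding poly_Tpoly sum_distrib_left[symmetric] opT_expand[OF wsp_vecs[OF wsp_closed(4)]] .
  qed
  hence e: "(\<lambda>S'. \<Sum>S\<in>carrier k. ?v S * coeff (Tpoly k lam b i j S' S) m)
     = (\<lambda>S'. \<Sum>a\<in>A. c a * opT (\<lambda>s. a + ?P s) (\<lambda>s. a + ?Q s) (\<lambda>_. 1) k i j ?v S')" by (rule ext)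
  show ?thesis unfolding e by (rule wsp_sum, rule wsp_opT_Gl) (use A(2) assms in auto)
qed

lemma Tpoly_outside: "S' \<notin> carrier k \<Longrightarrow> S \<in> carrier k \<Longrightarrow> Tpoly k lam b i j S' S = 0"
proof -
  assume a: "S' \<notin> carrier k" "S \<in> carrier k"
  have "Tpoly k lam b i j S' S = opT (\<lambda>s. [:- b s + fst (lam s), 1:]) (\<lambda>s. [:- b s - snd (lam s), 1:]) (\<lambda>s. 1) k i j (\<lambda>S. 0) S'"
    unfolding Tpoly_def by (rule opT_cong) (use a in \<open>auto simp: delta_def carrier_def\<close>)
  thus ?thesis by simp
qed

lemma Tser_nth:
  assumes "S \<in> carrier k" "i \<le> 1" "j \<le> 1"
  shows "Tser k lam b i j (S', S) $ r = (\<Sum>a=0..r. inverse (Dser k b) $ a * (if r - a \<le> k then coeff (Tpoly k lam b i j S' S) (k - (r - a)) else 0))"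
proof (cases "S' \<in> carrier k")
  case True
  have "inverse (Dser k b) * Dser k b = 1" by (rule inverse_mult_eq_1) (simp add: Dser_0)
  hence "Tser k lam b i j (S', S) = inverse (Dser k b) * (Dser k b * Tser k lam b i j (S', S))"
    by (simp add: mult.assoc[symmetric])
  moreover have "(Dser k b * Tser k lam b i j (S', S)) $ m = (if m \<le> k then coeff (Tpoly k lam b i j S' S) (k - m) else 0)" for m
    using Dser_Tser[OF True assms] by (simp add: rev_of_def)
  ultimately show ?thesis using fps_mult_nth[of "inverse (Dser k b)" "Dser k b * Tser k lam b i j (S', S)" r] by (simp only:)
next
  case False
  thus ?thesis unfolding Tpoly_outside[OF False assms(1)] coeff_0 if_cancel mult_zero_right sum.neutral_const
    by (simp add: Tser_outside)
qed

text \<open>Dividing by the cleared denominator makes each series coefficient of T_ij a finite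
  combination of coefficients of the polynomial entries.\<close>

lemma wsp_Tco:
  assumes "v \<in> wsp (Pb lam b) (Qb lam b) k" "i \<le> 1" "j \<le> 1"
  shows "mvec (carrier k) (Tco k lam b r i j) v \<in> wsp (Pb lam b) (Qb lam b) k"
  using assms(1)
proof (induction v rule: wsp_induct)
  case (gen xs)
  let ?v = "Gl (Pb lam b) (Qb lam b) k vac xs"
  define f where "f = (\<lambda>a S'. if r - a \<le> k then (\<Sum>S\<in>carrier k. ?v S * coeff (Tpoly k lam b i j S' S) (k - (r - a))) else 0)"
  have "f a \<in> wsp (Pb lam b) (Qb lam b) k" for a
    using wsp_Tpoly_coeff[OF assms(2,3)] wsp_closed(3) by (cases "r - a \<le> k") (simp_all add: f_def)
  hence "(\<lambda>S'. \<Sum>a=0..r. inverse (Dser k b) $ a * f a S') \<in> wsp (Pb lam b) (Qb lam b) k" by (intro wsp_sum)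
  moreover have "mvec (carrier k) (Tco k lam b r i j) ?v = (\<lambda>S'. \<Sum>a=0..r. inverse (Dser k b) $ a * f a S')"
  proof
    fix S'
    have "mvec (carrier k) (Tco k lam b r i j) ?v S'
       = (\<Sum>S\<in>carrier k. \<Sum>a=0..r. inverse (Dser k b) $ a * (if r - a \<le> k then ?v S * coeff (Tpoly k lam b i j S' S) (k - (r - a)) else 0))"
      unfolding mvec_def Tco_def using assms by (intro sum.cong refl) (auto simp: Tser_nth sum_distrib_right intro!: sum.cong)
    also have "\<dots> = (\<Sum>a=0..r. \<Sum>S\<in>carrier k. inverse (Dser k b) $ a * (if r - a \<le> k then ?v S * coeff (Tpoly k lam b i j S' S) (k - (r - a)) else 0))"
      by (rule sum.swap)
    also have "\<dots> = (\<Sum>a=0..r. inverse (Dser k b) $ a * f a S')"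
      by (intro sum.cong refl) (simp add: f_def sum_distrib_left)
    finally show "mvec (carrier k) (Tco k lam b r i j) ?v S' = (\<Sum>a=0..r. inverse (Dser k b) $ a * f a S')" .
  qed
  ultimately show ?case by simp
next
  case zero
  have e: "mvec (carrier k) (Tco k lam b r i j) (\<lambda>S. 0) = (\<lambda>S. 0)" by (simp add: mvec_def)
  show ?case unfolding e by (rule wsp_closed(3))
next
  case (add u v)
  have "mvec (carrier k) (Tco k lam b r i j) (\<lambda>S. u S + v S) = (\<lambda>S. mvec (carrier k) (Tco k lam b r i j) u S + mvec (carrier k) (Tco k lam b r i j) v S)"
    by (simp add: mvec_def distrib_left sum.distrib)
  thus ?case using wsp_closed(1)[OF add] by simp
next
  case (scale c u)
  have "mvec (carrier k) (Tco k lam b r i j) (\<lambda>S. c * u S) = (\<lambda>S. c * mvec (carrier k) (Tco k lam b r i j) u S)"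
    by (simp add: mvec_def sum_distrib_left mult_ac)
  thus ?case using wsp_closed(2)[OF scale] by simp
qed

lemma cyclic_wsp:
  assumes "cyclicL k lam b" "v \<in> vecs (carrier k)"
  shows "v \<in> wsp (Pb lam b) (Qb lam b) k"
proof -
  let ?N = "wsp (Pb lam b) (Qb lam b) k"
  have M: "mvec (carrier k) A v \<in> ?N"
    if "A \<in> alg_gen (carrier k) {Tco k lam b r i j | r i j. r \<ge> 1 \<and> i \<le> 1 \<and> j \<le> 1}" "v \<in> ?N" for A v
    using that
  proof (induction arbitrary: v rule: alg_gen.induct)
    case gen_id
    show ?case unfolding mvec_idm[OF finite_carrier wsp_vecs[OF gen_id]] by (rule gen_id)
  next
    case (gen_base g)
    then obtain r i j where g: "g = Tco k lam b r i j" "i \<le> 1" "j \<le> 1" by blast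
    show ?case unfolding g(1) by (rule wsp_Tco[OF gen_base.prems g(2,3)])
  next
    case (gen_add A B) show ?case unfolding mvec_lin(3) unfolding plus_fun_def by (intro wsp_closed(1) gen_add.IH gen_add.prems)
  next
    case (gen_scale A c) show ?case unfolding mvec_lin(4) unfolding fscale_def by (intro wsp_closed(2) gen_scale.IH gen_scale.prems)
  next
    case (gen_mul A B) show ?case unfolding mvec_mmul[OF finite_carrier] by (intro gen_mul.IH gen_mul.prems)
  qed
  have B: "basisv {} \<in> ?N"
  proof -
    have e: "basisv {} = Gl (Pb lam b) (Qb lam b) k vac []" by (simp add: basisv_def delta_def)
    show ?thesis unfolding e by (rule wsp_closed(4))
  qed
  have "v \<in> {mvec (carrier k) A (basisv {}) | A.
      A \<in> alg_gen (carrier k) {Tco k lam b r i j | r i j. r \<ge> 1 \<and> i \<le> 1 \<and> j \<le> 1}}"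
    using assms(2) unfolding assms(1)[unfolded cyclicL_def] .
  then obtain A where A: "v = mvec (carrier k) A (basisv {})"
    "A \<in> alg_gen (carrier k) {Tco k lam b r i j | r i j. r \<ge> 1 \<and> i \<le> 1 \<and> j \<le> 1}"
    by (elim CollectE exE conjE)
  show ?thesis unfolding A(1) by (rule M[OF A(2) B])
qed

definition chip :: "(nat \<Rightarrow> complex) \<Rightarrow> (nat \<Rightarrow> complex) \<Rightarrow> nat \<Rightarrow> nat \<Rightarrow> complex poly" where
  "chip P Q k s = - (\<Prod>t<s. [:Q t, 1:]) * (\<Prod>t\<in>{s<..<k}. [:P t, 1:])"

lemma degree_chip: "s < k \<Longrightarrow> degree (chip P Q k s) < k"
proof -
  assume s: "s < k"
  have "degree (\<Prod>t\<in>A. [:f t, 1::complex:]) \<le> card A" if "finite A" for A and f :: "nat \<Rightarrow> complex"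
    using degree_prod_sum_le[OF that, of "\<lambda>t. [:f t, 1:]"] by simp
  hence "degree (\<Prod>t<s. [:Q t, 1:]) \<le> s" "degree (\<Prod>t\<in>{s<..<k}. [:P t, 1:]) \<le> k - Suc s"
    by (metis card_lessThan finite_lessThan, metis card_greaterThanLessThan finite_greaterThanLessThan)
  thus ?thesis using degree_mult_le[of "- (\<Prod>t<s. [:Q t, 1:])" "\<Prod>t\<in>{s<..<k}. [:P t, 1:]"] s by (simp add: chip_def)
qed

lemma poly_sum_less:
  fixes p :: "'a::comm_ring_1 poly"
  shows "degree p < k \<Longrightarrow> poly p x = (\<Sum>i<k. coeff p i * x ^ i)"
  unfolding poly_altdef by (rule sum.mono_neutral_left) (auto simp: coeff_eq_0)

lemma chip_eval: "s < k \<Longrightarrow> chi (\<lambda>s. mconst (P s)) (\<lambda>s. mconst (Q s)) k x s = (\<Sum>i<k. mconst (coeff (chip P Q k s) i) * x ^ i)"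
proof -
  assume s: "s < k"
  let ?h = "map_poly mconst"
  have um: "?h (- p) = - ?h p" for p by (rule poly_eqI) (simp add: coeff_map_poly mconst_uminus)
  have "?h (chip P Q k s) = - (\<Prod>t<s. [:mconst (Q t), 1:]) * (\<Prod>t\<in>{s<..<k}. [:mconst (P t), 1:])"
    unfolding chip_def by (simp add: map_poly_hom[of mconst] um mconst_1 mconst_add mconst_mult)
  hence "chi (\<lambda>s. mconst (P s)) (\<lambda>s. mconst (Q s)) k x s = poly (?h (chip P Q k s)) x"
    by (simp add: chi_def poly_prod add.commute)
  also have "\<dots> = (\<Sum>i<k. coeff (?h (chip P Q k s)) i * x ^ i)"
  proof (rule poly_sum_less)
    have "mconst c = 0 \<longleftrightarrow> c = 0" for c using mconst_eq_iff[of c 0] by simp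
    hence "degree (?h (chip P Q k s)) = degree (chip P Q k s)" by (intro degree_map_poly) auto
    thus "degree (?h (chip P Q k s)) < k" using degree_chip[OF s] by simp
  qed
  finally show ?thesis by (simp add: coeff_map_poly)
qed

lemma poly_chip: "poly (chip P Q k s) x = chi P Q k x s"
  by (simp add: chip_def chi_def poly_prod add.commute)

text \<open>Only wedges of a single v(x) have components on one-element sets, and these are linear
  in the powers of x. \<open>B j\<close> is the resulting combination of the powers x^j, the same
  for all positions \<open>r\<close>.\<close>

lemma wsp_singleton:
  "v \<in> wsp P Q k \<Longrightarrow> \<exists>B. \<forall>r<k. v {r} = (\<Sum>j<k. coeff (chip P Q k r) j * B j)"
proof (induction v rule: wsp_induct)
  case (gen xs)
  show ?case
  proof (cases "length xs = 1")
    case True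
    then obtain x where xs: "xs = [x]" by (auto simp: length_Suc_conv)
    have "Gl P Q k vac xs {r} = (\<Sum>j<k. coeff (chip P Q k r) j * x ^ j)" if r: "r < k" for r
    proof -
      have "{s \<in> {r}. s < k} = {r}" using r by auto
      hence "Gl P Q k vac xs {r} = chi P Q k x r"
        unfolding xs by (simp add: wg_expand chi_def sg_def delta_def)
      thus ?thesis unfolding poly_chip[symmetric] using poly_sum_less[OF degree_chip[OF r]] by simp
    qed
    thus ?thesis by blast
  next
    case False
    have "Gl P Q k vac xs {r} = 0" for r using Gl_support[of P Q k "{}" xs "{r}"] False by auto
    thus ?thesis by (intro exI[of _ "\<lambda>_. 0"]) simp
  qed
next
  case zero show ?case by (intro exI[of _ "\<lambda>_. 0"]) simp
next
  case (add u v)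
  then obtain B B' where "\<forall>r<k. u {r} = (\<Sum>j<k. coeff (chip P Q k r) j * B j)" "\<forall>r<k. v {r} = (\<Sum>j<k. coeff (chip P Q k r) j * B' j)" by blast
  thus ?case by (intro exI[of _ "\<lambda>j. B j + B' j"]) (simp add: distrib_left sum.distrib)
next
  case (scale c u)
  then obtain B where "\<forall>r<k. u {r} = (\<Sum>j<k. coeff (chip P Q k r) j * B j)" by blast
  thus ?case by (intro exI[of _ "\<lambda>j. c * B j"]) (simp add: sum_distrib_left mult_ac)
qed

text \<open>Cyclicity puts the one-particle basis vectors into the span, and
  \<open>wsp_singleton\<close> then gives a right inverse of the coefficient matrix of the
  components of v(x). Being square, the matrix has it as left inverse too, and that side recovers
  x^j from the components.\<close>

lemma cyclic_eta:
  assumes cyc: "cyclicL k lam b"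
  obtains eta where "\<And>j x. j < k \<Longrightarrow> (\<Sum>s<k. mconst (eta j s) * chi (\<lambda>s. mconst (Pb lam b s)) (\<lambda>s. mconst (Qb lam b s)) k x s) = x ^ j"
proof -
  let ?c = "chip (Pb lam b) (Qb lam b) k"
  have "\<exists>B. \<forall>r<k. basisv {s} {r} = (\<Sum>j<k. coeff (?c r) j * B j)" if "s < k" for s
    by (rule wsp_singleton[OF cyclic_wsp[OF cyc basisv_in_vecs]]) (use that in \<open>simp add: carrier_def\<close>)
  then obtain B where B: "\<And>s r. s < k \<Longrightarrow> r < k \<Longrightarrow> basisv {s} {r} = (\<Sum>j<k. coeff (?c r) j * B s j)" by metis
  define Mm where "Mm = (\<lambda>(r, j). if r < k \<and> j < k then coeff (?c r) j else 0)"
  define Bm where "Bm = (\<lambda>(j, s). if s < k \<and> j < k then B s j else 0)"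
  have MB: "mmul {..<k} Mm Bm = idm {..<k}"
  proof (rule ext, clarify)
    fix r s
    show "mmul {..<k} Mm Bm (r, s) = idm {..<k} (r, s)"
      using B[of s r] by (cases "r < k \<and> s < k") (auto simp: mmul_def Mm_def Bm_def idm_def basisv_def)
  qed
  have BM: "mmul {..<k} Bm Mm = idm {..<k}"
    by (rule left_inverse_is_right[OF finite_lessThan _ _ MB]) (auto simp: supp_on_def Mm_def Bm_def)
  have inv: "(\<Sum>s<k. B s j * coeff (?c s) i) = (if j = i then 1 else 0)" if "j < k" "i < k" for i j
    using fun_cong[OF BM, of "(j, i)"] that by (simp add: mmul_def idm_def Mm_def Bm_def)
  have "(\<Sum>s<k. mconst (B s j) * chi (\<lambda>s. mconst (Pb lam b s)) (\<lambda>s. mconst (Qb lam b s)) k x s) = x ^ j" if j: "j < k" for j x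
  proof -
    have "(\<Sum>s<k. mconst (B s j) * chi (\<lambda>s. mconst (Pb lam b s)) (\<lambda>s. mconst (Qb lam b s)) k x s)
      = (\<Sum>s<k. \<Sum>i<k. mconst (B s j * coeff (?c s) i) * x ^ i)"
      by (intro sum.cong refl) (simp add: chip_eval sum_distrib_left mconst_mult mult.assoc)
    also have "\<dots> = (\<Sum>i<k. \<Sum>s<k. mconst (B s j * coeff (?c s) i) * x ^ i)" by (rule sum.swap)
    also have "\<dots> = (\<Sum>i<k. mconst (if j = i then 1 else 0) * x ^ i)"
    proof (rule sum.cong[OF refl])
      fix i assume "i \<in> {..<k}"
      hence i: "i < k" by simp
      show "(\<Sum>s<k. mconst (B s j * coeff (?c s) i) * x ^ i) = mconst (if j = i then 1 else 0) * x ^ i"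
        unfolding sum_distrib_right[symmetric] mconst_sum[symmetric] inv[OF j i] ..
    qed
    also have "\<dots> = (\<Sum>i<k. if j = i then x ^ i else 0)" by (intro sum.cong) (auto simp: mconst_1)
    also have "\<dots> = x ^ j" using j by simp
    finally show ?thesis .
  qed
  thus thesis by (rule that[of "\<lambda>j s. B s j"])
qed

section \<open>The matrix model of the Bethe algebra\<close>

lemma dim_by_coordinates:
  fixes V :: "('a \<Rightarrow> complex) set" and w :: "'j \<Rightarrow> 'a \<Rightarrow> complex"
  assumes J: "finite J" and w: "\<And>j. j \<in> J \<Longrightarrow> w j \<in> V"
    and sp: "\<And>v. v \<in> V \<Longrightarrow> \<exists>c. v = (\<Sum>j\<in>J. fscale (c j) (w j))"
    and ind: "\<And>c j. (\<Sum>j\<in>J. fscale (c j) (w j)) = 0 \<Longrightarrow> j \<in> J \<Longrightarrow> c j = 0"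
  shows "cdim V = card J"
proof -
  have inj: "inj_on w J"
  proof (rule inj_onI, rule ccontr)
    fix i j assume ij: "i \<in> J" "j \<in> J" "w i = w j" "i \<noteq> j"
    define c where "c = (\<lambda>x. if x = i then 1 else if x = j then - 1 else 0 :: complex)"
    have "(\<Sum>x\<in>J. fscale (c x) (w x)) = (\<Sum>x\<in>{i, j}. fscale (c x) (w x))"
      by (rule sum.mono_neutral_right) (use J ij in \<open>auto simp: c_def\<close>)
    also have "\<dots> = 0" using ij by (auto simp: c_def fun_eq_iff fscale_apply)
    finally show False using ind[of c i] ij(1) by (simp add: c_def)
  qed
  show ?thesis
  proof (rule fvs.dim_unique[of "w ` J"])
    show "w ` J \<subseteq> V" using w by auto
    show "V \<subseteq> fvs.span (w ` J)"
    proof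
      fix v assume "v \<in> V"
      then obtain c where "v = (\<Sum>j\<in>J. fscale (c j) (w j))" using sp by blast
      show "v \<in> fvs.span (w ` J)" unfolding \<open>v = _\<close>
        by (rule fvs.span_sum, rule fvs.span_scale, rule fvs.span_base, rule imageI)
    qed
    show "fvs.independent (w ` J)"
    proof (rule fvs.independent_if_scalars_zero)
      fix f x assume s: "(\<Sum>x\<in>w ` J. fscale (f x) x) = 0" and x: "x \<in> w ` J"
      have "(\<Sum>j\<in>J. fscale (f (w j)) (w j)) = 0" using s by (simp add: sum.reindex[OF inj])
      thus "f x = 0" using ind[of "\<lambda>j. f (w j)"] x by auto
    qed (use J in simp)
    show "card (w ` J) = card J" by (rule card_image[OF inj])
  qed
qed

context tframe begin

abbreviation "RR \<equiv> inv_ring k l"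
abbreviation "JJ \<equiv> gen_ideal k l eps"

lemma JJ: "0 \<in> JJ" "p \<in> JJ \<Longrightarrow> q \<in> JJ \<Longrightarrow> p + q \<in> JJ" "p \<in> JJ \<Longrightarrow> q \<in> JJ \<Longrightarrow> p - q \<in> JJ"
  "p \<in> RR \<Longrightarrow> q \<in> JJ \<Longrightarrow> p * q \<in> JJ" "p \<in> RR \<Longrightarrow> q \<in> JJ \<Longrightarrow> q * p \<in> JJ" "(\<And>a. a \<in> A \<Longrightarrow> f a \<in> JJ) \<Longrightarrow> sum f A \<in> JJ"
proof -
  note s = subring_inv_ring[of k l]
  show "0 \<in> JJ" unfolding gen_ideal_eq by (rule gideal_0[OF s])
  show "p \<in> JJ \<Longrightarrow> q \<in> JJ \<Longrightarrow> p + q \<in> JJ" unfolding gen_ideal_eq by (rule gideal_add[OF s])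
  show "p \<in> JJ \<Longrightarrow> q \<in> JJ \<Longrightarrow> p - q \<in> JJ" unfolding gen_ideal_eq by (rule gideal_diff[OF s])
  show m: "p \<in> RR \<Longrightarrow> q \<in> JJ \<Longrightarrow> p * q \<in> JJ" unfolding gen_ideal_eq by (rule gideal_mult[OF s])
  show "p \<in> RR \<Longrightarrow> q \<in> JJ \<Longrightarrow> q * p \<in> JJ" using m by (simp add: mult.commute)
  show "(\<And>a. a \<in> A \<Longrightarrow> f a \<in> JJ) \<Longrightarrow> sum f A \<in> JJ" unfolding gen_ideal_eq by (rule gideal_sum[OF s])
qed

lemma JJ_RR: "p \<in> JJ \<Longrightarrow> p \<in> RR"
proof -
  assume "p \<in> JJ"
  then obtain r where r: "\<And>i. r i \<in> RR" "p = (\<Sum>i\<in>{1..k}. r i * (esym k i - mconst (eps i)))"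
    by (auto simp: gen_ideal_def)
  have "esym k i \<in> RR" for i
    using esym_inv_ring[of k i] unfolding inv_ring_k_iff inv_ring_iff by (auto simp: Gp_def)
  thus ?thesis unfolding r(2) by (intro inv_ring_sum inv_ring_closed(2,3,5) r(1))
qed

lemma JJ_uminus: "p \<in> JJ \<Longrightarrow> - p \<in> JJ"
  using JJ(3)[OF JJ(1), of p] by simp

lemma lam0_zero [simp]: "lam0 0 = 0" using lam0_ideal[OF JJ(1)] .

lemma lam0_cong: "p \<in> RR \<Longrightarrow> q \<in> RR \<Longrightarrow> p - q \<in> JJ \<Longrightarrow> lam0 p = lam0 q"
  using lam0_add[of q "p - q"] lam0_ideal[of "p - q"] inv_ring_closed(3)[of p k l q] by simp

lemma lam0_sum: "(\<And>a. a \<in> A \<Longrightarrow> f a \<in> RR) \<Longrightarrow> lam0 (sum f A) = (\<Sum>a\<in>A. lam0 (f a))"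
  by (induction A rule: infinite_finite_induct) (simp_all add: lam0_add inv_ring_sum)

text \<open>Row \<open>S'\<close> holds the coordinates of \<open>p * g S'\<close> in the generators
  \<open>g\<close>, by \<open>H2\<close> (see \<open>phi_rep\<close>). So the column of all
  \<open>g S\<close> is an eigenvector of \<open>phi p\<close> with eigenvalue \<open>p\<close> in
  the quotient ring, which is the shape of the transfer relation.\<close>

definition phi :: "mpoly \<Rightarrow> nat set \<times> nat set \<Rightarrow> complex" where
  "phi p = (\<lambda>(S', S). if S' \<in> W \<and> S \<in> W then lam0 (p * g S' * u S) else 0)"

lemma phi_supp: "supp_on W (phi p)" by (auto simp: supp_on_def phi_def)

lemma phi_apply: "S' \<in> W \<Longrightarrow> S \<in> W \<Longrightarrow> phi p (S', S) = lam0 (p * g S' * u S)" by (simp add: phi_def)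

lemma phi_rep: "p \<in> RR \<Longrightarrow> S' \<in> W \<Longrightarrow> p * g S' - (\<Sum>S\<in>W. mconst (phi p (S', S)) * g S) \<in> JJ"
proof -
  assume p: "p \<in> RR" and S': "S' \<in> W"
  have "(\<Sum>S\<in>W. mconst (phi p (S', S)) * g S) = (\<Sum>S\<in>W. mconst (lam0 ((p * g S') * u S)) * g S)"
    using S' by (intro sum.cong) (simp_all add: phi_apply)
  thus ?thesis using H2[of "p * g S'"] p by (simp add: inv_ring_closed(2) g(1))
qed

lemma lam0_phi_rep:
  assumes "p \<in> RR" "q \<in> RR" "S' \<in> W"
  shows "lam0 (p * g S' * q) = (\<Sum>S\<in>W. phi p (S', S) * lam0 (g S * q))"
proof -
  have c: "mconst (phi p (S', S)) * (g S * q) \<in> RR" for S by (intro inv_ring_closed(2,5) g assms)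
  have "(p * g S' - (\<Sum>S\<in>W. mconst (phi p (S', S)) * g S)) * q \<in> JJ"
    by (rule JJ(5)[OF assms(2) phi_rep[OF assms(1,3)]])
  hence "p * g S' * q - (\<Sum>S\<in>W. mconst (phi p (S', S)) * (g S * q)) \<in> JJ"
    by (simp add: left_diff_distrib sum_distrib_right mult.assoc)
  hence "lam0 (p * g S' * q) = lam0 (\<Sum>S\<in>W. mconst (phi p (S', S)) * (g S * q))"
    by (rule lam0_cong[rotated 2]) (intro inv_ring_closed(2) inv_ring_sum c g assms)+
  also have "\<dots> = (\<Sum>S\<in>W. phi p (S', S) * lam0 (g S * q))"
    unfolding lam0_sum[OF c] by (intro sum.cong refl lam0_cmult inv_ring_closed(2) g assms)
  finally show ?thesis .
qed

lemma phi_mult: "p \<in> RR \<Longrightarrow> q \<in> RR \<Longrightarrow> phi (p * q) = mmul W (phi p) (phi q)"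
proof (rule ext, clarify)
  fix S' S assume pq: "p \<in> RR" "q \<in> RR"
  show "phi (p * q) (S', S) = mmul W (phi p) (phi q) (S', S)"
  proof (cases "S' \<in> W \<and> S \<in> W")
    case True
    have "phi (p * q) (S', S) = lam0 (p * g S' * (q * u S))" using True by (simp add: phi_apply mult_ac)
    also have "\<dots> = (\<Sum>R\<in>W. phi p (S', R) * lam0 (g R * (q * u S)))"
      by (rule lam0_phi_rep) (use pq True in \<open>auto intro: inv_ring_closed u\<close>)
    also have "\<dots> = (\<Sum>R\<in>W. phi p (S', R) * phi q (R, S))"
      using True by (intro sum.cong refl) (simp add: phi_apply mult_ac)
    finally show ?thesis by (simp add: mmul_def)
  next
    case False
    thus ?thesis by (auto simp: mmul_def phi_def intro!: sum.neutral[symmetric])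
  qed
qed

lemma phi_add: "p \<in> RR \<Longrightarrow> q \<in> RR \<Longrightarrow> phi (p + q) = phi p + phi q"
  by (auto simp: phi_def fun_eq_iff distrib_right intro!: lam0_add inv_ring_closed(2) g u)

lemma phi_scale: "p \<in> RR \<Longrightarrow> phi (mconst c * p) = fscale c (phi p)"
  by (auto simp: phi_def fun_eq_iff fscale_apply mult.assoc intro!: lam0_cmult inv_ring_closed(2) g u)

text \<open>\<open>phi 1\<close> is idempotent by multiplicativity, and \<open>H4\<close> computes
  its trace as k! / (l!(k-l)!), the number of l-subsets. Duality of \<open>g\<close> and
  \<open>u\<close> under the trace form is read off from this identity.\<close>

lemma phi_one: "phi 1 = idm W"
proof (rule idempotent_full_trace[OF finite_Wset phi_supp])
  have one: "1 \<in> RR" by (rule inv_ring_closed(6))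
  show "mmul W (phi 1) (phi 1) = phi 1" using phi_mult[OF one one] by simp
  have "(\<Sum>x\<in>W. phi 1 (x, x)) = (\<Sum>S\<in>W. lam0 (1 * g S * u S))" by (intro sum.cong) (simp_all add: phi_apply)
  also have "\<dots> = (\<Sum>\<pi> | \<pi> permutes fl. 1) / N" unfolding H4[OF one] by simp
  also have "(\<Sum>\<pi> | \<pi> permutes fl. 1) = N * (\<Sum>S\<in>W. 1)" using sum_over_cosets[OF lk, of "\<lambda>_. 1 :: complex"] by simp
  finally show "(\<Sum>x\<in>W. phi 1 (x, x)) = of_nat (card W)" using N_nonzero by simp
qed

lemma lam0_dual: "S' \<in> W \<Longrightarrow> S \<in> W \<Longrightarrow> lam0 (g S' * u S) = (if S' = S then 1 else 0)"
  using fun_cong[OF phi_one, of "(S', S)"] by (simp add: phi_apply idm_def)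

lemma expand_g: "p \<in> RR \<Longrightarrow> p - (\<Sum>S\<in>W. mconst (lam0 (u S)) * (p * g S)) \<in> JJ"
proof -
  assume p: "p \<in> RR"
  have "p * (1 - (\<Sum>S\<in>W. mconst (lam0 (1 * u S)) * g S)) \<in> JJ" by (rule JJ(4)[OF p H2[OF inv_ring_closed(6)]])
  thus ?thesis by (simp add: right_diff_distrib sum_distrib_left mult.left_commute)
qed

text \<open>A vanishing matrix puts all products \<open>p * g S\<close> into the ideal, and modulo
  the ideal 1 is a combination of the \<open>g S\<close>.\<close>

lemma phi_zero_iff: "p \<in> RR \<Longrightarrow> phi p = 0 \<longleftrightarrow> p \<in> JJ"
proof
  assume p: "p \<in> RR" "p \<in> JJ"
  have "phi p (S', S) = 0" for S' S
    using lam0_ideal[OF JJ(5)[OF u(1) JJ(5)[OF g(1) p(2)]]] by (auto simp: phi_def)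
  thus "phi p = 0" by (auto simp: fun_eq_iff)
next
  assume p: "p \<in> RR" and 0: "phi p = 0"
  have pg: "p * g S \<in> JJ" if "S \<in> W" for S using phi_rep[OF p that] 0 by simp
  have s: "(\<Sum>S\<in>W. mconst (lam0 (u S)) * (p * g S)) \<in> JJ"
    by (rule JJ(6), rule JJ(4)[OF inv_ring_closed(5) pg])
  show "p \<in> JJ" using JJ(2)[OF expand_g[OF p] s] by simp
qed

lemma phi_eq_iff: "p \<in> RR \<Longrightarrow> q \<in> RR \<Longrightarrow> phi p = phi q \<longleftrightarrow> p - q \<in> JJ"
proof -
  assume pq: "p \<in> RR" "q \<in> RR"
  have d: "p - q \<in> RR" by (rule inv_ring_closed(3)[OF pq])
  have "phi p = phi (p - q) + phi q" using phi_add[OF d pq(2)] by simp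
  hence "phi p = phi q \<longleftrightarrow> phi (p - q) = 0" by simp
  thus ?thesis using phi_zero_iff[OF d] by simp
qed

text \<open>The cyclic vector: \<open>v0\<close> records the trace form on the generators
  \<open>g S\<close>, and \<open>vr p\<close> is its image under \<open>phi p\<close>. Through
  \<open>vr\<close> the regular representation of the quotient ring becomes the action on the weight
  space; \<open>pv\<close> inverts it by means of the dual basis.\<close>

definition v0 :: "nat set \<Rightarrow> complex" where "v0 S = (if S \<in> W then lam0 (g S) else 0)"
definition vr :: "mpoly \<Rightarrow> nat set \<Rightarrow> complex" where "vr p S = (if S \<in> W then lam0 (p * g S) else 0)"

lemma vr_add: "p \<in> RR \<Longrightarrow> q \<in> RR \<Longrightarrow> vr (p + q) = vr p + vr q"
  by (auto simp: vr_def fun_eq_iff distrib_right intro!: lam0_add inv_ring_closed(2) g)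

lemma vr_vecs: "vr p \<in> vecs W" by (simp add: vr_def vecs_def)

lemma phi_v0: "p \<in> RR \<Longrightarrow> mvec W (phi p) v0 = vr p"
proof
  fix S' assume p: "p \<in> RR"
  show "mvec W (phi p) v0 S' = vr p S'"
  proof (cases "S' \<in> W")
    case True
    show ?thesis using lam0_phi_rep[OF p inv_ring_closed(6) True] True by (simp add: mvec_def v0_def vr_def)
  next
    case False
    thus ?thesis by (simp add: mvec_def phi_def vr_def)
  qed
qed

lemma phi_vr: "p \<in> RR \<Longrightarrow> q \<in> RR \<Longrightarrow> mvec W (phi p) (vr q) = vr (p * q)"
  unfolding phi_v0[symmetric] mvec_mmul[OF finite_Wset, symmetric]
  by (simp add: phi_mult[symmetric] phi_v0 inv_ring_closed(2))

definition pv :: "(nat set \<Rightarrow> complex) \<Rightarrow> mpoly" where "pv v = (\<Sum>S\<in>W. mconst (v S) * u S)"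

lemma pv_RR: "pv v \<in> RR" unfolding pv_def by (intro inv_ring_sum inv_ring_closed(2,5) u)

lemma vr_pv: "v \<in> vecs W \<Longrightarrow> vr (pv v) = v"
proof
  fix S assume v: "v \<in> vecs W"
  show "vr (pv v) S = v S"
  proof (cases "S \<in> W")
    case True
    have c: "mconst (v R) * (g S * u R) \<in> RR" for R by (intro inv_ring_closed(2,5) g u)
    have "pv v * g S = (\<Sum>R\<in>W. mconst (v R) * (g S * u R))"
      unfolding pv_def sum_distrib_right by (intro sum.cong refl) (simp only: mult_ac)
    hence "lam0 (pv v * g S) = (\<Sum>R\<in>W. lam0 (mconst (v R) * (g S * u R)))" using lam0_sum[OF c] by simp
    also have "\<dots> = (\<Sum>R\<in>W. v R * lam0 (g S * u R))" by (intro sum.cong refl lam0_cmult inv_ring_closed(2) g u)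
    also have "\<dots> = (\<Sum>R\<in>W. if R = S then v R else 0)" using True by (intro sum.cong refl) (simp add: lam0_dual)
    finally show ?thesis using True by (simp add: vr_def)
  next
    case False thus ?thesis using v by (simp add: vr_def vecs_def)
  qed
qed

text \<open>Recovers \<open>lam0 p\<close> from \<open>vr p\<close>; the weights
  \<open>lam0 (u S)\<close> are the coordinates of 1 in the generators \<open>g\<close>.\<close>

definition Lv :: "(nat set \<Rightarrow> complex) \<Rightarrow> complex" where "Lv v = (\<Sum>S\<in>W. lam0 (u S) * v S)"

lemma Lv_vr: "p \<in> RR \<Longrightarrow> Lv (vr p) = lam0 p"
proof -
  assume p: "p \<in> RR"
  have c: "mconst (lam0 (u S)) * (p * g S) \<in> RR" for S by (intro inv_ring_closed(2,5) g p)
  have "lam0 p = lam0 (\<Sum>S\<in>W. mconst (lam0 (u S)) * (p * g S))"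
    by (rule lam0_cong[OF p _ expand_g[OF p]]) (intro inv_ring_sum c)
  also have "\<dots> = (\<Sum>S\<in>W. lam0 (u S) * lam0 (p * g S))"
    unfolding lam0_sum[OF c] by (intro sum.cong refl lam0_cmult inv_ring_closed(2) g p)
  finally show ?thesis by (simp add: Lv_def vr_def)
qed

text \<open>The trace form is nondegenerate: if \<open>vr p\<close> vanishes, so does
  \<open>vr (q * p)\<close> and with it \<open>lam0 (q * p)\<close> for every \<open>q\<close>, and
  among these numbers are the entries of \<open>phi p\<close>.\<close>

lemma vr_zero: "p \<in> RR \<Longrightarrow> vr p = 0 \<Longrightarrow> p \<in> JJ"
proof -
  assume p: "p \<in> RR" and 0: "vr p = 0"
  have z: "lam0 (p * g S) = 0" if "S \<in> W" for S using fun_cong[OF 0, of S] that by (simp add: vr_def)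
  have "lam0 (p * q) = 0" if q: "q \<in> RR" for q
  proof -
    have "vr (q * p) = 0" unfolding phi_vr[OF q p, symmetric] 0 mvec_lin(5) ..
    hence "lam0 (q * p) = 0" using Lv_vr[OF inv_ring_closed(2)[OF q p]] by (simp add: Lv_def)
    thus ?thesis by (simp add: mult.commute)
  qed
  hence "phi p (S', S) = 0" for S' S using inv_ring_closed(2)[OF g(1) u(1)] by (simp add: phi_def mult.assoc)
  hence "phi p = 0" by (auto simp: fun_eq_iff)
  thus ?thesis using phi_zero_iff[OF p] by simp
qed

abbreviation "CC \<equiv> phi ` RR"

lemma subalg_CC: "subalg W CC"
  unfolding subalg_def
proof (intro conjI ballI allI)
  show "idm W \<in> CC" using phi_one inv_ring_closed(6) by (metis imageI)
  fix A B assume "A \<in> CC" "B \<in> CC"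
  then obtain p q where pq: "p \<in> RR" "A = phi p" "q \<in> RR" "B = phi q" by blast
  show "A + B \<in> CC" using pq phi_add inv_ring_closed(1) by (metis imageI)
  show "mmul W A B \<in> CC" using pq phi_mult inv_ring_closed(2) by (metis imageI)
next
  fix c A assume "A \<in> CC"
  then obtain p where p: "p \<in> RR" "A = phi p" by blast
  show "fscale c A \<in> CC" unfolding p(2) phi_scale[OF p(1), symmetric] by (intro imageI inv_ring_closed(2,5) p)
next
  fix A assume "A \<in> CC" thus "supp_on W A" using phi_supp by blast
qed

lemma commut_CC: "commut W CC"
  unfolding commut_def by (auto simp: phi_mult[symmetric] mult.commute)

lemma regular_CC: "regular_iso W CC"
  unfolding regular_iso_def
proof (intro exI[of _ "\<lambda>A. mvec W A v0"] conjI ballI allI)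
  show "bij_betw (\<lambda>A. mvec W A v0) CC (vecs W)"
    unfolding bij_betw_def
  proof
    show "inj_on (\<lambda>A. mvec W A v0) CC"
    proof (rule inj_onI)
      fix A B assume "A \<in> CC" "B \<in> CC" and eq: "mvec W A v0 = mvec W B v0"
      then obtain p q where pq: "p \<in> RR" "A = phi p" "q \<in> RR" "B = phi q" by blast
      have "vr p = vr q" using eq pq by (simp add: phi_v0)
      moreover have "vr p = vr (p - q) + vr q"
        using vr_add[OF inv_ring_closed(3)[OF pq(1,3)] pq(3)] by simp
      ultimately have "vr (p - q) = 0" by simp
      thus "A = B" using vr_zero[OF inv_ring_closed(3)[OF pq(1,3)]] phi_eq_iff pq by simp
    qed
    show "(\<lambda>A. mvec W A v0) ` CC = vecs W"
    proof
      show "(\<lambda>A. mvec W A v0) ` CC \<subseteq> vecs W" by (auto simp: phi_v0 vr_vecs)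
      show "vecs W \<subseteq> (\<lambda>A. mvec W A v0) ` CC"
      proof
        fix v assume "v \<in> vecs W"
        hence e: "mvec W (phi (pv v)) v0 = v" by (simp add: phi_v0[OF pv_RR] vr_pv)
        show "v \<in> (\<lambda>A. mvec W A v0) ` CC" using imageI[OF imageI[OF pv_RR[of v], of phi], of "\<lambda>A. mvec W A v0"] unfolding e .
      qed
    qed
  qed
qed (auto simp: mvec_lin mvec_mmul)

lemma frobenius_CC: "frobenius W CC"
  unfolding frobenius_def
proof (intro conjI subalg_CC commut_CC)
  have "CC \<subseteq> vecs (W \<times> W)" using phi_supp by (auto simp: vecs_def supp_on_def)
  thus "\<exists>F. finite F \<and> CC \<subseteq> fvs.span F"
    using vecs_span[of "W \<times> W"] by (intro exI[of _ "basisv ` (W \<times> W)"]) auto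
  \<comment> \<open>On representatives this form is \<open>lam0 (p * q)\<close>, the trace form of
    the quotient ring.\<close>
  let ?b = "\<lambda>A B. Lv (mvec W (mmul W A B) v0)"
  have b: "?b (phi p) (phi q) = lam0 (p * q)" if "p \<in> RR" "q \<in> RR" for p q
    using that by (simp add: phi_mult[symmetric] phi_v0 Lv_vr inv_ring_closed(2))
  show "\<exists>\<beta>. (\<forall>A\<in>CC. \<forall>B\<in>CC. \<forall>D\<in>CC. \<beta> (A + B) D = \<beta> A D + \<beta> B D) \<and>
         (\<forall>c. \<forall>A\<in>CC. \<forall>B\<in>CC. \<beta> (fscale c A) B = c * \<beta> A B) \<and>
         (\<forall>A\<in>CC. \<forall>B\<in>CC. \<beta> A B = \<beta> B A) \<and>
         (\<forall>A\<in>CC. \<forall>B\<in>CC. \<forall>D\<in>CC. \<beta> (mmul W A B) D = \<beta> A (mmul W B D)) \<and>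
         (\<forall>A\<in>CC. (\<forall>B\<in>CC. \<beta> A B = 0) \<longrightarrow> A = 0)"
  proof (rule exI[of _ ?b], intro conjI ballI allI impI)
    fix A B D assume "A \<in> CC" "B \<in> CC" "D \<in> CC"
    then obtain p q r where R: "p \<in> RR" "A = phi p" "q \<in> RR" "B = phi q" "r \<in> RR" "D = phi r" by blast
    show "?b (A + B) D = ?b A D + ?b B D"
      unfolding R phi_add[OF R(1,3), symmetric] b[OF R(1,5)] b[OF R(3,5)] b[OF inv_ring_closed(1)[OF R(1,3)] R(5)] distrib_right
      by (intro lam0_add inv_ring_closed(2) R)
    show "?b (mmul W A B) D = ?b A (mmul W B D)" by (simp add: mmul_assoc)
  next
    fix c A B assume "A \<in> CC" "B \<in> CC"
    then obtain p q where R: "p \<in> RR" "A = phi p" "q \<in> RR" "B = phi q" by blast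
    show "?b (fscale c A) B = c * ?b A B"
      unfolding R phi_scale[OF R(1), symmetric] b[OF R(1,3)] b[OF inv_ring_closed(2)[OF inv_ring_closed(5) R(1)] R(3)] mult.assoc
      by (intro lam0_cmult inv_ring_closed(2) R)
  next
    fix A B assume "A \<in> CC" "B \<in> CC"
    hence "mmul W A B = mmul W B A" using commut_CC unfolding commut_def by blast
    thus "?b A B = ?b B A" by simp
  next
    fix A assume "A \<in> CC" and z: "\<forall>B\<in>CC. ?b A B = 0"
    then obtain p where p: "p \<in> RR" "A = phi p" by blast
    have "lam0 (p * q) = 0" if "q \<in> RR" for q using z b[OF p(1) that] that p(2) by auto
    hence "phi p (S', S) = 0" for S' S using inv_ring_closed(2)[OF g(1) u(1)] by (simp add: phi_def mult.assoc)
    thus "A = 0" unfolding p(2) by (auto simp: fun_eq_iff)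
  qed
qed

lemma matrix_eqI: "finite J \<Longrightarrow> supp_on J A \<Longrightarrow> supp_on J B \<Longrightarrow> (\<And>v. v \<in> vecs J \<Longrightarrow> mvec J A v = mvec J B v) \<Longrightarrow> A = B"
proof (rule ext, clarify)
  fix x z assume J: "finite J" "supp_on J A" "supp_on J B" "\<And>v. v \<in> vecs J \<Longrightarrow> mvec J A v = mvec J B v"
  show "A (x, z) = B (x, z)"
  proof (cases "z \<in> J")
    case True
    show ?thesis using fun_cong[OF J(4)[OF basisv_in_vecs[OF True]], of x] unfolding mvec_basisv_col[OF J(1) True] .
  next
    case False thus ?thesis using J(2,3) by (simp add: supp_on_def)
  qed
qed

text \<open>A matrix commuting with the algebra is determined by its value on the cyclic vector, and
  that value is already attained by some \<open>phi p\<close>.\<close>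

lemma maximal_CC: "subalg W D' \<Longrightarrow> commut W D' \<Longrightarrow> CC \<subseteq> D' \<Longrightarrow> D' = CC"
proof
  assume "CC \<subseteq> D'" thus "CC \<subseteq> D'" .
next
  assume D: "subalg W D'" "commut W D'" "CC \<subseteq> D'"
  show "D' \<subseteq> CC"
  proof
    fix X assume X: "X \<in> D'"
    hence s: "supp_on W X" using D(1) by (simp add: subalg_def)
    obtain p where p: "p \<in> RR" "mvec W X v0 = vr p"
      using vr_pv[OF mvec_in_vecs[OF s], of v0] pv_RR by metis
    have "X = phi p"
    proof (rule matrix_eqI[OF finite_Wset s phi_supp])
      fix v assume vW: "v \<in> vecs W"
      obtain q where q: "q \<in> RR" "vr q = v" using vr_pv[OF vW] pv_RR by metis
      have "phi q \<in> D'" using D(3) q(1) by blast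
      hence c: "mmul W X (phi q) = mmul W (phi q) X" using D(2) X unfolding commut_def by blast
      have "mvec W X v = mvec W X (mvec W (phi q) v0)" unfolding phi_v0[OF q(1)] q(2) ..
      also have "\<dots> = mvec W (phi q) (mvec W X v0)" unfolding mvec_mmul[OF finite_Wset, symmetric] c ..
      also have "\<dots> = vr (q * p)" unfolding p(2) by (rule phi_vr[OF q(1) p(1)])
      also have "\<dots> = mvec W (phi p) v" unfolding q(2)[symmetric] phi_vr[OF p(1) q(1)] by (simp only: mult.commute)
      finally show "mvec W X v = mvec W (phi p) v" .
    qed
    thus "X \<in> CC" using p(1) by blast
  qed
qed

lemma vr_lin: "finite A \<Longrightarrow> (\<And>a. a \<in> A \<Longrightarrow> f a \<in> RR) \<Longrightarrow> vr (\<Sum>a\<in>A. mconst (c a) * f a) = (\<Sum>a\<in>A. fscale (c a) (vr (f a)))"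
proof
  fix S assume A: "finite A" "\<And>a. a \<in> A \<Longrightarrow> f a \<in> RR"
  show "vr (\<Sum>a\<in>A. mconst (c a) * f a) S = (\<Sum>a\<in>A. fscale (c a) (vr (f a))) S"
  proof (cases "S \<in> W")
    case True
    have "lam0 ((\<Sum>a\<in>A. mconst (c a) * f a) * g S) = (\<Sum>a\<in>A. lam0 (mconst (c a) * (f a * g S)))"
      unfolding sum_distrib_right mult.assoc by (rule lam0_sum) (intro inv_ring_closed(2,5) A g)
    also have "\<dots> = (\<Sum>a\<in>A. c a * lam0 (f a * g S))" by (intro sum.cong refl lam0_cmult inv_ring_closed(2) A g)
    finally show ?thesis using True by (simp add: vr_def sum_fun_apply fscale_apply)
  qed (simp add: vr_def sum_fun_apply fscale_apply)
qed

lemma phi_lin: "finite A \<Longrightarrow> (\<And>a. a \<in> A \<Longrightarrow> f a \<in> RR) \<Longrightarrow> phi (\<Sum>a\<in>A. mconst (c a) * f a) = (\<Sum>a\<in>A. fscale (c a) (phi (f a)))"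
proof (induction A rule: finite_induct)
  case empty
  show ?case using phi_zero_iff[of 0] JJ(1) by (simp add: inv_ring_closed(7))
next
  case (insert x A)
  have "mconst (c x) * f x \<in> RR" "(\<Sum>a\<in>A. mconst (c a) * f a) \<in> RR"
    using insert.prems by (auto intro!: inv_ring_sum inv_ring_closed(2,5))
  thus ?case using insert by (simp add: phi_add phi_scale)
qed

lemma dim_CC: "cdim CC = k choose l"
proof -
  have "cdim CC = card W"
  proof (rule dim_by_coordinates[of W "\<lambda>S. phi (u S)"])
    fix A assume "A \<in> CC"
    then obtain p where p: "p \<in> RR" "A = phi p" by blast
    have "vr (p - pv (vr p)) = 0"
    proof -
      have "vr (\<Sum>a\<in>{True, False}. mconst (if a then 1 else - 1) * (if a then p else pv (vr p)))
        = (\<Sum>a\<in>{True, False}. fscale (if a then 1 else - 1) (vr (if a then p else pv (vr p))))"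
        by (rule vr_lin) (auto simp: p pv_RR)
      thus ?thesis using vr_pv[OF vr_vecs] by (simp add: mconst_1 mconst_uminus fscale_def fun_eq_iff)
    qed
    hence "A = phi (pv (vr p))" using vr_zero[OF inv_ring_closed(3)[OF p(1) pv_RR]] phi_eq_iff[OF p(1) pv_RR] p(2) by blast
    also have "\<dots> = (\<Sum>S\<in>W. fscale (vr p S) (phi (u S)))" unfolding pv_def by (rule phi_lin) (auto simp: u)
    finally show "\<exists>c. A = (\<Sum>S\<in>W. fscale (c S) (phi (u S)))" by blast
  next
    fix c S assume z: "(\<Sum>S\<in>W. fscale (c S) (phi (u S))) = 0" and S: "S \<in> W"
    define c' where "c' = (\<lambda>S. if S \<in> W then c S else 0)"
    have c': "c' \<in> vecs W" by (simp add: c'_def vecs_def)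
    have "phi (pv c') = 0" unfolding pv_def using phi_lin[of W u c'] u z by (simp add: c'_def)
    hence "mvec W (phi (pv c')) v0 = 0" by (simp add: mvec_def fun_eq_iff)
    hence c0: "c' = 0" unfolding phi_v0[OF pv_RR] vr_pv[OF c'] .
    have "c' S = 0" unfolding c0 by simp
    thus "c S = 0" using S by (simp add: c'_def)
  qed (auto intro: u)
  thus ?thesis by (simp add: card_Wset)
qed

text \<open>Multiplying the transfer relation by \<open>u S\<close> and applying \<open>lam0\<close>
  reads off one matrix entry, by duality.\<close>

lemma phi_RHS: "S' \<in> W \<Longrightarrow> S \<in> W \<Longrightarrow> phi (coeff RHS m) (S', S) = coeff (taup S' S) m"
proof -
  assume S: "S' \<in> W" "S \<in> W"
  have c: "mconst (coeff (taup S' R) m) * (g R * u S) \<in> RR" for R by (intro inv_ring_closed(2,5) g u)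
  have "((\<Sum>R\<in>W. mconst (coeff (taup S' R) m) * g R) - coeff RHS m * g S') * u S \<in> JJ"
    by (rule JJ(5)[OF u(1) transfer_relation[OF S(1)]])
  hence "(\<Sum>R\<in>W. mconst (coeff (taup S' R) m) * (g R * u S)) - coeff RHS m * g S' * u S \<in> JJ"
    by (simp add: left_diff_distrib sum_distrib_right mult.assoc)
  hence "lam0 (\<Sum>R\<in>W. mconst (coeff (taup S' R) m) * (g R * u S)) = lam0 (coeff RHS m * g S' * u S)"
    by (rule lam0_cong[rotated 2]) (intro inv_ring_sum inv_ring_closed(2) c g u RHS_inv)+
  moreover have "lam0 (\<Sum>R\<in>W. mconst (coeff (taup S' R) m) * (g R * u S)) = (\<Sum>R\<in>W. coeff (taup S' R) m * lam0 (g R * u S))"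
    unfolding lam0_sum[OF c] by (intro sum.cong refl lam0_cmult inv_ring_closed(2) g u)
  moreover have "\<dots> = (\<Sum>R\<in>W. if R = S then coeff (taup S' R) m else 0)"
    using S by (intro sum.cong refl) (simp add: lam0_dual)
  ultimately show ?thesis using S by (simp add: phi_apply)
qed

end

section \<open>Characters and local idempotents\<close>

context tframe begin

text \<open>Characters of the quotient of \<open>RR\<close> by \<open>JJ\<close>, given on
  representatives.\<close>

definition rhom :: "(mpoly \<Rightarrow> complex) \<Rightarrow> bool" where
  "rhom e \<longleftrightarrow> e 1 = 1 \<and> (\<forall>p\<in>RR. \<forall>q\<in>RR. e (p + q) = e p + e q \<and> e (p * q) = e p * e q)
     \<and> (\<forall>c. \<forall>p\<in>RR. e (mconst c * p) = c * e p) \<and> (\<forall>p\<in>JJ. e p = 0)"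

lemma rhomD:
  assumes "rhom e"
  shows "e 1 = 1" "p \<in> RR \<Longrightarrow> q \<in> RR \<Longrightarrow> e (p + q) = e p + e q" "p \<in> RR \<Longrightarrow> q \<in> RR \<Longrightarrow> e (p * q) = e p * e q"
    "p \<in> RR \<Longrightarrow> e (mconst c * p) = c * e p" "p \<in> JJ \<Longrightarrow> e p = 0" "e 0 = 0" "e (mconst c) = c"
    "p \<in> RR \<Longrightarrow> q \<in> RR \<Longrightarrow> e (p - q) = e p - e q"
proof -
  show 1: "e 1 = 1" "p \<in> RR \<Longrightarrow> q \<in> RR \<Longrightarrow> e (p + q) = e p + e q" "p \<in> RR \<Longrightarrow> q \<in> RR \<Longrightarrow> e (p * q) = e p * e q"
    "p \<in> JJ \<Longrightarrow> e p = 0" for p q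
    using assms unfolding rhom_def by blast+
  show c: "p \<in> RR \<Longrightarrow> e (mconst c * p) = c * e p" for c p using assms unfolding rhom_def by blast
  show "e 0 = 0" by (rule 1(4)[OF JJ(1)])
  show "e (mconst c) = c" using c[OF inv_ring_closed(6), of c] 1(1) by simp
  assume pq: "p \<in> RR" "q \<in> RR"
  have "e (p - q) + e q = e (p - q + q)" by (rule 1(2)[symmetric]) (intro inv_ring_closed(3) pq, rule pq)
  thus "e (p - q) = e p - e q" by (simp add: eq_diff_eq)
qed

lemma rhom_sum: "rhom e \<Longrightarrow> (\<And>a. a \<in> A \<Longrightarrow> f a \<in> RR) \<Longrightarrow> e (sum f A) = (\<Sum>a\<in>A. e (f a))"
  by (induction A rule: infinite_finite_induct) (simp_all add: rhomD inv_ring_sum)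

lemma rhom_power: "rhom e \<Longrightarrow> p \<in> RR \<Longrightarrow> e (p ^ n) = e p ^ n"
  by (induction n) (simp_all add: rhomD inv_ring_closed(8))

definition evp :: "(nat \<Rightarrow> nat) \<Rightarrow> mpoly \<Rightarrow> complex" where
  "evp \<pi> p = ev (\<lambda>c. c) (\<lambda>i. \<rho> (\<pi> i)) p"

lemma rhom_evp: "\<pi> permutes fl \<Longrightarrow> rhom (evp \<pi>)"
  unfolding rhom_def evp_def using ev_gideal[OF roots] by (auto simp: ev_simps gen_ideal_eq)

lemma map_poly_mult_RR:
  assumes e: "rhom e" and P: "\<And>j. coeff P j \<in> RR" and Q: "\<And>j. coeff Q j \<in> RR"
  shows "map_poly e (P * Q) = map_poly e P * map_poly e Q"
proof (rule poly_eqI)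
  fix n
  have "coeff (map_poly e (P * Q)) n = e (\<Sum>i\<le>n. coeff P i * coeff Q (n - i))"
    by (simp add: coeff_map_poly rhomD[OF e] coeff_mult)
  also have "\<dots> = (\<Sum>i\<le>n. e (coeff P i) * e (coeff Q (n - i)))"
    by (subst rhom_sum[OF e]) (auto intro: inv_ring_closed P Q simp: rhomD[OF e] P Q)
  finally show "coeff (map_poly e (P * Q)) n = coeff (map_poly e P * map_poly e Q) n"
    by (simp add: coeff_map_poly rhomD[OF e] coeff_mult)
qed

lemma ysz_RR: "coeff (ysp l * zp k l) j \<in> RR"
proof -
  have "mconst (1 / (q1 - q2)) * coeff RHS j \<in> RR" by (intro inv_ring_closed(2,5) RHS_inv)
  moreover have "mconst (1 / (q1 - q2)) * coeff RHS j = coeff (ysp l * zp k l) j"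
  proof -
    have "mconst (1 / (q1 - q2) * (q1 - q2)) = 1" using qne by (simp add: mconst_1)
    moreover have "coeff RHS j = mconst (q1 - q2) * coeff (ysp l * zp k l) j" by (simp add: RHS_def mult.assoc)
    ultimately show ?thesis by (simp only: mult.assoc[symmetric] mconst_mult[symmetric] mult_1_left)
  qed
  ultimately show ?thesis by simp
qed

lemma wp_RR: "coeff (yp l * zp k l) j \<in> RR"
proof -
  have "coeff (yp l * zp k l) j - mconst (coeff (\<Prod>i<k. [:- \<rho> i, 1:]) j) \<in> JJ"
    using coeff_wpoly_gideal[OF subring_inv_ring roots] unfolding yp_zp[OF lk] gen_ideal_eq .
  from inv_ring_closed(1)[OF JJ_RR[OF this] inv_ring_closed(5)[of "coeff (\<Prod>i<k. [:- \<rho> i, 1:]) j"]] show ?thesis by simp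
qed

text \<open>The invariant ring is itself a subring containing the coefficients of yz and of
  y(x-1)z.\<close>

lemma yp_RR: "coeff (yp l) j \<in> RR"
  by (rule coeff_yp_in_subring[OF subring_inv_ring lk wp_RR ysz_RR])

lemma ysp_RR: "coeff (ysp l) j \<in> RR"
proof -
  have "of_nat n * (- 1) ^ m = mconst (of_nat n * (- 1) ^ m)" for n m :: nat
    by (simp add: mconst_mult mconst_power mconst_uminus mconst_1) (simp add: mconst_def)
  hence i: "of_nat n * (- 1) ^ m \<in> RR" for n m :: nat using inv_ring_closed(5) by metis
  show ?thesis unfolding coeff_ysp by (intro inv_ring_sum inv_ring_closed(2)[OF yp_RR i])
qed

lemma zp_RR: "coeff (zp k l) j \<in> RR"
proof -
  have perm: "(\<Prod>i\<in>A. [:f (\<pi> i), 1:]) = (\<Prod>i\<in>A. [:f i, 1:])" if "\<pi> ` A = A" "inj \<pi>" for f :: "nat \<Rightarrow> mpoly" and A \<pi>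
    using prod.reindex[of \<pi> A "\<lambda>i. [:f i, 1:]"] that by (simp add: inj_on_subset)
  show ?thesis
    unfolding inv_ring_iff
  proof (intro conjI ballI)
    have "map_poly (trunc k) (zp k l) = zp k l"
      unfolding zp_def using lk by (simp add: map_poly_hom[of "trunc k"])
    thus "trunc k (coeff (zp k l) j) = coeff (zp k l) j"
      using coeff_map_poly[of "trunc k" "zp k l" j] by simp
    fix \<pi> assume \<pi>: "\<pi> \<in> Gp k l"
    hence inj: "inj \<pi>" and im: "\<pi> ` {..<l} = {..<l}" and imk: "\<pi> ` fl = fl"
      by (auto simp: Gp_def permutes_inj permutes_image)
    have "\<pi> ` {l..<k} = \<pi> ` fl - \<pi> ` {..<l}"
      unfolding image_set_diff[OF inj, symmetric] by (rule arg_cong[where f="(`) \<pi>"]) (use lk in auto)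
    also have "\<dots> = fl - {..<l}" by (simp only: im imk)
    also have "\<dots> = {l..<k}" using lk by auto
    finally have im2: "\<pi> ` {l..<k} = {l..<k}" .
    have "map_poly (rename \<pi>) (zp k l) = (\<Prod>j\<in>{l..<k}. [:- mvar (\<pi> j), 1:])"
      unfolding zp_def by (simp add: map_poly_hom[of "rename \<pi>"])
    also have "\<dots> = zp k l" unfolding zp_def using perm[OF im2 inj, of "\<lambda>i. - mvar i"] by simp
    finally show "rename \<pi> (coeff (zp k l) j) = coeff (zp k l) j"
      using coeff_map_poly[of "rename \<pi>" "zp k l" j] by simp
  qed
qed

abbreviation "F0 \<equiv> \<Prod>i<k. [:- \<rho> i, 1:]"

text \<open>The image of y(x): the divisor of the Bethe polynomial attached to a character.\<close>

definition ye :: "(mpoly \<Rightarrow> complex) \<Rightarrow> complex poly" where "ye e = map_poly e (yp l)"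

lemma ye_monic: "rhom e \<Longrightarrow> coeff (ye e) l = 1" "rhom e \<Longrightarrow> degree (ye e) = l"
proof -
  assume e: "rhom e"
  show c: "coeff (ye e) l = 1" by (simp add: ye_def coeff_map_poly rhomD[OF e] degree_yp)
  have "degree (ye e) \<le> l" unfolding ye_def using map_poly_degree_leq[of e "yp l"] degree_yp(1)[of l] by simp
  thus "degree (ye e) = l" using le_degree[of "ye e" l] c by simp
qed

lemma map_wp: "rhom e \<Longrightarrow> map_poly e (yp l * zp k l) = F0"
proof (rule poly_eqI)
  fix j assume e: "rhom e"
  have "coeff (yp l * zp k l) j - mconst (coeff F0 j) \<in> JJ"
    using coeff_wpoly_gideal[OF subring_inv_ring roots] unfolding yp_zp[OF lk] gen_ideal_eq .
  from rhomD(5)[OF e this] have "e (coeff (yp l * zp k l) j) = coeff F0 j"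
    unfolding rhomD(8)[OF e wp_RR inv_ring_closed(5)] rhomD(7)[OF e] by simp
  thus "coeff (map_poly e (yp l * zp k l)) j = coeff F0 j" by (simp add: coeff_map_poly rhomD[OF e])
qed

lemma ye_dvd: "rhom e \<Longrightarrow> F0 = ye e * map_poly e (zp k l)"
  using map_poly_mult_RR[OF _ yp_RR zp_RR] map_wp unfolding ye_def by metis

lemma map_ysp: "rhom e \<Longrightarrow> map_poly e (ysp l) = pcompose (ye e) [:- 1, 1:]"
proof (rule poly_eqI)
  fix j assume e: "rhom e"
  have i: "of_nat n * (- 1) ^ m = mconst (of_nat n * (- 1) ^ m)" for n m :: nat
    by (simp add: mconst_mult mconst_power mconst_uminus mconst_1) (simp add: mconst_def)
  have r: "coeff (yp l) i * mconst c \<in> RR" for i c by (intro inv_ring_closed(2,5) yp_RR)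
  have "coeff (map_poly e (ysp l)) j = (\<Sum>i\<le>l. coeff (ye e) i * (of_nat (i choose j) * (- 1) ^ (i - j)))"
    unfolding ye_def coeff_map_poly[of e, OF rhomD(6)[OF e]] coeff_ysp i rhom_sum[OF e r] rhomD(3)[OF e yp_RR inv_ring_closed(5)] rhomD(7)[OF e] ..
  also have "\<dots> = coeff (\<Sum>i\<le>l. smult (coeff (ye e) i) ([:- 1, 1:] ^ i)) j"
    by (simp add: coeff_sum coeff_shift_power)
  also have "(\<Sum>i\<le>l. smult (coeff (ye e) i) ([:- 1, 1:] ^ i)) = pcompose (ye e) [:- 1, 1:]"
  proof -
    have "degree (map_poly (\<lambda>x. [:x:]) (ye e)) = l" by (subst degree_map_poly) (auto simp: ye_monic[OF e])
    thus ?thesis by (simp add: pcompose_altdef poly_altdef coeff_map_poly)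
  qed
  finally show "coeff (map_poly e (ysp l)) j = coeff (pcompose (ye e) [:- 1, 1:]) j" .
qed

lemma map_ysz: "rhom e \<Longrightarrow> map_poly e (ysp l * zp k l) * ye e = pcompose (ye e) [:- 1, 1:] * F0"
  unfolding map_poly_mult_RR[OF _ ysp_RR zp_RR] map_ysp using ye_dvd by (simp add: mult_ac)

text \<open>The image M of y(x-1)z satisfies M y = y(x-1) F0, where y is the divisor of the
  character, so the divisor determines M; the coefficients of y(x-1)z together with the ideal
  generate the invariants.\<close>

lemma rhom_determined:
  assumes e: "rhom e" and e': "rhom e'" and y: "ye e = ye e'" and p: "p \<in> RR"
  shows "e p = e' p"
proof -
  let ?R = "{p \<in> RR. e p = e' p}"
  have R: "subring ?R" unfolding subring_def
    using rhomD[OF e] rhomD[OF e'] by (auto intro: inv_ring_closed)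
  have ne: "ye e' \<noteq> 0" using ye_monic(1)[OF e'] by auto
  have "map_poly e (ysp l * zp k l) * ye e' = map_poly e' (ysp l * zp k l) * ye e'"
    using map_ysz[OF e] map_ysz[OF e'] unfolding y by (simp only:)
  hence "map_poly e (ysp l * zp k l) = map_poly e' (ysp l * zp k l)"
    by (rule mult_right_cancel[THEN iffD1, OF ne])
  hence c: "e (coeff (ysp l * zp k l) j) = e' (coeff (ysp l * zp k l) j)" for j
    by (metis coeff_map_poly rhomD(6) e e')
  have "RR \<subseteq> ?R"
    by (rule inv_ring_generated_by_transfer[OF R lk roots]) (use ysz_RR c JJ_RR rhomD(5)[OF e] rhomD(5)[OF e'] in auto)
  thus ?thesis using p by auto
qed

lemma ye_evp: "\<pi> permutes fl \<Longrightarrow> ye (evp \<pi>) = (\<Prod>i\<in>\<pi> ` {..<l}. [:- \<rho> i, 1:])"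
proof -
  assume p: "\<pi> permutes fl"
  have "ye (evp \<pi>) = (\<Prod>i<l. [:- \<rho> (\<pi> i), 1:])"
    unfolding ye_def yp_def evp_def by (simp add: map_poly_hom[of "ev (\<lambda>c. c) (\<lambda>i. \<rho> (\<pi> i))"] ev_simps)
  thus ?thesis using prod.reindex[of \<pi> "{..<l}" "\<lambda>i. [:- \<rho> i, 1:]"] permutes_inj[OF p] by (simp add: inj_on_subset)
qed

lemma monic_dvd_prod_linear:
  fixes r :: "nat \<Rightarrow> complex"
  assumes "finite A" "y dvd (\<Prod>i\<in>A. [:- r i, 1:])" "lead_coeff y = 1"
  shows "\<exists>S\<subseteq>A. y = (\<Prod>i\<in>S. [:- r i, 1:])"
  using assms
proof (induction A arbitrary: y rule: finite_induct)
  case empty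
  hence "y = 1" by (metis is_unit_poly_iff lead_coeff_pCons(2) one_pCons prod.empty zero_neq_one)
  thus ?case by auto
next
  case (insert a A)
  let ?P = "\<Prod>i\<in>A. [:- r i, 1:]"
  have "y dvd [:- r a, 1:] * ?P" using insert.prems(1) unfolding prod.insert[OF insert.hyps] .
  then obtain q where q: "[:- r a, 1:] * ?P = y * q" by (rule dvdE)
  show ?case
  proof (cases "poly y (r a) = 0")
    case True
    then obtain y' where y': "y = [:- r a, 1:] * y'" by (auto simp: poly_eq_0_iff_dvd elim: dvdE)
    have "[:- r a, 1:] * ?P = [:- r a, 1:] * (y' * q)" using q unfolding y' by (simp only: mult.assoc)
    hence "?P = y' * q" by (metis mult_cancel_left pCons_eq_0_iff zero_neq_one)
    moreover have "lead_coeff y' = 1" using insert.prems(2) unfolding y' lead_coeff_mult by simp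
    ultimately obtain S where "S \<subseteq> A" "y' = (\<Prod>i\<in>S. [:- r i, 1:])" using insert.IH[of y'] by auto
    moreover have "finite S" "a \<notin> S" using calculation insert.hyps finite_subset by auto
    ultimately have "y = (\<Prod>i\<in>insert a S. [:- r i, 1:])" unfolding y' by simp
    thus ?thesis using \<open>S \<subseteq> A\<close> by (intro exI[of _ "insert a S"]) auto
  next
    case False
    have "poly (y * q) (r a) = 0" unfolding q[symmetric] by simp
    hence "poly q (r a) = 0" using False by simp
    then obtain q' where q': "q = [:- r a, 1:] * q'" by (auto simp: poly_eq_0_iff_dvd elim: dvdE)
    have "[:- r a, 1:] * ?P = [:- r a, 1:] * (y * q')" using q unfolding q' by (simp only: mult.left_commute)
    hence "?P = y * q'" by (metis mult_cancel_left pCons_eq_0_iff zero_neq_one)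
    then obtain S where "S \<subseteq> A" "y = (\<Prod>i\<in>S. [:- r i, 1:])" using insert.IH[of y] insert.prems(2) by auto
    thus ?thesis by auto
  qed
qed

lemma divisor_evp:
  assumes "y dvd F0" "lead_coeff y = 1" "degree y = l"
  shows "\<exists>\<pi>. \<pi> permutes fl \<and> ye (evp \<pi>) = y"
proof -
  obtain S where S: "S \<subseteq> fl" "y = (\<Prod>i\<in>S. [:- \<rho> i, 1:])" using monic_dvd_prod_linear[OF finite_lessThan assms(1,2)] by blast
  have "card S = l" using assms(3) degree_prod_linear[of S \<rho>] S finite_subset[OF S(1)] by simp
  hence "S \<in> W" using S by (simp add: Wset_def)
  obtain \<pi> where "\<pi> permutes fl" "\<pi> ` {..<l} = S" by (rule permutes_onto_subset[OF \<open>S \<in> W\<close>])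
  thus ?thesis using ye_evp[of \<pi>] S(2) by auto
qed

text \<open>The on-shell Bethe vector: the generic vector of the \<open>g S\<close> evaluated at a
  character. Because the Vandermonde factor was removed beforehand, it stays nonzero when Bethe
  roots coincide.\<close>

definition we :: "(mpoly \<Rightarrow> complex) \<Rightarrow> nat set \<Rightarrow> complex" where "we e S = (if S \<in> W then e (g S) else 0)"

lemma we_vecs: "we e \<in> vecs W" by (simp add: we_def vecs_def)

lemma phi_we: "rhom e \<Longrightarrow> p \<in> RR \<Longrightarrow> mvec W (phi p) (we e) = fscale (e p) (we e)"
proof
  fix S' assume e: "rhom e" and p: "p \<in> RR"
  show "mvec W (phi p) (we e) S' = fscale (e p) (we e) S'"
  proof (cases "S' \<in> W")
    case True
    have c: "mconst (phi p (S', S)) * g S \<in> RR" for S by (intro inv_ring_closed(2,5) g)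
    have "e (p * g S') - e (\<Sum>S\<in>W. mconst (phi p (S', S)) * g S) = 0"
      using rhomD(5)[OF e phi_rep[OF p True]] rhomD(8)[OF e inv_ring_closed(2)[OF p g(1)] inv_ring_sum[of W, OF c]] by simp
    hence "e p * e (g S') = (\<Sum>S\<in>W. phi p (S', S) * e (g S))"
      by (simp add: rhom_sum[OF e c] rhomD(3)[OF e p g(1)] rhomD(4)[OF e g(1)])
    thus ?thesis using True by (simp add: mvec_def we_def fscale_apply)
  qed (simp add: mvec_def phi_def we_def fscale_apply)
qed

text \<open>Applying \<open>e\<close> to the expansion of 1 in the \<open>g S\<close> gives a
  combination of the entries of \<open>we e\<close> with value 1.\<close>

lemma we_nonzero: "rhom e \<Longrightarrow> we e \<noteq> 0"
proof
  assume e: "rhom e" and 0: "we e = 0"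
  have z: "e (g S) = 0" if "S \<in> W" for S using fun_cong[OF 0, of S] that by (simp add: we_def)
  have c: "mconst (lam0 (u S)) * (1 * g S) \<in> RR" for S by (intro inv_ring_closed(2,5,6) g)
  have "e 1 - e (\<Sum>S\<in>W. mconst (lam0 (u S)) * (1 * g S)) = 0"
    using rhomD(5)[OF e expand_g[OF inv_ring_closed(6)]] rhomD(8)[OF e inv_ring_closed(6) inv_ring_sum[of W, OF c]] by simp
  thus False using z by (simp add: rhom_sum[OF e c[simplified]] rhomD(4)[OF e g(1)] rhomD(1)[OF e])
qed

text \<open>The value of \<open>Lv\<close> on the image of \<open>v\<close> under
  \<open>phi (g S)\<close> is computed in two ways: the eigenvalue equation gives
  \<open>e (g S) * Lv v\<close>, the regular representation gives the component
  \<open>v S\<close>.\<close>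

lemma we_unique:
  assumes v: "v \<in> vecs W" and ev: "\<And>p. p \<in> RR \<Longrightarrow> mvec W (phi p) v = fscale (e p) v"
  shows "v = fscale (Lv v) (we e)"
proof
  fix S
  show "v S = fscale (Lv v) (we e) S"
  proof (cases "S \<in> W")
    case True
    let ?r = "pv v"
    have vr: "vr ?r = v" by (rule vr_pv[OF v])
    have "Lv (mvec W (phi (g S)) v) = e (g S) * Lv v"
      unfolding ev[OF g(1)] by (simp add: Lv_def fscale_apply sum_distrib_left mult_ac)
    moreover have "mvec W (phi (g S)) v = vr (g S * ?r)" using phi_vr[OF g(1) pv_RR, of S v] vr by simp
    moreover have "Lv (vr (g S * ?r)) = v S"
      using Lv_vr[OF inv_ring_closed(2)[OF g(1) pv_RR], of S v] fun_cong[OF vr, of S] True by (simp add: vr_def mult.commute)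
    ultimately show ?thesis using True by (simp add: fscale_apply we_def mult.commute)
  next
    case False thus ?thesis using v by (simp add: vecs_def fscale_apply we_def)
  qed
qed

text \<open>The divisor of \<open>e\<close> is the product over some l-subset of the root indices. A
  permutation carrying the first block onto that subset has the same divisor, and divisors separate
  characters.\<close>

lemma evp_pred:
  assumes e: "rhom e"
  shows "\<exists>\<pi>. \<pi> permutes fl \<and> (\<forall>p\<in>RR. e p = evp \<pi> p)"
proof -
  have "ye e dvd F0" using ye_dvd[OF e] by (metis dvd_triv_left)
  then obtain \<pi> where "\<pi> permutes fl" "ye (evp \<pi>) = ye e"
    using divisor_evp[of "ye e"] ye_monic[OF e] by auto
  thus ?thesis using rhom_determined[OF e rhom_evp] by metis
qed

text \<open>\<open>r\<close> is an idempotent of the quotient ring with value 1 at the character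
  \<open>e\<close> and 0 at those with another divisor; \<open>n\<close> bounds the nilpotency of
  the kernel of \<open>e\<close> on the local factor. The last clause says that every power of
  \<open>p0\<close> divides 1 - r modulo the ideal, so \<open>p0\<close> is invertible on the
  complementary factor.\<close>

definition loc :: "(mpoly \<Rightarrow> complex) \<Rightarrow> mpoly \<Rightarrow> nat \<Rightarrow> mpoly \<Rightarrow> bool" where
  "loc e r n p0 \<longleftrightarrow> r \<in> RR \<and> p0 \<in> RR \<and> e p0 = 0 \<and> r * r - r \<in> JJ \<and>
    (\<forall>\<pi>. \<pi> permutes fl \<longrightarrow> evp \<pi> r = (if ye (evp \<pi>) = ye e then 1 else 0)) \<and>
    (\<forall>q\<in>RR. e q = 0 \<longrightarrow> q ^ n * r \<in> JJ) \<and> (\<forall>m. \<exists>s\<in>RR. 1 - r - s * p0 ^ m \<in> JJ)"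

text \<open>A single element \<open>p0\<close> separates \<open>e\<close> from the finitely many
  other characters. Its resolvent splits as a power of \<open>p0\<close> times V(p0) with V(0)
  nonzero, and a Bezout relation between the two factors yields \<open>r\<close>, as in the Chinese
  remainder theorem for polynomials in \<open>p0\<close>.\<close>

lemma local_idempotent:
  assumes e: "rhom e"
  shows "\<exists>r n p0. loc e r n p0"
proof -
  let ?Pm = "{\<pi>. \<pi> permutes fl}"
  have fP: "finite ?Pm" by (rule finite_permutations) simp
  \<comment> \<open>A value t0 outside \<open>Bad\<close> makes the number y(t0) distinguish
    \<open>e\<close> from every character with another divisor; \<open>p0\<close> is y(t0) minus its
    value at \<open>e\<close>.\<close>
  define Bad where "Bad = (\<Union>\<pi>\<in>{\<pi>\<in>?Pm. ye (evp \<pi>) \<noteq> ye e}. {t. poly (ye (evp \<pi>) - ye e) t = 0})"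
  have "finite Bad" unfolding Bad_def by (rule finite_UN_I, use fP in simp, rule poly_roots_finite, simp)
  then obtain t0 :: complex where t0: "t0 \<notin> Bad" using ex_new_if_finite[OF infinite_UNIV_char_0] by blast
  define pc where "pc = poly (yp l) (mconst t0)"
  have pcs: "pc = (\<Sum>i\<le>l. mconst (t0 ^ i) * coeff (yp l) i)"
    unfolding pc_def poly_altdef degree_yp by (simp add: mconst_power mult.commute)
  have pcR: "pc \<in> RR" unfolding pcs by (intro inv_ring_sum inv_ring_closed(2,5) yp_RR)
  have epc: "e' pc = poly (ye e') t0" if e': "rhom e'" for e'
  proof -
    have c: "mconst (t0 ^ i) * coeff (yp l) i \<in> RR" for i by (intro inv_ring_closed(2,5) yp_RR)
    show ?thesis unfolding pcs rhom_sum[OF e' c] rhomD(4)[OF e' yp_RR] poly_altdef ye_monic(2)[OF e']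
      by (simp add: ye_def coeff_map_poly rhomD[OF e'] mult.commute)
  qed
  define p0 where "p0 = pc - mconst (e pc)"
  have p0R: "p0 \<in> RR" unfolding p0_def by (intro inv_ring_closed(3,5) pcR)
  have ep0: "e' p0 = poly (ye e') t0 - poly (ye e) t0" if "rhom e'" for e'
    unfolding p0_def rhomD(8)[OF that pcR inv_ring_closed(5)] rhomD(7)[OF that] epc[OF that] epc[OF e] ..
  have zero_iff: "evp \<pi> p0 = 0 \<longleftrightarrow> ye (evp \<pi>) = ye e" if "\<pi> permutes fl" for \<pi>
    using t0 that unfolding ep0[OF rhom_evp[OF that]] Bad_def by auto
  define P1 where "P1 = {\<pi>\<in>?Pm. evp \<pi> p0 = 0}"
  define V where "V = (\<Prod>\<pi>\<in>?Pm - P1. [:- evp \<pi> p0, 1:])"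
  obtain \<pi>0 where p00: "\<pi>0 permutes fl" "\<And>p. p \<in> RR \<Longrightarrow> e p = evp \<pi>0 p" using evp_pred[OF e] by blast
  have "\<pi>0 \<in> P1" using p00(1) p00(2)[OF p0R] ep0[OF e] by (simp add: P1_def)
  hence n0: "card P1 \<noteq> 0" using fP by (auto simp: P1_def)
  have V0: "poly V 0 \<noteq> 0" unfolding V_def poly_prod using fP by (auto simp: P1_def)
  \<comment> \<open>The constant term of \<open>V\<close> is nonzero, so \<open>V\<close> and x are
    coprime; multiplying in the relation between them raises the power of x by one.\<close>
  have "\<exists>a h. a * [:0, 1:] ^ n + h * V = 1" for n
  proof (induction n)
    case 0
    show ?case by (intro exI[of _ 1] exI[of _ 0]) simp
  next
    case (Suc n)
    then obtain a h where ah: "a * [:0, 1:] ^ n + h * V = 1" by blast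
    obtain c V' where V: "V = pCons c V'" by (cases V)
    have c: "c \<noteq> 0" using V0 by (simp add: V)
    have one: "smult (- (1 / c)) V' * [:0, 1:] + [:1 / c:] * V = 1" using c by (simp add: V one_pCons)
    have "a * [:0, 1:] ^ n * (smult (- (1 / c)) V' * [:0, 1:] + [:1 / c:] * V) + h * V = 1" unfolding one using ah by simp
    hence "(a * smult (- (1 / c)) V') * [:0, 1:] ^ Suc n + (a * [:0, 1:] ^ n * [:1 / c:] + h) * V = 1"
      unfolding power_Suc distrib_left distrib_right by (simp only: mult_ac add_ac)
    thus ?case by blast
  qed
  then obtain a h where bez: "a * [:0, 1:] ^ card P1 + h * V = 1" by blast
  define E where "E = (\<lambda>P. \<Sum>i\<le>degree P. mconst (coeff P i) * p0 ^ i)"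
  have Ep: "E P = poly (map_poly mconst P) p0" for P
  proof -
    have "mconst c = 0 \<longleftrightarrow> c = 0" for c using mconst_eq_iff[of c 0] by simp
    hence "degree (map_poly mconst P) = degree P" by (intro degree_map_poly) auto
    thus ?thesis by (simp add: E_def poly_altdef coeff_map_poly)
  qed
  have ER: "E P \<in> RR" for P unfolding E_def by (intro inv_ring_sum inv_ring_closed(2,5,8) p0R)
  have E_hom: "E (P + Q) = E P + E Q" "E (P * Q) = E P * E Q" "E 1 = 1" "E [:c, 1:] = mconst c + p0"
    for P Q c
    using map_poly_hom[of mconst] by (simp_all add: Ep mconst_add mconst_mult mconst_1)
  have E_prod: "E (prod f A) = (\<Prod>a\<in>A. E (f a))" for f and A :: "(nat \<Rightarrow> nat) set"
    by (induction A rule: infinite_finite_induct) (simp_all add: E_hom(2,3))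
  have Epow: "E (P ^ n) = E P ^ n" for P n by (induction n) (simp_all add: E_hom)
  have eE: "e' (E P) = poly P (e' p0)" if e': "rhom e'" for e' P
  proof -
    have c: "mconst (coeff P i) * p0 ^ i \<in> RR" for i by (intro inv_ring_closed(2,5,8) p0R)
    show ?thesis unfolding E_def rhom_sum[OF e' c] rhomD(4)[OF e' inv_ring_closed(8)[OF p0R]] rhom_power[OF e' p0R] poly_altdef ..
  qed
  define r where "r = E (h * V)"
  have rR: "r \<in> RR" unfolding r_def by (rule ER)
  have one_r: "1 - r = E a * p0 ^ card P1"
  proof -
    have "1 = E (a * [:0, 1:] ^ card P1 + h * V)" unfolding bez E_hom ..
    also have "\<dots> = E a * (E [:0, 1:]) ^ card P1 + r" unfolding E_hom(1) r_def E_hom(2)[of a] Epow ..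
    also have "E [:0, 1:] = p0" unfolding E_hom(4) by simp
    finally show ?thesis by (simp add: algebra_simps)
  qed
  have resJ: "p0 ^ card P1 * E V \<in> JJ"
  proof -
    have "(\<Prod>\<pi>\<in>?Pm. p0 - mconst (evp \<pi> p0)) \<in> JJ"
      using resolvent[OF roots p0R lk] unfolding evp_def .
    also have "(\<Prod>\<pi>\<in>?Pm. p0 - mconst (evp \<pi> p0)) = (\<Prod>\<pi>\<in>P1. p0 - mconst (evp \<pi> p0)) * (\<Prod>\<pi>\<in>?Pm - P1. p0 - mconst (evp \<pi> p0))"
      by (subst mult.commute, rule prod.subset_diff) (use fP in \<open>auto simp: P1_def\<close>)
    also have "(\<Prod>\<pi>\<in>P1. p0 - mconst (evp \<pi> p0)) = p0 ^ card P1" by (simp add: P1_def)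
    also have "(\<Prod>\<pi>\<in>?Pm - P1. p0 - mconst (evp \<pi> p0)) = E V"
      unfolding V_def E_prod E_hom(4) by (simp add: mconst_uminus)
    finally show ?thesis .
  qed
  have idem: "r * (1 - r) \<in> JJ"
  proof -
    have "r * (1 - r) = (E h * E a) * (p0 ^ card P1 * E V)" unfolding one_r unfolding r_def E_hom(2) by (simp only: mult_ac)
    also have "\<dots> \<in> JJ" by (intro JJ(4)[OF _ resJ] inv_ring_closed(2) ER)
    finally show ?thesis .
  qed
  have "r * r - r = - (r * (1 - r))" by (simp add: algebra_simps)
  hence rr: "r * r - r \<in> JJ" using JJ_uminus[OF idem] by simp
  have evr: "evp \<pi> r = (if ye (evp \<pi>) = ye e then 1 else 0)" if p: "\<pi> permutes fl" for \<pi>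
  proof (cases "ye (evp \<pi>) = ye e")
    case True
    hence z: "evp \<pi> p0 = 0" using zero_iff[OF p] by simp
    have "1 - evp \<pi> r = evp \<pi> (1 - r)" using rhomD(8)[OF rhom_evp[OF p] inv_ring_closed(6) rR] rhomD(1)[OF rhom_evp[OF p]] by simp
    also have "\<dots> = 0" unfolding one_r rhomD(3)[OF rhom_evp[OF p] ER inv_ring_closed(8)[OF p0R]] rhom_power[OF rhom_evp[OF p] p0R] z using n0 by simp
    finally show ?thesis using True by simp
  next
    case False
    hence "\<pi> \<in> ?Pm - P1" using zero_iff[OF p] p by (simp add: P1_def)
    hence "poly V (evp \<pi> p0) = 0" unfolding V_def poly_prod using fP by (intro prod_zero) auto
    thus ?thesis using False unfolding r_def eE[OF rhom_evp[OF p]] by simp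
  qed
  have rpow: "r ^ Suc n - r \<in> JJ" for n
  proof (induction n)
    case (Suc n)
    have e: "r ^ Suc (Suc n) - r = r * (r ^ Suc n - r) + (r * r - r)" by (simp add: algebra_simps)
    show ?case unfolding e by (rule JJ(2)[OF JJ(4)[OF rR Suc] rr])
  qed (simp add: JJ)
  define n where "n = card ?Pm"
  have nil: "q ^ n * r \<in> JJ" if q: "q \<in> RR" "e q = 0" for q
  proof -
    have z: "evp \<pi> (q * r) = 0" if p: "\<pi> permutes fl" for \<pi>
    proof (cases "ye (evp \<pi>) = ye e")
      case True
      hence "evp \<pi> q = 0" using rhom_determined[OF e rhom_evp[OF p] _ q(1)] q(2) by simp
      thus ?thesis using rhomD(3)[OF rhom_evp[OF p] q(1) rR] by simp
    next
      case False
      thus ?thesis using rhomD(3)[OF rhom_evp[OF p] q(1) rR] evr[OF p] by simp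
    qed
    \<comment> \<open>\<open>q * r\<close> vanishes at every character, so its resolvent is a bare
      power.\<close>
    have "(\<Prod>\<pi>\<in>?Pm. q * r - mconst (evp \<pi> (q * r))) \<in> JJ"
      using resolvent[OF roots inv_ring_closed(2)[OF q(1) rR] lk] unfolding evp_def .
    hence 1: "(q * r) ^ n \<in> JJ" by (simp add: z n_def)
    have "id \<in> ?Pm" using permutes_id by simp
    hence "?Pm \<noteq> {}" by blast
    hence "n \<noteq> 0" unfolding n_def using fP by (simp only: card_eq_0_iff simp_thms)
    then obtain n' where n': "n = Suc n'" by (cases n) auto
    have 2: "q ^ n * (r ^ n - r) \<in> JJ" by (rule JJ(4)[OF inv_ring_closed(8)[OF q(1)] rpow[of n', folded n']])
    have e: "q ^ n * r = (q * r) ^ n - q ^ n * (r ^ n - r)" by (simp add: power_mult_distrib right_diff_distrib)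
    show ?thesis unfolding e by (rule JJ(3)[OF 1 2])
  qed
  have co: "\<exists>s\<in>RR. 1 - r - s * p0 ^ m \<in> JJ" for m
  proof -
    let ?o = "1 - r"
    have oR: "?o \<in> RR" by (intro inv_ring_closed(3,6) rR)
    have e1: "?o * ?o - ?o = r * r - r" by (simp add: algebra_simps)
    have oo: "?o * ?o - ?o \<in> JJ" unfolding e1 by (rule rr)
    have opow: "?o ^ Suc n - ?o \<in> JJ" for n
    proof (induction n)
      case (Suc n)
      have e: "x ^ Suc (Suc n) - x = x * (x ^ Suc n - x) + (x * x - x)" for x :: mpoly by (simp add: algebra_simps)
      show ?case unfolding e[of ?o] by (rule JJ(2)[OF JJ(4)[OF oR Suc] oo])
    qed (simp add: JJ)
    \<comment> \<open>1 - r is idempotent modulo the ideal, so it may be replaced by its power with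
      exponent m + 1, which contains \<open>p0\<close> at least m times because \<open>P1\<close> is
      nonempty.\<close>
    have "m \<le> card P1 * Suc m" using n0 by (cases "card P1") auto
    then obtain d where d: "card P1 * Suc m = m + d" using le_Suc_ex by blast
    have om: "?o ^ Suc m = (E a ^ Suc m * p0 ^ d) * p0 ^ m"
      unfolding one_r power_mult_distrib power_mult[symmetric] d power_add by (simp only: mult_ac)
    have "?o - ?o ^ Suc m \<in> JJ" using JJ_uminus[OF opow[of m]] unfolding minus_diff_eq .
    hence "?o - (E a ^ Suc m * p0 ^ d) * p0 ^ m \<in> JJ" unfolding om .
    moreover have "E a ^ Suc m * p0 ^ d \<in> RR" by (intro inv_ring_closed(2,8) ER p0R)
    ultimately show ?thesis by blast
  qed
  have ep00: "e p0 = 0" using ep0[OF e] by simp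
  show ?thesis unfolding loc_def
    by (intro exI[of _ r] exI[of _ n] exI[of _ p0] conjI allI impI ballI rR p0R ep00 rr evr nil co)
qed

text \<open>By \<open>H4\<close> the trace counts the permutations at which \<open>r\<close> is 1,
  divided by the order of the block group; these permutations fill the cosets of the l-subsets with
  divisor \<open>y\<close>.\<close>

lemma trace_evp:
  assumes r: "r \<in> RR" and ev: "\<And>\<pi>. \<pi> permutes fl \<Longrightarrow> evp \<pi> r = (if ye (evp \<pi>) = y then 1 else 0)"
  shows "(\<Sum>S\<in>W. phi r (S, S)) = of_nat (card {S\<in>W. (\<Prod>i\<in>S. [:- \<rho> i, 1:]) = y})"
proof -
  have "(\<Sum>S\<in>W. phi r (S, S)) = (\<Sum>S\<in>W. lam0 (r * g S * u S))" by (intro sum.cong) (simp_all add: phi_apply)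
  also have "\<dots> = (\<Sum>\<pi> | \<pi> permutes fl. evp \<pi> r) / N" unfolding H4[OF r] evp_def ..
  also have "(\<Sum>\<pi> | \<pi> permutes fl. evp \<pi> r) = (\<Sum>\<pi> | \<pi> permutes fl. if (\<Prod>i\<in>\<pi> ` {..<l}. [:- \<rho> i, 1:]) = y then 1 else 0)"
    by (intro sum.cong refl) (simp add: ev ye_evp)
  also have "\<dots> = N * (\<Sum>S\<in>W. if (\<Prod>i\<in>S. [:- \<rho> i, 1:]) = y then 1 else 0)"
    by (rule sum_over_cosets[OF lk])
  also have "\<dots> / N = (\<Sum>S\<in>W. if (\<Prod>i\<in>S. [:- \<rho> i, 1:]) = y then 1 else 0)" using N_nonzero by simp
  also have "\<dots> = of_nat (card {S\<in>W. (\<Prod>i\<in>S. [:- \<rho> i, 1:]) = y})"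
    by (simp add: sum.If_cases Int_def)
  finally show ?thesis .
qed

end

section \<open>Counting the root subsets with a given divisor\<close>

lemma order_prod_linear:
  fixes r :: "nat \<Rightarrow> complex"
  shows "finite A \<Longrightarrow> order a (\<Prod>i\<in>A. [:- r i, 1:]) = card {i\<in>A. r i = a}"
proof (induction A rule: finite_induct)
  case (insert x A)
  have "(\<Prod>i\<in>A. [:- r i, 1:]) \<noteq> 0" using insert.hyps by simp
  hence ne: "[:- r x, 1:] * (\<Prod>i\<in>A. [:- r i, 1:]) \<noteq> 0" by (intro no_zero_divisors) simp_all
  have o: "order a [:- r x, 1:] = (if r x = a then 1 else 0)"
  proof (cases "r x = a")
    case True thus ?thesis using order_power_n_n[of a 1] by simp
  next
    case False thus ?thesis by (simp add: order_0I)
  qed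
  have s: "{i \<in> insert x A. r i = a} = (if r x = a then insert x {i\<in>A. r i = a} else {i\<in>A. r i = a})" by auto
  show ?case unfolding prod.insert[OF insert.hyps] order_mult[OF ne] o s insert.IH using insert.hyps by simp
qed simp

text \<open>A subset has the given product exactly when it takes the prescribed number of indices
  from each fibre of \<open>r\<close>, so such subsets amount to independent choices in the
  fibres.\<close>

lemma card_divisor_subsets:
  fixes r :: "nat \<Rightarrow> complex"
  assumes S0: "S0 \<subseteq> {..<k}" "card S0 = l"
  shows "card {S\<in>Wset k l. (\<Prod>i\<in>S. [:- r i, 1:]) = (\<Prod>i\<in>S0. [:- r i, 1:])}
     = (\<Prod>a\<in>r ` {..<k}. card {i\<in>{..<k}. r i = a} choose card {i\<in>S0. r i = a})"
proof -
  let ?fib = "\<lambda>a. {i\<in>{..<k}. r i = a}" and ?m = "\<lambda>a. card {i\<in>S0. r i = a}"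
  let ?L = "{S\<in>Wset k l. (\<Prod>i\<in>S. [:- r i, 1:]) = (\<Prod>i\<in>S0. [:- r i, 1:])}"
  let ?P = "PiE (r ` {..<k}) (\<lambda>a. {T. T \<subseteq> ?fib a \<and> card T = ?m a})"
  have grp: "(\<Prod>i\<in>S. [:- r i, 1:]) = (\<Prod>a\<in>r ` {..<k}. [:- a, 1:] ^ card {i\<in>S. r i = a})" if "S \<subseteq> {..<k}" for S
  proof -
    have "(\<Prod>i\<in>S. [:- r i, 1:]) = (\<Prod>a\<in>r ` {..<k}. \<Prod>i\<in>{i\<in>S. r i = a}. [:- r i, 1:])"
      by (rule prod.group[symmetric]) (use that finite_subset in auto)
    also have "\<dots> = (\<Prod>a\<in>r ` {..<k}. \<Prod>i\<in>{i\<in>S. r i = a}. [:- a, 1:])" by (intro prod.cong) auto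
    finally show ?thesis by simp
  qed
  have iff: "S \<in> ?L \<longleftrightarrow> S \<subseteq> {..<k} \<and> (\<forall>a\<in>r ` {..<k}. card {i\<in>S. r i = a} = ?m a)" for S
  proof
    assume S: "S \<in> ?L"
    hence "S \<subseteq> {..<k}" "finite S" by (auto simp: Wset_def intro: finite_subset)
    moreover have "finite S0" using S0 finite_subset by auto
    ultimately show "S \<subseteq> {..<k} \<and> (\<forall>a\<in>r ` {..<k}. card {i\<in>S. r i = a} = ?m a)"
      using S order_prod_linear[of S _ r] order_prod_linear[of S0 _ r] by (metis (mono_tags, lifting) mem_Collect_eq)
  next
    assume S: "S \<subseteq> {..<k} \<and> (\<forall>a\<in>r ` {..<k}. card {i\<in>S. r i = a} = ?m a)"
    have eq: "(\<Prod>i\<in>S. [:- r i, 1:]) = (\<Prod>i\<in>S0. [:- r i, 1:])"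
      unfolding grp[OF conjunct1[OF S]] grp[OF S0(1)] using S by (intro prod.cong) auto
    have "finite S" "finite S0" using S S0 finite_subset by auto
    hence "card S = l" using arg_cong[OF eq, of degree] S0(2) by (simp add: degree_prod_linear)
    thus "S \<in> ?L" using S eq by (simp add: Wset_def)
  qed
  have "bij_betw (\<lambda>S. restrict (\<lambda>a. {i\<in>S. r i = a}) (r ` {..<k})) ?L ?P"
  proof (rule bij_betwI[where g="\<lambda>f. \<Union>a\<in>r ` {..<k}. f a"])
    show "(\<lambda>S. restrict (\<lambda>a. {i\<in>S. r i = a}) (r ` {..<k})) \<in> ?L \<rightarrow> ?P"
    proof
      fix S assume "S \<in> ?L"
      hence "S \<subseteq> {..<k} \<and> (\<forall>a\<in>r ` {..<k}. card {i\<in>S. r i = a} = ?m a)" using iff by blast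
      thus "restrict (\<lambda>a. {i\<in>S. r i = a}) (r ` {..<k}) \<in> ?P" unfolding restrict_PiE_iff by blast
    qed
    show "(\<lambda>f. \<Union>a\<in>r ` {..<k}. f a) \<in> ?P \<rightarrow> ?L"
    proof
      fix f assume f: "f \<in> ?P"
      have "{i \<in> \<Union>a\<in>r ` {..<k}. f a. r i = a} = f a" if "a \<in> r ` {..<k}" for a
        using f that by (fastforce simp: PiE_def Pi_def)
      thus "(\<Union>a\<in>r ` {..<k}. f a) \<in> ?L" unfolding iff using f by (fastforce simp: PiE_def Pi_def)
    qed
    fix S assume "S \<in> ?L"
    hence "S \<subseteq> {..<k}" using iff by blast
    thus "(\<Union>a\<in>r ` {..<k}. restrict (\<lambda>a. {i\<in>S. r i = a}) (r ` {..<k}) a) = S" by auto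
  next
    fix f assume f: "f \<in> ?P"
    show "restrict (\<lambda>a. {i \<in> \<Union>a\<in>r ` {..<k}. f a. r i = a}) (r ` {..<k}) = f"
    proof
      fix a
      show "restrict (\<lambda>a. {i \<in> \<Union>a\<in>r ` {..<k}. f a. r i = a}) (r ` {..<k}) a = f a"
        using f by (cases "a \<in> r ` {..<k}") (fastforce simp: PiE_def Pi_def extensional_def)+
    qed
  qed
  hence "card ?L = card ?P" by (rule bij_betw_same_card)
  also have "\<dots> = (\<Prod>a\<in>r ` {..<k}. card {T. T \<subseteq> ?fib a \<and> card T = ?m a})" by (rule card_PiE) simp
  also have "\<dots> = (\<Prod>a\<in>r ` {..<k}. card (?fib a) choose ?m a)" by (intro prod.cong refl n_subsets) simp
  finally show ?thesis .
qed

section \<open>The Bethe algebra\<close>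

lemma restr_add: "restr J (Xa + Y) = restr J Xa + restr J Y"
  and restr_scale: "restr J (fscale c Xa) = fscale c (restr J Xa)"
  by (auto simp: restr_def fun_eq_iff fscale_apply)

lemma restr_sum: "restr J (sum f A) = (\<Sum>a\<in>A. restr J (f a))"
proof (induction A rule: infinite_finite_induct)
  case (insert x A)
  show ?case unfolding sum.insert[OF insert.hyps] restr_add insert.IH ..
qed (auto simp: restr_def fun_eq_iff)

locale bethe = tframe +
  fixes lam :: "nat \<Rightarrow> complex \<times> complex" and b :: "nat \<Rightarrow> complex"
  assumes P0: "P0 = (\<lambda>s. - b s + fst (lam s))" and Q0: "Q0 = (\<lambda>s. - b s - snd (lam s))"
begin

abbreviation "AA \<equiv> BQ q1 q2 k lam b"
abbreviation "Tq \<equiv> TQco q1 q2 k lam b"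
abbreviation "D \<equiv> D_poly k b"

lemma taup_eq: "taup S' S = smult q1 (Tpoly k lam b 0 0 S' S) - smult q2 (Tpoly k lam b 1 1 S' S)"
  unfolding taup_def tauop_def Tpoly_def unfolding P0 Q0 by simp

text \<open>Both sides are the coefficient of x^(-m) in T_Q(x) times \<Prod>(1 - b_s / x); the index
  \<open>k - p\<close> reads the coefficients of \<open>D\<close> backwards.\<close>

lemma D_Tq:
  assumes "S' \<in> carrier k" "S \<in> carrier k"
  shows "(\<Sum>p\<le>min m k. coeff D (k - p) * Tq (m - p) (S', S)) = (if m \<le> k then coeff (taup S' S) (k - m) else 0)"
proof -
  have "(\<Sum>p\<le>min m k. coeff D (k - p) * (Tser k lam b i i (S', S) $ (m - p))) = (if m \<le> k then coeff (Tpoly k lam b i i S' S) (k - m) else 0)"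
    if i: "i \<le> 1" for i
  proof -
    have "(if m \<le> k then coeff (Tpoly k lam b i i S' S) (k - m) else 0) = (Dser k b * Tser k lam b i i (S', S)) $ m"
      using Dser_Tser[OF assms i i] by (simp add: rev_of_def)
    also have "\<dots> = (\<Sum>p=0..m. (if p \<le> k then coeff D (k - p) else 0) * (Tser k lam b i i (S', S) $ (m - p)))"
      unfolding fps_mult_nth using Dser[of k b] by (simp add: rev_of_def)
    also have "\<dots> = (\<Sum>p\<le>min m k. coeff D (k - p) * (Tser k lam b i i (S', S) $ (m - p)))"
      by (rule sum.mono_neutral_cong_right) auto
    finally show ?thesis ..
  qed
  from this[of 0] this[of 1] show ?thesis
    unfolding TQco_def taup_eq
    by (simp add: fscale_apply Tco_def right_diff_distrib sum_subtractf mult.left_commute sum_distrib_left[symmetric])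
qed

lemma coeff_D: "coeff D k = 1" "degree D = k"
proof -
  have "Dser k b $ 0 = coeff D (k - 0)" using Dser[of k b] unfolding rev_of_def by simp
  thus 1: "coeff D k = 1" using Dser_0 by simp
  have "degree D \<le> k" using Dser[of k b] unfolding rev_of_def by simp
  thus "degree D = k" using le_degree[of D k] 1 by simp
qed

text \<open>Block diagonality with respect to the number of odd factors, that is, preservation of
  the weight spaces; it makes \<open>restr\<close> multiplicative on the Bethe algebra.\<close>

definition bd :: "(nat set \<times> nat set \<Rightarrow> complex) \<Rightarrow> bool" where
  "bd Xa \<longleftrightarrow> (\<forall>S'\<in>carrier k. \<forall>S\<in>carrier k. card S' \<noteq> card S \<longrightarrow> Xa (S', S) = 0)"

lemma bd_Tq: "bd (Tq r)"
proof -
  have "Tser k lam b i i (S', S) = 0" if "S' \<in> carrier k" "S \<in> carrier k" "card S' \<noteq> card S" "i \<le> 1" for i S' S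
  proof -
    have "finite S'" using that(1) by (auto simp: carrier_def intro: finite_subset)
    thus ?thesis unfolding Tser_opT[OF that(1,2,4,4)] using opT_delta_card[OF _ _ that(4,4)] that(3) by fastforce
  qed
  from this[where i=0] this[where i=1] show ?thesis unfolding bd_def TQco_def by (simp add: fscale_apply Tco_def)
qed

lemma bd_AA: "Xa \<in> AA \<Longrightarrow> bd Xa"
  unfolding BQ_def
proof (induction rule: alg_gen.induct)
  case gen_id show ?case by (auto simp: bd_def idm_def)
next
  case (gen_base g)
  thus ?case
  proof
    assume "g \<in> range (BerCo q1 q2 k lam b)"
    then obtain r c where "g = fscale c (idm (carrier k))" using BerCo_scalar by blast
    thus ?thesis by (auto simp: bd_def idm_def fscale_apply)
  qed (auto simp: bd_Tq)
next
  case (gen_add A B) thus ?case by (simp add: bd_def)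
next
  case (gen_scale A c) thus ?case by (simp add: bd_def fscale_apply)
next
  case (gen_mul A B)
  show ?case unfolding bd_def
  proof (intro ballI impI)
    fix S' S assume S: "S' \<in> carrier k" "S \<in> carrier k" "card S' \<noteq> card S"
    have z: "A (S', y) * B (y, S) = 0" if "y \<in> carrier k" for y
      using gen_mul.IH S that unfolding bd_def by (cases "card S' = card y") auto
    have "(\<Sum>y\<in>carrier k. A (S', y) * B (y, S)) = 0" by (rule sum.neutral) (use z in blast)
    thus "mmul (carrier k) A B (S', S) = 0" by (simp add: mmul_def)
  qed
qed

lemma W_carrier: "W \<subseteq> carrier k" by (auto simp: Wset_def carrier_def)

lemma restr_idm: "restr W (idm (carrier k)) = idm W"
  using W_carrier by (auto simp: restr_def idm_def fun_eq_iff)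

lemma restr_mmul: "Xa \<in> AA \<Longrightarrow> restr W (mmul (carrier k) Xa Y) = mmul W (restr W Xa) (restr W Y)"
proof (rule ext, clarify)
  fix S' S assume Xa: "Xa \<in> AA"
  show "restr W (mmul (carrier k) Xa Y) (S', S) = mmul W (restr W Xa) (restr W Y) (S', S)"
  proof (cases "S' \<in> W \<and> S \<in> W")
    case True
    have "Xa (S', y) = 0" if "y \<in> carrier k - W" for y
      using bd_AA[OF Xa] W_carrier True that unfolding bd_def by (auto simp: Wset_def carrier_def)
    hence "(\<Sum>y\<in>carrier k. Xa (S', y) * Y (y, S)) = (\<Sum>y\<in>W. Xa (S', y) * Y (y, S))"
      by (intro sum.mono_neutral_right) (auto intro: W_carrier[THEN subsetD])
    also have "\<dots> = (\<Sum>y\<in>W. restr W Xa (S', y) * restr W Y (y, S))"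
      using True by (intro sum.cong) (auto simp: restr_def)
    finally show ?thesis using True by (simp add: restr_def mmul_def)
  next
    case False
    thus ?thesis by (auto simp: restr_def mmul_def intro!: sum.neutral[symmetric])
  qed
qed

lemma restr_relation:
  "phi (if m \<le> k then coeff RHS (k - m) else 0) = restr W (\<Sum>p\<le>min m k. fscale (coeff D (k - p)) (Tq (m - p)))"
proof (rule ext, clarify)
  fix S' S
  show "phi (if m \<le> k then coeff RHS (k - m) else 0) (S', S) = restr W (\<Sum>p\<le>min m k. fscale (coeff D (k - p)) (Tq (m - p))) (S', S)"
  proof (cases "S' \<in> W \<and> S \<in> W")
    case True
    have "phi 0 = 0" using phi_zero_iff[OF inv_ring_closed(7)] JJ(1) by simp
    hence "phi (if m \<le> k then coeff RHS (k - m) else 0) (S', S) = (if m \<le> k then coeff (taup S' S) (k - m) else 0)"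
      using True by (simp add: phi_RHS)
    also have "\<dots> = (\<Sum>p\<le>min m k. coeff D (k - p) * Tq (m - p) (S', S))"
      by (rule D_Tq[symmetric]) (use True W_carrier in auto)
    finally show ?thesis using True by (simp add: restr_def sum_fun_apply fscale_apply)
  next
    case False
    have 1: "phi q (S', S) = 0" for q using False by (auto simp: phi_def)
    have 2: "restr W Y (S', S) = 0" for Y using False by (auto simp: restr_def)
    show ?thesis unfolding 1 2 ..
  qed
qed

lemma RHS_if_RR: "(if m \<le> k then coeff RHS (k - m) else 0) \<in> RR"
  using RHS_inv inv_ring_closed(7) by simp

lemma AA_closed: "Xa \<in> AA \<Longrightarrow> Y \<in> AA \<Longrightarrow> Xa + Y \<in> AA" "Xa \<in> AA \<Longrightarrow> fscale c Xa \<in> AA"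
  "Xa \<in> AA \<Longrightarrow> Y \<in> AA \<Longrightarrow> mmul (carrier k) Xa Y \<in> AA" "idm (carrier k) \<in> AA" "Tq r \<in> AA" "0 \<in> AA"
proof -
  show "Xa \<in> AA \<Longrightarrow> Y \<in> AA \<Longrightarrow> Xa + Y \<in> AA" "Xa \<in> AA \<Longrightarrow> fscale c Xa \<in> AA"
    "Xa \<in> AA \<Longrightarrow> Y \<in> AA \<Longrightarrow> mmul (carrier k) Xa Y \<in> AA"
    unfolding BQ_def by (rule gen_add gen_scale gen_mul; assumption)+
  show i: "idm (carrier k) \<in> AA" unfolding BQ_def by (rule gen_id)
  show "Tq r \<in> AA" unfolding BQ_def by (rule gen_base) simp
  have "fscale 0 (idm (carrier k)) \<in> AA" using i unfolding BQ_def by (rule gen_scale)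
  moreover have "fscale 0 (idm (carrier k) :: nat set \<times> nat set \<Rightarrow> complex) = 0" by (auto simp: fscale_apply fun_eq_iff)
  ultimately show "0 \<in> AA" by simp
qed

lemma AA_sum: "(\<And>a. a \<in> A \<Longrightarrow> f a \<in> AA) \<Longrightarrow> sum f A \<in> AA"
  by (induction A rule: infinite_finite_induct) (simp_all add: AA_closed)

lemma CC_closed: "A \<in> CC \<Longrightarrow> B \<in> CC \<Longrightarrow> A + B \<in> CC" "A \<in> CC \<Longrightarrow> fscale c A \<in> CC"
  "A \<in> CC \<Longrightarrow> B \<in> CC \<Longrightarrow> mmul W A B \<in> CC" "idm W \<in> CC" "0 \<in> CC"
proof -
  show "A \<in> CC \<Longrightarrow> B \<in> CC \<Longrightarrow> A + B \<in> CC" "A \<in> CC \<Longrightarrow> fscale c A \<in> CC"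
    "A \<in> CC \<Longrightarrow> B \<in> CC \<Longrightarrow> mmul W A B \<in> CC" "idm W \<in> CC"
    using subalg_CC unfolding subalg_def by blast+
  have "phi 0 = 0" using phi_zero_iff[OF inv_ring_closed(7)] JJ(1) by simp
  thus "0 \<in> CC" using inv_ring_closed(7)[of k l] by (metis imageI)
qed

lemma CC_sum: "(\<And>a. a \<in> A \<Longrightarrow> f a \<in> CC) \<Longrightarrow> sum f A \<in> CC"
proof (induction A rule: infinite_finite_induct)
  case (insert x A) thus ?case unfolding sum.insert[OF insert.hyps] by (intro CC_closed(1)) auto
qed (simp_all only: sum.infinite sum.empty CC_closed(5) not_False_eq_True)

text \<open>\<open>D\<close> is monic, so \<open>restr_relation\<close> can be solved for the r-th
  coefficient in terms of earlier ones and an element of \<open>CC\<close>.\<close>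

lemma restr_Tq: "restr W (Tq r) \<in> CC"
proof (induction r rule: less_induct)
  case (less r)
  let ?t = "\<lambda>p. fscale (coeff D (k - p)) (restr W (Tq (r - p)))"
  have "phi (if r \<le> k then coeff RHS (k - r) else 0) = (\<Sum>p\<le>min r k. ?t p)"
    unfolding restr_relation restr_sum restr_scale ..
  also have "{..min r k} = insert 0 {1..min r k}" by auto
  also have "(\<Sum>p\<in>insert 0 {1..min r k}. ?t p) = ?t 0 + (\<Sum>p\<in>{1..min r k}. ?t p)" by (rule sum.insert) auto
  also have "?t 0 = restr W (Tq r)" by (simp add: coeff_D fscale_def)
  finally have rel: "phi (if r \<le> k then coeff RHS (k - r) else 0) = restr W (Tq r) + (\<Sum>p\<in>{1..min r k}. ?t p)" .
  have aux: "A = B + C \<Longrightarrow> B = A + fscale (- 1) C" for A B C :: "nat set \<times> nat set \<Rightarrow> complex"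
    by (auto simp: fun_eq_iff fscale_apply)
  have "restr W (Tq r) = phi (if r \<le> k then coeff RHS (k - r) else 0) + fscale (- 1) (\<Sum>p\<in>{1..min r k}. ?t p)"
    by (rule aux[OF rel])
  also have "\<dots> \<in> CC"
  proof (rule CC_closed(1)[OF imageI[OF RHS_if_RR] CC_closed(2)[OF CC_sum]])
    fix p assume "p \<in> {1..min r k}"
    hence "r - p < r" by auto
    thus "?t p \<in> CC" by (intro CC_closed(2) less.IH)
  qed
  finally show ?case .
qed

text \<open>For one inclusion it suffices to look at the generators, the Berezinian being scalar.
  For the other, the invariants whose matrix comes from the Bethe algebra form a subring containing
  the ideal and the coefficients of the transfer eigenvalue, hence everything.\<close>

lemma restr_AA: "restr W ` AA = CC"
proof
  show "restr W ` AA \<subseteq> CC"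
  proof
    fix Z assume "Z \<in> restr W ` AA"
    then obtain Xa where Xa: "Xa \<in> AA" "Z = restr W Xa" by blast
    have "Xa \<in> AA \<and> restr W Xa \<in> CC" using Xa(1) unfolding BQ_def
    proof (induction rule: alg_gen.induct)
      case gen_id show ?case using CC_closed(4) alg_gen.gen_id unfolding restr_idm by blast
    next
      case (gen_base g)
      hence "restr W g \<in> CC"
      proof
        assume "g \<in> range (BerCo q1 q2 k lam b)"
        then obtain c where "g = fscale c (idm (carrier k))" using BerCo_scalar by blast
        thus ?thesis by (simp add: restr_scale restr_idm CC_closed)
      qed (auto simp: restr_Tq)
      thus ?case using alg_gen.gen_base[OF gen_base] by blast
    next
      case (gen_add A B) thus ?case using CC_closed(1) alg_gen.gen_add unfolding restr_add by blast
    next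
      case (gen_scale A c) thus ?case using CC_closed(2) alg_gen.gen_scale unfolding restr_scale by blast
    next
      case (gen_mul A B)
      hence "A \<in> AA" unfolding BQ_def by blast
      thus ?case using gen_mul alg_gen.gen_mul CC_closed(3) unfolding restr_mmul[OF \<open>A \<in> AA\<close>] by blast
    qed
    thus "Z \<in> CC" using Xa(2) by blast
  qed
  let ?R = "{p \<in> RR. phi p \<in> restr W ` AA}"
  have R: "subring ?R"
    unfolding subring_def
  proof (intro conjI allI ballI)
    fix c
    have "phi (mconst c) = restr W (fscale c (idm (carrier k)))"
      using phi_scale[OF inv_ring_closed(6), of c] by (simp add: phi_one restr_scale restr_idm)
    thus "mconst c \<in> ?R" using AA_closed(2)[OF AA_closed(4)] inv_ring_closed(5) by blast
  next
    fix p q assume "p \<in> ?R" "q \<in> ?R"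
    then obtain Xa Y where XY: "p \<in> RR" "q \<in> RR" "Xa \<in> AA" "Y \<in> AA" "phi p = restr W Xa" "phi q = restr W Y" by blast
    have "phi (p + q) = restr W (Xa + Y)" using XY by (simp add: phi_add restr_add)
    thus "p + q \<in> ?R" using AA_closed(1)[OF XY(3,4)] inv_ring_closed(1)[OF XY(1,2)] by blast
    have "phi (p * q) = restr W (mmul (carrier k) Xa Y)" using XY by (simp add: phi_mult restr_mmul)
    thus "p * q \<in> ?R" using AA_closed(3)[OF XY(3,4)] inv_ring_closed(2)[OF XY(1,2)] by blast
  qed
  have J: "JJ \<subseteq> ?R"
  proof
    fix p assume p: "p \<in> JJ"
    have "phi p = restr W 0" using phi_zero_iff[OF JJ_RR[OF p]] p by (auto simp: restr_def fun_eq_iff)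
    thus "p \<in> ?R" using JJ_RR[OF p] AA_closed(6) by blast
  qed
  have T: "coeff RHS j \<in> ?R" for j
  proof (cases "j \<le> k")
    case True
    hence "phi (coeff RHS j) = restr W (\<Sum>p\<le>min (k - j) k. fscale (coeff D (k - p)) (Tq (k - j - p)))"
      using restr_relation[of "k - j"] by simp
    thus ?thesis using RHS_inv AA_sum[of "{..min (k - j) k}" "\<lambda>p. fscale (coeff D (k - p)) (Tq (k - j - p))"] AA_closed(2,5) by blast
  next
    case False
    have "degree (ysp l * zp k l) \<le> l + (k - l)" using degree_mult_le[of "ysp l" "zp k l"] by (simp add: degree_ysp degree_zp)
    hence "coeff (ysp l * zp k l) j = 0" using False lk by (intro coeff_eq_0) linarith
    hence "coeff RHS j = 0" by (simp add: RHS_def mult.assoc)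
    thus ?thesis using subringD(3)[OF R] by simp
  qed
  have "RR \<subseteq> ?R"
  proof (rule inv_ring_generated_by_transfer[OF R lk roots J])
    fix j
    have "mconst (1 / (q1 - q2)) * coeff RHS j \<in> ?R" by (rule subringD(5)[OF R subringD(1)[OF R] T])
    moreover have "mconst (1 / (q1 - q2)) * coeff RHS j = coeff (ysp l * zp k l) j"
    proof -
      have "mconst (1 / (q1 - q2) * (q1 - q2)) = 1" using qne by (simp add: mconst_1)
      moreover have "coeff RHS j = mconst (q1 - q2) * coeff (ysp l * zp k l) j" by (simp add: RHS_def mult.assoc)
      ultimately show ?thesis by (simp only: mult.assoc[symmetric] mconst_mult[symmetric] mult_1_left)
    qed
    ultimately show "coeff (ysp l * zp k l) j \<in> ?R" by simp
  qed
  thus "CC \<subseteq> restr W ` AA" by blast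
qed

text \<open>\<open>E\<close> is a character of the Bethe algebra on the whole tensor product;
  compatibility says that it factors through the restriction to \<open>W\<close> and there becomes
  the character \<open>e\<close> of the quotient ring.\<close>

definition compat :: "((nat set \<times> nat set \<Rightarrow> complex) \<Rightarrow> complex) \<Rightarrow> (mpoly \<Rightarrow> complex) \<Rightarrow> bool" where
  "compat E e \<longleftrightarrow> rhom e \<and> (\<forall>Xa\<in>AA. \<forall>p\<in>RR. phi p = restr W Xa \<longrightarrow> E Xa = e p)"

lemma AA_rep: "Xa \<in> AA \<Longrightarrow> \<exists>p\<in>RR. phi p = restr W Xa" using restr_AA by (metis imageE imageI)
lemma RR_rep: "p \<in> RR \<Longrightarrow> \<exists>Xa\<in>AA. phi p = restr W Xa" using restr_AA by (metis imageE imageI)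

lemma compat_exists:
  assumes e: "rhom e"
  shows "\<exists>E. character (carrier k) AA E \<and> compat E e"
proof -
  define E where "E = (\<lambda>Xa. e (SOME p. p \<in> RR \<and> phi p = restr W Xa))"
  have E: "E Xa = e p" if "p \<in> RR" "phi p = restr W Xa" for Xa p
  proof -
    have s: "(SOME p. p \<in> RR \<and> phi p = restr W Xa) \<in> RR \<and> phi (SOME p. p \<in> RR \<and> phi p = restr W Xa) = restr W Xa"
      by (rule someI[of _ p]) (use that in simp)
    let ?p = "SOME p. p \<in> RR \<and> phi p = restr W Xa"
    have "?p - p \<in> JJ" using phi_eq_iff[of ?p p] s that by simp
    hence "e (?p - p) = 0" by (rule rhomD(5)[OF e])
    thus ?thesis unfolding E_def using rhomD(8)[OF e conjunct1[OF s] that(1)] by simp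
  qed
  have "character (carrier k) AA E"
    unfolding character_def
  proof (intro conjI ballI allI)
    show "E (idm (carrier k)) = 1"
      using E[OF inv_ring_closed(6), of "idm (carrier k)"] rhomD(1)[OF e] by (simp add: phi_one restr_idm)
    fix Xa Y assume XY: "Xa \<in> AA" "Y \<in> AA"
    obtain p q where pq: "p \<in> RR" "phi p = restr W Xa" "q \<in> RR" "phi q = restr W Y" using AA_rep XY by metis
    show "E (Xa + Y) = E Xa + E Y"
      using E[OF inv_ring_closed(1)[OF pq(1,3)], of "Xa + Y"] E[OF pq(1,2)] E[OF pq(3,4)] pq by (simp add: phi_add restr_add rhomD(2)[OF e])
    show "E (mmul (carrier k) Xa Y) = E Xa * E Y"
      using E[OF inv_ring_closed(2)[OF pq(1,3)], of "mmul (carrier k) Xa Y"] E[OF pq(1,2)] E[OF pq(3,4)] pq XY(1)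
      by (simp add: phi_mult restr_mmul rhomD(3)[OF e])
  next
    fix c Xa assume Xa: "Xa \<in> AA"
    obtain p where p: "p \<in> RR" "phi p = restr W Xa" using AA_rep Xa by metis
    show "E (fscale c Xa) = c * E Xa"
      using E[OF inv_ring_closed(2)[OF inv_ring_closed(5) p(1)], of c "fscale c Xa"] E[OF p] p by (simp add: phi_scale restr_scale rhomD(4)[OF e])
  qed
  moreover have "compat E e" unfolding compat_def using e E by blast
  ultimately show ?thesis by blast
qed

lemma charD:
  assumes "character (carrier k) AA E"
  shows "E (idm (carrier k)) = 1" "Xa \<in> AA \<Longrightarrow> Y \<in> AA \<Longrightarrow> E (Xa + Y) = E Xa + E Y"
    "Xa \<in> AA \<Longrightarrow> Y \<in> AA \<Longrightarrow> E (mmul (carrier k) Xa Y) = E Xa * E Y" "Xa \<in> AA \<Longrightarrow> E (fscale c Xa) = c * E Xa" "E 0 = 0"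
proof -
  show 1: "E (idm (carrier k)) = 1" "Xa \<in> AA \<Longrightarrow> Y \<in> AA \<Longrightarrow> E (Xa + Y) = E Xa + E Y"
    "Xa \<in> AA \<Longrightarrow> Y \<in> AA \<Longrightarrow> E (mmul (carrier k) Xa Y) = E Xa * E Y" "Xa \<in> AA \<Longrightarrow> E (fscale c Xa) = c * E Xa" for Xa Y c
    using assms unfolding character_def by blast+
  have "fscale 0 (0 :: nat set \<times> nat set \<Rightarrow> complex) = 0" by (auto simp: fscale_apply fun_eq_iff)
  thus "E 0 = 0" using 1(4)[OF AA_closed(6), of 0] by simp
qed

lemma char_sum: "character (carrier k) AA E \<Longrightarrow> (\<And>a. a \<in> A \<Longrightarrow> f a \<in> AA) \<Longrightarrow> E (sum f A) = (\<Sum>a\<in>A. E (f a))"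
  by (induction A rule: infinite_finite_induct) (simp_all add: charD AA_sum)

text \<open>The kernel condition makes \<open>E\<close> well defined on restrictions. It is a
  genuine condition, since \<open>E\<close> may come from another weight space.\<close>

lemma char_compat:
  assumes E: "character (carrier k) AA E" and z: "\<And>Xa. Xa \<in> AA \<Longrightarrow> restr W Xa = 0 \<Longrightarrow> E Xa = 0"
  shows "\<exists>e. compat E e"
proof -
  have eq: "E Xa = E Y" if "Xa \<in> AA" "Y \<in> AA" "restr W Xa = restr W Y" for Xa Y
  proof -
    have m: "fscale (- 1) Y \<in> AA" by (rule AA_closed(2)[OF that(2)])
    have "restr W (Xa + fscale (- 1) Y) = 0" unfolding restr_add restr_scale that(3) by (auto simp: fun_eq_iff fscale_apply)
    hence "E (Xa + fscale (- 1) Y) = 0" by (rule z[OF AA_closed(1)[OF that(1) m]])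
    thus ?thesis unfolding charD(2)[OF E that(1) m] charD(4)[OF E that(2)] by simp
  qed
  define e where "e = (\<lambda>p. E (SOME Xa. Xa \<in> AA \<and> phi p = restr W Xa))"
  have e: "e p = E Xa" if "Xa \<in> AA" "phi p = restr W Xa" for p Xa
  proof -
    let ?Xa = "SOME Xa. Xa \<in> AA \<and> phi p = restr W Xa"
    have "?Xa \<in> AA \<and> phi p = restr W ?Xa" by (rule someI[of _ Xa]) (use that in simp)
    thus ?thesis unfolding e_def using eq[of ?Xa Xa] that by simp
  qed
  have "rhom e" unfolding rhom_def
  proof (intro conjI ballI allI)
    show "e 1 = 1" using e[OF AA_closed(4), of 1] charD(1)[OF E] by (simp add: phi_one restr_idm)
    fix p q assume "p \<in> RR" "q \<in> RR"
    then obtain Xa Y where XY: "p \<in> RR" "q \<in> RR" "Xa \<in> AA" "Y \<in> AA" "phi p = restr W Xa" "phi q = restr W Y" using RR_rep by metis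
    show "e (p + q) = e p + e q"
      using e[OF AA_closed(1)[OF XY(3,4)], of "p + q"] e[OF XY(3,5)] e[OF XY(4,6)] XY by (simp add: phi_add restr_add charD(2)[OF E])
    show "e (p * q) = e p * e q"
      using e[OF AA_closed(3)[OF XY(3,4)], of "p * q"] e[OF XY(3,5)] e[OF XY(4,6)] XY by (simp add: phi_mult restr_mmul charD(3)[OF E])
  next
    fix c p assume "p \<in> RR"
    then obtain Xa where Xa: "p \<in> RR" "Xa \<in> AA" "phi p = restr W Xa" using RR_rep by metis
    show "e (mconst c * p) = c * e p"
      using e[OF AA_closed(2)[OF Xa(2)], of "mconst c * p" c] e[OF Xa(2,3)] Xa by (simp add: phi_scale restr_scale charD(4)[OF E])
  next
    fix p assume p: "p \<in> JJ"
    have "restr W 0 = 0" by (auto simp: restr_def fun_eq_iff)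
    hence "e p = E 0" using e[OF AA_closed(6), of p] phi_zero_iff[OF JJ_RR[OF p]] p by simp
    thus "e p = 0" by (simp add: charD(5)[OF E])
  qed
  thus ?thesis unfolding compat_def using e by metis
qed

section \<open>Eigenspaces and eigenvalues\<close>

lemma eigsp_compat:
  assumes c: "compat E e"
  shows "eigsp W AA E = range (\<lambda>c. fscale c (we e))"
proof -
  have e: "rhom e" and Ee: "\<And>Xa p. Xa \<in> AA \<Longrightarrow> p \<in> RR \<Longrightarrow> phi p = restr W Xa \<Longrightarrow> E Xa = e p"
    using c unfolding compat_def by auto
  show ?thesis
  proof (intro equalityI subsetI)
    fix v assume v: "v \<in> eigsp W AA E"
    have "mvec W (phi p) v = fscale (e p) v" if p: "p \<in> RR" for p
    proof -
      obtain Xa where Xa: "Xa \<in> AA" "phi p = restr W Xa" using RR_rep[OF p] by blast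
      have "mvec W (restr W Xa) v = fscale (E Xa) v" using v Xa(1) unfolding eigsp_def by blast
      thus ?thesis using Ee[OF Xa(1) p Xa(2)] Xa(2) by simp
    qed
    from we_unique[OF _ this] v show "v \<in> range (\<lambda>c. fscale c (we e))" unfolding eigsp_def by blast
  next
    fix v assume "v \<in> range (\<lambda>c. fscale c (we e))"
    then obtain c where v: "v = fscale c (we e)" by blast
    show "v \<in> eigsp W AA E"
      unfolding eigsp_def mem_Collect_eq
    proof (intro conjI ballI)
      show "v \<in> vecs W" using we_vecs[of e] by (simp add: v vecs_def fscale_apply)
      fix Xa assume Xa: "Xa \<in> AA"
      obtain p where p: "p \<in> RR" "phi p = restr W Xa" using AA_rep[OF Xa] by blast
      show "mvec W (restr W Xa) v = fscale (E Xa) v"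
        unfolding p(2)[symmetric] Ee[OF Xa p] v mvec_lin(2) phi_we[OF e p(1)] by (simp add: fscale_def mult_ac)
    qed
  qed
qed

text \<open>An operator restricting to zero acts on a nonzero eigenvector both by zero and by its
  eigenvalue, so \<open>E\<close> vanishes on it.\<close>

lemma eigsp_nonzero_compat:
  assumes E: "character (carrier k) AA E" and ne: "eigsp W AA E \<noteq> {0}"
  shows "\<exists>e. compat E e"
proof (rule char_compat[OF E])
  fix Xa assume Xa: "Xa \<in> AA" "restr W Xa = 0"
  have "0 \<in> eigsp W AA E" unfolding eigsp_def by (simp add: vecs_def mvec_lin(5))
  then obtain v where v: "v \<in> eigsp W AA E" "v \<noteq> 0" using ne by blast
  have "fscale (E Xa) v = mvec W (restr W Xa) v" using v(1) Xa(1) unfolding eigsp_def by auto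
  also have "\<dots> = 0" unfolding Xa(2) by (simp add: mvec_def fun_eq_iff)
  finally show "E Xa = 0" using v(2) by (auto simp: fscale_def fun_eq_iff)
qed

lemma we_line_nonzero: "rhom e \<Longrightarrow> range (\<lambda>c. fscale c (we e)) \<noteq> {0}"
proof
  assume e: "rhom e" and "range (\<lambda>c. fscale c (we e)) = {0}"
  hence "fscale 1 (we e) = 0" by blast
  thus False using we_nonzero[OF e] by (simp add: fscale_def)
qed

lemma dim_we_line:
  assumes e: "rhom e" shows "cdim (range (\<lambda>c. fscale c (we e))) = 1"
proof -
  have "cdim (range (\<lambda>c. fscale c (we e))) = card {()}"
  proof (rule dim_by_coordinates[of "{()}" "\<lambda>_. we e"])
    fix j :: unit
    have "we e = fscale 1 (we e)" by (simp add: fscale_def)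
    thus "we e \<in> range (\<lambda>c. fscale c (we e))" by (rule range_eqI)
  next
    fix v assume "v \<in> range (\<lambda>c. fscale c (we e))"
    then obtain c where "v = fscale c (we e)" by blast
    thus "\<exists>c. v = (\<Sum>j\<in>{()}. fscale (c j) (we e))" by (intro exI[of _ "\<lambda>_. c"]) simp
  next
    fix c :: "unit \<Rightarrow> complex" and j :: unit
    assume "(\<Sum>j\<in>{()}. fscale (c j) (we e)) = 0"
    hence "fscale (c ()) (we e) = 0" by simp
    thus "c j = 0" using we_nonzero[OF e] by (auto simp: fscale_def fun_eq_iff)
  qed simp
  thus ?thesis by simp
qed

lemma we_line_inj:
  assumes e: "rhom e" and e': "rhom e'" and eq: "range (\<lambda>c. fscale c (we e)) = range (\<lambda>c. fscale c (we e'))"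
  shows "ye e = ye e'"
proof -
  have "we e = fscale 1 (we e)" by (simp add: fscale_def)
  hence "we e \<in> range (\<lambda>c. fscale c (we e'))" using eq by blast
  then obtain c where c: "we e = fscale c (we e')" by blast
  have "e p = e' p" if p: "p \<in> RR" for p
  proof -
    have "fscale (e p) (we e) = fscale (e' p) (we e)"
      using phi_we[OF e p] phi_we[OF e' p] unfolding c mvec_lin(2) by (simp add: fscale_def mult_ac)
    moreover obtain S where "we e S \<noteq> 0" using we_nonzero[OF e] by (auto simp: fun_eq_iff)
    ultimately show ?thesis using fun_cong[of "fscale (e p) (we e)" "fscale (e' p) (we e)" S] by (simp add: fscale_apply)
  qed
  hence "coeff (ye e) j = coeff (ye e') j" for j
    using yp_RR by (simp add: ye_def coeff_map_poly rhomD[OF e] rhomD[OF e'])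
  thus ?thesis by (rule poly_eqI)
qed

abbreviation "FF \<equiv> smult (q1 - q2) F0"

text \<open>With M the image of y(x-1)z, the eigenvalue of the cleared transfer matrix is T = (q1 -
  q2) M, and y T = y(x-1) \<open>FF\<close>. Numerator and denominator both have degree k + l, so no
  power of x^(-1) is left over in \<open>laurent_eq\<close>.\<close>

lemma eigenvalue_laurent:
  assumes E: "character (carrier k) AA E" and c: "compat E e"
  shows "laurent_eq (\<lambda>r. E (Tq r)) (pcompose (ye e) [:- 1, 1:] * FF) (ye e * D)"
proof -
  have e: "rhom e" and Ee: "\<And>Xa p. Xa \<in> AA \<Longrightarrow> p \<in> RR \<Longrightarrow> phi p = restr W Xa \<Longrightarrow> E Xa = e p"
    using c unfolding compat_def by auto
  let ?y = "ye e" and ?ys = "pcompose (ye e) [:- 1, 1:]"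
  define M where "M = map_poly e (ysp l * zp k l)"
  define T where "T = smult (q1 - q2) M"
  have ne: "q1 - q2 \<noteq> 0" using qne by simp
  have y0: "?y \<noteq> 0" using ye_monic(1)[OF e] by auto
  have F00: "F0 \<noteq> 0" by auto
  have dF0: "degree F0 = k" using degree_prod_linear[of "{..<k}" \<rho>] by simp
  have dys: "degree ?ys = l" by (simp add: degree_pcompose ye_monic(2)[OF e])
  have ys0: "?ys \<noteq> 0"
    using pcompose_eq_0[of ?y "[:- 1, 1:]"] y0 by auto
  have My: "M * ?y = ?ys * F0" unfolding M_def by (rule map_ysz[OF e])
  have M0: "M \<noteq> 0" using My ys0 F00 by (metis mult_eq_0_iff)
  have "degree (M * ?y) = degree (?ys * F0)" unfolding My ..
  hence dM: "degree M = k"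
    unfolding degree_mult_eq[OF M0 y0] degree_mult_eq[OF ys0 F00] dys dF0 ye_monic(2)[OF e] by simp
  have dT: "degree T = k" by (simp add: T_def dM qne)
  have eRHS: "e (coeff RHS j) = coeff T j" for j
  proof -
    have "coeff RHS j = mconst (q1 - q2) * coeff (ysp l * zp k l) j" by (simp add: RHS_def mult.assoc)
    thus ?thesis by (simp add: T_def M_def coeff_map_poly rhomD(6)[OF e] rhomD(4)[OF e ysz_RR])
  qed
  have D0: "D \<noteq> 0" using coeff_D(1) by auto
  have key: "fps_of_poly (reflect_poly D) * Abs_fps (\<lambda>r. E (Tq r)) = fps_of_poly (reflect_poly T)"
  proof (rule fps_ext)
    fix m
    have "(fps_of_poly (reflect_poly D) * Abs_fps (\<lambda>r. E (Tq r))) $ m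
      = (\<Sum>p=0..m. (if p \<le> k then coeff D (k - p) else 0) * E (Tq (m - p)))"
      unfolding fps_mult_nth by (intro sum.cong refl) (simp add: coeff_reflect_poly coeff_D(2))
    also have "\<dots> = (\<Sum>p\<le>min m k. E (fscale (coeff D (k - p)) (Tq (m - p))))"
      by (rule sum.mono_neutral_cong_right) (auto simp: charD(4)[OF E AA_closed(5)])
    also have "\<dots> = E (\<Sum>p\<le>min m k. fscale (coeff D (k - p)) (Tq (m - p)))"
      by (rule char_sum[OF E, symmetric]) (intro AA_closed(2,5))
    also have "\<dots> = e (if m \<le> k then coeff RHS (k - m) else 0)"
      by (rule Ee[OF AA_sum RHS_if_RR restr_relation]) (intro AA_closed(2,5))
    also have "\<dots> = (if m \<le> k then coeff T (k - m) else 0)" by (simp add: eRHS rhomD(6)[OF e])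
    finally show "(fps_of_poly (reflect_poly D) * Abs_fps (\<lambda>r. E (Tq r))) $ m = fps_of_poly (reflect_poly T) $ m"
      by (simp add: coeff_reflect_poly dT)
  qed
  have yT: "?y * T = ?ys * FF" using My by (simp add: T_def mult.commute)
  have FF0: "FF \<noteq> 0" using ne F00 by (simp only: smult_eq_0_iff simp_thms)
  have dFF: "degree FF = k" using ne dF0 by (simp only: degree_smult_eq if_False)
  have deg: "degree (?ys * FF) = degree (?y * D)"
    unfolding degree_mult_eq[OF ys0 FF0] degree_mult_eq[OF y0 D0] dys dFF ye_monic(2)[OF e] coeff_D(2) ..
  have "fps_of_poly (reflect_poly (?y * D)) * Abs_fps (\<lambda>r. E (Tq r))
     = fps_of_poly (reflect_poly ?y) * (fps_of_poly (reflect_poly D) * Abs_fps (\<lambda>r. E (Tq r)))"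
    by (simp add: reflect_poly_mult fps_of_poly_mult mult.assoc)
  also have "\<dots> = fps_of_poly (reflect_poly (?y * T))"
    unfolding key by (simp add: reflect_poly_mult fps_of_poly_mult)
  finally show ?thesis unfolding laurent_eq_def deg yT by simp
qed

section \<open>Generalized eigenspaces\<close>

lemma funpow_eig:
  assumes p: "p \<in> RR" "phi p = restr W Xa" and v: "v \<in> vecs W"
  shows "((\<lambda>u. mvec W (restr W Xa) u - fscale c u) ^^ m) v = mvec W (phi ((p - mconst c) ^ m)) v"
proof (induction m)
  case 0
  show ?case by (simp add: phi_one mvec_idm[OF finite_Wset v])
next
  case (Suc m)
  let ?q = "p - mconst c"
  have q: "?q \<in> RR" by (intro inv_ring_closed(3,5) p)
  let ?w = "mvec W (phi (?q ^ m)) v"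
  have w: "?w \<in> vecs W" by (rule mvec_in_vecs[OF phi_supp])
  have one: "1 \<in> RR" "mconst c * 1 \<in> RR" by (intro inv_ring_closed(2,5,6))+
  have "phi p = phi ?q + fscale c (phi 1)"
    using phi_add[OF q one(2)] phi_scale[OF one(1), of c] by simp
  hence "mvec W (restr W Xa) ?w - fscale c ?w = mvec W (phi ?q) ?w"
    unfolding p(2)[symmetric] by (simp add: mvec_lin phi_one mvec_idm[OF finite_Wset w])
  moreover have "mvec W (phi ?q) ?w = mvec W (phi (?q ^ Suc m)) v"
    unfolding power_Suc phi_mult[OF q inv_ring_closed(8)[OF q]] mvec_mmul[OF finite_Wset] ..
  ultimately show ?case unfolding funpow.simps(2) o_apply Suc.IH by (rule trans)
qed

lemma v0_vecs: "v0 \<in> vecs W" by (simp add: v0_def vecs_def)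

text \<open>On the image of the local idempotent every p - e(p) is nilpotent. Conversely, a power of
  \<open>p0\<close> kills any generalized eigenvector, while 1 - r is a multiple of that power
  modulo the ideal, so the idempotent fixes the vector.\<close>

lemma geigsp_compat:
  assumes c: "compat E e"
  shows "\<exists>r. r \<in> RR \<and> phi (r * r) = phi r \<and> geigsp W AA E = {mvec W (phi r) v | v. v \<in> vecs W} \<and>
    (\<forall>\<pi>. \<pi> permutes fl \<longrightarrow> evp \<pi> r = (if ye (evp \<pi>) = ye e then 1 else 0))"
proof -
  have e: "rhom e" and Ee: "\<And>Xa p. Xa \<in> AA \<Longrightarrow> p \<in> RR \<Longrightarrow> phi p = restr W Xa \<Longrightarrow> E Xa = e p"
    using c unfolding compat_def by auto
  obtain r n p0 where L: "loc e r n p0" using local_idempotent[OF e] by (elim exE) (rule that)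
  have r: "r \<in> RR" "p0 \<in> RR" "e p0 = 0" "r * r - r \<in> JJ"
    and evr: "\<And>\<pi>. \<pi> permutes fl \<Longrightarrow> evp \<pi> r = (if ye (evp \<pi>) = ye e then 1 else 0)"
    and nil: "\<And>q. q \<in> RR \<Longrightarrow> e q = 0 \<Longrightarrow> q ^ n * r \<in> JJ"
    and co: "\<And>m. \<exists>s\<in>RR. 1 - r - s * p0 ^ m \<in> JJ"
    using L unfolding loc_def by simp_all
  have rr: "phi (r * r) = phi r" using phi_eq_iff[OF inv_ring_closed(2)[OF r(1) r(1)] r(1)] r(4) by simp
  have gg: "geigsp W AA E = {mvec W (phi r) v | v. v \<in> vecs W}"
  proof (intro equalityI subsetI)
    fix v assume v: "v \<in> geigsp W AA E"
    hence vW: "v \<in> vecs W" by (simp add: geigsp_def)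
    obtain Xa where Xa: "Xa \<in> AA" "phi p0 = restr W Xa" using RR_rep[OF r(2)] by blast
    have EX: "E Xa = 0" using Ee[OF Xa(1) r(2) Xa(2)] r(3) by simp
    obtain m where "((\<lambda>u. mvec W (restr W Xa) u - fscale (E Xa) u) ^^ m) v = 0" using v Xa(1) unfolding geigsp_def by blast
    hence z: "mvec W (phi (p0 ^ m)) v = 0" unfolding funpow_eig[OF r(2) Xa(2) vW] EX by simp
    obtain s where s: "s \<in> RR" "1 - r - s * p0 ^ m \<in> JJ" using co by blast
    have pm: "p0 ^ m \<in> RR" by (rule inv_ring_closed(8)[OF r(2)])
    have sp: "s * p0 ^ m \<in> RR" by (rule inv_ring_closed(2)[OF s(1) pm])
    have "phi 1 = phi (r + s * p0 ^ m)"
      using phi_eq_iff[OF inv_ring_closed(6) inv_ring_closed(1)[OF r(1) sp]] s(2) by (simp add: diff_diff_eq)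
    hence "v = mvec W (phi (r + s * p0 ^ m)) v" using mvec_idm[OF finite_Wset vW] phi_one by metis
    also have "\<dots> = mvec W (phi r) v + mvec W (phi s) (mvec W (phi (p0 ^ m)) v)"
      unfolding phi_add[OF r(1) sp] phi_mult[OF s(1) pm] mvec_lin mvec_mmul[OF finite_Wset] ..
    finally show "v \<in> {mvec W (phi r) v | v. v \<in> vecs W}" using vW unfolding z mvec_lin(5) by auto
  next
    fix v assume "v \<in> {mvec W (phi r) v | v. v \<in> vecs W}"
    then obtain v' where v': "v' \<in> vecs W" "v = mvec W (phi r) v'" by blast
    have vW: "v \<in> vecs W" unfolding v'(2) by (rule mvec_in_vecs[OF phi_supp])
    show "v \<in> geigsp W AA E" unfolding geigsp_def mem_Collect_eq
    proof (intro conjI ballI vW)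
      fix Xa assume Xa: "Xa \<in> AA"
      obtain p where p: "p \<in> RR" "phi p = restr W Xa" using AA_rep[OF Xa] by blast
      let ?q = "p - mconst (E Xa)"
      have q: "?q \<in> RR" by (intro inv_ring_closed(3,5) p)
      have "e ?q = 0" unfolding rhomD(8)[OF e p(1) inv_ring_closed(5)] rhomD(7)[OF e] Ee[OF Xa p] by simp
      hence "?q ^ n * r \<in> JJ" by (rule nil[OF q])
      hence "phi (?q ^ n * r) = 0" using phi_zero_iff[OF inv_ring_closed(2)[OF inv_ring_closed(8)[OF q] r(1)]] by simp
      hence "mmul W (phi (?q ^ n)) (phi r) = 0" unfolding phi_mult[OF inv_ring_closed(8)[OF q] r(1)] .
      hence "mvec W (phi (?q ^ n)) v = 0" unfolding v'(2) mvec_mmul[OF finite_Wset, symmetric] by (simp add: mvec_def fun_eq_iff)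
      thus "\<exists>m. ((\<lambda>u. mvec W (restr W Xa) u - fscale (E Xa) u) ^^ m) v = 0"
        unfolding funpow_eig[OF p vW] by blast
    qed
  qed
  show ?thesis by (intro exI[of _ r] conjI allI impI r(1) rr gg evr)
qed

text \<open>The dimension of the image is the trace of the local idempotent, which counts the
  l-subsets of root indices having the divisor of \<open>e\<close>.\<close>

lemma dim_geigsp:
  assumes c: "compat E e"
  shows "cdim (geigsp W AA E) = (\<Prod>a\<in>{a. poly FF a = 0}. order a FF choose order a (ye e))"
proof -
  have e: "rhom e" using c unfolding compat_def by auto
  obtain r where R: "r \<in> RR \<and> phi (r * r) = phi r \<and> geigsp W AA E = {mvec W (phi r) v | v. v \<in> vecs W} \<and>
    (\<forall>\<pi>. \<pi> permutes fl \<longrightarrow> evp \<pi> r = (if ye (evp \<pi>) = ye e then 1 else 0))"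
    using geigsp_compat[OF c] by (elim exE) (rule that)
  have r: "r \<in> RR" "phi (r * r) = phi r" "geigsp W AA E = {mvec W (phi r) v | v. v \<in> vecs W}"
    using R by blast+
  have evr: "\<And>\<pi>. \<pi> permutes fl \<Longrightarrow> evp \<pi> r = (if ye (evp \<pi>) = ye e then 1 else 0)" using R by simp
  have mm: "mmul W (phi r) (phi r) = phi r" using phi_mult[OF r(1) r(1)] r(2) by simp
  obtain B where "finite B" "{mvec W (phi r) v | v. v \<in> vecs W} \<subseteq> fvs.span B"
    "(\<Sum>x\<in>W. phi r (x, x)) = of_nat (card B)" "card B = cdim {mvec W (phi r) v | v. v \<in> vecs W}"
    by (rule trace_idempotent[OF finite_Wset phi_supp mm])
  hence "of_nat (cdim (geigsp W AA E)) = (of_nat (card {S\<in>W. (\<Prod>i\<in>S. [:- \<rho> i, 1:]) = ye e}) :: complex)"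
    unfolding r(3) using trace_evp[OF r(1) evr] by simp
  hence d: "cdim (geigsp W AA E) = card {S\<in>W. (\<Prod>i\<in>S. [:- \<rho> i, 1:]) = ye e}" by (simp only: of_nat_eq_iff)
  obtain \<pi> where \<pi>: "\<pi> permutes fl" "ye (evp \<pi>) = ye e"
  proof -
    have "ye e dvd F0" by (subst ye_dvd[OF e]) (rule dvd_triv_left)
    moreover have "lead_coeff (ye e) = 1" unfolding ye_monic(2)[OF e] by (rule ye_monic(1)[OF e])
    ultimately have "\<exists>\<pi>. \<pi> permutes fl \<and> ye (evp \<pi>) = ye e" by (rule divisor_evp[OF _ _ ye_monic(2)[OF e]])
    thus thesis using that by blast
  qed
  let ?S0 = "\<pi> ` {..<l}"
  have S0: "?S0 \<subseteq> fl" using lk permutes_image[OF \<pi>(1)] by auto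
  have cS0: "card ?S0 = l" using card_image[OF inj_on_subset[OF permutes_inj[OF \<pi>(1)] subset_UNIV], of "{..<l}"] by simp
  have y: "ye e = (\<Prod>i\<in>?S0. [:- \<rho> i, 1:])" using ye_evp[OF \<pi>(1)] \<pi>(2) by simp
  have ne: "q1 - q2 \<noteq> 0" using qne by simp
  have roots: "{a. poly FF a = 0} = \<rho> ` fl" using ne by (auto simp: poly_prod)
  have oF: "order a FF = card {i\<in>fl. \<rho> i = a}" for a
    unfolding order_smult[OF ne] by (rule order_prod_linear) simp
  have oy: "order a (ye e) = card {i\<in>?S0. \<rho> i = a}" for a
    unfolding y by (rule order_prod_linear) simp
  show ?thesis unfolding d roots oF oy unfolding y by (rule card_divisor_subsets[OF S0 cS0])
qed

text \<open>The image of the cyclic vector under the local idempotent generates. A character that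
  does not factor through the restriction has zero generalized eigenspace, generated by the zero
  vector.\<close>

lemma cyclic_geigsp:
  assumes E: "character (carrier k) AA E"
  shows "cyclic_mod W AA (geigsp W AA E)"
proof (cases "\<exists>Xa\<in>AA. restr W Xa = 0 \<and> E Xa \<noteq> 0")
  case True
  then obtain Xa where Xa: "Xa \<in> AA" "restr W Xa = 0" "E Xa \<noteq> 0" by blast
  have z: "mvec W (restr W Xa) u - fscale (E Xa) u = fscale (- E Xa) u" for u
    unfolding Xa(2) by (simp add: mvec_def fun_eq_iff fscale_apply)
  \<comment> \<open>Since \<open>Xa\<close> restricts to zero, the shifted operator is a nonzero
    scalar, and no power of it kills a nonzero vector.\<close>
  have pw: "((\<lambda>u. mvec W (restr W Xa) u - fscale (E Xa) u) ^^ m) v = fscale ((- E Xa) ^ m) v" for m v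
    unfolding z by (induction m) (simp_all add: fscale_def mult_ac)
  have "v = 0" if vg: "v \<in> geigsp W AA E" for v
  proof -
    obtain m where "((\<lambda>u. mvec W (restr W Xa) u - fscale (E Xa) u) ^^ m) v = 0" using vg Xa(1) unfolding geigsp_def by blast
    thus ?thesis unfolding pw using Xa(3) by (auto simp: fscale_def fun_eq_iff)
  qed
  moreover have "0 \<in> geigsp W AA E"
    unfolding geigsp_def mem_Collect_eq
  proof (intro conjI ballI)
    show "0 \<in> vecs W" by (simp add: vecs_def)
    fix Xa show "\<exists>m. ((\<lambda>u. mvec W (restr W Xa) u - fscale (E Xa) u) ^^ m) 0 = 0" by (intro exI[of _ 0]) simp
  qed
  ultimately have g: "geigsp W AA E = {0}" by blast
  have "{mvec W (restr W Xa) (0 :: nat set \<Rightarrow> complex) | Xa. Xa \<in> AA} = {0}" using AA_closed(6) by (auto simp: mvec_lin(5))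
  thus ?thesis unfolding cyclic_mod_def g by blast
next
  case False
  then obtain e where c: "compat E e" using char_compat[OF E] by blast
  obtain r where R: "r \<in> RR \<and> phi (r * r) = phi r \<and> geigsp W AA E = {mvec W (phi r) v | v. v \<in> vecs W} \<and>
    (\<forall>\<pi>. \<pi> permutes fl \<longrightarrow> evp \<pi> r = (if ye (evp \<pi>) = ye e then 1 else 0))"
    using geigsp_compat[OF c] by (elim exE) (rule that)
  have r: "r \<in> RR" "phi (r * r) = phi r" "geigsp W AA E = {mvec W (phi r) v | v. v \<in> vecs W}"
    using R by blast+
  have comm: "mvec W (phi p) (mvec W (phi r) v) = mvec W (phi r) (mvec W (phi p) v)" if "p \<in> RR" for p v
    unfolding mvec_mmul[OF finite_Wset, symmetric] phi_mult[OF that r(1), symmetric] phi_mult[OF r(1) that, symmetric]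
    by (simp only: mult.commute)
  show ?thesis unfolding cyclic_mod_def
  proof (intro bexI[of _ "mvec W (phi r) v0"] equalityI subsetI)
    fix v assume "v \<in> geigsp W AA E"
    then obtain v' where v': "v' \<in> vecs W" "v = mvec W (phi r) v'" unfolding r(3) by blast
    obtain Xa where Xa: "Xa \<in> AA" "phi (pv v') = restr W Xa" using RR_rep[OF pv_RR] by blast
    have "v' = mvec W (phi (pv v')) v0" unfolding phi_v0[OF pv_RR] vr_pv[OF v'(1)] ..
    hence "v = mvec W (restr W Xa) (mvec W (phi r) v0)" unfolding Xa(2)[symmetric] comm[OF pv_RR] v'(2) by simp
    thus "v \<in> {mvec W (restr W Xa) (mvec W (phi r) v0) | Xa. Xa \<in> AA}" using Xa(1) by blast
  next
    fix v assume "v \<in> {mvec W (restr W Xa) (mvec W (phi r) v0) | Xa. Xa \<in> AA}"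
    then obtain Xa where Xa: "Xa \<in> AA" "v = mvec W (restr W Xa) (mvec W (phi r) v0)" by blast
    obtain p where p: "p \<in> RR" "phi p = restr W Xa" using AA_rep[OF Xa(1)] by blast
    show "v \<in> geigsp W AA E" unfolding r(3) Xa(2) p(2)[symmetric] comm[OF p(1)]
      using mvec_in_vecs[OF phi_supp] by blast
  next
    show "mvec W (phi r) v0 \<in> geigsp W AA E" unfolding r(3) using v0_vecs by blast
  qed
qed

text \<open>Divisors correspond to characters of the quotient ring, and these to the lines spanned
  by \<open>we\<close>. Characters of the Bethe algebra are not compared directly: any
  \<open>E\<close> with the given eigenspace is compatible with some \<open>e\<close>, and the line
  determines the divisor of \<open>e\<close>.\<close>

lemma eigenspaces_bij:
  "\<exists>f. bij_betw f {y. lead_coeff y = 1 \<and> degree y = l \<and> y dvd FF}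
        {eigsp W AA E | E. character (carrier k) AA E \<and> eigsp W AA E \<noteq> {0}} \<and>
       (\<forall>y. lead_coeff y = 1 \<and> degree y = l \<and> y dvd FF \<longrightarrow>
          (\<forall>E. character (carrier k) AA E \<and> eigsp W AA E = f y \<longrightarrow>
              laurent_eq (\<lambda>r. E (Tq r)) (pcompose y [:-1, 1:] * FF) (y * D) \<and>
              cdim (geigsp W AA E) = (\<Prod>a\<in>{a. poly FF a = 0}. order a FF choose order a y)))"
proof -
  let ?Y = "{y. lead_coeff y = 1 \<and> degree y = l \<and> y dvd FF}"
  let ?Z = "{eigsp W AA E | E. character (carrier k) AA E \<and> eigsp W AA E \<noteq> {0}}"
  have ne: "q1 - q2 \<noteq> 0" using qne by simp
  have ex: "\<exists>e. rhom e \<and> ye e = y" if y: "y \<in> ?Y" for y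
  proof -
    have y1: "lead_coeff y = 1" "degree y = l" "y dvd FF" using y by blast+
    have "\<exists>\<pi>. \<pi> permutes fl \<and> ye (evp \<pi>) = y" by (rule divisor_evp[OF dvd_smult_cancel[OF y1(3) ne] y1(1,2)])
    thus ?thesis using rhom_evp by blast
  qed
  define ey where "ey = (\<lambda>y. SOME e. rhom e \<and> ye e = y)"
  have ey: "rhom (ey y) \<and> ye (ey y) = y" if "y \<in> ?Y" for y
    unfolding ey_def by (rule someI_ex[OF ex[OF that]])
  note ey1 = conjunct1[OF ey] and ey2 = conjunct2[OF ey]
  define f where "f = (\<lambda>y. range (\<lambda>c. fscale c (we (ey y))))"
  have yeY: "ye e \<in> ?Y" if e: "rhom e" for e
  proof -
    have "ye e dvd FF" by (rule dvd_smult) (subst ye_dvd[OF e], rule dvd_triv_left)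
    moreover have "lead_coeff (ye e) = 1" unfolding ye_monic(2)[OF e] by (rule ye_monic(1)[OF e])
    ultimately show ?thesis using ye_monic(2)[OF e] by blast
  qed
  have inj: "inj_on f ?Y"
  proof (rule inj_onI)
    fix y y' assume y: "y \<in> ?Y" "y' \<in> ?Y" "f y = f y'"
    have "ye (ey y) = ye (ey y')" by (rule we_line_inj[OF ey1[OF y(1)] ey1[OF y(2)] y(3)[unfolded f_def]])
    thus "y = y'" unfolding ey2[OF y(1)] ey2[OF y(2)] .
  qed
  have im: "f ` ?Y = ?Z"
  proof (intro equalityI subsetI)
    fix V assume "V \<in> f ` ?Y"
    then obtain y where y: "y \<in> ?Y" "V = f y" by blast
    obtain E where E: "character (carrier k) AA E" "compat E (ey y)" using compat_exists[OF ey1[OF y(1)]] by blast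
    have V: "eigsp W AA E = V" unfolding eigsp_compat[OF E(2)] y(2) f_def ..
    have "V \<noteq> {0}" unfolding y(2) f_def by (rule we_line_nonzero[OF ey1[OF y(1)]])
    hence "eigsp W AA E \<noteq> {0}" unfolding V .
    thus "V \<in> ?Z" using E(1) V by blast
  next
    fix V assume "V \<in> ?Z"
    then obtain E where E: "character (carrier k) AA E" "eigsp W AA E \<noteq> {0}" "V = eigsp W AA E" by blast
    obtain e where c: "compat E e" using eigsp_nonzero_compat[OF E(1,2)] by blast
    have e: "rhom e" using c unfolding compat_def by (rule conjunct1)
    have det: "e (g S) = ey (ye e) (g S)" for S
      by (rule rhom_determined[OF e ey1[OF yeY[OF e]] ey2[OF yeY[OF e], symmetric] g(1)])
    have "we e = we (ey (ye e))" by (rule ext) (simp only: we_def det)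
    hence "range (\<lambda>c. fscale c (we e)) = range (\<lambda>c. fscale c (we (ey (ye e))))"
      by (rule arg_cong[where f="\<lambda>w. range (\<lambda>c. fscale c w)"])
    hence "V = f (ye e)" unfolding E(3) eigsp_compat[OF c] f_def .
    thus "V \<in> f ` ?Y" using yeY[OF e] by (rule image_eqI)
  qed
  show ?thesis
  proof (intro exI[of _ f] conjI allI impI)
    show "bij_betw f ?Y ?Z" unfolding bij_betw_def using inj im by (rule conjI)
    fix y E assume y: "lead_coeff y = 1 \<and> degree y = l \<and> y dvd FF" and E: "character (carrier k) AA E \<and> eigsp W AA E = f y"
    have yY: "y \<in> ?Y" using y by (rule CollectI)
    have ne0: "eigsp W AA E \<noteq> {0}" unfolding conjunct2[OF E] f_def by (rule we_line_nonzero[OF ey1[OF yY]])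
    obtain e where c: "compat E e" using eigsp_nonzero_compat[OF conjunct1[OF E] ne0] by blast
    have e: "rhom e" using c unfolding compat_def by (rule conjunct1)
    have "ye e = ye (ey y)"
      by (rule we_line_inj[OF e ey1[OF yY] trans[OF eigsp_compat[OF c, symmetric] conjunct2[OF E, unfolded f_def]]])
    hence ye: "ye e = y" unfolding ey2[OF yY] .
    show "laurent_eq (\<lambda>r. E (Tq r)) (pcompose y [:-1, 1:] * FF) (y * D)"
      using eigenvalue_laurent[OF conjunct1[OF E] c] unfolding ye .
    show "cdim (geigsp W AA E) = (\<Prod>a\<in>{a. poly FF a = 0}. order a FF choose order a y)"
      using dim_geigsp[OF c] unfolding ye .
  qed
qed

lemma eigsp_dim: "character (carrier k) AA E \<Longrightarrow> eigsp W AA E \<noteq> {0} \<Longrightarrow> cdim (eigsp W AA E) = 1"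
proof -
  assume E: "character (carrier k) AA E" "eigsp W AA E \<noteq> {0}"
  obtain e where c: "compat E e" using eigsp_nonzero_compat[OF E] by blast
  thus ?thesis unfolding eigsp_compat[OF c] by (intro dim_we_line) (simp add: compat_def)
qed

end

section \<open>Factorization of the Bethe polynomial and conclusion\<close>

lemma complex_poly_roots:
  fixes F :: "complex poly"
  assumes "degree F = k" "lead_coeff F = c" "c \<noteq> 0"
  shows "\<exists>\<rho>. F = smult c (\<Prod>i<k. [:- \<rho> i, 1:])"
proof -
  have "F \<noteq> 0" using assms by auto
  then obtain A where A: "size A = degree F" "F = smult (lead_coeff F) (\<Prod>x\<in>#A. [:- x, 1:])"
    using alg_closed_imp_factorization[of F] by blast
  obtain xs where xs: "mset xs = A" using ex_mset by blast
  have "(\<Prod>x\<in>#A. [:- x, 1:]) = (\<Prod>x\<leftarrow>xs. [:- x, 1:])" unfolding xs[symmetric] by (metis mset_map prod_mset_prod_list)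
  also have "\<dots> = (\<Prod>i<length xs. [:- (xs ! i), 1:])"
  proof (induction xs rule: rev_induct)
    case (snoc x xs)
    have "(\<Prod>i<length xs. [:- ((xs @ [x]) ! i), 1:]) = (\<Prod>i<length xs. [:- (xs ! i), 1:])"
      by (intro prod.cong refl) (simp add: nth_append)
    thus ?case using snoc by simp
  qed simp
  finally have eq: "(\<Prod>x\<in>#A. [:- x, 1:]) = (\<Prod>i<length xs. [:- (xs ! i), 1:])" .
  have "length xs = k" using A(1) xs assms(1) size_mset[of xs] by simp
  hence "F = smult c (\<Prod>i<k. [:- (xs ! i), 1:])" using A(2) unfolding assms(2) eq by (simp only:)
  thus ?thesis by (intro exI[of _ "\<lambda>i. xs ! i"])
qed

theorem theorem4p11:
  fixes q1 q2 :: complex and k l :: nat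
    and lam :: "nat \<Rightarrow> complex \<times> complex" and b :: "nat \<Rightarrow> complex"
  assumes q: "q1 \<noteq> 0" "q2 \<noteq> 0" "q1 \<noteq> q2"
    and wts: "\<forall>s<k. nondeg (lam s) \<and> poly_weight (lam s)"
    and cyc: "cyclicL k lam b"
    and lk: "l \<le> k"
  defines "W \<equiv> wt_carrier k lam b ((\<Sum>s<k. fst (lam s)) - of_nat l) ((\<Sum>s<k. snd (lam s)) + of_nat l)"
    and "B \<equiv> BQ q1 q2 k lam b"
    and "C \<equiv> restr (wt_carrier k lam b ((\<Sum>s<k. fst (lam s)) - of_nat l) ((\<Sum>s<k. snd (lam s)) + of_nat l)) ` BQ q1 q2 k lam b"
    and "F \<equiv> smult q1 (phi_poly k lam b) - smult q2 (psi_poly k lam b)"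
    and "D \<equiv> D_poly k b"
    and "eps \<equiv> (\<lambda>i. (-1) ^ i * coeff (smult q1 (phi_poly k lam b) - smult q2 (psi_poly k lam b)) (k - i) / (q1 - q2))"
    and "RHS \<equiv> [:mconst (q1 - q2):] * (\<Prod>i<l. [:- mvar i - 1, 1:]) * (\<Prod>j\<in>{l..<k}. [:- mvar j, 1:])"
  shows
    \<comment> \<open>(i)\<close>
    "(\<exists>\<phi>. (\<forall>p\<in>inv_ring k l. \<forall>p'\<in>inv_ring k l.
              \<phi> (p + p') = \<phi> p + \<phi> p' \<and> \<phi> (p * p') = mmul W (\<phi> p) (\<phi> p')) \<and>
          \<phi> 1 = idm W \<and>
          (\<forall>c. \<forall>p\<in>inv_ring k l. \<phi> (mconst c * p) = fscale c (\<phi> p)) \<and>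
          \<phi> ` inv_ring k l = C \<and>
          (\<forall>p\<in>inv_ring k l. \<phi> p = 0 \<longleftrightarrow> p \<in> gen_ideal k l eps) \<and>
          (\<forall>m. \<phi> (if m \<le> k then coeff RHS (k - m) else 0) =
                 restr W (\<Sum>p\<in>{..min m k}. fscale (coeff D (k - p)) (TQco q1 q2 k lam b (m - p)))))
     \<comment> \<open>(ii)\<close>
     \<and> frobenius W C \<and> regular_iso W C
     \<comment> \<open>(iii)\<close>
     \<and> subalg W C \<and> commut W C \<and> (\<forall>D'. subalg W D' \<and> commut W D' \<and> C \<subseteq> D' \<longrightarrow> D' = C)
     \<and> cdim C = k choose l
     \<comment> \<open>(iv)\<close>
     \<and> (\<forall>E. character (carrier k) B E \<and> eigsp W B E \<noteq> {0} \<longrightarrow> cdim (eigsp W B E) = 1)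
     \<comment> \<open>(v) and (vii)\<close>
     \<and> (\<exists>f. bij_betw f {y. lead_coeff y = 1 \<and> degree y = l \<and> y dvd F}
                    {eigsp W B E | E. character (carrier k) B E \<and> eigsp W B E \<noteq> {0}} \<and>
           (\<forall>y. lead_coeff y = 1 \<and> degree y = l \<and> y dvd F \<longrightarrow>
              (\<forall>E. character (carrier k) B E \<and> eigsp W B E = f y \<longrightarrow>
                  laurent_eq (\<lambda>r. E (TQco q1 q2 k lam b r)) (pcompose y [:-1, 1:] * F) (y * D) \<and>
                  cdim (geigsp W B E) = (\<Prod>a\<in>{a. poly F a = 0}. order a F choose order a y))))
     \<comment> \<open>(vi)\<close>
     \<and> (\<forall>E. character (carrier k) B E \<longrightarrow> cyclic_mod W B (geigsp W B E))"
proof -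
  have deg1: "degree (\<Prod>s<k. [:f s, 1::complex:]) = k" "coeff (\<Prod>s<k. [:f s, 1::complex:]) k = 1" for f :: "nat \<Rightarrow> complex"
    using degree_prod_linear[of "{..<k}" "\<lambda>s. - f s"] coeff_prod_linear_card[of "{..<k}" "\<lambda>s. - f s"] by simp_all
  have Fk: "coeff F k = q1 - q2" unfolding F_def phi_poly_def psi_poly_def by (simp add: deg1)
  have "degree F \<le> k" unfolding F_def phi_poly_def psi_poly_def
    by (intro degree_diff_le order_trans[OF degree_smult_le]) (simp_all add: deg1)
  moreover have "q1 - q2 \<noteq> 0" using q by simp
  \<comment> \<open>Since q1 and q2 differ, the two monic polynomials of degree k do not cancel in
    top degree; counted with multiplicity there are exactly k roots, as many as variables.\<close>
  ultimately have dF: "degree F = k" using Fk le_degree[of F k] by simp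
  obtain \<rho> where \<rho>: "F = smult (q1 - q2) (\<Prod>i<k. [:- \<rho> i, 1:])"
    using complex_poly_roots[OF dF _ \<open>q1 - q2 \<noteq> 0\<close>] Fk unfolding dF by blast
  obtain eta where eta: "\<And>j x. j < k \<Longrightarrow> (\<Sum>s<k. mconst (eta j s) * chi (\<lambda>s. mconst (- b s + fst (lam s))) (\<lambda>s. mconst (- b s - snd (lam s))) k x s) = x ^ j"
    using cyclic_eta[OF cyc] by blast
  have roots: "roots_of k eps \<rho>"
    unfolding roots_of_def eps_def F_def[symmetric] \<rho> using \<open>q1 - q2 \<noteq> 0\<close> by simp
  interpret bb: bethe k l "\<lambda>s. - b s + fst (lam s)" "\<lambda>s. - b s - snd (lam s)" eta \<rho> eps q1 q2 lam b
  proof unfold_locales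
    show "smult q1 (\<Prod>s<k. [:- b s + fst (lam s), 1:]) - smult q2 (\<Prod>s<k. [:- b s - snd (lam s), 1:]) = smult (q1 - q2) (\<Prod>i<k. [:- \<rho> i, 1:])"
      using \<rho> unfolding F_def phi_poly_def psi_poly_def .
  qed ((rule lk | (rule eta, assumption) | rule roots | rule q(3) | rule refl)+)
  have Weq: "W = Wset k l" unfolding W_def by (rule wt_carrier_eq)
  have Ceq: "C = bb.phi ` inv_ring k l" unfolding C_def wt_carrier_eq by (rule bb.restr_AA)
  have RHSeq: "RHS = bb.RHS" unfolding RHS_def bb.RHS_def ysp_def zp_def ..
  show ?thesis
  proof (intro conjI)
    show "\<exists>\<phi>. (\<forall>p\<in>inv_ring k l. \<forall>p'\<in>inv_ring k l.
              \<phi> (p + p') = \<phi> p + \<phi> p' \<and> \<phi> (p * p') = mmul W (\<phi> p) (\<phi> p')) \<and>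
          \<phi> 1 = idm W \<and>
          (\<forall>c. \<forall>p\<in>inv_ring k l. \<phi> (mconst c * p) = fscale c (\<phi> p)) \<and>
          \<phi> ` inv_ring k l = C \<and>
          (\<forall>p\<in>inv_ring k l. \<phi> p = 0 \<longleftrightarrow> p \<in> gen_ideal k l eps) \<and>
          (\<forall>m. \<phi> (if m \<le> k then coeff RHS (k - m) else 0) =
                 restr W (\<Sum>p\<in>{..min m k}. fscale (coeff D (k - p)) (TQco q1 q2 k lam b (m - p))))"
      unfolding Weq Ceq D_def RHSeq
      by (intro exI[of _ bb.phi] conjI ballI allI bb.phi_add bb.phi_mult bb.phi_one bb.phi_scale bb.phi_zero_iff bb.restr_relation refl)
    show "frobenius W C" unfolding Weq Ceq by (rule bb.frobenius_CC)
    show "regular_iso W C" unfolding Weq Ceq by (rule bb.regular_CC)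
    show "subalg W C" unfolding Weq Ceq by (rule bb.subalg_CC)
    show "commut W C" unfolding Weq Ceq by (rule bb.commut_CC)
    show "\<forall>D'. subalg W D' \<and> commut W D' \<and> C \<subseteq> D' \<longrightarrow> D' = C" unfolding Weq Ceq using bb.maximal_CC by blast
    show "cdim C = k choose l" unfolding Ceq by (rule bb.dim_CC)
    show "\<forall>E. character (carrier k) B E \<and> eigsp W B E \<noteq> {0} \<longrightarrow> cdim (eigsp W B E) = 1"
      unfolding Weq B_def using bb.eigsp_dim by blast
    show "\<exists>f. bij_betw f {y. lead_coeff y = 1 \<and> degree y = l \<and> y dvd F}
                    {eigsp W B E | E. character (carrier k) B E \<and> eigsp W B E \<noteq> {0}} \<and>
           (\<forall>y. lead_coeff y = 1 \<and> degree y = l \<and> y dvd F \<longrightarrow>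
              (\<forall>E. character (carrier k) B E \<and> eigsp W B E = f y \<longrightarrow>
                  laurent_eq (\<lambda>r. E (TQco q1 q2 k lam b r)) (pcompose y [:-1, 1:] * F) (y * D) \<and>
                  cdim (geigsp W B E) = (\<Prod>a\<in>{a. poly F a = 0}. order a F choose order a y)))"
      unfolding Weq B_def D_def \<rho> by (rule bb.eigenspaces_bij)
    show "\<forall>E. character (carrier k) B E \<longrightarrow> cyclic_mod W B (geigsp W B E)"
      unfolding Weq B_def using bb.cyclic_geigsp by blast
  qed
qed

end
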